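(* Let $m>0$, let $\Sigma=\Sigma_L:=\{(0,y)\in\mathbb{R}^2\mid y\in\mathbb{R}\}$, and let $\eta,\tau\in\mathbb{R}$ satisfy $\eta^2-\tau^2=4$. Let $H_{\eta,\tau}$ be the associated Dirac operator with $\delta$-shell interaction on $\Sigma_L$ (defined in the context), and let $z_*=-\frac{\tau}{\eta}\,m$, which is an eigenvalue of $H_{\eta,\tau}$ of infinite multiplicity. Then the eigenspace of $H_{\eta,\tau}$ associated to $z_*$ consists of the functions of the form $$\psi_{\Xi}(x,y)=\frac{1}{2\sqrt{\pi}}\big[\theta(x)\,\Lambda_{\eta,\tau}+\theta(-x)\,\sigma_0\big]\int_{\mathbb{R}}dk\,\begin{pmatrix}\sqrt{\left(1-\frac{\tau}{\eta}\right)\left(\sqrt{k^2+\frac{4m^2}{\eta^2}}+k\right)}\\[4pt] -i\,\sqrt{\left(1+\frac{\tau}{\eta}\right)\left(\sqrt{k^2+\frac{4m^2}{\eta^2}}-k\right)}\end{pmatrix}\Xi(k)\,e^{iky-\sqrt{k^2+\frac{4m^2}{\eta^2}}\,|x|},$$ where $\Xi\in L^2(\mathbb{R},dk)$ is a normalization factor fulfilling $$\|\psi_{\Xi}\|_{L^2(\mathbb{R}^2,dx\,dy;\mathbb{C}^2)}=\|\Xi\|_{L^2(\mathbb{R},dk)}.$$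
   Context: $\sigma_0$ is the $2\times2$ identity matrix and $\sigma_1=\begin{pmatrix}0&1\\1&0\end{pmatrix}$, $\sigma_2=\begin{pmatrix}0&-i\\i&0\end{pmatrix}$, $\sigma_3=\begin{pmatrix}1&0\\0&-1\end{pmatrix}$ are the Pauli matrices; for a vector $v=(v_1,v_2)$ write $v\cdot\boldsymbol{\sigma}=v_1\sigma_1+v_2\sigma_2$, and $\boldsymbol\sigma\cdot\nabla=\sigma_1\partial_x+\sigma_2\partial_y$. $\theta$ denotes the Heaviside step function. Set $\Omega_\pm=\{(x,y)\in\mathbb{R}^2\mid \pm x>0\}$, and let $\boldsymbol n=(-1,0)$ be the unit normal to $\Sigma_L$ pointing outwards of $\Omega_+$. Define $H(\boldsymbol\sigma,\Omega_\pm)=\{f\in L^2(\Omega_\pm;\mathbb{C}^2)\mid(\boldsymbol\sigma\cdot\nabla)f\in L^2(\Omega_\pm;\mathbb{C}^2)\}$; functions in this space admit Dirichlet traces $\mathcal{T}^D_\pm f\in H^{-1/2}(\Sigma_L;\mathbb{C}^2)$ (extending the usual trace by continuity). The self-adjoint operator $H_{\eta,\tau}$ on $L^2(\mathbb{R}^2;\mathbb{C}^2)$ has domain the set of $\psi=\psi_+\oplus\psi_-\in H(\boldsymbol\sigma,\Omega_+)\oplus H(\boldsymbol\sigma,\Omega_-)$ such that $$-i(\boldsymbol n\cdot\boldsymbol\sigma)(\mathcal{T}^D_+\psi_+-\mathcal{T}^D_-\psi_-)=\tfrac12(\eta\sigma_0+\tau\sigma_3)(\mathcal{T}^D_+\psi_++\mathcal{T}^D_-\psi_-),$$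 and acts as $H_{\eta,\tau}\psi=(-i\boldsymbol\sigma\cdot\nabla+m\sigma_3)\psi_+\oplus(-i\boldsymbol\sigma\cdot\nabla+m\sigma_3)\psi_-$. The matrix $\Lambda_{\eta,\tau}$ is $$\Lambda_{\eta,\tau}=\left[i\sigma_1-\tfrac12(\eta\sigma_0+\tau\sigma_3)\right]^{-1}\left[i\sigma_1+\tfrac12(\eta\sigma_0+\tau\sigma_3)\right].$$ The condition $\eta^2-\tau^2=4$ implies $|\eta|\geq 2$ and $|\tau/\eta|<1$. *)

theory Defs
  imports "HOL-Analysis.Analysis"
begin

text \<open>Elements of $L^2$ are represented by Borel functions; two of them represent the same
  element iff they agree almost everywhere.\<close>

definition L2 :: "'a measure \<Rightarrow> ('a \<Rightarrow> 'b::euclidean_space) set" where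
  "L2 M = {f. f \<in> borel_measurable M \<and> integrable M (\<lambda>x. (norm (f x))\<^sup>2)}"

definition L2_norm :: "'a measure \<Rightarrow> ('a \<Rightarrow> 'b::euclidean_space) \<Rightarrow> real" where
  "L2_norm M f = sqrt (LINT x|M. (norm (f x))\<^sup>2)"

abbreviation lborel_on :: "'a::euclidean_space set \<Rightarrow> 'a measure" where
  "lborel_on \<Omega> \<equiv> restrict_space lborel \<Omega>"

primrec Ck :: "nat \<Rightarrow> ('a::euclidean_space \<Rightarrow> 'b::euclidean_space) \<Rightarrow> bool" where
  "Ck 0 f \<longleftrightarrow> continuous_on UNIV f"
| "Ck (Suc n) f \<longleftrightarrow>
     (\<forall>x. f differentiable (at x)) \<and> (\<forall>v. Ck n (\<lambda>x. frechet_derivative f (at x) v))"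

definition test_functions :: "'a::euclidean_space set \<Rightarrow> ('a \<Rightarrow> 'b::euclidean_space) set" where
  "test_functions \<Omega> =
     {\<phi>. (\<forall>n. Ck n \<phi>) \<and> compact (closure (support_on UNIV \<phi>)) \<and> closure (support_on UNIV \<phi>) \<subseteq> \<Omega>}"

text \<open>For a matrix $A$ and a complex number $c$, the product $cA$ is written
  \<^term>\<open>mat c ** A\<close>.\<close>

type_synonym spinor = "complex^2"
type_synonym cmat = "complex^2^2"

definition pauli0 :: cmat where "pauli0 = mat 1"
definition pauli1 :: cmat where "pauli1 = vector [vector [0, 1], vector [1, 0]]"
definition pauli2 :: cmat where "pauli2 = vector [vector [0, - \<i>], vector [\<i>, 0]]"
definition pauli3 :: cmat where "pauli3 = vector [vector [1, 0], vector [0, - 1]]"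

definition dot_sigma :: "real \<times> real \<Rightarrow> cmat" where
  "dot_sigma v = fst v *\<^sub>R pauli1 + snd v *\<^sub>R pauli2"

definition partial_x :: "(real \<times> real \<Rightarrow> 'b::euclidean_space) \<Rightarrow> real \<times> real \<Rightarrow> 'b" where
  "partial_x f p = frechet_derivative f (at p) (1, 0)"

definition partial_y :: "(real \<times> real \<Rightarrow> 'b::euclidean_space) \<Rightarrow> real \<times> real \<Rightarrow> 'b" where
  "partial_y f p = frechet_derivative f (at p) (0, 1)"

definition sigma_grad :: "(real \<times> real \<Rightarrow> spinor) \<Rightarrow> real \<times> real \<Rightarrow> spinor" where
  "sigma_grad f p = pauli1 *v partial_x f p + pauli2 *v partial_y f p"

text \<open>\<open>weak_sigma_grad \<Omega> f g\<close>: the distribution $(\sigma\cdot\nabla) f$ on the open set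
  $\Omega$ is given by the function $g \in L^2(\Omega;\mathbb{C}^2)$.\<close>

definition weak_sigma_grad ::
  "(real \<times> real) set \<Rightarrow> (real \<times> real \<Rightarrow> spinor) \<Rightarrow> (real \<times> real \<Rightarrow> spinor) \<Rightarrow> bool" where
  "weak_sigma_grad \<Omega> f g \<longleftrightarrow> g \<in> L2 (lborel_on \<Omega>) \<and>
     (\<forall>\<phi> :: real \<times> real \<Rightarrow> complex. \<phi> \<in> test_functions \<Omega> \<longrightarrow>
        (LINT p|lborel_on \<Omega>. \<phi> p *s g p) =
        - (LINT p|lborel_on \<Omega>.
             partial_x \<phi> p *s (pauli1 *v f p) + partial_y \<phi> p *s (pauli2 *v f p)))"

definition H_sigma :: "(real \<times> real) set \<Rightarrow> (real \<times> real \<Rightarrow> spinor) set" where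
  "H_sigma \<Omega> = {f \<in> L2 (lborel_on \<Omega>). \<exists>g. weak_sigma_grad \<Omega> f g}"

text \<open>A $\mathbb{C}^2$-valued distribution $u$ on $\mathbb{R}$ is represented by its action
  $\phi \mapsto \langle u, \phi\rangle \in \mathbb{C}^2$ on scalar test functions
  (the pairing is bilinear, and values off the test functions are irrelevant).\<close>

type_synonym distr = "(real \<Rightarrow> complex) \<Rightarrow> spinor"

definition inv_fourier :: "(real \<Rightarrow> complex) \<Rightarrow> real \<Rightarrow> complex" where
  "inv_fourier \<phi> k = complex_of_real (1 / sqrt (2 * pi)) * (LINT y|lborel. exp (\<i> * k * y) * \<phi> y)"

text \<open>\<open>sobolev_rep s u w\<close>: $w$ is the Fourier transform of $u$, that is
  $\langle u, \phi\rangle = \langle w, \mathcal{F}^{-1}\phi\rangle$, and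
  $(1+k^2)^{s/2} w \in L^2(\mathbb{R})$, i.e. $u \in H^s(\mathbb{R};\mathbb{C}^2)$.
  Such a $w$ is unique up to null sets, so that the norm below is well defined.\<close>

definition sobolev_rep :: "real \<Rightarrow> distr \<Rightarrow> (real \<Rightarrow> spinor) \<Rightarrow> bool" where
  "sobolev_rep s u w \<longleftrightarrow>
     (\<lambda>k. (1 + k\<^sup>2) powr (s / 2) *\<^sub>R w k) \<in> L2 lborel \<and>
     (\<forall>\<phi> \<in> test_functions UNIV. u \<phi> = (LINT k|lborel. inv_fourier \<phi> k *s w k))"

definition sobolev :: "real \<Rightarrow> distr set" where
  "sobolev s = {u. \<exists>w. sobolev_rep s u w}"

definition sobolev_norm :: "real \<Rightarrow> distr \<Rightarrow> real" where
  "sobolev_norm s u =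
     (THE r. \<exists>w. sobolev_rep s u w \<and> r = L2_norm lborel (\<lambda>k. (1 + k\<^sup>2) powr (s / 2) *\<^sub>R w k))"

definition Omega_plus :: "(real \<times> real) set" where "Omega_plus = {p. fst p > 0}"
definition Omega_minus :: "(real \<times> real) set" where "Omega_minus = {p. fst p < 0}"

text \<open>The line is identified with $\mathbb{R}$ via $y \mapsto (0,y)$; the restriction of a
  continuous function to it is regarded as a distribution.\<close>

definition line_restriction :: "(real \<times> real \<Rightarrow> spinor) \<Rightarrow> distr" where
  "line_restriction f = (\<lambda>\<phi>. LINT y|lborel. \<phi> y *s f (0, y))"

text \<open>Extension by continuity of the restriction map: \<open>has_dirichlet_trace \<Omega> f T\<close> holds if
  restrictions to $\Omega$ of functions in $C_c^\infty(\mathbb{R}^2;\mathbb{C}^2)$ converge to $f$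
  in $H(\sigma,\Omega)$ (graph norm) and their values on the line converge to $T$ in
  $H^{-1/2}(\mathbb{R};\mathbb{C}^2)$.\<close>

definition has_dirichlet_trace ::
  "(real \<times> real) set \<Rightarrow> (real \<times> real \<Rightarrow> spinor) \<Rightarrow> distr \<Rightarrow> bool" where
  "has_dirichlet_trace \<Omega> f T \<longleftrightarrow>
     f \<in> H_sigma \<Omega> \<and> T \<in> sobolev (- 1 / 2) \<and>
     (\<exists>g F. weak_sigma_grad \<Omega> f g \<and>
        (\<forall>n::nat. F n \<in> test_functions UNIV) \<and>
        (\<lambda>n. L2_norm (lborel_on \<Omega>) (\<lambda>p. F n p - f p)) \<longlonglongrightarrow> 0 \<and>
        (\<lambda>n. L2_norm (lborel_on \<Omega>) (\<lambda>p. sigma_grad (F n) p - g p)) \<longlonglongrightarrow> 0 \<and>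
        (\<lambda>n. sobolev_norm (- 1 / 2) (\<lambda>\<phi>. line_restriction (F n) \<phi> - T \<phi>)) \<longlonglongrightarrow> 0)"

definition shell_matrix :: "real \<Rightarrow> real \<Rightarrow> cmat" where
  "shell_matrix \<eta> \<tau> = (1 / 2) *\<^sub>R (\<eta> *\<^sub>R pauli0 + \<tau> *\<^sub>R pauli3)"

definition normal_vec :: "real \<times> real" where "normal_vec = (- 1, 0)"

definition shell_domain :: "real \<Rightarrow> real \<Rightarrow> (real \<times> real \<Rightarrow> spinor) set" where
  "shell_domain \<eta> \<tau> =
     {\<psi> \<in> L2 lborel. \<psi> \<in> H_sigma Omega_plus \<and> \<psi> \<in> H_sigma Omega_minus \<and>
        (\<exists>Tp Tm. has_dirichlet_trace Omega_plus \<psi> Tp \<and> has_dirichlet_trace Omega_minus \<psi> Tm \<and>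
           (\<forall>\<phi> \<in> test_functions UNIV.
              (- \<i>) *s (dot_sigma normal_vec *v (Tp \<phi> - Tm \<phi>)) =
              shell_matrix \<eta> \<tau> *v (Tp \<phi> + Tm \<phi>)))}"

definition acts_as_dirac ::
  "real \<Rightarrow> (real \<times> real) set \<Rightarrow> (real \<times> real \<Rightarrow> spinor) \<Rightarrow> (real \<times> real \<Rightarrow> spinor) \<Rightarrow> bool" where
  "acts_as_dirac m \<Omega> \<psi> \<zeta> \<longleftrightarrow>
     (\<exists>g. weak_sigma_grad \<Omega> \<psi> g \<and>
          (AE p in lborel_on \<Omega>. \<zeta> p = (- \<i>) *s g p + m *\<^sub>R (pauli3 *v \<psi> p)))"

text \<open>The unbounded operator is given by its graph, the set of pairs $(\psi, H\psi)$.\<close>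

definition dirac_shell ::
  "real \<Rightarrow> real \<Rightarrow> real \<Rightarrow> ((real \<times> real \<Rightarrow> spinor) \<times> (real \<times> real \<Rightarrow> spinor)) set" where
  "dirac_shell m \<eta> \<tau> =
     {(\<psi>, \<zeta>). \<psi> \<in> shell_domain \<eta> \<tau> \<and> \<zeta> \<in> L2 lborel \<and>
        acts_as_dirac m Omega_plus \<psi> \<zeta> \<and> acts_as_dirac m Omega_minus \<psi> \<zeta>}"

definition eigenspace ::
  "(('a \<Rightarrow> spinor) \<times> ('a \<Rightarrow> spinor)) set \<Rightarrow> complex \<Rightarrow> ('a \<Rightarrow> spinor) set" where
  "eigenspace H z = {\<psi>. (\<psi>, \<lambda>p. z *s \<psi> p) \<in> H}"

text \<open>The eigenspace, with functions identified when they agree almost everywhere, has infinite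
  dimension over $\mathbb{C}$.\<close>

definition eigenvalue_of_infinite_multiplicity ::
  "(('a::euclidean_space \<Rightarrow> spinor) \<times> ('a \<Rightarrow> spinor)) set \<Rightarrow> complex \<Rightarrow> bool" where
  "eigenvalue_of_infinite_multiplicity H z \<longleftrightarrow>
     (\<exists>e :: nat \<Rightarrow> 'a \<Rightarrow> spinor. (\<forall>n. e n \<in> eigenspace H z) \<and>
        (\<forall>N c. (AE p in lborel. (\<Sum>n<N. c n *s e n p) = 0) \<longrightarrow> (\<forall>n<N. c n = 0)))"

definition Lambda :: "real \<Rightarrow> real \<Rightarrow> cmat" where
  "Lambda \<eta> \<tau> = matrix_inv (mat \<i> ** pauli1 - shell_matrix \<eta> \<tau>) ** (mat \<i> ** pauli1 + shell_matrix \<eta> \<tau>)"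

definition heaviside :: "real \<Rightarrow> real" where "heaviside x = (if x > 0 then 1 else 0)"

definition kappa :: "real \<Rightarrow> real \<Rightarrow> real \<Rightarrow> real" where
  "kappa m \<eta> k = sqrt (k\<^sup>2 + 4 * m\<^sup>2 / \<eta>\<^sup>2)"

definition amplitude :: "real \<Rightarrow> real \<Rightarrow> real \<Rightarrow> real \<Rightarrow> spinor" where
  "amplitude m \<eta> \<tau> k =
     vector [complex_of_real (sqrt ((1 - \<tau> / \<eta>) * (kappa m \<eta> k + k))),
             - \<i> * complex_of_real (sqrt ((1 + \<tau> / \<eta>) * (kappa m \<eta> k - k)))]"

definition psi :: "real \<Rightarrow> real \<Rightarrow> real \<Rightarrow> (real \<Rightarrow> complex) \<Rightarrow> real \<times> real \<Rightarrow> spinor" where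
  "psi m \<eta> \<tau> \<Xi> = (\<lambda>(x :: real, y :: real).
     complex_of_real (1 / (2 * sqrt pi)) *s
       ((heaviside x *\<^sub>R Lambda \<eta> \<tau> + heaviside (- x) *\<^sub>R pauli0) *v
        (LINT k|lborel.
           (\<Xi> k * exp (\<i> * of_real (k * y) - of_real (kappa m \<eta> k * \<bar>x\<bar>))) *s amplitude m \<eta> \<tau> k)))"

end

theory Submission
  imports Defs "HOL-Probability.Characteristic_Functions" "HOL-Probability.Sinc_Integral"
begin

text \<open>After the Fourier transform in $y$ and a rescaling of the two components, the eigenvalue equation for
  $z_*$ on a half plane is, for every frequency $k$, an ordinary differential equation in $x$ with a
  Hermitian matrix whose eigenvalues are $\pm\kappa(k)$. A square integrable solution can only contain the decaying
  mode, so it is determined by its trace, which is a scalar multiple of an explicit amplitude. At $z_*$ the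
  matrix $\Lambda_{\eta,\tau}$ maps the amplitude that decays on the left to a multiple of the one that decays on
  the right, for all $k$ simultaneously; the jump condition therefore leaves the scalar density free.

  The trace is only defined by approximation, so the argument is carried out on test functions as a priori
  estimates: on each half plane the growing mode of the trace is bounded by the residual of the equation,
  and the function itself by trace and residual. For the converse, a superposition of decaying modes is
  approximated by truncating its density and cutting it off in space. The norm identity is the Plancherel
  identity in $y$ combined with $\int_0^\infty e^{-2\kappa x}\,dx = 1/(2\kappa)$.\<close>

section \<open>Smooth functions and cut-offs\<close>

text \<open>The shell condition says that the diagonal entries of the shell matrix have product 1.
  This annihilates the diagonal of Lambda, which then only exchanges the two components. At the
  given energy the decaying amplitudes of the two sides differ, up to sign, by exchanging sqrt(kappa
  + k) and sqrt(kappa - k), so matching them reduces to an identity between sqrt(1 - tau/eta) and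
  sqrt(1 + tau/eta) in which k does not occur. This is why one energy carries a whole L^2 of
  densities.

  The obstacle is regularity: traces exist only in H^(-1/2). An amplitude has length of order
  sqrt(kappa), hence L^2 densities correspond to decaying traces in H^(-1/2), and the estimates have
  to be uniform in k in precisely this weight. An eigenfunction is accessible only through the
  approximants in the definition of its trace, so the estimates are proved for test functions and
  passed to the limit in squared norms with values in the extended nonnegative reals, where Tonelli
  and Fatou apply directly.\<close>

lemma Ck_SucI:
  assumes "\<And>x. (f has_derivative f' x) (at x)" "\<And>v. Ck n (\<lambda>x. f' x v)"
  shows "Ck (Suc n) f"
proof -
  have "f' x = frechet_derivative f (at x)" for x
    using assms(1) by (rule frechet_derivative_at)
  then show ?thesis using assms by (auto simp: differentiable_def)
qed

lemma Ck_SucE: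
  assumes "Ck (Suc n) f"
  obtains f' where "\<And>x. (f has_derivative f' x) (at x)" "\<And>v. Ck n (\<lambda>x. f' x v)"
  using assms that[of "\<lambda>x. frechet_derivative f (at x)"] by (auto simp: frechet_derivative_works)

lemma Ck_continuous: "Ck n f \<Longrightarrow> continuous_on UNIV f"
  by (cases n) (auto intro!: continuous_at_imp_continuous_on differentiable_imp_continuous_within)

lemma Ck_Suc_imp: "Ck (Suc n) f \<Longrightarrow> Ck n f"
proof (induction n arbitrary: f)
  case 0 then show ?case using Ck_continuous[OF 0] by simp
next
  case (Suc n) then show ?case by (subst Ck.simps) (auto simp del: Ck.simps simp: Ck.simps(2)[of "Suc n"])
qed

definition smooth :: "('a::euclidean_space \<Rightarrow> 'b::euclidean_space) \<Rightarrow> bool" where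
  "smooth f \<longleftrightarrow> (\<forall>n. Ck n f)"

lemma smooth_continuous_on: "smooth f \<Longrightarrow> continuous_on S f"
  unfolding smooth_def using Ck_continuous continuous_on_subset by blast

lemma smooth_differentiable: "smooth f \<Longrightarrow> f differentiable (at x)"
  unfolding smooth_def using Ck.simps(2)[of 0 f] by simp

lemma smooth_has_derivative:
  "smooth f \<Longrightarrow> (f has_derivative frechet_derivative f (at x)) (at x)"
  using smooth_differentiable frechet_derivative_works by blast

lemma smooth_frechet_derivative: "smooth f \<Longrightarrow> smooth (\<lambda>x. frechet_derivative f (at x) v)"
  unfolding smooth_def using Ck.simps(2) by blast

lemma smooth_borel_measurable [measurable_dest]: "smooth f \<Longrightarrow> f \<in> borel_measurable borel"
  by (rule borel_measurable_continuous_onI) (rule smooth_continuous_on)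

text \<open>Smoothness by coinduction: it suffices that the family contains all directional
  derivatives of its members. Applied to superpositions of exponentials, whose derivatives only
  change the density.\<close>

lemma smooth_family:
  assumes "f \<in> X"
    and "\<And>g. g \<in> X \<Longrightarrow> \<exists>g'. (\<forall>x. (g has_derivative g' x) (at x)) \<and> (\<forall>v. (\<lambda>x. g' x v) \<in> X)"
  shows "smooth f"
proof -
  have "Ck n g" if "g \<in> X" for n g
    using that
  proof (induction n arbitrary: g)
    case 0
    then obtain g' where "\<And>x. (g has_derivative g' x) (at x)" using assms(2) by blast
    then show ?case by (auto intro!: continuous_at_imp_continuous_on has_derivative_continuous)
  next
    case (Suc n)
    then obtain g' where "\<And>x. (g has_derivative g' x) (at x)" "\<And>v. (\<lambda>x. g' x v) \<in> X"
      using assms(2) by blast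
    then show ?case using Suc.IH by (intro Ck_SucI) auto
  qed
  then show ?thesis using assms(1) by (simp add: smooth_def)
qed

lemma Ck_const: "Ck n (\<lambda>x. c)"
proof (induction n arbitrary: c)
  case (Suc n)
  then show ?case by (intro Ck_SucI[where f'="\<lambda>x h. 0"]) auto
qed auto

lemma Ck_add: "Ck n f \<Longrightarrow> Ck n g \<Longrightarrow> Ck n (\<lambda>x. f x + g x)"
proof (induction n arbitrary: f g)
  case (Suc n)
  from Suc.prems obtain f' g' where "\<And>x. (f has_derivative f' x) (at x)" "\<And>v. Ck n (\<lambda>x. f' x v)"
    "\<And>x. (g has_derivative g' x) (at x)" "\<And>v. Ck n (\<lambda>x. g' x v)" by (metis Ck_SucE)
  then show ?case using Suc.IH
    by (intro Ck_SucI[where f'="\<lambda>x h. f' x h + g' x h"]) (auto intro: has_derivative_add)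
qed (auto intro: continuous_intros)

lemma Ck_linear:
  assumes "bounded_linear L"
  shows "Ck n f \<Longrightarrow> Ck n (\<lambda>x. L (f x))"
proof (induction n arbitrary: f)
  case 0 then show ?case
    using bounded_linear.continuous_on[OF assms] by auto
next
  case (Suc n)
  from Suc.prems obtain f' where "\<And>x. (f has_derivative f' x) (at x)" "\<And>v. Ck n (\<lambda>x. f' x v)"
    by (metis Ck_SucE)
  then show ?case using Suc.IH
    by (intro Ck_SucI[where f'="\<lambda>x h. L (f' x h)"]) (auto intro: bounded_linear.has_derivative[OF assms])
qed

lemma Ck_compose_affine:
  assumes "bounded_linear L"
  shows "Ck n f \<Longrightarrow> Ck n (\<lambda>x. f (a + L x))"
proof (induction n arbitrary: f)
  case 0
  have "continuous_on UNIV (\<lambda>x. a + L x)" by (intro continuous_intros linear_continuous_on[OF assms])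
  then show ?case using 0 continuous_on_compose2[of UNIV f UNIV "\<lambda>x. a + L x"] by auto
next
  case (Suc n)
  from Suc.prems obtain f' where f': "\<And>x. (f has_derivative f' x) (at x)" "\<And>v. Ck n (\<lambda>x. f' x v)"
    by (metis Ck_SucE)
  have "((\<lambda>x. a + L x) has_derivative L) (at x)" for x
    using has_derivative_add[OF has_derivative_const bounded_linear_imp_has_derivative[OF assms], of a] by simp
  from has_derivative_compose[OF this f'(1)]
  have "((\<lambda>x. f (a + L x)) has_derivative (\<lambda>h. f' (a + L x) (L h))) (at x)" for x .
  then show ?case using Suc.IH f'(2)
    by (intro Ck_SucI[where f'="\<lambda>x h. f' (a + L x) (L h)"]) auto
qed

lemma Ck_bilinear:
  assumes "bounded_bilinear B"
  shows "Ck n f \<Longrightarrow> Ck n g \<Longrightarrow> Ck n (\<lambda>x. B (f x) (g x))"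
proof (induction n arbitrary: f g)
  case 0 then show ?case
    using bounded_bilinear.continuous_on[OF assms] by auto
next
  case (Suc n)
  from Suc.prems obtain f' g' where fg: "\<And>x. (f has_derivative f' x) (at x)" "\<And>v. Ck n (\<lambda>x. f' x v)"
    "\<And>x. (g has_derivative g' x) (at x)" "\<And>v. Ck n (\<lambda>x. g' x v)" by (metis Ck_SucE)
  have "Ck n f" "Ck n g" using Suc.prems Ck_Suc_imp by blast+
  with fg show ?case using Suc.IH
    by (intro Ck_SucI[where f'="\<lambda>x h. B (f x) (g' x h) + B (f' x h) (g x)"])
      (auto intro!: bounded_bilinear.FDERIV[OF assms] Ck_add)
qed

text \<open>With a real inner function the derivative is the product of \<open>g' x h\<close> and
  \<open>f' (g x) 1\<close>, so the induction rests on the product rule and the one-variable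
  derivative of \<open>f\<close>.\<close>

lemma Ck_compose_real:
  fixes f :: "real \<Rightarrow> 'b::euclidean_space" and g :: "'a::euclidean_space \<Rightarrow> real"
  shows "Ck n f \<Longrightarrow> Ck n g \<Longrightarrow> Ck n (\<lambda>x. f (g x))"
proof (induction n arbitrary: f)
  case 0 then show ?case
    using continuous_on_compose2[of UNIV f UNIV g] by auto
next
  case (Suc n)
  from Suc.prems obtain f' g' where fg: "\<And>x. (f has_derivative f' x) (at x)" "\<And>v. Ck n (\<lambda>x. f' x v)"
    "\<And>x. (g has_derivative g' x) (at x)" "\<And>v. Ck n (\<lambda>x. g' x v)" by (metis Ck_SucE)
  have lin: "f' (g x) (g' x h) = g' x h *\<^sub>R f' (g x) 1" for x h
    using linear_scale[OF has_derivative_linear[OF fg(1)], of "g x" "g' x h" 1] by simp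
  have "((\<lambda>x. f (g x)) has_derivative (\<lambda>h. g' x h *\<^sub>R f' (g x) 1)) (at x)" for x
    using has_derivative_compose[OF fg(3) fg(1)] by (simp add: lin)
  moreover have "Ck n (\<lambda>x. f' (g x) 1)" using Suc.IH fg(2) Suc.prems Ck_Suc_imp by blast
  ultimately show ?case using fg(4)
    by (intro Ck_SucI[where f'="\<lambda>x h. g' x h *\<^sub>R f' (g x) 1"])
      (auto intro!: Ck_bilinear[OF bounded_bilinear_scaleR])
qed

lemma Ck_ident: "Ck n (\<lambda>x. x)"
  by (cases n) (auto intro!: Ck_SucI[where f'="\<lambda>x h. h"] Ck_const simp del: Ck.simps(2))

lemma smooth_const: "smooth (\<lambda>x. c)"
  by (simp add: smooth_def Ck_const)

lemma smooth_ident: "smooth (\<lambda>x. x)"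
  by (simp add: smooth_def Ck_ident)

lemma smooth_add: "smooth f \<Longrightarrow> smooth g \<Longrightarrow> smooth (\<lambda>x. f x + g x)"
  by (simp add: smooth_def Ck_add)

lemma smooth_linear: "bounded_linear L \<Longrightarrow> smooth f \<Longrightarrow> smooth (\<lambda>x. L (f x))"
  unfolding smooth_def by (intro allI Ck_linear[of L]) auto

lemma smooth_compose_affine: "bounded_linear L \<Longrightarrow> smooth f \<Longrightarrow> smooth (\<lambda>x. f (a + L x))"
  unfolding smooth_def by (intro allI Ck_compose_affine[of L]) auto

lemma smooth_compose_linear: "bounded_linear L \<Longrightarrow> smooth f \<Longrightarrow> smooth (\<lambda>x. f (L x))"
  using smooth_compose_affine[of L f 0] by simp

lemma smooth_bilinear:
  "bounded_bilinear B \<Longrightarrow> smooth f \<Longrightarrow> smooth g \<Longrightarrow> smooth (\<lambda>x. B (f x) (g x))"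
  unfolding smooth_def by (intro allI Ck_bilinear[of B]) auto

lemma smooth_compose_real: "smooth f \<Longrightarrow> smooth g \<Longrightarrow> smooth (\<lambda>x. f (g x :: real))"
  unfolding smooth_def by (intro allI Ck_compose_real[of _ f g]) auto

lemmas smooth_mult = smooth_bilinear[OF bounded_bilinear_mult]
lemmas smooth_scaleR = smooth_bilinear[OF bounded_bilinear_scaleR]
lemmas smooth_fst = smooth_linear[OF bounded_linear_fst]
lemmas smooth_snd = smooth_linear[OF bounded_linear_snd]
lemmas smooth_uminus = smooth_linear[OF bounded_linear_minus[OF bounded_linear_ident]]

lemma smooth_diff: "smooth f \<Longrightarrow> smooth g \<Longrightarrow> smooth (\<lambda>x. f x - g x)"
  using smooth_add[of f "\<lambda>x. - g x"] smooth_uminus[of g] by simp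

lemma smooth_of_real: "smooth f \<Longrightarrow> smooth (\<lambda>x. complex_of_real (f x))"
  by (rule smooth_linear[OF bounded_linear_of_real])

section \<open>A smooth function vanishing on a half line\<close>

definition flat :: "nat \<Rightarrow> real \<Rightarrow> real" where
  "flat j x = (if x > 0 then exp (- 1 / x) / x ^ j else 0)"

lemma flat_tendsto_0: "((\<lambda>h. exp (- 1 / h) / h ^ j) \<longlongrightarrow> (0::real)) (at_right 0)"
proof -
  have "((\<lambda>x. x ^ j / exp x) \<longlongrightarrow> (0::real)) at_top" by (rule tendsto_power_div_exp_0)
  then have "((\<lambda>h. (inverse h) ^ j / exp (inverse h)) \<longlongrightarrow> (0::real)) (at_right 0)"
    by (rule filterlim_compose) (rule filterlim_inverse_at_top_right)
  then show ?thesis by (simp add: exp_minus field_simps)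
qed

text \<open>The powers of 1/x close the family under differentiation; smoothness of every member
  then follows by one induction over all \<open>j\<close>. At 0 the right difference quotient of
  \<open>flat j\<close> is \<open>flat (Suc j)\<close>, which tends to 0.\<close>

lemma flat_has_real_derivative:
  "(flat j has_real_derivative (flat (j + 2) x - j * flat (j + 1) x)) (at x)"
proof (cases "x > 0")
  case True
  have "((\<lambda>x. exp (- 1 / x) / x ^ j) has_real_derivative (flat (j + 2) x - j * flat (j + 1) x)) (at x)"
    using True
    by (auto intro!: derivative_eq_intros simp: flat_def divide_simps)
      (cases j; simp add: algebra_simps power2_eq_square power_add)
  then show ?thesis
    by (rule has_field_derivative_transform_within[where d=x]) (use True in \<open>auto simp: flat_def dist_real_def\<close>)
next
  case False
  show ?thesis
  proof (cases "x = 0")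
    case True
    have "((\<lambda>h. flat j h / h) \<longlongrightarrow> 0) (at_right 0)"
    proof (rule Lim_transform_eventually[OF flat_tendsto_0[of "Suc j"]])
      show "\<forall>\<^sub>F h in at_right 0. exp (- 1 / h) / h ^ Suc j = flat j h / h"
        by (auto simp: eventually_at_filter flat_def)
    qed
    moreover have "((\<lambda>h. flat j h / h) \<longlongrightarrow> 0) (at_left 0)"
      by (rule Lim_transform_eventually[of "\<lambda>_. 0"]) (auto simp: eventually_at_filter flat_def)
    ultimately have "((\<lambda>h. flat j h / h) \<longlongrightarrow> 0) (at 0)" by (simp add: filterlim_split_at)
    then show ?thesis using True by (simp add: DERIV_def flat_def)
  next
    case neq: False
    have "((\<lambda>x. 0) has_real_derivative (flat (j + 2) x - j * flat (j + 1) x)) (at x)"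
      using False by (auto simp: flat_def)
    then show ?thesis
      by (rule has_field_derivative_transform_within[where d="-x"])
        (use False neq in \<open>auto simp: flat_def dist_real_def\<close>)
  qed
qed

lemma smooth_flat: "smooth (flat j)"
proof -
  have "Ck n (flat j)" for n
  proof (induction n arbitrary: j)
    case 0
    show ?case by (auto intro!: continuous_at_imp_continuous_on DERIV_isCont flat_has_real_derivative)
  next
    case (Suc n)
    have "Ck n (\<lambda>x. (flat (j + 2) x + (- real j) * flat (j + 1) x) * v)" for v
      by (intro Ck_add Ck_bilinear[OF bounded_bilinear_mult] Suc.IH Ck_const)
    then show ?case
      by (intro Ck_SucI[where f'="\<lambda>x h. (flat (j + 2) x + (- real j) * flat (j + 1) x) * h"])
        (use flat_has_real_derivative[of j] in \<open>simp_all add: has_field_derivative_def\<close>)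
  qed
  then show ?thesis by (simp add: smooth_def)
qed

section \<open>Test functions and their derivatives\<close>

lemma test_functions_UNIV_iff:
  "\<phi> \<in> test_functions UNIV \<longleftrightarrow> smooth \<phi> \<and> bounded {x. \<phi> x \<noteq> 0}"
  by (simp add: test_functions_def smooth_def support_on_def compact_closure)

lemma test_functions_subset: "test_functions \<Omega> \<subseteq> test_functions UNIV"
  by (auto simp: test_functions_def)

lemma test_functions_smooth: "\<phi> \<in> test_functions \<Omega> \<Longrightarrow> smooth \<phi>"
  by (simp add: test_functions_def smooth_def)

lemma test_functions_zero_outside: "\<phi> \<in> test_functions \<Omega> \<Longrightarrow> x \<notin> \<Omega> \<Longrightarrow> \<phi> x = 0"
  using closure_subset[of "support_on UNIV \<phi>"]
  by (metis (mono_tags, lifting) UNIV_I in_support_on mem_Collect_eq subsetD test_functions_def)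

lemma compact_closed_subset: "compact S \<Longrightarrow> closed T \<Longrightarrow> T \<subseteq> S \<Longrightarrow> compact T"
  using compact_Int_closed[of S T] by (simp add: inf.absorb2)

lemma test_functions_frechet_derivative:
  assumes "\<phi> \<in> test_functions \<Omega>"
  shows "(\<lambda>x. frechet_derivative \<phi> (at x) v) \<in> test_functions \<Omega>"
proof -
  let ?S = "closure (support_on UNIV \<phi>)"
  have "frechet_derivative \<phi> (at x) v = 0" if "x \<notin> closure (support_on UNIV \<phi>)" for x
  proof -
    have "((\<lambda>x. 0) has_derivative (\<lambda>h. 0)) (at x)" by simp
    then have "(\<phi> has_derivative (\<lambda>h. 0)) (at x)"
      by (rule has_derivative_transform_within_open[where s="- closure (support_on UNIV \<phi>)"])
        (use that closure_subset[of "support_on UNIV \<phi>"] closed_closure in \<open>auto simp: support_on_def\<close>)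
    then have "frechet_derivative \<phi> (at x) = (\<lambda>h. 0)" by (rule frechet_derivative_at[symmetric])
    then show ?thesis by simp
  qed
  then have "support_on UNIV (\<lambda>x. frechet_derivative \<phi> (at x) v) \<subseteq> ?S"
    by (auto simp: support_on_def)
  then have "closure (support_on UNIV (\<lambda>x. frechet_derivative \<phi> (at x) v)) \<subseteq> ?S"
    by (simp add: closure_minimal)
  moreover have "smooth (\<lambda>x. frechet_derivative \<phi> (at x) v)"
    using assms by (intro smooth_frechet_derivative test_functions_smooth)
  ultimately show ?thesis using assms
    unfolding test_functions_def smooth_def
    by (auto intro: compact_closed_subset simp del: compact_closure)
qed

text \<open>The factor \<open>exp 1\<close> normalizes the value at the centre to 1. The function is
  not constant near 0 and only converges pointwise to 1 as the radius grows, but the exact value 1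
  at 0 means that cutting off in x does not alter the values on the line x = 0.\<close>

definition cut :: "real \<Rightarrow> real \<Rightarrow> real" where
  "cut R x = exp 1 * flat 0 (1 - (x / R)\<^sup>2)"

lemma smooth_cut: "smooth (cut R)"
  unfolding cut_def power2_eq_square divide_inverse
  by (intro smooth_mult smooth_const smooth_compose_real[OF smooth_flat] smooth_diff smooth_ident)

lemma cut_nonneg: "0 \<le> cut R x" and cut_le_1: "cut R x \<le> 1"
proof -
  show "0 \<le> cut R x" by (simp add: cut_def flat_def)
  have "exp 1 * exp (- 1 / (1 - u)) \<le> 1" if "u < 1" "u \<ge> 0" for u :: real
  proof -
    have "1 \<le> 1 / (1 - u)" using that by (simp add: field_simps)
    then have "exp (1 + - 1 / (1 - u)) \<le> 1" by simp
    then show ?thesis by (simp add: exp_add [symmetric])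
  qed
  then show "cut R x \<le> 1" by (auto simp: cut_def flat_def)
qed

lemma cut_zero: "R > 0 \<Longrightarrow> \<bar>x\<bar> \<ge> R \<Longrightarrow> cut R x = 0"
proof -
  assume "R > 0" "\<bar>x\<bar> \<ge> R"
  then have "1 \<le> \<bar>x / R\<bar>" by (simp add: field_simps)
  then have "1 \<le> (x / R)\<^sup>2" by (metis one_le_power power2_abs)
  then show ?thesis by (simp add: cut_def flat_def)
qed

lemma cut_tendsto_1: "(\<lambda>n. cut (real (Suc n)) x) \<longlonglongrightarrow> 1"
proof -
  have "(\<lambda>n. x / real (Suc n)) \<longlonglongrightarrow> 0" by real_asymp
  then have "(\<lambda>n. cut 1 (x / real (Suc n))) \<longlonglongrightarrow> cut 1 0"
    by (rule continuous_on_tendsto_compose[OF smooth_continuous_on[OF smooth_cut, of UNIV]]) auto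
  moreover have "cut 1 0 = 1" by (simp add: cut_def flat_def exp_minus)
  moreover have "cut 1 (x / r) = cut r x" for r by (simp add: cut_def)
  ultimately show ?thesis by simp
qed

lemma compact_support_bounded:
  fixes f :: "'a::euclidean_space \<Rightarrow> 'b::euclidean_space"
  assumes "continuous_on UNIV f" "bounded {x. f x \<noteq> 0}"
  obtains B where "B > 0" "\<And>x. norm (f x) \<le> B"
proof -
  let ?K = "closure {x. f x \<noteq> 0}"
  have "compact (f ` ?K)"
    using assms by (intro compact_continuous_image) (auto intro: continuous_on_subset)
  then obtain B where B: "B > 0" "\<And>y. y \<in> f ` ?K \<Longrightarrow> norm y \<le> B"
    using compact_imp_bounded bounded_pos by metis
  have "norm (f x) \<le> B" for x
    using B closure_subset[of "{x. f x \<noteq> 0}"] by (cases "f x = 0") auto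
  with B(1) that show ?thesis by blast
qed

text \<open>Dilation: \<open>cut R x\<close> is \<open>cut 1 (x / R)\<close>, so one bound for
  radius 1, where the derivative is continuous with bounded support, yields the decay 1/R. This
  makes the terms in which a derivative hits the cut-off negligible.\<close>

lemma cut_derivative_bound:
  obtains C where "C > 0" "\<And>R x. R > 0 \<Longrightarrow> \<bar>deriv (cut R) x\<bar> \<le> C / R"
    "\<And>R x. (cut R has_real_derivative deriv (cut R) x) (at x)"
proof -
  have D: "(cut R has_real_derivative deriv (cut R) x) (at x)" for R x
    using smooth_differentiable[OF smooth_cut, of R x]
    by (simp add: real_differentiable_def differentiable_def DERIV_deriv_iff_real_differentiable)
  have fd: "frechet_derivative (cut 1) (at x) 1 = deriv (cut 1) x" for x
    using frechet_derivative_at[OF D[of 1 x, unfolded has_field_derivative_def]]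
    by (metis mult.right_neutral)
  have "cut 1 \<in> test_functions UNIV"
    unfolding test_functions_UNIV_iff
    using smooth_cut cut_zero[of 1] by (auto intro!: boundedI[of _ 1]) (metis linorder_linear)
  from test_functions_frechet_derivative[OF this, of 1]
  have "continuous_on UNIV (deriv (cut 1))" "bounded {x. deriv (cut 1) x \<noteq> 0}"
    unfolding fd test_functions_UNIV_iff by (auto intro: smooth_continuous_on)
  then obtain C where C: "C > 0" "\<And>x. norm (deriv (cut 1) x) \<le> C"
    using compact_support_bounded by blast
  have scale: "deriv (cut R) x = deriv (cut 1) (x / R) / R" if "R > 0" for R x
  proof -
    have "((\<lambda>x. cut 1 (x / R)) has_real_derivative (deriv (cut 1) (x / R) * (1 / R))) (at x)"
      by (rule DERIV_chain2[OF D]) (use that in \<open>auto intro!: derivative_eq_intros\<close>)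
    moreover have "(\<lambda>x. cut 1 (x / R)) = cut R" by (auto simp: cut_def)
    ultimately show ?thesis using DERIV_imp_deriv by fastforce
  qed
  have bd: "\<bar>deriv (cut R) x\<bar> \<le> C / R" if "R > 0" for R x
    unfolding scale[OF that] using that C(2)[of "x / R"] by (simp add: divide_right_mono)
  show thesis
  proof (rule that[of C])
    show "C > 0" by (rule C(1))
    show "\<bar>deriv (cut R) x\<bar> \<le> C / R" if "R > 0" for R x using that by (rule bd)
    show "(cut R has_real_derivative deriv (cut R) x) (at x)" for R x by (rule D)
  qed
qed

section \<open>Square integrable functions and the Fourier integral\<close>

text \<open>The squared norm as an extended nonnegative real: Tonelli, monotonicity and Fatou apply
  before anything is known to be integrable, and finiteness becomes a conclusion.\<close>

definition nn2 :: "'a measure \<Rightarrow> ('a \<Rightarrow> 'b::euclidean_space) \<Rightarrow> ennreal" where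
  "nn2 M f = (\<integral>\<^sup>+x. ennreal ((norm (f x))\<^sup>2) \<partial>M)"

lemma L2_iff: "f \<in> L2 M \<longleftrightarrow> f \<in> borel_measurable M \<and> nn2 M f < \<infinity>"
  by (auto simp: L2_def nn2_def integrable_iff_bounded)

lemma L2_norm_eq: "f \<in> borel_measurable M \<Longrightarrow> L2_norm M f = sqrt (enn2real (nn2 M f))"
  unfolding L2_norm_def nn2_def by (subst integral_eq_nn_integral) auto

lemma nn2_eq_integral: "f \<in> L2 M \<Longrightarrow> nn2 M f = ennreal (LINT x|M. (norm (f x))\<^sup>2)"
  unfolding nn2_def L2_def by (subst nn_integral_eq_integral) auto

lemma nn2_cong_AE: "(AE x in M. f x = g x) \<Longrightarrow> nn2 M f = nn2 M g"
  unfolding nn2_def by (rule nn_integral_cong_AE) auto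

lemma nn2_mono: "(\<And>x. x \<in> space M \<Longrightarrow> norm (f x) \<le> norm (g x)) \<Longrightarrow> nn2 M f \<le> nn2 M g"
  unfolding nn2_def by (intro nn_integral_mono ennreal_leI power_mono) auto

lemma norm_add_squared_le: "(norm (a + b))\<^sup>2 \<le> 2 * (norm a)\<^sup>2 + 2 * (norm b)\<^sup>2"
  for a b :: "'a::real_normed_vector"
proof -
  have "(norm (a + b))\<^sup>2 \<le> (norm a + norm b)\<^sup>2"
    by (intro power_mono norm_triangle_ineq norm_ge_zero)
  also have "\<dots> \<le> 2 * (norm a)\<^sup>2 + 2 * (norm b)\<^sup>2"
    using zero_le_power2[of "norm a - norm b"] by (simp add: power2_eq_square algebra_simps)
  finally show ?thesis .
qed

text \<open>The constant 2 is the price for squared norms in place of Minkowski's inequality; it is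
  harmless wherever only finiteness or convergence to 0 is at stake.\<close>

lemma nn2_add_le:
  assumes [measurable]: "f \<in> borel_measurable M" "g \<in> borel_measurable M"
  shows "nn2 M (\<lambda>x. f x + g x) \<le> 2 * nn2 M f + 2 * nn2 M g"
proof -
  have "nn2 M (\<lambda>x. f x + g x) \<le> (\<integral>\<^sup>+x. 2 * ennreal ((norm (f x))\<^sup>2) + 2 * ennreal ((norm (g x))\<^sup>2) \<partial>M)"
    unfolding nn2_def
  proof (rule nn_integral_mono)
    fix x
    have "ennreal ((norm (f x + g x))\<^sup>2) \<le> ennreal (2 * (norm (f x))\<^sup>2 + 2 * (norm (g x))\<^sup>2)"
      by (rule ennreal_leI) (rule norm_add_squared_le)
    also have "\<dots> = 2 * ennreal ((norm (f x))\<^sup>2) + 2 * ennreal ((norm (g x))\<^sup>2)"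
      by (simp add: ennreal_mult ennreal_plus)
    finally show "ennreal ((norm (f x + g x))\<^sup>2)
      \<le> 2 * ennreal ((norm (f x))\<^sup>2) + 2 * ennreal ((norm (g x))\<^sup>2)" .
  qed
  also have "\<dots> = 2 * nn2 M f + 2 * nn2 M g"
    unfolding nn2_def by (simp add: nn_integral_add nn_integral_cmult)
  finally show ?thesis .
qed

lemma nn2_uminus: "nn2 M (\<lambda>x. - f x) = nn2 M f"
  by (simp add: nn2_def)

lemma nn2_diff_le:
  assumes "f \<in> borel_measurable M" "g \<in> borel_measurable M"
  shows "nn2 M (\<lambda>x. f x - g x) \<le> 2 * nn2 M f + 2 * nn2 M g"
  using nn2_add_le[of f M "\<lambda>x. - g x"] assms by (simp add: nn2_uminus)

lemma nn2_minus_commute: "nn2 M (\<lambda>x. f x - g x) = nn2 M (\<lambda>x. g x - f x)"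
  by (simp add: nn2_def norm_minus_commute)

lemma nn2_triangle3:
  assumes "f \<in> borel_measurable M" "g \<in> borel_measurable M" "h \<in> borel_measurable M"
  shows "nn2 M (\<lambda>x. f x - h x) \<le> 2 * nn2 M (\<lambda>x. f x - g x) + 2 * nn2 M (\<lambda>x. g x - h x)"
  using nn2_add_le[of "\<lambda>x. f x - g x" M "\<lambda>x. g x - h x"] assms by simp

lemma L2_add: "f \<in> L2 M \<Longrightarrow> g \<in> L2 M \<Longrightarrow> (\<lambda>x. f x + g x) \<in> L2 M"
  unfolding L2_iff
  by (intro conjI borel_measurable_add le_less_trans[OF nn2_add_le]) (simp_all add: ennreal_mult_less_top)

lemma L2_diff: "f \<in> L2 M \<Longrightarrow> g \<in> L2 M \<Longrightarrow> (\<lambda>x. f x - g x) \<in> L2 M"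
  unfolding L2_iff
  by (intro conjI borel_measurable_diff le_less_trans[OF nn2_diff_le]) (simp_all add: ennreal_mult_less_top)

lemma nn2_scale_le:
  assumes [measurable]: "f \<in> borel_measurable M" and "\<And>x. x \<in> space M \<Longrightarrow> norm (g x) \<le> C * norm (f x)" "C \<ge> 0"
  shows "nn2 M g \<le> ennreal (C\<^sup>2) * nn2 M f"
proof -
  have "nn2 M g \<le> (\<integral>\<^sup>+x. ennreal (C\<^sup>2) * ennreal ((norm (f x))\<^sup>2) \<partial>M)"
    unfolding nn2_def
  proof (rule nn_integral_mono)
    fix x assume "x \<in> space M"
    then have "(norm (g x))\<^sup>2 \<le> (C * norm (f x))\<^sup>2" using assms by (intro power_mono) auto
    then show "ennreal ((norm (g x))\<^sup>2) \<le> ennreal (C\<^sup>2) * ennreal ((norm (f x))\<^sup>2)"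
      by (simp add: ennreal_mult [symmetric] power_mult_distrib)
  qed
  then show ?thesis by (simp add: nn2_def nn_integral_cmult)
qed

text \<open>Cauchy-Schwarz for the bilinear pairing, without conjugation; integrability is read off
  from the finiteness of the right-hand side.\<close>

lemma L2_product:
  fixes f g :: "'a \<Rightarrow> complex"
  assumes f: "f \<in> L2 M" and g: "g \<in> L2 M"
  shows "integrable M (\<lambda>x. f x * g x)"
    and "ennreal ((cmod (LINT x|M. f x * g x))\<^sup>2) \<le> nn2 M f * nn2 M g"
proof -
  have [measurable]: "f \<in> borel_measurable M" "g \<in> borel_measurable M"
    and fin: "nn2 M f < \<infinity>" "nn2 M g < \<infinity>" using assms by (auto simp: L2_iff)
  have *: "(\<integral>\<^sup>+x. ennreal (norm (f x * g x)) \<partial>M)\<^sup>2 \<le> nn2 M f * nn2 M g"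
    using Cauchy_Schwarz_nn_integral[of "\<lambda>x. ennreal (norm (f x))" M "\<lambda>x. ennreal (norm (g x))"]
    by (simp add: nn2_def norm_mult ennreal_mult ennreal_power)
  also have "\<dots> < \<infinity>" using fin by (simp add: ennreal_mult_less_top)
  finally have **: "(\<integral>\<^sup>+x. ennreal (norm (f x * g x)) \<partial>M) < \<infinity>"
    by (simp add: power_less_top_ennreal)
  then show int: "integrable M (\<lambda>x. f x * g x)" by (simp add: integrable_iff_bounded)
  have "ennreal (cmod (LINT x|M. f x * g x)) \<le> (\<integral>\<^sup>+x. ennreal (norm (f x * g x)) \<partial>M)"
    using int by (intro integral_norm_bound_ennreal)
  then have "(ennreal (cmod (LINT x|M. f x * g x)))\<^sup>2 \<le> (\<integral>\<^sup>+x. ennreal (norm (f x * g x)) \<partial>M)\<^sup>2"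
    by (rule power_mono_ennreal)
  with * show "ennreal ((cmod (LINT x|M. f x * g x))\<^sup>2) \<le> nn2 M f * nn2 M g"
    by (simp add: ennreal_power)
qed

lemma ennreal_tendsto_0_bound:
  fixes u v :: "nat \<Rightarrow> ennreal"
  assumes "\<And>n. u n \<le> v n" "v \<longlonglongrightarrow> 0"
  shows "u \<longlonglongrightarrow> 0"
  by (rule tendsto_sandwich[of "\<lambda>_. 0" _ _ v]) (use assms in auto)

lemma ennreal_cmult_tendsto_0:
  fixes u :: "nat \<Rightarrow> ennreal"
  assumes "u \<longlonglongrightarrow> 0" "c < \<infinity>"
  shows "(\<lambda>n. c * u n) \<longlonglongrightarrow> 0"
  using ennreal_tendsto_cmult[OF _ assms(1), of c] assms(2) by simp

lemma L2_product_tendsto: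
  fixes f :: "nat \<Rightarrow> 'a \<Rightarrow> complex"
  assumes "\<And>n. f n \<in> L2 M" "h \<in> L2 M" "g \<in> L2 M" "(\<lambda>n. nn2 M (\<lambda>x. f n x - h x)) \<longlonglongrightarrow> 0"
  shows "(\<lambda>n. LINT x|M. f n x * g x) \<longlonglongrightarrow> (LINT x|M. h x * g x)"
proof -
  have "(\<lambda>n. nn2 M g * nn2 M (\<lambda>x. f n x - h x)) \<longlonglongrightarrow> 0"
    by (rule ennreal_cmult_tendsto_0) (use assms in \<open>auto simp: L2_iff\<close>)
  then have "(\<lambda>n. ennreal ((cmod (LINT x|M. (f n x - h x) * g x))\<^sup>2)) \<longlonglongrightarrow> 0"
    by (rule ennreal_tendsto_0_bound[rotated])
      (use L2_product(2)[OF L2_diff[OF assms(1,2)] assms(3)] in \<open>simp add: mult.commute\<close>)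
  then have "(\<lambda>n. (cmod (LINT x|M. (f n x - h x) * g x))\<^sup>2) \<longlonglongrightarrow> 0"
    by (simp add: ennreal_0 [symmetric] del: ennreal_0)
  then have "(\<lambda>n. cmod (LINT x|M. (f n x - h x) * g x)) \<longlonglongrightarrow> 0"
    using tendsto_real_sqrt by fastforce
  then have "(\<lambda>n. (LINT x|M. (f n x - h x) * g x)) \<longlonglongrightarrow> 0" by (rule tendsto_norm_zero_cancel)
  moreover have "(LINT x|M. (f n x - h x) * g x) = (LINT x|M. f n x * g x) - (LINT x|M. h x * g x)" for n
    using L2_product(1)[OF assms(1,3)] L2_product(1)[OF assms(2,3)] by (simp add: left_diff_distrib)
  ultimately show ?thesis by (simp add: LIM_zero_iff)
qed

lemma integrable_compact_support:
  fixes f :: "'a::euclidean_space \<Rightarrow> 'b::euclidean_space"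
  assumes "continuous_on UNIV f" "bounded {x. f x \<noteq> 0}"
  shows "integrable lborel f"
proof -
  obtain B where B: "B > 0" "\<And>x. norm (f x) \<le> B" using compact_support_bounded[OF assms] by blast
  let ?K = "closure {x. f x \<noteq> 0}"
  have K: "compact ?K" using assms(2) by simp
  show ?thesis
  proof (rule Bochner_Integration.integrable_bound[of _ "\<lambda>x. indicator ?K x *\<^sub>R B"])
    show "integrable lborel (\<lambda>x. indicator ?K x *\<^sub>R B)"
      using emeasure_compact_finite[OF K] by (intro integrable_real_indicator integrable_scaleR_left) auto
    show "f \<in> borel_measurable lborel" using assms(1) borel_measurable_continuous_onI by auto
    have "norm (f x) \<le> norm (indicator ?K x *\<^sub>R B)" for x
    proof (cases "f x = 0")
      case False
      then have "x \<in> ?K" using closure_subset[of "{x. f x \<noteq> 0}"] by auto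
      then have "indicator ?K x = (1::real)" by (rule indicator_simps(1))
      then show ?thesis using B(2)[of x] B(1) by (simp del: indicator_eq_1_iff)
    qed simp
    then show "AE x in lborel. norm (f x) \<le> norm (indicator ?K x *\<^sub>R B)" by (rule AE_I2)
  qed
qed

lemma L2_compact_support:
  fixes f :: "'a::euclidean_space \<Rightarrow> 'b::euclidean_space"
  assumes "continuous_on UNIV f" "bounded {x. f x \<noteq> 0}"
  shows "f \<in> L2 lborel"
proof -
  have "integrable lborel (\<lambda>x. (norm (f x))\<^sup>2)"
    by (rule integrable_compact_support) (use assms in \<open>auto intro!: continuous_intros\<close>)
  then show ?thesis using assms(1) borel_measurable_continuous_onI by (auto simp: L2_def)
qed

lemma test_functions_continuous: "f \<in> test_functions \<Omega> \<Longrightarrow> continuous_on S f"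
  using smooth_continuous_on test_functions_smooth by blast

lemma test_functions_bounded_support: "f \<in> test_functions \<Omega> \<Longrightarrow> bounded {x. f x \<noteq> 0}"
  using test_functions_UNIV_iff[of f] test_functions_subset[of \<Omega>] by auto

lemma test_functions_integrable: "f \<in> test_functions \<Omega> \<Longrightarrow> integrable lborel f"
  by (rule integrable_compact_support[OF test_functions_continuous test_functions_bounded_support])

lemma test_functions_L2: "f \<in> test_functions \<Omega> \<Longrightarrow> f \<in> L2 lborel"
  by (rule L2_compact_support[OF test_functions_continuous test_functions_bounded_support])

section \<open>The Fourier integral of an integrable function\<close>

lemma inv_fourier_measurable [measurable]:
  assumes [measurable]: "g \<in> borel_measurable borel"
  shows "inv_fourier g \<in> borel_measurable borel"
proof -
  have "(\<lambda>k. LINT y|lborel. exp (\<i> * of_real k * of_real y) * g y) \<in> borel_measurable lborel"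
    by (rule lborel.borel_measurable_lebesgue_integral) (simp add: split_beta', measurable)
  then show ?thesis unfolding inv_fourier_def by measurable
qed

lemma inv_fourier_integrable_integrand:
  assumes "integrable lborel g"
  shows "integrable lborel (\<lambda>y. exp (\<i> * of_real k * of_real y) * g y)"
  by (rule Bochner_Integration.integrable_bound[OF assms]) (use assms in \<open>auto simp: norm_mult\<close>)

lemma inv_fourier_bound:
  assumes "integrable lborel g"
  shows "cmod (inv_fourier g k) \<le> (LINT y|lborel. cmod (g y))"
proof -
  have "cmod (LINT y|lborel. exp (\<i> * of_real k * of_real y) * g y) \<le> (LINT y|lborel. cmod (g y))"
    by (rule order_trans[OF integral_norm_bound]) (simp add: norm_mult)
  moreover have "cmod (inv_fourier g k) \<le> 1 * cmod (LINT y|lborel. exp (\<i> * of_real k * of_real y) * g y)"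
    unfolding inv_fourier_def norm_mult norm_of_real
    using pi_gt3 by (intro mult_right_mono norm_ge_zero) (simp add: field_simps)
  ultimately show ?thesis by simp
qed

lemma inv_fourier_add:
  "integrable lborel f \<Longrightarrow> integrable lborel g \<Longrightarrow>
    inv_fourier (\<lambda>x. f x + g x) k = inv_fourier f k + inv_fourier g k"
  using inv_fourier_integrable_integrand[of f k] inv_fourier_integrable_integrand[of g k]
  unfolding inv_fourier_def by (simp add: distrib_left)

lemma inv_fourier_cmult: "inv_fourier (\<lambda>x. c * f x) k = c * inv_fourier f k"
proof -
  have "(LINT y|lborel. exp (\<i> * of_real k * of_real y) * (c * f y))
    = (LINT y|lborel. c * (exp (\<i> * of_real k * of_real y) * f y))"
    by (simp add: mult.left_commute)
  then show ?thesis unfolding inv_fourier_def by simp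
qed

lemma inv_fourier_diff:
  "integrable lborel f \<Longrightarrow> integrable lborel g \<Longrightarrow>
    inv_fourier (\<lambda>x. f x - g x) k = inv_fourier f k - inv_fourier g k"
  using inv_fourier_add[of f "\<lambda>x. (-1) * g x" k] inv_fourier_cmult[of "-1" g k] by simp

lemma inv_fourier_cnj: "inv_fourier (\<lambda>x. cnj (f x)) k = cnj (inv_fourier f (- k))"
proof -
  have "(LINT y|lborel. exp (\<i> * of_real k * of_real y) * cnj (f y))
    = (LINT y|lborel. cnj (exp (\<i> * of_real (- k) * of_real y) * f y))"
    by (rule Bochner_Integration.integral_cong) (auto simp: exp_cnj)
  also have "\<dots> = cnj (LINT y|lborel. exp (\<i> * of_real (- k) * of_real y) * f y)"
    by (rule Bochner_Integration.integral_cnj)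
  finally show ?thesis
    unfolding inv_fourier_def by (simp only: complex_cnj_mult complex_cnj_complex_of_real)
qed

text \<open>Fubini, because the kernel exp(iky) is symmetric in k and y. The pairing is bilinear,
  the form in which distributions act.\<close>

lemma inv_fourier_parseval:
  assumes f: "integrable lborel f" and g: "integrable lborel g"
  shows "(LINT k|lborel. inv_fourier f k * g k) = (LINT y|lborel. f y * inv_fourier g y)"
proof -
  have [measurable]: "f \<in> borel_measurable borel" "g \<in> borel_measurable borel" using f g by auto
  have int: "integrable (lborel \<Otimes>\<^sub>M lborel) (\<lambda>(k, y). exp (\<i> * of_real k * of_real y) * f y * g k)"
  proof (rule lborel_pair.Fubini_integrable)
    show "(\<lambda>(k, y). exp (\<i> * of_real k * of_real y) * f y * g k) \<in> borel_measurable (lborel \<Otimes>\<^sub>M lborel)"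
      by (simp add: split_beta', measurable)
    have "integrable lborel (\<lambda>x. (LINT y|lborel. cmod (f y)) * cmod (g x))" using g by simp
    then show "integrable lborel (\<lambda>x. LINT y|lborel. norm (case (x, y) of (k, y) \<Rightarrow> exp (\<i> * of_real k * of_real y) * f y * g k))"
      using f by (simp add: norm_mult)
    show "AE x in lborel. integrable lborel (\<lambda>y. case (x, y) of (k, y) \<Rightarrow> exp (\<i> * of_real k * of_real y) * f y * g k)"
      using inv_fourier_integrable_integrand[OF f] by auto
  qed
  have "inv_fourier f k * g k
    = of_real (1 / sqrt (2 * pi)) * (LINT y|lborel. exp (\<i> * of_real k * of_real y) * f y * g k)" for k
    unfolding inv_fourier_def by (subst integral_mult_left_zero) (simp only: mult.assoc)
  then have "(LINT k|lborel. inv_fourier f k * g k)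
    = of_real (1 / sqrt (2 * pi)) * (LINT k|lborel. (LINT y|lborel. exp (\<i> * of_real k * of_real y) * f y * g k))"
    by (simp only: integral_mult_right_zero)
  also have "(LINT k|lborel. (LINT y|lborel. exp (\<i> * of_real k * of_real y) * f y * g k))
    = (LINT y|lborel. (LINT k|lborel. exp (\<i> * of_real k * of_real y) * f y * g k))"
    by (rule lborel_pair.Fubini_integral[OF int, symmetric])
  also have "\<dots> = (LINT y|lborel. f y * (LINT k|lborel. exp (\<i> * of_real y * of_real k) * g k))"
    by (intro Bochner_Integration.integral_cong refl) (simp add: ac_simps flip: integral_mult_right_zero)
  also have "of_real (1 / sqrt (2 * pi)) * \<dots> = (LINT y|lborel. f y * inv_fourier g y)"
    unfolding inv_fourier_def by (simp add: mult.left_commute)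
  finally show ?thesis .
qed

text \<open>This is the characteristic function of the standard normal distribution, stripped of its
  normalization.\<close>

lemma integral_gaussian_iexp:
  "(LINT x|lborel. complex_of_real (exp (- x\<^sup>2 / 2)) * exp (\<i> * of_real t * of_real x))
    = of_real (sqrt (2 * pi) * exp (- t\<^sup>2 / 2))"
proof -
  have "(LINT x|lborel. std_normal_density x *\<^sub>R iexp (t * x)) = of_real (exp (- t\<^sup>2 / 2))"
    using char_std_normal_distribution
    by (simp add: char_def fun_eq_iff integral_density)
  moreover have "std_normal_density x *\<^sub>R iexp (t * x)
    = of_real (1 / sqrt (2 * pi)) * (complex_of_real (exp (- x\<^sup>2 / 2)) * exp (\<i> * of_real t * of_real x))" for x
    by (simp add: std_normal_density_def scaleR_conv_of_real mult.assoc)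
  ultimately have "of_real (1 / sqrt (2 * pi)) * (LINT x|lborel. complex_of_real (exp (- x\<^sup>2 / 2)) * exp (\<i> * of_real t * of_real x))
    = complex_of_real (exp (- t\<^sup>2 / 2))"
    by (simp only: integral_mult_right_zero)
  then show ?thesis by (simp add: field_simps)
qed

lemma integrable_gaussian: "integrable lborel (\<lambda>x::real. exp (- x\<^sup>2 / 2))"
proof -
  have "integrable lborel (\<lambda>x. sqrt (2 * pi) * std_normal_density x)"
    by (intro integrable_mult_right integrable_normal_density) auto
  then show ?thesis by (simp add: std_normal_density_def)
qed

lemma inv_fourier_gaussian:
  assumes "\<epsilon> > 0"
  shows "inv_fourier (\<lambda>k. exp (\<i> * of_real y * of_real k) * of_real (exp (- (\<epsilon> * k)\<^sup>2 / 2))) s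
    = of_real (1 / \<epsilon> * exp (- ((s + y) / \<epsilon>)\<^sup>2 / 2))"
proof -
  let ?g = "\<lambda>k. exp (\<i> * of_real s * of_real k) * (exp (\<i> * of_real y * of_real k) * complex_of_real (exp (- (\<epsilon> * k)\<^sup>2 / 2)))"
  have "(LINT k|lborel. ?g k) = (1 / \<epsilon>) *\<^sub>R (LINT k|lborel. ?g (0 + 1 / \<epsilon> * k))"
    using lborel_integral_real_affine[of "1 / \<epsilon>" ?g 0] assms by simp
  also have "(\<lambda>k. ?g (0 + 1 / \<epsilon> * k))
    = (\<lambda>k. complex_of_real (exp (- k\<^sup>2 / 2)) * exp (\<i> * of_real ((s + y) / \<epsilon>) * of_real k))"
    using assms by (auto simp: fun_eq_iff exp_add [symmetric] field_simps power_divide)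
  finally show ?thesis
    unfolding inv_fourier_def integral_gaussian_iexp by (simp add: scaleR_conv_of_real)
qed

text \<open>A Gaussian factor of width 1/eps in k regularizes the outer integral; by the
  multiplication formula the result is an average of \<open>f\<close> against a Gaussian of width
  eps around -y. The sign of the argument arises because the same kernel is applied twice, instead
  of a kernel and its conjugate.\<close>

lemma inv_fourier_inversion:
  assumes cont: "continuous_on UNIV f" and bd: "\<And>x. cmod (f x) \<le> B" and f: "integrable lborel f"
    and h: "integrable lborel (inv_fourier f)"
  shows "inv_fourier (inv_fourier f) y = f (- y)"
proof -
  have [measurable]: "f \<in> borel_measurable borel" using f by auto
  define e where "e n = 1 / real (Suc n)" for n
  have e: "e n > 0" for n by (simp add: e_def)
  have e0: "e \<longlonglongrightarrow> 0" unfolding e_def by real_asymp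
  define G where "G n k = exp (\<i> * of_real y * of_real k) * complex_of_real (exp (- (e n * k)\<^sup>2 / 2))" for n k
  have [measurable]: "G n \<in> borel_measurable borel" for n unfolding G_def by measurable
  have G: "integrable lborel (G n)" for n
  proof (rule Bochner_Integration.integrable_bound)
    show "integrable lborel (\<lambda>k. exp (- (0 + e n * k)\<^sup>2 / 2))"
      using lborel_integrable_real_affine[OF integrable_gaussian, of "e n" 0] e[of n] by simp
  qed (auto simp: G_def norm_mult)
  have "(\<lambda>n. LINT k|lborel. inv_fourier f k * G n k)
      \<longlonglongrightarrow> (LINT k|lborel. inv_fourier f k * exp (\<i> * of_real y * of_real k))"
  proof (rule integral_dominated_convergence[where w="\<lambda>k. cmod (inv_fourier f k)"])
    show "integrable lborel (\<lambda>k. cmod (inv_fourier f k))" using h by simp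
    have "(\<lambda>n. G n k) \<longlonglongrightarrow> exp (\<i> * of_real y * of_real k) * complex_of_real (exp (- (0 * k)\<^sup>2 / 2))" for k
      unfolding G_def by (intro tendsto_intros e0) auto
    then show "AE k in lborel. (\<lambda>n. inv_fourier f k * G n k)
      \<longlonglongrightarrow> inv_fourier f k * exp (\<i> * of_real y * of_real k)"
      by (intro AE_I2 tendsto_mult_left) simp
    show "AE k in lborel. cmod (inv_fourier f k * G n k) \<le> cmod (inv_fourier f k)" for n
      by (intro AE_I2) (simp add: G_def norm_mult mult_left_le)
  qed (auto simp: G_def)
  also have "(LINT k|lborel. inv_fourier f k * exp (\<i> * of_real y * of_real k))
    = of_real (sqrt (2 * pi)) * inv_fourier (inv_fourier f) y"
    by (simp add: inv_fourier_def[of "inv_fourier f"] mult.commute)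
  finally have lim1: "(\<lambda>n. LINT k|lborel. inv_fourier f k * G n k)
      \<longlonglongrightarrow> of_real (sqrt (2 * pi)) * inv_fourier (inv_fourier f) y" .
  \<comment> \<open>The substitution s = -y + e n * u rescales the Gaussian to unit width, so that
    afterwards the limit can be taken under the integral with the majorant B exp(-u^2/2).\<close>
  have eq: "(LINT k|lborel. inv_fourier f k * G n k)
    = (LINT u|lborel. f (- y + e n * u) * of_real (exp (- u\<^sup>2 / 2)))" for n
  proof -
    have "(LINT k|lborel. inv_fourier f k * G n k) = (LINT s|lborel. f s * inv_fourier (G n) s)"
      by (rule inv_fourier_parseval[OF f G])
    also have "\<dots> = (LINT s|lborel. f s * of_real (1 / e n * exp (- ((s + y) / e n)\<^sup>2 / 2)))"
      unfolding G_def inv_fourier_gaussian[OF e] ..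
    also have "\<dots> = \<bar>e n\<bar> *\<^sub>R (LINT u|lborel. f (- y + e n * u)
        * of_real (1 / e n * exp (- ((- y + e n * u + y) / e n)\<^sup>2 / 2)))"
      using e[of n] by (intro lborel_integral_real_affine) simp
    also have "(\<lambda>u. f (- y + e n * u) * complex_of_real (1 / e n * exp (- ((- y + e n * u + y) / e n)\<^sup>2 / 2)))
        = (\<lambda>u. (1 / e n) *\<^sub>R (f (- y + e n * u) * of_real (exp (- u\<^sup>2 / 2))))"
      using e[of n] by (auto simp: fun_eq_iff scaleR_conv_of_real)
    also have "\<bar>e n\<bar> *\<^sub>R (LINT u|lborel. (1 / e n) *\<^sub>R (f (- y + e n * u) * complex_of_real (exp (- u\<^sup>2 / 2))))
        = (LINT u|lborel. f (- y + e n * u) * of_real (exp (- u\<^sup>2 / 2)))"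
      using e[of n] by (simp only: integral_scaleR_right scaleR_scaleR) simp
    finally show ?thesis .
  qed
  have "(\<lambda>n. LINT u|lborel. f (- y + e n * u) * of_real (exp (- u\<^sup>2 / 2)))
    \<longlonglongrightarrow> (LINT u|lborel. f (- y) * complex_of_real (exp (- u\<^sup>2 / 2)))"
  proof (rule integral_dominated_convergence[where w="\<lambda>u. B * exp (- u\<^sup>2 / 2)"])
    show "integrable lborel (\<lambda>u::real. B * exp (- u\<^sup>2 / 2))"
      by (intro integrable_mult_right integrable_gaussian)
    have "(\<lambda>n. f (- y + e n * u)) \<longlonglongrightarrow> f (- y + 0 * u)" for u
      by (rule continuous_on_tendsto_compose[OF cont]) (intro tendsto_intros e0, auto)
    then show "AE u in lborel. (\<lambda>n. f (- y + e n * u) * of_real (exp (- u\<^sup>2 / 2)))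
      \<longlonglongrightarrow> f (- y) * complex_of_real (exp (- u\<^sup>2 / 2))"
      by (intro AE_I2 tendsto_mult_right) simp
    show "AE u in lborel. cmod (f (- y + e n * u) * of_real (exp (- u\<^sup>2 / 2))) \<le> B * exp (- u\<^sup>2 / 2)" for n
      using bd by (intro AE_I2) (simp add: norm_mult mult_right_mono)
  qed auto
  also have "(LINT u|lborel. f (- y) * complex_of_real (exp (- u\<^sup>2 / 2))) = of_real (sqrt (2 * pi)) * f (- y)"
    using integral_gaussian_iexp[of 0] by simp
  finally have "of_real (sqrt (2 * pi)) * inv_fourier (inv_fourier f) y = of_real (sqrt (2 * pi)) * f (- y)"
    using lim1 unfolding eq by (rule LIMSEQ_unique[rotated])
  then show ?thesis by simp
qed

section \<open>Test functions under the Fourier integral\<close>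

lemma integral_derivative_eq_0:
  fixes h :: "real \<Rightarrow> 'b::euclidean_space"
  assumes d: "\<And>x. (h has_vector_derivative h' x) (at x)" and c: "continuous_on UNIV h'"
    and b: "bounded {x. h x \<noteq> 0}"
  shows "(LINT x|lborel. h' x) = 0"
proof -
  obtain M where M: "M > 0" "\<And>x. h x \<noteq> 0 \<Longrightarrow> norm x \<le> M"
    using b by (auto simp: bounded_pos)
  have z: "h x = 0" if "\<bar>x\<bar> > M" for x using M(2)[of x] that by auto
  have z': "h' x = 0" if "\<bar>x\<bar> > M" for x
  proof -
    have "open {x::real. \<bar>x\<bar> > M}" by (intro open_Collect_less continuous_intros)
    then have "(h has_vector_derivative 0) (at x)"
      using that z
      by (intro has_vector_derivative_transform_within_open[OF has_vector_derivative_const]) auto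
    then show ?thesis using d vector_derivative_unique_at by blast
  qed
  have "(LINT x|lborel. h' x) = (LINT x|lborel. indicator {- (M + 1)..M + 1} x *\<^sub>R h' x)"
    using z' by (intro Bochner_Integration.integral_cong) (auto simp: indicator_def)
  also have "\<dots> = h (M + 1) - h (- (M + 1))"
    using M(1) by (intro integral_FTC_Icc)
      (auto intro: continuous_on_subset[OF c] has_vector_derivative_at_within[OF d])
  also have "\<dots> = 0" using z M(1) by simp
  finally show ?thesis .
qed

definition ddx :: "(real \<Rightarrow> 'b::euclidean_space) \<Rightarrow> real \<Rightarrow> 'b" where
  "ddx f x = frechet_derivative f (at x) 1"

lemma ddx_has_vector_derivative: "smooth f \<Longrightarrow> (f has_vector_derivative ddx f x) (at x)"
  using smooth_has_derivative[of f x] has_derivative_linear[OF smooth_has_derivative[of f x]]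
  by (auto simp: has_vector_derivative_def ddx_def elim!: has_derivative_eq_rhs
        simp flip: linear_scale)

lemma test_functions_ddx: "f \<in> test_functions \<Omega> \<Longrightarrow> ddx f \<in> test_functions \<Omega>"
  unfolding ddx_def by (rule test_functions_frechet_derivative)

text \<open>The product of the exponential with \<open>f\<close> has bounded support, so its
  derivative integrates to 0; this is integration by parts without boundary terms.\<close>

lemma inv_fourier_ddx:
  assumes f: "f \<in> test_functions \<Omega>"
  shows "inv_fourier (ddx f) k = - \<i> * of_real k * inv_fourier f k"
proof -
  let ?e = "\<lambda>y. exp (\<i> * of_real k * complex_of_real y)"
  note sm = test_functions_smooth[OF f]
  have e: "(?e has_vector_derivative (\<i> * of_real k * ?e y)) (at y)" for y
    by (rule has_vector_derivative_real_field) (auto intro!: derivative_eq_intros)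
  have "((\<lambda>y. ?e y * f y) has_vector_derivative (?e y * ddx f y + \<i> * of_real k * ?e y * f y)) (at y)" for y
    by (rule has_vector_derivative_mult[OF e ddx_has_vector_derivative[OF sm]])
  then have "(LINT y|lborel. ?e y * ddx f y + \<i> * of_real k * ?e y * f y) = 0"
    by (rule integral_derivative_eq_0)
      (use test_functions_bounded_support[OF f] in \<open>auto intro!: continuous_intros
        test_functions_continuous[OF f] test_functions_continuous[OF test_functions_ddx[OF f]]\<close>)
  also have "(LINT y|lborel. ?e y * ddx f y + \<i> * of_real k * ?e y * f y)
     = (LINT y|lborel. ?e y * ddx f y) + (LINT y|lborel. \<i> * of_real k * (?e y * f y))"
    using inv_fourier_integrable_integrand[OF test_functions_integrable[OF f], of k]
      inv_fourier_integrable_integrand[OF test_functions_integrable[OF test_functions_ddx[OF f]], of k]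
    by (subst Bochner_Integration.integral_add[symmetric]) (auto simp: mult.assoc)
  finally have "(LINT y|lborel. ?e y * ddx f y) = - \<i> * of_real k * (LINT y|lborel. ?e y * f y)"
    by (simp add: eq_neg_iff_add_eq_0)
  then show ?thesis unfolding inv_fourier_def by simp
qed

text \<open>The transform of f - f'' is (1 + k^2) times that of f, and it is bounded by an L^1
  norm.\<close>

lemma inv_fourier_test_decay:
  assumes f: "f \<in> test_functions \<Omega>"
  obtains C where "C > 0" "\<And>k. cmod (inv_fourier f k) \<le> C / (1 + k\<^sup>2)"
proof -
  let ?f2 = "ddx (ddx f)"
  have f2: "?f2 \<in> test_functions \<Omega>" using f by (intro test_functions_ddx)
  \<comment> \<open>The summand 1 makes \<open>C\<close> strictly positive even for the zero
    function.\<close>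
  define C where "C = (LINT y|lborel. cmod (f y - ?f2 y)) + 1"
  have "integrable lborel (\<lambda>y. f y - ?f2 y)"
    using test_functions_integrable f f2 by (intro Bochner_Integration.integrable_diff)
  then have "cmod (inv_fourier (\<lambda>y. f y - ?f2 y) k) \<le> C" for k
    using inv_fourier_bound[of "\<lambda>y. f y - ?f2 y" k] by (simp add: C_def)
  moreover have "inv_fourier (\<lambda>y. f y - ?f2 y) k = of_real (1 + k\<^sup>2) * inv_fourier f k" for k
    using test_functions_integrable[OF f] test_functions_integrable[OF f2]
    by (subst inv_fourier_diff)
      (auto simp: inv_fourier_ddx[OF test_functions_ddx[OF f]] inv_fourier_ddx[OF f] algebra_simps power2_eq_square)
  ultimately have "(1 + k\<^sup>2) * cmod (inv_fourier f k) \<le> C" for k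
    by (metis abs_of_nonneg add_increasing norm_mult norm_of_real zero_le_one zero_le_power2)
  moreover have "(1 + k\<^sup>2) > 0" for k :: real by (simp add: add_pos_nonneg)
  ultimately have "cmod (inv_fourier f k) \<le> C / (1 + k\<^sup>2)" for k
    by (simp add: pos_le_divide_eq mult.commute)
  moreover have "C > 0" unfolding C_def by (intro add_nonneg_pos integral_nonneg) auto
  ultimately show thesis using that by blast
qed

lemma integrable_inverse_1_plus: "integrable lborel (\<lambda>k::real. 1 / (1 + k\<^sup>2))"
  using integrable_inverse_1_plus_square by (simp add: set_integrable_def inverse_eq_divide)

lemma inv_fourier_test_integrable:
  assumes f: "f \<in> test_functions \<Omega>"
  shows "integrable lborel (inv_fourier f)" "inv_fourier f \<in> L2 lborel"
proof -
  obtain C where C: "C > 0" "\<And>k. cmod (inv_fourier f k) \<le> C / (1 + k\<^sup>2)"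
    using inv_fourier_test_decay[OF f] by blast
  have [measurable]: "f \<in> borel_measurable borel" by (rule smooth_borel_measurable[OF test_functions_smooth[OF f]])
  have "integrable lborel (\<lambda>k::real. C * (1 / (1 + k\<^sup>2)))"
    by (intro integrable_mult_right integrable_inverse_1_plus)
  then show i: "integrable lborel (inv_fourier f)"
    by (rule Bochner_Integration.integrable_bound) (use C in \<open>auto simp: abs_mult\<close>)
  have "integrable lborel (\<lambda>k. C * cmod (inv_fourier f k))" using i by simp
  then have "integrable lborel (\<lambda>k. (cmod (inv_fourier f k))\<^sup>2)"
  proof (rule Bochner_Integration.integrable_bound)
    have "cmod (inv_fourier f k) \<le> C" for k
      by (rule order_trans[OF C(2)]) (use C(1) in \<open>simp add: field_simps add_pos_nonneg\<close>)
    then show "AE k in lborel. norm ((cmod (inv_fourier f k))\<^sup>2) \<le> norm (C * cmod (inv_fourier f k))"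
      using C(1) by (auto simp: power2_eq_square abs_mult intro!: AE_I2 mult_right_mono)
  qed auto
  then show "inv_fourier f \<in> L2 lborel" by (simp add: L2_def)
qed

lemma inv_fourier_inversion_test:
  assumes f: "f \<in> test_functions \<Omega>"
  shows "inv_fourier (inv_fourier f) y = f (- y)"
proof -
  obtain B where B: "B > 0" "\<And>x. norm (f x) \<le> B"
    using compact_support_bounded[OF test_functions_continuous[OF f] test_functions_bounded_support[OF f]]
    by blast
  show ?thesis
    by (rule inv_fourier_inversion[OF test_functions_continuous[OF f] B(2)
          test_functions_integrable[OF f] inv_fourier_test_integrable(1)[OF f]])
qed

text \<open>The multiplication formula is applied to \<open>f\<close> and the conjugate of its
  transform; by inversion the transform of the latter is the conjugate of \<open>f\<close>, the two
  reflections cancelling.\<close>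

lemma plancherel_test:
  assumes f: "f \<in> test_functions \<Omega>"
  shows "nn2 lborel (inv_fourier f) = nn2 lborel f"
proof -
  have h: "integrable lborel (inv_fourier f)" "inv_fourier f \<in> L2 lborel"
    by (rule inv_fourier_test_integrable[OF f])+
  have "complex_of_real (LINT k|lborel. (norm (inv_fourier f k))\<^sup>2)
     = (LINT k|lborel. inv_fourier f k * cnj (inv_fourier f k))"
    by (simp only: complex_norm_square[symmetric] integral_complex_of_real)
  also have "\<dots> = (LINT y|lborel. f y * inv_fourier (\<lambda>k. cnj (inv_fourier f k)) y)"
    using h(1) by (intro inv_fourier_parseval test_functions_integrable[OF f]) simp
  also have "\<dots> = (LINT y|lborel. f y * cnj (f y))"
    by (simp add: inv_fourier_cnj inv_fourier_inversion_test[OF f])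
  also have "\<dots> = complex_of_real (LINT y|lborel. (norm (f y))\<^sup>2)"
    by (simp only: complex_norm_square[symmetric] integral_complex_of_real)
  finally have "(LINT k|lborel. (norm (inv_fourier f k))\<^sup>2) = (LINT y|lborel. (norm (f y))\<^sup>2)"
    by (simp only: of_real_eq_iff)
  then show ?thesis using nn2_eq_integral[OF h(2)] nn2_eq_integral[OF test_functions_L2[OF f]] by simp
qed

section \<open>Density of the test functions and the Plancherel identity\<close>

text \<open>The approximation takes place in $L^1$ and $L^2$ at once: the Fourier integral is continuous in the
  former norm, and the Plancherel identity passes to the limit in the latter.\<close>

definition nn12 :: "('a::euclidean_space \<Rightarrow> 'b::euclidean_space) \<Rightarrow> ennreal" where
  "nn12 f = (\<integral>\<^sup>+x. ennreal (norm (f x)) \<partial>lborel) + nn2 lborel f"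

definition test_closure :: "(real \<Rightarrow> complex) set" where
  "test_closure = {g \<in> borel_measurable borel.
     \<forall>e>0. \<exists>f\<in>test_functions UNIV. nn12 (\<lambda>x. g x - f x) < ennreal e}"

lemma nn12_add_le:
  assumes [measurable]: "f \<in> borel_measurable borel" "g \<in> borel_measurable borel"
  shows "nn12 (\<lambda>x. f x + g x) \<le> 2 * nn12 f + 2 * nn12 g"
proof -
  have "(\<integral>\<^sup>+x. ennreal (norm (f x + g x)) \<partial>lborel)
      \<le> (\<integral>\<^sup>+x. ennreal (norm (f x)) + ennreal (norm (g x)) \<partial>lborel)"
    by (intro nn_integral_mono) (auto simp: norm_triangle_ineq simp flip: ennreal_plus intro!: ennreal_leI)
  also have "\<dots> = (\<integral>\<^sup>+x. ennreal (norm (f x)) \<partial>lborel) + (\<integral>\<^sup>+x. ennreal (norm (g x)) \<partial>lborel)"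
    by (rule nn_integral_add) auto
  also have "\<dots> \<le> 2 * (\<integral>\<^sup>+x. ennreal (norm (f x)) \<partial>lborel) + 2 * (\<integral>\<^sup>+x. ennreal (norm (g x)) \<partial>lborel)"
    by (intro add_mono) (auto simp: mult_2)
  finally show ?thesis
    unfolding nn12_def using nn2_add_le[of f lborel g]
    by (auto simp: distrib_left add_mono ac_simps intro: order_trans[OF add_mono])
qed

lemma nn12_cmult:
  fixes f :: "real \<Rightarrow> complex"
  assumes [measurable]: "f \<in> borel_measurable borel"
  shows "nn12 (\<lambda>x. c * f x) \<le> ennreal (cmod c + (cmod c)\<^sup>2) * nn12 f"
proof -
  have "(\<integral>\<^sup>+x. ennreal (norm (c * f x)) \<partial>lborel) = ennreal (cmod c) * (\<integral>\<^sup>+x. ennreal (norm (f x)) \<partial>lborel)"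
    by (simp add: norm_mult ennreal_mult nn_integral_cmult)
  moreover have "nn2 lborel (\<lambda>x. c * f x) = ennreal ((cmod c)\<^sup>2) * nn2 lborel f"
    unfolding nn2_def by (simp add: norm_mult power_mult_distrib ennreal_mult nn_integral_cmult)
  moreover have "ennreal (cmod c) \<le> ennreal (cmod c + (cmod c)\<^sup>2)" "ennreal ((cmod c)\<^sup>2) \<le> ennreal (cmod c + (cmod c)\<^sup>2)"
    by (simp_all add: ennreal_leI)
  ultimately show ?thesis
    unfolding nn12_def distrib_left by (auto intro!: add_mono mult_right_mono)
qed

lemma nn12_dominated:
  fixes f :: "nat \<Rightarrow> real \<Rightarrow> complex" and w :: "real \<Rightarrow> real"
  assumes [measurable]: "\<And>n. f n \<in> borel_measurable borel" "g \<in> borel_measurable borel"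
      "w \<in> borel_measurable borel"
    and lim: "\<And>x. (\<lambda>n. f n x) \<longlonglongrightarrow> g x" and bd: "\<And>n x. cmod (f n x) \<le> w x"
    and w: "nn12 w < \<infinity>"
  shows "(\<lambda>n. nn12 (\<lambda>x. g x - f n x)) \<longlonglongrightarrow> 0"
proof -
  have gw: "cmod (g x) \<le> w x" for x
    by (rule LIMSEQ_le_const2[OF tendsto_norm[OF lim[of x]]]) (use bd in auto)
  have w0: "0 \<le> w x" for x using order_trans[OF norm_ge_zero gw] .
  have d: "cmod (g x - f n x) \<le> 2 * w x" for n x
    using norm_triangle_ineq4[of "g x" "f n x"] gw[of x] bd[of n x] by simp
  have fin: "(\<integral>\<^sup>+x. ennreal (norm (w x)) \<partial>lborel) < \<infinity>" "nn2 lborel w < \<infinity>"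
    using w by (auto simp: nn12_def)
  have dif: "(\<lambda>n. cmod (g x - f n x)) \<longlonglongrightarrow> 0" for x
    using tendsto_norm[OF tendsto_diff[OF tendsto_const[of "g x"] lim[of x]]] by simp
  have "(\<lambda>n. \<integral>\<^sup>+x. ennreal (norm (g x - f n x)) \<partial>lborel) \<longlonglongrightarrow> (\<integral>\<^sup>+x. 0 \<partial>(lborel::real measure))"
  proof (rule nn_integral_dominated_convergence[where w="\<lambda>x. 2 * ennreal (norm (w x))"])
    show "AE x in lborel. ennreal (norm (g x - f n x)) \<le> 2 * ennreal (norm (w x))" for n
      using d w0 by (auto intro!: AE_I2 ennreal_leI simp flip: ennreal_mult ennreal_numeral)
    show "AE x in lborel. (\<lambda>n. ennreal (norm (g x - f n x))) \<longlonglongrightarrow> 0"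
      using dif by (intro AE_I2) (simp add: ennreal_0 [symmetric] del: ennreal_0)
  qed (use fin in \<open>auto simp: nn_integral_cmult ennreal_mult_less_top\<close>)
  moreover have "(\<lambda>n. nn2 lborel (\<lambda>x. g x - f n x)) \<longlonglongrightarrow> (\<integral>\<^sup>+x. 0 \<partial>(lborel::real measure))"
    unfolding nn2_def
  proof (rule nn_integral_dominated_convergence[where w="\<lambda>x. 4 * ennreal ((norm (w x))\<^sup>2)"])
    have "(cmod (g x - f n x))\<^sup>2 \<le> 4 * (w x)\<^sup>2" for n x
      using power_mono[OF d[of x n], of 2] by (simp add: power_mult_distrib)
    then show "AE x in lborel. ennreal ((norm (g x - f n x))\<^sup>2) \<le> 4 * ennreal ((norm (w x))\<^sup>2)" for n
      by (auto intro!: AE_I2 ennreal_leI simp flip: ennreal_mult ennreal_numeral)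
    have "(\<lambda>n. (norm (g x - f n x))\<^sup>2) \<longlonglongrightarrow> 0" for x
      using tendsto_power[OF dif[of x], of 2] by simp
    then show "AE x in lborel. (\<lambda>n. ennreal ((norm (g x - f n x))\<^sup>2)) \<longlonglongrightarrow> 0"
      by (intro AE_I2) (simp add: ennreal_0 [symmetric] del: ennreal_0)
  qed (use fin in \<open>auto simp: nn2_def nn_integral_cmult ennreal_mult_less_top\<close>)
  ultimately show ?thesis
    unfolding nn12_def using tendsto_add by fastforce
qed

lemma test_functions_measurable: "f \<in> test_functions \<Omega> \<Longrightarrow> f \<in> borel_measurable borel"
  by (intro smooth_borel_measurable test_functions_smooth)

lemma test_functions_UNIV_add:
  "f \<in> test_functions UNIV \<Longrightarrow> g \<in> test_functions UNIV \<Longrightarrow> (\<lambda>x. f x + g x) \<in> test_functions UNIV"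
  unfolding test_functions_UNIV_iff
  by (intro conjI smooth_add; (elim conjE)?; (rule bounded_subset[of "{x. f x \<noteq> 0} \<union> {x. g x \<noteq> 0}"])?) auto

lemma test_functions_UNIV_mult:
  fixes f g :: "'a::euclidean_space \<Rightarrow> complex"
  shows "smooth f \<Longrightarrow> g \<in> test_functions UNIV \<Longrightarrow> (\<lambda>x. f x * g x) \<in> test_functions UNIV"
  unfolding test_functions_UNIV_iff by (auto intro: smooth_mult elim: bounded_subset)

lemma test_functions_UNIV_diff:
  assumes "f \<in> test_functions UNIV" "g \<in> test_functions UNIV"
  shows "(\<lambda>x. f x - g x) \<in> test_functions UNIV"
proof -
  have "(\<lambda>x. - g x) \<in> test_functions UNIV"
    using assms(2) unfolding test_functions_UNIV_iff by (auto intro: smooth_uminus)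
  then show ?thesis using test_functions_UNIV_add[OF assms(1)] by force
qed

lemma ennreal_quarters:
  assumes "e \<ge> 0"
  shows "2 * ennreal (e / 4) + 2 * ennreal (e / 4) = ennreal e"
proof -
  have "2 * ennreal (e / 4) = ennreal (2 * (e / 4))"
    using assms ennreal_mult[of 2 "e / 4"] by simp
  then show ?thesis using assms by (simp flip: ennreal_plus)
qed

section \<open>Linear operations and limits in the closure\<close>

lemma test_closure_add:
  assumes f: "f \<in> test_closure" and g: "g \<in> test_closure"
  shows "(\<lambda>x. f x + g x) \<in> test_closure"
proof -
  have m: "f \<in> borel_measurable borel" "g \<in> borel_measurable borel"
    using f g by (auto simp: test_closure_def)
  have "\<exists>h\<in>test_functions UNIV. nn12 (\<lambda>x. f x + g x - h x) < ennreal e" if "e > 0" for e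
  proof -
    have "e / 4 > 0" using that by simp
    then obtain f' g' where fg: "f' \<in> test_functions UNIV" "nn12 (\<lambda>x. f x - f' x) < ennreal (e / 4)"
      "g' \<in> test_functions UNIV" "nn12 (\<lambda>x. g x - g' x) < ennreal (e / 4)"
      using f g unfolding test_closure_def by blast
    have m': "f' \<in> borel_measurable borel" "g' \<in> borel_measurable borel"
      using fg by (auto intro: test_functions_measurable)
    have "nn12 (\<lambda>x. (f x - f' x) + (g x - g' x)) \<le> 2 * nn12 (\<lambda>x. f x - f' x) + 2 * nn12 (\<lambda>x. g x - g' x)"
      using m m' by (intro nn12_add_le borel_measurable_diff)
    also have "\<dots> < 2 * ennreal (e / 4) + 2 * ennreal (e / 4)"
      using fg by (intro add_strict_mono ennreal_mult_strict_left_mono) auto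
    also have "\<dots> = ennreal e" using that by (intro ennreal_quarters) simp
    finally have "nn12 (\<lambda>x. f x + g x - (f' x + g' x)) < ennreal e" by (simp add: algebra_simps)
    then show ?thesis
      using test_functions_UNIV_add[OF fg(1,3)] by (intro bexI[of _ "\<lambda>x. f' x + g' x"])
  qed
  then show ?thesis using m by (auto simp: test_closure_def)
qed

lemma ennreal_mult_divide: "0 < C \<Longrightarrow> 0 \<le> e \<Longrightarrow> ennreal C * ennreal (e / C) = ennreal e"
  by (simp flip: ennreal_mult)

lemma test_closure_cmult:
  assumes f: "f \<in> test_closure"
  shows "(\<lambda>x. c * f x) \<in> test_closure"
proof -
  have m: "f \<in> borel_measurable borel" using f by (auto simp: test_closure_def)
  have "\<exists>h\<in>test_functions UNIV. nn12 (\<lambda>x. c * f x - h x) < ennreal e" if "e > 0" for e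
  proof -
    let ?c = "cmod c + (cmod c)\<^sup>2 + 1"
    have c: "?c > 0" by (simp add: add_nonneg_pos)
    then have "e / ?c > 0" using that by simp
    then obtain f' where f': "f' \<in> test_functions UNIV" "nn12 (\<lambda>x. f x - f' x) < ennreal (e / ?c)"
      using f unfolding test_closure_def by blast
    have "nn12 (\<lambda>x. c * (f x - f' x)) \<le> ennreal (cmod c + (cmod c)\<^sup>2) * nn12 (\<lambda>x. f x - f' x)"
      using m test_functions_measurable[OF f'(1)] by (intro nn12_cmult borel_measurable_diff)
    also have "\<dots> \<le> ennreal ?c * nn12 (\<lambda>x. f x - f' x)" by (intro mult_right_mono ennreal_leI) auto
    also have "\<dots> < ennreal ?c * ennreal (e / ?c)"
      using f' c by (intro ennreal_mult_strict_left_mono) (simp_all only: ennreal_less_top ennreal_less_zero_iff)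
    also have "\<dots> = ennreal e" using c that by (intro ennreal_mult_divide) auto
    finally have "nn12 (\<lambda>x. c * f x - c * f' x) < ennreal e" by (simp add: algebra_simps)
    then show ?thesis
      using test_functions_UNIV_mult[OF smooth_const f'(1), of c] by (intro bexI[of _ "\<lambda>x. c * f' x"])
  qed
  then show ?thesis using m by (auto simp: test_closure_def)
qed

lemma test_closure_limit:
  assumes f: "\<And>n. f n \<in> test_closure" and [measurable]: "g \<in> borel_measurable borel"
    and lim: "(\<lambda>n. nn12 (\<lambda>x. g x - f n x)) \<longlonglongrightarrow> 0"
  shows "g \<in> test_closure"
proof -
  have m: "f n \<in> borel_measurable borel" for n using f by (auto simp: test_closure_def)
  have "\<exists>h\<in>test_functions UNIV. nn12 (\<lambda>x. g x - h x) < ennreal e" if "e > 0" for e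
  proof -
    have "e / 4 > 0" using that by simp
    then have "eventually (\<lambda>n. nn12 (\<lambda>x. g x - f n x) < ennreal (e / 4)) sequentially"
      using order_tendstoD(2)[OF lim] by simp
    then obtain n where n: "nn12 (\<lambda>x. g x - f n x) < ennreal (e / 4)"
      by (auto simp: eventually_sequentially)
    obtain h where h: "h \<in> test_functions UNIV" "nn12 (\<lambda>x. f n x - h x) < ennreal (e / 4)"
      using f[of n] \<open>e / 4 > 0\<close> unfolding test_closure_def by blast
    have "nn12 (\<lambda>x. (g x - f n x) + (f n x - h x)) \<le> 2 * nn12 (\<lambda>x. g x - f n x) + 2 * nn12 (\<lambda>x. f n x - h x)"
      using m test_functions_measurable[OF h(1)] by (intro nn12_add_le borel_measurable_diff) auto
    also have "\<dots> < 2 * ennreal (e / 4) + 2 * ennreal (e / 4)"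
      using n h by (intro add_strict_mono ennreal_mult_strict_left_mono) auto
    also have "\<dots> = ennreal e" using that by (intro ennreal_quarters) simp
    finally show ?thesis using h(1) by auto
  qed
  then show ?thesis by (auto simp: test_closure_def)
qed

text \<open>Multiplying the argument by a growing factor flattens the bump: exp(-1/(n c)) tends to 1
  wherever c = (x - a)(b - x) is positive, and elsewhere the value is 0 for every n. The support
  stays in [a, b] throughout.\<close>

lemma bump_tendsto:
  assumes "a \<le> b"
  shows "(\<lambda>n. flat 0 (real n * ((x - a) * (b - x)))) \<longlonglongrightarrow> indicator {a<..<b} x"
proof (cases "x \<in> {a<..<b}")
  case True
  define c where "c = (x - a) * (b - x)"
  have "c > 0" using True by (simp add: c_def)
  then have "(\<lambda>n. exp (- 1 / (real n * c))) \<longlonglongrightarrow> exp 0" by real_asymp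
  moreover have "\<forall>\<^sub>F n in sequentially. exp (- 1 / (real n * c)) = flat 0 (real n * c)"
    using eventually_gt_at_top[of 0] by eventually_elim (use \<open>c > 0\<close> in \<open>simp add: flat_def\<close>)
  ultimately have "(\<lambda>n. flat 0 (real n * c)) \<longlonglongrightarrow> exp 0" by (rule Lim_transform_eventually)
  then show ?thesis using True by (simp add: c_def)
next
  case False
  then have "x \<le> a \<or> b \<le> x" by auto
  then have "(x - a) * (b - x) \<le> 0"
    using assms mult_nonpos_nonneg[of "x - a" "b - x"] mult_nonneg_nonpos[of "x - a" "b - x"] by auto
  then have "real n * ((x - a) * (b - x)) \<le> 0" for n
    by (rule mult_nonneg_nonpos[OF of_nat_0_le_iff])
  then have z: "flat 0 (real n * ((x - a) * (b - x))) = 0" for n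
    unfolding flat_def by (intro if_not_P) (simp only: not_less)
  have "indicator {a<..<b} x = (0::real)" using False by (rule indicator_simps(2))
  then show ?thesis unfolding z by simp
qed

lemma bump_le: "a \<le> b \<Longrightarrow> flat 0 (real n * ((x - a) * (b - x))) \<le> indicator {a..b} x"
  and bump_nonneg: "0 \<le> flat 0 y"
proof -
  have "y > 0 \<Longrightarrow> exp (- 1 / y) \<le> 1" for y :: real by simp
  moreover have "x \<in> {a..b}" if "0 < real n * ((x - a) * (b - x))" "a \<le> b"
    using that by (auto simp: zero_less_mult_iff)
  ultimately show "a \<le> b \<Longrightarrow> flat 0 (real n * ((x - a) * (b - x))) \<le> indicator {a..b} x"
    by (auto simp: flat_def)
  show "0 \<le> flat 0 y" by (simp add: flat_def)
qed

lemma bump_smooth: "smooth f \<Longrightarrow> smooth (\<lambda>x. flat 0 (r * ((f x - a) * (b - f x))))"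
  by (intro smooth_compose_real[OF smooth_flat] smooth_mult smooth_const smooth_diff)

lemma bump_test:
  assumes "a \<le> b"
  shows "(\<lambda>x. complex_of_real (flat 0 (real n * ((x - a) * (b - x))))) \<in> test_functions UNIV"
proof -
  have "{x. complex_of_real (flat 0 (real n * ((x - a) * (b - x)))) \<noteq> 0} \<subseteq> {a..b}"
  proof safe
    fix x assume "complex_of_real (flat 0 (real n * ((x - a) * (b - x)))) \<noteq> 0"
    then show "x \<in> {a..b}"
      using bump_le[OF assms, of n x] bump_nonneg[of "real n * ((x - a) * (b - x))"]
      by (cases "x \<in> {a..b}") simp_all
  qed
  then have "bounded {x. complex_of_real (flat 0 (real n * ((x - a) * (b - x)))) \<noteq> 0}"
    by (rule bounded_subset[OF bounded_closed_interval])
  then show ?thesis unfolding test_functions_UNIV_iff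
    by (intro conjI smooth_of_real bump_smooth smooth_ident)
qed

lemma nn12_indicator:
  "A \<in> sets borel \<Longrightarrow> nn12 (indicator A :: real \<Rightarrow> real) = 2 * emeasure lborel A"
proof -
  have "ennreal (norm (indicator A x :: real)) = indicator A x"
    "ennreal ((norm (indicator A x :: real))\<^sup>2) = indicator A x" for x :: real
    by (auto simp: indicator_def)
  then show "A \<in> sets borel \<Longrightarrow> ?thesis" by (simp add: nn12_def nn2_def mult_2)
qed

lemma test_functions_subset_closure: "f \<in> test_functions UNIV \<Longrightarrow> f \<in> test_closure"
  using test_functions_measurable[of f UNIV]
  by (auto simp: test_closure_def nn12_def nn2_def intro!: bexI[of _ f])

lemma test_closure_interval: "(\<lambda>x. complex_of_real (indicator {a<..<b} x)) \<in> test_closure"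
proof (cases "a \<le> b")
  case True
  show ?thesis
  proof (rule test_closure_limit)
    show "(\<lambda>x. complex_of_real (flat 0 (real n * ((x - a) * (b - x))))) \<in> test_closure" for n
      by (rule test_functions_subset_closure[OF bump_test[OF True]])
    show "(\<lambda>n. nn12 (\<lambda>x. complex_of_real (indicator {a<..<b} x)
        - complex_of_real (flat 0 (real n * ((x - a) * (b - x)))))) \<longlonglongrightarrow> 0"
    proof (rule nn12_dominated[where w="indicator {a..b}"])
      show "(\<lambda>n. complex_of_real (flat 0 (real n * ((x - a) * (b - x)))))
        \<longlonglongrightarrow> complex_of_real (indicator {a<..<b} x)" for x
        by (intro tendsto_of_real bump_tendsto True)
      show "cmod (complex_of_real (flat 0 (real n * ((x - a) * (b - x))))) \<le> indicator {a..b} x" for n x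
        using bump_le[OF True] bump_nonneg by simp
      show "nn12 (indicator {a..b} :: real \<Rightarrow> real) < \<infinity>"
        by (simp add: nn12_indicator ennreal_mult_less_top emeasure_lborel_Icc_eq)
    qed (auto intro: test_functions_measurable[OF bump_test[OF True]])
  qed auto
next
  case False
  then have "(\<lambda>x. complex_of_real (indicator {a<..<b} x)) = (\<lambda>x. 0)" by (auto simp: indicator_def)
  moreover have "(\<lambda>x::real. 0::complex) \<in> test_functions UNIV"
    by (simp add: test_functions_UNIV_iff smooth_const)
  ultimately show ?thesis using test_functions_subset_closure by simp
qed

text \<open>Dynkin's argument: open intervals form an intersection-stable generator of the Borel
  sets. Intersecting with a fixed bounded interval keeps complements inside the class and supplies
  an integrable majorant for countable disjoint unions.\<close>

lemma test_closure_bounded_set: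
  assumes "A \<in> sets borel"
  shows "(\<lambda>x. complex_of_real (indicator (A \<inter> {-N<..<N}) x)) \<in> test_closure"
proof -
  let ?I = "{-N<..<N}" and ?G = "range (\<lambda>(a, b). {a<..<b :: real})"
  have "sets (borel :: real measure) = sigma_sets UNIV ?G"
    using arg_cong[OF borel_eq_box[where 'a=real], of sets] by (simp add: sets_measure_of box_real)
  then have gen: "A \<in> sigma_sets UNIV ?G"
    and *: "\<And>A'. A' \<in> sigma_sets UNIV ?G \<Longrightarrow> A' \<in> sets borel"
    using assms by auto
  have "Int_stable ?G"
  proof (rule Int_stableI_image)
    fix p q :: "real \<times> real"
    have "{fst p<..<snd p} \<inter> {fst q<..<snd q} = {max (fst p) (fst q)<..<min (snd p) (snd q)}" by auto
    then show "\<exists>r\<in>UNIV. (case p of (a, b) \<Rightarrow> {a<..<b}) \<inter> (case q of (a, b) \<Rightarrow> {a<..<b}) = (case r of (a, b) \<Rightarrow> {a<..<b})"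
      by (intro bexI[of _ "(max (fst p) (fst q), min (snd p) (snd q))"]) (auto simp: split_beta)
  qed
  moreover have "?G \<subseteq> Pow UNIV" by simp
  ultimately show ?thesis using gen
  proof (induct rule: sigma_sets_induct_disjoint)
    case (basic A)
    then obtain a b where "A = {a<..<b}" by auto
    then have "A \<inter> ?I = {max a (-N)<..<min b N}" by auto
    then show ?case using test_closure_interval by simp
  next
    case empty
    then show ?case using test_closure_interval[of 0 0] by simp
  next
    case (compl A)
    have "(\<lambda>x. complex_of_real (indicator ((UNIV - A) \<inter> ?I) x))
      = (\<lambda>x. complex_of_real (indicator ?I x) + (-1) * complex_of_real (indicator (A \<inter> ?I) x))"
      by (auto simp: indicator_def fun_eq_iff)
    then show ?case
      using test_closure_add[OF test_closure_interval test_closure_cmult[OF compl(2)], of "-N" N "-1"] by simp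
  next
    case (union A)
    define S where "S n x = (\<Sum>i<n. complex_of_real (indicator (A i \<inter> ?I) x))" for n x
    have meas: "A i \<in> sets borel" for i using union(2) * by auto
    \<comment> \<open>By disjointness the partial sum is itself an indicator, hence bounded by the
      indicator of the interval.\<close>
    have S_eq: "S n x = complex_of_real (indicator ((\<Union>i<n. A i) \<inter> ?I) x)" for n x
    proof -
      have dis: "disjoint_family_on (\<lambda>i. A i \<inter> ?I) {..<n}"
        using union(1) by (auto simp: disjoint_family_on_def)
      have "indicator ((\<Union>i<n. A i) \<inter> ?I) x = (indicator (\<Union>i<n. A i \<inter> ?I) x :: real)"
        by (rule arg_cong[where f="\<lambda>S. indicator S x"]) auto
      also have "\<dots> = (\<Sum>i<n. indicator (A i \<inter> ?I) x)"
        by (rule indicator_UN_disjoint[OF _ dis]) simp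
      finally show ?thesis by (simp add: S_def)
    qed
    show ?case
    proof (rule test_closure_limit)
      show "S n \<in> test_closure" for n
      proof (induction n)
        case 0
        show ?case using test_closure_interval[of 0 0] by (simp add: S_def[abs_def])
      next
        case (Suc n)
        show ?case using test_closure_add[OF Suc union(3)[of n]] by (simp add: S_def[abs_def])
      qed
      show "(\<lambda>x. complex_of_real (indicator ((\<Union>i. A i) \<inter> ?I) x)) \<in> borel_measurable borel"
        using meas by measurable
      show "(\<lambda>n. nn12 (\<lambda>x. complex_of_real (indicator ((\<Union>i. A i) \<inter> ?I) x) - S n x)) \<longlonglongrightarrow> 0"
      proof (rule nn12_dominated[where w="indicator ?I"])
        show "S n \<in> borel_measurable borel" for n
          unfolding S_def[abs_def] using meas by measurable
        show "(\<lambda>x. complex_of_real (indicator ((\<Union>i. A i) \<inter> ?I) x)) \<in> borel_measurable borel"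
          using meas by measurable
        show "cmod (S n x) \<le> indicator ?I x" for n x
          unfolding S_eq by (simp add: indicator_def)
        show "nn12 (indicator ?I :: real \<Rightarrow> real) < \<infinity>"
          by (cases "-N \<le> N") (simp_all add: nn12_indicator ennreal_mult_less_top)
        show "(\<lambda>n. S n x) \<longlonglongrightarrow> complex_of_real (indicator ((\<Union>i. A i) \<inter> ?I) x)" for x
        proof (cases "x \<in> (\<Union>i. A i) \<inter> ?I")
          case True
          then obtain i where i: "x \<in> A i" by auto
          have "\<forall>\<^sub>F n in sequentially. S n x = complex_of_real (indicator ((\<Union>i. A i) \<inter> ?I) x)"
            using eventually_gt_at_top[of i]
            by eventually_elim (use i True in \<open>auto simp: S_eq indicator_def\<close>)
          then show ?thesis by (rule tendsto_eventually)
        next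
          case False
          then have "S n x = complex_of_real (indicator ((\<Union>i. A i) \<inter> ?I) x)" for n
            by (auto simp: S_eq indicator_def)
          then show ?thesis by simp
        qed
      qed auto
    qed
  qed
qed

lemma nn12_mono: "(\<And>x. norm (f x) \<le> norm (g x)) \<Longrightarrow> nn12 f \<le> nn12 g"
  unfolding nn12_def by (intro add_mono nn_integral_mono nn2_mono ennreal_leI)

text \<open>Monotone-class induction from indicators to nonnegative functions. The finiteness
  hypothesis is part of the induction, so each case has to pass it down to the smaller functions
  before their approximation is available.\<close>

lemma test_closure_nonneg:
  fixes u :: "real \<Rightarrow> real"
  assumes "u \<in> borel_measurable borel" "\<And>x. 0 \<le> u x" "nn12 u < \<infinity>"
  shows "(\<lambda>x. complex_of_real (u x)) \<in> test_closure"
  using assms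
proof (induction rule: borel_measurable_induct_real)
  case (set A)
  show ?case
  proof (rule test_closure_limit[OF test_closure_bounded_set])
    show "A \<in> sets borel" by fact
    have "(\<lambda>n. complex_of_real (indicator (A \<inter> {- real n<..<real n}) x)) \<longlonglongrightarrow> complex_of_real (indicator A x)" for x
    proof (rule tendsto_eventually)
      obtain m where "\<bar>x\<bar> < real m" using reals_Archimedean2 by blast
      then have "x \<in> {- real n<..<real n}" if "n \<ge> m" for n using that by auto
      then show "\<forall>\<^sub>F n in sequentially. complex_of_real (indicator (A \<inter> {- real n<..<real n}) x) = complex_of_real (indicator A x)"
        unfolding eventually_sequentially by (intro exI[of _ m]) (auto simp: indicator_def)
    qed
    then show "(\<lambda>n. nn12 (\<lambda>x. complex_of_real (indicator A x) - complex_of_real (indicator (A \<inter> {- real n<..<real n}) x))) \<longlonglongrightarrow> 0"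
    proof (rule nn12_dominated[where w="indicator A", rotated 3])
      show "cmod (complex_of_real (indicator (A \<inter> {- real n<..<real n}) x)) \<le> indicator A x" for n x
        by (simp add: indicator_def)
    qed (use set in measurable)
  qed (use set in auto)
next
  case (mult u c)
  show ?case
  \<comment> \<open>Finiteness for \<open>u\<close> is recovered from that for the product by
    dividing by \<open>c\<close>; for c = 0 this is impossible, but then the product is the zero
    function.\<close>
  proof (cases "c = 0")
    case True
    then show ?thesis using test_closure_interval[of 0 0] by simp
  next
    case False
    have r: "nn12 (\<lambda>x. complex_of_real (f x)) = nn12 f" for f :: "real \<Rightarrow> real"
      by (simp add: nn12_def nn2_def)
    have "nn12 u = nn12 (\<lambda>x. complex_of_real (1 / c) * complex_of_real (c * u x))"
      using False r[of u] by simp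
    also have "\<dots> \<le> ennreal (cmod (complex_of_real (1 / c)) + (cmod (complex_of_real (1 / c)))\<^sup>2)
        * nn12 (\<lambda>x. complex_of_real (c * u x))"
      using mult(2) by (intro nn12_cmult) simp
    also have "\<dots> < \<infinity>" unfolding r using mult.prems by (simp add: ennreal_mult_less_top)
    finally show ?thesis using test_closure_cmult[OF mult.IH, of "complex_of_real c"] by simp
  qed
next
  case (add u v)
  have "nn12 u \<le> nn12 (\<lambda>x. v x + u x)" "nn12 v \<le> nn12 (\<lambda>x. v x + u x)"
    using add by (auto intro!: nn12_mono)
  then have "nn12 u < \<infinity>" "nn12 v < \<infinity>" using add.prems le_less_trans by blast+
  then show ?case using test_closure_add[OF add.IH(2) add.IH(1)] by simp
next
  case (seq U)
  have le: "U i x \<le> u x" for i x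
    using seq by (intro incseq_le) (auto simp: incseq_def le_fun_def)
  have "nn12 (U i) \<le> nn12 u" for i
    using seq le by (intro nn12_mono) (simp add: order_trans[OF _ le])
  then have "nn12 (U i) < \<infinity>" for i using seq.prems le_less_trans by blast
  then have "(\<lambda>x. complex_of_real (U i x)) \<in> test_closure" for i using seq by blast
  then show ?case
  proof (rule test_closure_limit)
    show "(\<lambda>n. nn12 (\<lambda>x. complex_of_real (u x) - complex_of_real (U n x))) \<longlonglongrightarrow> 0"
      by (rule nn12_dominated[where w=u]) (use seq le assms(1) in \<open>auto intro!: tendsto_of_real\<close>)
  qed (use assms(1) in auto)
qed

lemma test_closure_UNIV:
  fixes g :: "real \<Rightarrow> complex"
  assumes [measurable]: "g \<in> borel_measurable borel" and fin: "nn12 g < \<infinity>"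
  shows "g \<in> test_closure"
proof -
  have real: "(\<lambda>x. complex_of_real (u x)) \<in> test_closure"
    if [measurable]: "u \<in> borel_measurable borel" and le: "\<And>x. \<bar>u x\<bar> \<le> cmod (g x)" for u
  proof -
    have "nn12 (\<lambda>x. max 0 (u x)) \<le> nn12 g" "nn12 (\<lambda>x. max 0 (- u x)) \<le> nn12 g"
      using le by (auto intro!: nn12_mono simp: max_def abs_le_iff)
    then have "(\<lambda>x. complex_of_real (max 0 (u x))) \<in> test_closure" "(\<lambda>x. complex_of_real (max 0 (- u x))) \<in> test_closure"
      using le_less_trans[OF _ fin] by (auto intro!: test_closure_nonneg)
    from test_closure_add[OF this(1) test_closure_cmult[OF this(2), of "-1"]]
    show ?thesis by (simp add: max_def if_distrib cong: if_cong)
  qed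
  have "(\<lambda>x. complex_of_real (Re (g x))) \<in> test_closure" "(\<lambda>x. complex_of_real (Im (g x))) \<in> test_closure"
    by (rule real; simp add: abs_Re_le_cmod abs_Im_le_cmod)+
  from test_closure_add[OF this(1) test_closure_cmult[OF this(2), of "\<i>"]]
  show ?thesis by (simp add: complex_eq [symmetric])
qed

text \<open>The factor 2 in \<open>nn2_add_le\<close> is too crude for convergence of norms. Instead
  the difference of squares is split with a free parameter t: the part t |b|^2 is made small by the
  choice of t, and the rest tends to 0 for this t.\<close>

lemma nn2_tendsto:
  fixes f :: "nat \<Rightarrow> 'a \<Rightarrow> 'b::euclidean_space"
  assumes "\<And>n. f n \<in> L2 M" "g \<in> L2 M" "(\<lambda>n. nn2 M (\<lambda>x. f n x - g x)) \<longlonglongrightarrow> 0"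
  shows "(\<lambda>n. nn2 M (f n)) \<longlonglongrightarrow> nn2 M g"
proof -
  define d where "d n = (LINT x|M. (norm (f n x - g x))\<^sup>2)" for n
  define s where "s = (LINT x|M. (norm (g x))\<^sup>2)"
  have fg: "(\<lambda>x. f n x - g x) \<in> L2 M" for n using assms by (intro L2_diff)
  have d0: "d \<longlonglongrightarrow> 0"
    using assms(3) unfolding nn2_eq_integral[OF fg] d_def[symmetric]
    by (subst (asm) ennreal_0[symmetric], subst (asm) tendsto_ennreal_iff) (auto simp: d_def)
  have int: "integrable M (\<lambda>x. (norm (f n x))\<^sup>2)" "integrable M (\<lambda>x. (norm (g x))\<^sup>2)"
    "integrable M (\<lambda>x. (norm (f n x - g x))\<^sup>2)" for n
    using assms fg by (auto simp: L2_def)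
  have key: "\<bar>(norm a)\<^sup>2 - (norm b)\<^sup>2\<bar> \<le> t * (norm b)\<^sup>2 + (1 + 1 / t) * (norm (a - b))\<^sup>2"
    if "t > 0" for a b :: 'b and t :: real
  proof -
    let ?x = "norm b" and ?y = "norm (a - b)"
    have "(sqrt t * ?x - ?y / sqrt t)\<^sup>2 = t * ?x\<^sup>2 + 1 / t * ?y\<^sup>2 - 2 * ?x * ?y"
      using that by (simp add: power2_diff power_mult_distrib power_divide)
    then have *: "2 * ?x * ?y \<le> t * ?x\<^sup>2 + 1 / t * ?y\<^sup>2"
      using zero_le_power2[of "sqrt t * ?x - ?y / sqrt t"] by simp
    have "norm a \<le> ?x + ?y" "?x \<le> norm a + ?y"
      using norm_triangle_sub[of a b] norm_triangle_sub[of b a] by (auto simp: norm_minus_commute)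
    then have "\<bar>norm a - ?x\<bar> \<le> ?y" by auto
    moreover have "norm a + ?x \<le> 2 * ?x + ?y" using \<open>norm a \<le> ?x + ?y\<close> by simp
    ultimately have "\<bar>norm a - ?x\<bar> * (norm a + ?x) \<le> ?y * (2 * ?x + ?y)" by (intro mult_mono) auto
    moreover have "\<bar>(norm a)\<^sup>2 - ?x\<^sup>2\<bar> = \<bar>norm a - ?x\<bar> * (norm a + ?x)"
      by (simp add: power2_eq_square square_diff_square_factored abs_mult)
    ultimately show ?thesis using * by (simp add: power2_eq_square algebra_simps)
  qed
  have "(\<lambda>n. LINT x|M. (norm (f n x))\<^sup>2) \<longlonglongrightarrow> s"
  proof (rule LIMSEQ_I)
    fix r :: real assume "r > 0"
    \<comment> \<open>The summand 1 avoids a division by zero and makes \<open>t * s\<close>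
      strictly smaller than r / 2.\<close>
    define t where "t = r / (2 * (s + 1))"
    have s: "s \<ge> 0" unfolding s_def by simp
    have t: "t > 0" using \<open>r > 0\<close> s by (simp add: t_def)
    have ts: "t * s < r / 2" using \<open>r > 0\<close> s by (simp add: t_def field_simps)
    have "(\<lambda>n. (1 + 1 / t) * d n) \<longlonglongrightarrow> 0" using tendsto_mult_left[OF d0, of "1 + 1 / t"] by simp
    then have "\<forall>\<^sub>F n in sequentially. (1 + 1 / t) * d n < r / 2"
      using \<open>r > 0\<close> by (intro order_tendstoD(2)) auto
    then obtain N where N: "\<And>n. n \<ge> N \<Longrightarrow> (1 + 1 / t) * d n < r / 2" by (auto simp: eventually_sequentially)
    have "norm ((LINT x|M. (norm (f n x))\<^sup>2) - s) < r" if "n \<ge> N" for n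
    proof -
      have "norm ((LINT x|M. (norm (f n x))\<^sup>2) - s) = norm (LINT x|M. (norm (f n x))\<^sup>2 - (norm (g x))\<^sup>2)"
        using int by (simp add: s_def)
      also have "\<dots> \<le> (LINT x|M. \<bar>(norm (f n x))\<^sup>2 - (norm (g x))\<^sup>2\<bar>)"
        using integral_norm_bound[of M "\<lambda>x. (norm (f n x))\<^sup>2 - (norm (g x))\<^sup>2"] by simp
      also have "\<dots> \<le> (LINT x|M. t * (norm (g x))\<^sup>2 + (1 + 1 / t) * (norm (f n x - g x))\<^sup>2)"
        using int by (intro integral_mono key t integrable_abs Bochner_Integration.integrable_diff
            Bochner_Integration.integrable_add integrable_mult_right)
      also have "\<dots> = t * s + (1 + 1 / t) * d n"
        using int by (simp add: s_def d_def)
      also have "\<dots> < r" using ts N[OF that] by linarith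
      finally show ?thesis .
    qed
    then show "\<exists>N. \<forall>n\<ge>N. norm ((LINT x|M. (norm (f n x))\<^sup>2) - s) < r" by blast
  qed
  then show ?thesis
    unfolding nn2_eq_integral[OF assms(1)] nn2_eq_integral[OF assms(2)] s_def by (rule tendsto_ennrealI)
qed

lemma nn2_fatou:
  fixes f :: "nat \<Rightarrow> 'a \<Rightarrow> 'b::euclidean_space"
  assumes [measurable]: "\<And>n. f n \<in> borel_measurable M" and "g \<in> borel_measurable M"
    and lim: "\<And>x. x \<in> space M \<Longrightarrow> (\<lambda>n. f n x) \<longlonglongrightarrow> g x" and bd: "\<And>n. nn2 M (f n) \<le> c n" and c: "c \<longlonglongrightarrow> C"
  shows "nn2 M g \<le> C"
proof -
  have "nn2 M g = (\<integral>\<^sup>+x. liminf (\<lambda>n. ennreal ((norm (f n x))\<^sup>2)) \<partial>M)"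
    unfolding nn2_def
  proof (rule nn_integral_cong)
    fix x assume "x \<in> space M"
    then have "(\<lambda>n. ennreal ((norm (f n x))\<^sup>2)) \<longlonglongrightarrow> ennreal ((norm (g x))\<^sup>2)"
      by (intro tendsto_intros lim)
    then show "ennreal ((norm (g x))\<^sup>2) = liminf (\<lambda>n. ennreal ((norm (f n x))\<^sup>2))"
      by (rule lim_imp_Liminf[OF sequentially_bot, symmetric])
  qed
  also have "\<dots> \<le> liminf (\<lambda>n. nn2 M (f n))" unfolding nn2_def by (rule nn_integral_liminf) simp
  also have "\<dots> \<le> liminf c" by (rule Liminf_mono) (simp add: bd)
  also have "\<dots> = C" by (rule lim_imp_Liminf[OF _ c]) simp
  finally show ?thesis .
qed

text \<open>Convergence in L^1 gives pointwise convergence of the transforms, and the isometry on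
  differences of test functions controls their mutual distances in L^2. Fatou's lemma turns the
  pointwise limit into an L^2 limit, along which the norms converge on both sides.\<close>

theorem plancherel:
  fixes g :: "real \<Rightarrow> complex"
  assumes g: "integrable lborel g" and g2: "g \<in> L2 lborel"
  shows "nn2 lborel (inv_fourier g) = nn2 lborel g"
proof -
  have [measurable]: "g \<in> borel_measurable borel" using g by auto
  have "nn12 g < \<infinity>" using g g2 by (auto simp: nn12_def integrable_iff_bounded L2_iff)
  then have "g \<in> test_closure" by (intro test_closure_UNIV) auto
  then have "\<exists>f\<in>test_functions UNIV. nn12 (\<lambda>x. g x - f x) < ennreal (1 / real (Suc n))" for n
    unfolding test_closure_def by auto
  then obtain f where f: "\<And>n. f n \<in> test_functions UNIV"
    "\<And>n. nn12 (\<lambda>x. g x - f n x) < ennreal (1 / real (Suc n))" by metis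
  note [measurable] = test_functions_measurable[OF f(1)]
  have lim: "(\<lambda>n. ennreal (1 / real (Suc n))) \<longlonglongrightarrow> 0"
    by (subst ennreal_0[symmetric]) (intro tendsto_ennrealI, real_asymp)
  have n1: "(\<lambda>n. \<integral>\<^sup>+x. ennreal (norm (g x - f n x)) \<partial>lborel) \<longlonglongrightarrow> 0"
    and n2: "(\<lambda>n. nn2 lborel (\<lambda>x. g x - f n x)) \<longlonglongrightarrow> 0"
    by (rule ennreal_tendsto_0_bound[OF _ lim];
      rule order_trans[OF _ less_imp_le[OF f(2)]]; simp add: nn12_def)+
  have fi: "integrable lborel (f n)" "f n \<in> L2 lborel" for n
    using f(1) test_functions_integrable test_functions_L2 by blast+
  have ptw: "(\<lambda>n. inv_fourier (f n) k) \<longlonglongrightarrow> inv_fourier g k" for k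
  proof -
    have "ennreal (cmod (inv_fourier (f n) k - inv_fourier g k)) \<le> (\<integral>\<^sup>+x. ennreal (norm (g x - f n x)) \<partial>lborel)" for n
    proof -
      have i: "integrable lborel (\<lambda>x. f n x - g x)" using fi g by simp
      have "ennreal (cmod (inv_fourier (f n) k - inv_fourier g k)) \<le> ennreal (LINT x|lborel. cmod (f n x - g x))"
        using inv_fourier_bound[OF i, of k] inv_fourier_diff[OF fi(1) g, of n k] by (simp add: ennreal_leI)
      also have "\<dots> = (\<integral>\<^sup>+x. ennreal (norm (f n x - g x)) \<partial>lborel)"
        using i by (intro nn_integral_eq_integral[symmetric]) auto
      finally show ?thesis by (simp add: norm_minus_commute)
    qed
    from ennreal_tendsto_0_bound[OF this n1]
    have "(\<lambda>n. cmod (inv_fourier (f n) k - inv_fourier g k)) \<longlonglongrightarrow> 0"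
      by (subst (asm) ennreal_0[symmetric], subst (asm) tendsto_ennreal_iff) auto
    then show ?thesis by (simp add: LIM_zero_iff tendsto_norm_zero_iff)
  qed
  have diff: "nn2 lborel (\<lambda>k. inv_fourier (f n) k - inv_fourier (f m) k) = nn2 lborel (\<lambda>x. f n x - f m x)" for n m
    using plancherel_test[OF test_functions_UNIV_diff[OF f(1) f(1)], of n m]
    by (simp add: inv_fourier_diff[OF fi(1) fi(1)] nn2_def)
  \<comment> \<open>Fatou in the first index with \<open>m\<close> fixed: the distance of the
    transforms is that of \<open>f n\<close> and \<open>f m\<close>, and letting n grow leaves the
    distance of \<open>g\<close> to \<open>f m\<close>.\<close>
  have est: "nn2 lborel (\<lambda>k. inv_fourier g k - inv_fourier (f m) k) \<le> 4 * nn2 lborel (\<lambda>x. g x - f m x)" for m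
  proof -
    have "nn2 lborel (\<lambda>k. inv_fourier g k - inv_fourier (f m) k) \<le> 2 * 0 + 2 * nn2 lborel (\<lambda>x. g x - f m x)"
    proof (rule nn2_fatou)
      show "(\<lambda>n. inv_fourier (f n) k - inv_fourier (f m) k) \<longlonglongrightarrow> inv_fourier g k - inv_fourier (f m) k" for k
        by (intro tendsto_intros ptw)
      show "nn2 lborel (\<lambda>k. inv_fourier (f n) k - inv_fourier (f m) k)
          \<le> 2 * nn2 lborel (\<lambda>x. g x - f n x) + 2 * nn2 lborel (\<lambda>x. g x - f m x)" for n
        unfolding diff using nn2_triangle3[of "f n" lborel g "f m"] by (simp add: nn2_minus_commute[of _ "f n"])
      show "(\<lambda>n. 2 * nn2 lborel (\<lambda>x. g x - f n x) + 2 * nn2 lborel (\<lambda>x. g x - f m x))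
        \<longlonglongrightarrow> 2 * 0 + 2 * nn2 lborel (\<lambda>x. g x - f m x)"
        using ennreal_cmult_tendsto_0[OF n2, of 2] by (intro tendsto_add tendsto_const) simp_all
    qed simp_all
    also have "\<dots> \<le> 4 * nn2 lborel (\<lambda>x. g x - f m x)" by (simp add: mult_right_mono)
    finally show ?thesis .
  qed
  have "(\<lambda>n. 4 * nn2 lborel (\<lambda>x. g x - f n x)) \<longlonglongrightarrow> 0" by (rule ennreal_cmult_tendsto_0[OF n2]) simp
  from ennreal_tendsto_0_bound[OF est this]
  have c: "(\<lambda>m. nn2 lborel (\<lambda>k. inv_fourier (f m) k - inv_fourier g k)) \<longlonglongrightarrow> 0"
    by (simp add: nn2_minus_commute[of _ "inv_fourier g"])
  have ig: "inv_fourier g \<in> L2 lborel"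
  proof -
    obtain m where "nn2 lborel (\<lambda>k. inv_fourier (f m) k - inv_fourier g k) < 1"
      using order_tendstoD(2)[OF c, of 1] by (auto simp: eventually_sequentially)
    then have "(\<lambda>k. inv_fourier (f m) k - inv_fourier g k) \<in> L2 lborel"
      by (auto simp: L2_iff intro: less_trans)
    from L2_diff[OF inv_fourier_test_integrable(2)[OF f(1)[of m]] this] show ?thesis by simp
  qed
  have "(\<lambda>n. nn2 lborel (inv_fourier (f n))) \<longlonglongrightarrow> nn2 lborel (inv_fourier g)"
    by (rule nn2_tendsto[OF inv_fourier_test_integrable(2)[OF f(1)] ig c])
  moreover have "(\<lambda>n. nn2 lborel (f n)) \<longlonglongrightarrow> nn2 lborel g"
    by (rule nn2_tendsto[OF fi(2) g2]) (use n2 in \<open>simp add: nn2_minus_commute[of _ g]\<close>)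
  ultimately show ?thesis
    using LIMSEQ_unique by (simp add: plancherel_test[OF f(1)])
qed

section \<open>The Sobolev space of order $-1/2$\<close>

lemma spinor_norm: "(norm (v :: spinor))\<^sup>2 = (cmod (v $ 1))\<^sup>2 + (cmod (v $ 2))\<^sup>2"
  by (simp add: norm_vec_def L2_set_def sum_2)

lemma spinor_measurable_nth [measurable]:
  fixes f :: "'a \<Rightarrow> spinor"
  assumes "f \<in> borel_measurable M"
  shows "(\<lambda>x. f x $ i) \<in> borel_measurable M"
proof -
  have "(\<lambda>v::spinor. v $ i) \<in> borel_measurable borel"
    by (intro borel_measurable_continuous_onI linear_continuous_on bounded_linear_vec_nth)
  from measurable_compose[OF assms this] show ?thesis .
qed

lemma spinor_measurableI:
  fixes f :: "'a \<Rightarrow> spinor"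
  assumes "(\<lambda>x. f x $ 1) \<in> borel_measurable M" "(\<lambda>x. f x $ 2) \<in> borel_measurable M"
  shows "f \<in> borel_measurable M"
proof -
  have eq: "f = (\<lambda>x. (\<lambda>z::complex. \<chi> i. if i = 1 then z else 0) (f x $ 1) + (\<lambda>z. \<chi> i. if i = 1 then 0 else z) (f x $ 2))"
  proof
    fix x
    show "f x = (\<chi> i. if i = 1 then f x $ 1 else 0) + (\<chi> i. if i = 1 then 0 else f x $ 2)"
      by (auto simp: vec_eq_iff) (metis exhaust_2)
  qed
  have 1: "(\<lambda>z::complex. (\<chi> i. if i = 1 then z else 0) :: spinor) \<in> borel_measurable borel"
    and 2: "(\<lambda>z::complex. (\<chi> i. if i = 1 then 0 else z) :: spinor) \<in> borel_measurable borel"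
    by (intro borel_measurable_continuous_onI continuous_on_vec_lambda; case_tac "i = 1"; simp)+
  show ?thesis
    by (subst eq, intro borel_measurable_add measurable_compose[OF assms(1) 1] measurable_compose[OF assms(2) 2])
qed

lemma nn2_spinor:
  fixes f :: "'a \<Rightarrow> spinor"
  assumes [measurable]: "f \<in> borel_measurable M"
  shows "nn2 M f = nn2 M (\<lambda>x. f x $ 1) + nn2 M (\<lambda>x. f x $ 2)"
  unfolding nn2_def spinor_norm by (subst nn_integral_add[symmetric]) (auto simp: ennreal_plus)

lemma L2_spinor_iff:
  fixes f :: "'a \<Rightarrow> spinor"
  shows "f \<in> L2 M \<longleftrightarrow> (\<lambda>x. f x $ 1) \<in> L2 M \<and> (\<lambda>x. f x $ 2) \<in> L2 M"
proof
  assume f: "f \<in> L2 M"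
  then have "f \<in> borel_measurable M" by (simp add: L2_iff)
  with nn2_spinor[OF this] f show "(\<lambda>x. f x $ 1) \<in> L2 M \<and> (\<lambda>x. f x $ 2) \<in> L2 M"
    by (auto simp: L2_iff)
next
  assume a: "(\<lambda>x. f x $ 1) \<in> L2 M \<and> (\<lambda>x. f x $ 2) \<in> L2 M"
  then have "f \<in> borel_measurable M" by (intro spinor_measurableI) (auto simp: L2_iff)
  with nn2_spinor[OF this] a show "f \<in> L2 M" by (auto simp: L2_iff)
qed

lemma spinor_integral_nth:
  fixes f :: "'a \<Rightarrow> spinor"
  shows "integrable M f \<Longrightarrow> (LINT x|M. f x) $ i = (LINT x|M. f x $ i)"
  by (rule integral_bounded_linear[OF bounded_linear_vec_nth, symmetric])

lemma spinor_integrable_iff: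
  fixes f :: "'a \<Rightarrow> spinor"
  shows "integrable M f \<longleftrightarrow> integrable M (\<lambda>x. f x $ 1) \<and> integrable M (\<lambda>x. f x $ 2)"
proof
  assume "integrable M f"
  then show "integrable M (\<lambda>x. f x $ 1) \<and> integrable M (\<lambda>x. f x $ 2)"
    by (auto intro: integrable_bounded_linear[OF bounded_linear_vec_nth])
next
  assume a: "integrable M (\<lambda>x. f x $ 1) \<and> integrable M (\<lambda>x. f x $ 2)"
  show "integrable M f"
  proof (rule Bochner_Integration.integrable_bound)
    show "integrable M (\<lambda>x. cmod (f x $ 1) + cmod (f x $ 2))" using a by auto
    show "f \<in> borel_measurable M" using a by (intro spinor_measurableI) auto
    have "norm v \<le> cmod (v $ 1) + cmod (v $ 2)" for v :: spinor
      by (rule power2_le_imp_le) (simp_all add: spinor_norm power2_sum)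
    then show "AE x in M. norm (f x) \<le> norm (cmod (f x $ 1) + cmod (f x $ 2))" by simp
  qed
qed

text \<open>The weight (1 + k^2)^(s/2) at s = -1/2. The exponent is kept as
  \<open>- 1 / 2 / 2\<close> so that it agrees literally with the corresponding instance of
  \<open>sobolev_rep\<close>.\<close>

definition wt :: "real \<Rightarrow> real" where "wt k = (1 + k\<^sup>2) powr (- 1 / 2 / 2)"

lemma wt_measurable [measurable]: "wt \<in> borel_measurable borel"
  unfolding wt_def[abs_def] by measurable

lemma wt_pos: "wt k > 0"
  and wt_le_1: "wt k \<le> 1"
  and wt_squared: "(wt k)\<^sup>2 = 1 / sqrt (1 + k\<^sup>2)"
proof -
  have p: "1 + k\<^sup>2 > 0" by (simp add: add_pos_nonneg)
  then show "wt k > 0" by (simp add: wt_def)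
  have "(1 + k\<^sup>2) powr (- 1 / 2 / 2) \<le> (1 + k\<^sup>2) powr 0" by (rule powr_mono) auto
  then show "wt k \<le> 1" using p by (simp add: wt_def)
  have "(wt k)\<^sup>2 = (1 + k\<^sup>2) powr (- 1 / 2 / 2 + - 1 / 2 / 2)"
    by (simp only: wt_def power2_eq_square powr_add)
  also have "\<dots> = (1 + k\<^sup>2) powr - (1 / 2)" by simp
  also have "\<dots> = 1 / sqrt (1 + k\<^sup>2)" using p by (simp only: powr_minus powr_half_sqrt less_imp_le inverse_eq_divide)
  finally show "(wt k)\<^sup>2 = 1 / sqrt (1 + k\<^sup>2)" .
qed

lemma inverse_wt_squared_le: "(1 / wt k)\<^sup>2 \<le> 1 + k\<^sup>2"
proof -
  have "(1 / wt k)\<^sup>2 = sqrt (1 + k\<^sup>2)" by (simp add: power_divide wt_squared)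
  also have "\<dots> \<le> 1 + k\<^sup>2" using self_le_power[of "1 + k\<^sup>2" 2] by (intro real_le_lsqrt) auto
  finally show ?thesis .
qed

lemma wt_product: "(a / complex_of_real (wt k)) * (of_real (wt k) * b) = a * b"
  using wt_pos[of k] by simp

text \<open>The duality of H^(1/2) and H^(-1/2): the two weights cancel, leaving a product of two
  L^2 functions.\<close>

lemma wt_product_integrable:
  fixes g v :: "real \<Rightarrow> complex"
  assumes "(\<lambda>k. g k / of_real (wt k)) \<in> L2 lborel" "(\<lambda>k. of_real (wt k) * v k) \<in> L2 lborel"
  shows "integrable lborel (\<lambda>k. g k * v k)"
  using L2_product(1)[OF assms] by (simp only: wt_product)

text \<open>The square of a decay of order 1/(1 + k^2) beats the squared inverse weight, which is at
  most 1 + k^2, and leaves an integrable majorant. Transforms of test functions may therefore be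
  paired with H^(-1/2).\<close>

lemma inv_fourier_test_wt:
  assumes "f \<in> test_functions \<Omega>"
  shows "(\<lambda>k. inv_fourier f k / of_real (wt k)) \<in> L2 lborel"
proof -
  obtain C where C: "C > 0" "\<And>k. cmod (inv_fourier f k) \<le> C / (1 + k\<^sup>2)"
    using inv_fourier_test_decay[OF assms] by blast
  have [measurable]: "f \<in> borel_measurable borel" by (rule test_functions_measurable[OF assms])
  have "integrable lborel (\<lambda>k. (cmod (inv_fourier f k / of_real (wt k)))\<^sup>2)"
  proof (rule Bochner_Integration.integrable_bound)
    show "integrable lborel (\<lambda>k::real. C\<^sup>2 * (1 / (1 + k\<^sup>2)))"
      by (intro integrable_mult_right integrable_inverse_1_plus)
    have "(cmod (inv_fourier f k / of_real (wt k)))\<^sup>2 \<le> C\<^sup>2 * (1 / (1 + k\<^sup>2))" for k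
    proof -
      have p: "1 + k\<^sup>2 > 0" by (simp add: add_pos_nonneg)
      have "(cmod (inv_fourier f k / of_real (wt k)))\<^sup>2 = (cmod (inv_fourier f k))\<^sup>2 * (1 / wt k)\<^sup>2"
        by (simp add: norm_divide power_divide)
      also have "\<dots> \<le> (C / (1 + k\<^sup>2))\<^sup>2 * (1 + k\<^sup>2)"
        by (intro mult_mono power_mono C inverse_wt_squared_le) auto
      also have "\<dots> = C\<^sup>2 * (1 / (1 + k\<^sup>2))" using p by (simp add: power_divide power2_eq_square)
      finally show ?thesis .
    qed
    then show "AE k in lborel. norm ((cmod (inv_fourier f k / of_real (wt k)))\<^sup>2) \<le> norm (C\<^sup>2 * (1 / (1 + k\<^sup>2)))"
      by (auto simp: abs_mult)
  qed measurable
  then show ?thesis by (simp add: L2_def)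
qed

text \<open>Densities for which every superposition of exponentials with continuous exponent
  converges, growing ones included, and which are stable under multiplication by continuous
  functions, as happens when such a superposition is differentiated.\<close>

definition bounded_cpt :: "(real \<Rightarrow> complex) set" where
  "bounded_cpt = {c \<in> borel_measurable borel. \<exists>N B. \<forall>k. cmod (c k) \<le> B \<and> (N < \<bar>k\<bar> \<longrightarrow> c k = 0)}"

lemma bounded_cptE:
  assumes "c \<in> bounded_cpt"
  obtains N B where "N > 0" "B > 0" "\<And>k. cmod (c k) \<le> B" "\<And>k. N < \<bar>k\<bar> \<Longrightarrow> c k = 0"
proof -
  from assms obtain N B where NB: "\<And>k. cmod (c k) \<le> B" "\<And>k. N < \<bar>k\<bar> \<Longrightarrow> c k = 0"
    by (auto simp: bounded_cpt_def)
  have B: "cmod (c k) \<le> max B 1" for k using NB(1)[of k] by simp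
  have N: "c k = 0" if "max N 1 < \<bar>k\<bar>" for k using NB(2) that by simp
  show thesis by (rule that[of "max N 1" "max B 1"]) (use B N in auto)
qed

lemma bounded_cpt_measurable [measurable_dest]: "c \<in> bounded_cpt \<Longrightarrow> c \<in> borel_measurable borel"
  by (simp add: bounded_cpt_def)

lemma bounded_cpt_integrable:
  assumes "c \<in> bounded_cpt"
  shows "integrable lborel c" "c \<in> L2 lborel"
proof -
  obtain N B where NB: "N > 0" "B > 0" "\<And>k. cmod (c k) \<le> B" "\<And>k. N < \<bar>k\<bar> \<Longrightarrow> c k = 0"
    using bounded_cptE[OF assms] by blast
  have [measurable]: "c \<in> borel_measurable borel" using assms by (rule bounded_cpt_measurable)
  have i: "integrable lborel (\<lambda>k. C * indicator {-N..N} k)" for C :: real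
    by (intro integrable_mult_right integrable_real_indicator) (auto simp: emeasure_lborel_Icc_eq)
  have le: "cmod (c k) \<le> B * indicator {-N..N} k" for k
    using NB(3,4)[of k] NB(2) by (auto simp: indicator_def not_le abs_if split: if_splits)
  show "integrable lborel c"
    by (rule Bochner_Integration.integrable_bound[OF i[of B]]) (use le NB(2) in \<open>auto simp: abs_mult\<close>)
  have "(cmod (c k))\<^sup>2 \<le> B\<^sup>2 * indicator {-N..N} k" for k
    using power_mono[OF le[of k], of 2] by (auto simp: indicator_def split: if_splits)
  then have "integrable lborel (\<lambda>k. (cmod (c k))\<^sup>2)"
    by (intro Bochner_Integration.integrable_bound[OF i[of "B\<^sup>2"]]) (auto simp: abs_mult)
  then show "c \<in> L2 lborel" by (simp add: L2_def)
qed

lemma bounded_cpt_mult: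
  assumes "c \<in> bounded_cpt" and h: "continuous_on UNIV h"
  shows "(\<lambda>k. h k * c k) \<in> bounded_cpt"
proof -
  obtain N B where NB: "N > 0" "B > 0" "\<And>k. cmod (c k) \<le> B" "\<And>k. N < \<bar>k\<bar> \<Longrightarrow> c k = 0"
    using bounded_cptE[OF assms(1)] by blast
  have [measurable]: "c \<in> borel_measurable borel" "h \<in> borel_measurable borel"
    using assms by (auto intro: borel_measurable_continuous_onI)
  have "compact (h ` {-N..N})" by (intro compact_continuous_image continuous_on_subset[OF h]) auto
  then obtain A where A: "A > 0" "\<And>z. z \<in> h ` {-N..N} \<Longrightarrow> cmod z \<le> A"
    using compact_imp_bounded bounded_pos by metis
  have "cmod (h k * c k) \<le> A * B" for k
  proof (cases "\<bar>k\<bar> \<le> N")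
    case True
    then have "cmod (h k) \<le> A" by (intro A(2)) (auto simp: abs_le_iff)
    then show ?thesis using NB(3)[of k] A(1) by (simp add: norm_mult mult_mono)
  next
    case False then show ?thesis using NB(2) NB(4)[of k] A(1) by simp
  qed
  moreover have "N < \<bar>k\<bar> \<longrightarrow> h k * c k = 0" for k using NB(4) by simp
  ultimately show ?thesis unfolding bounded_cpt_def by (intro CollectI conjI exI[of _ N] exI[of _ "A * B"]) auto
qed

lemma bounded_cpt_reflect: "c \<in> bounded_cpt \<Longrightarrow> (\<lambda>k. c (- k)) \<in> bounded_cpt"
proof -
  assume c: "c \<in> bounded_cpt"
  obtain N B where NB: "N > 0" "B > 0" "\<And>k. cmod (c k) \<le> B" "\<And>k. N < \<bar>k\<bar> \<Longrightarrow> c k = 0"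
    using bounded_cptE[OF c] by blast
  have [measurable]: "c \<in> borel_measurable borel" using c by (rule bounded_cpt_measurable)
  show ?thesis unfolding bounded_cpt_def using NB(3) NB(4)[of "- _"]
    by (intro CollectI conjI exI[of _ N] exI[of _ B]) auto
qed

text \<open>A superposition of the waves exp(a(k) x + i k y). The exponent a = 0 yields band-limited
  functions of y, and a = -s kappa the modes decaying on the half plane s x > 0.\<close>

definition efun :: "(real \<Rightarrow> real) \<Rightarrow> (real \<Rightarrow> complex) \<Rightarrow> real \<times> real \<Rightarrow> complex" where
  "efun a c p = inv_fourier (\<lambda>k. c k * exp (of_real (a k * fst p))) (snd p)"

text \<open>Differentiation under the integral by a quadratic Taylor bound. On the bounded support
  of the density the exponent \<open>L k h\<close> is at most \<open>K * norm h\<close>, uniformly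
  in k, so the remainder is of second order in the increment.\<close>

lemma efun_has_derivative:
  assumes c: "c \<in> bounded_cpt" and a: "continuous_on UNIV a"
  shows "(efun a c has_derivative
    (\<lambda>h. efun a (\<lambda>k. (of_real (a k * fst h) + \<i> * of_real (k * snd h)) * c k) p)) (at p)"
proof -
  \<comment> \<open>The exponent as a real-linear form in the point, so that
    \<open>exp (L k (p + h))\<close> factors and the derivative in direction \<open>h\<close>
    multiplies the density by \<open>L k h\<close>.\<close>
  define L where "L k h = of_real (a k * fst h) + \<i> * complex_of_real (k * snd h)" for k and h :: "real \<times> real"
  define r where "r = complex_of_real (1 / sqrt (2 * pi))"
  have L_add: "L k (g + h) = L k g + L k h" and L_scale: "L k (s *\<^sub>R h) = s *\<^sub>R L k h" for k g h s
    by (auto simp: L_def algebra_simps scaleR_conv_of_real)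
  have Lc: "continuous_on UNIV (\<lambda>k. L k h)" for h unfolding L_def by (intro continuous_intros a)
  have ef: "efun a d q = r * (LINT k|lborel. d k * exp (L k q))" for d q
    unfolding efun_def inv_fourier_def r_def L_def
    by (simp add: exp_add ac_simps)
  have B: "(\<lambda>k. exp (L k q) * d k) \<in> bounded_cpt" if "d \<in> bounded_cpt" for d q
    by (rule bounded_cpt_mult[OF that]) (intro continuous_intros Lc)
  have int: "integrable lborel (\<lambda>k. d k * exp (L k q))" if "d \<in> bounded_cpt" for d q
    using bounded_cpt_integrable(1)[OF B[OF that]] by (simp add: mult.commute)
  have cL: "(\<lambda>k. L k h * c k) \<in> bounded_cpt" for h by (rule bounded_cpt_mult[OF c Lc])
  obtain N M where NB: "N > 0" "M > 0" "\<And>k. cmod (c k) \<le> M" "\<And>k. N < \<bar>k\<bar> \<Longrightarrow> c k = 0"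
    using bounded_cptE[OF c] by blast
  have "compact (a ` {-N..N})" by (intro compact_continuous_image continuous_on_subset[OF a]) auto
  then obtain A where A: "A > 0" "\<And>z. z \<in> a ` {-N..N} \<Longrightarrow> norm z \<le> A"
    using compact_imp_bounded bounded_pos by metis
  define K where "K = A + N"
  have K: "K > 0" using A(1) NB(1) by (simp add: K_def)
  have Lbd: "cmod (L k h) \<le> K * norm h" if "\<bar>k\<bar> \<le> N" for k h
  proof -
    have "\<bar>a k\<bar> \<le> A" using A(2)[of "a k", OF imageI] that by (auto simp: abs_le_iff)
    have "cmod (L k h) \<le> \<bar>a k\<bar> * \<bar>fst h\<bar> + \<bar>k\<bar> * \<bar>snd h\<bar>"
      unfolding L_def by (rule order_trans[OF norm_triangle_ineq]) (simp add: norm_mult abs_mult)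
    also have "\<dots> \<le> A * norm h + N * norm h"
      using \<open>\<bar>a k\<bar> \<le> A\<close> that norm_fst_le[of "fst h" "snd h"] norm_snd_le[of "snd h" "fst h"] A(1) NB(1)
      by (intro add_mono mult_mono) auto
    finally show ?thesis by (simp add: K_def algebra_simps)
  qed
  define D where "D h = (LINT k|lborel. L k h * c k * exp (L k p))" for h
  have "linear D"
  proof (rule linearI)
    fix g h s
    show "D (g + h) = D g + D h"
      unfolding D_def L_add distrib_right by (rule Bochner_Integration.integral_add[OF int[OF cL] int[OF cL]])
    have "D (s *\<^sub>R h) = (LINT k|lborel. s *\<^sub>R (L k h * c k * exp (L k p)))"
      unfolding D_def L_scale by simp
    then show "D (s *\<^sub>R h) = s *\<^sub>R D h" unfolding D_def by (simp only: integral_scaleR_right)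
  qed
  then have D: "bounded_linear D" by (simp add: linear_conv_bounded_linear)
  define G where "G q = (LINT k|lborel. c k * exp (L k q))" for q
  define J where "J = (LINT k|lborel. cmod (c k * exp (L k p)))"
  have est: "cmod (G q - G p - D (q - p)) \<le> exp K * K\<^sup>2 * J * (norm (q - p))\<^sup>2" if "norm (q - p) < 1" for q
  proof -
    define h where "h = q - p"
    have q: "q = p + h" by (simp add: h_def)
    have i: "integrable lborel (\<lambda>k. c k * exp (L k p) * (exp (L k h) - 1 - L k h))"
    proof -
      have "(\<lambda>k. (exp (L k p) * (exp (L k h) - 1 - L k h)) * c k) \<in> bounded_cpt"
        by (rule bounded_cpt_mult[OF c]) (intro continuous_intros Lc)
      from bounded_cpt_integrable(1)[OF this] show ?thesis by (simp add: ac_simps)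
    qed
    have "G q - G p - D h = (LINT k|lborel. c k * exp (L k q) - c k * exp (L k p) - L k h * c k * exp (L k p))"
      unfolding G_def D_def using int[OF c] int[OF cL] by simp
    also have "\<dots> = (LINT k|lborel. c k * exp (L k p) * (exp (L k h) - 1 - L k h))"
      unfolding q L_add exp_add by (rule Bochner_Integration.integral_cong) (auto simp: algebra_simps)
    finally have "cmod (G q - G p - D h) \<le> (LINT k|lborel. cmod (c k * exp (L k p) * (exp (L k h) - 1 - L k h)))"
      by (simp only: integral_norm_bound)
    also have "\<dots> \<le> (LINT k|lborel. cmod (c k * exp (L k p)) * (exp K * (K * norm h)\<^sup>2))"
    proof (rule integral_mono)
      show "integrable lborel (\<lambda>k. cmod (c k * exp (L k p) * (exp (L k h) - 1 - L k h)))" using i by (rule integrable_norm)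
      show "integrable lborel (\<lambda>k. cmod (c k * exp (L k p)) * (exp K * (K * norm h)\<^sup>2))"
        by (intro integrable_mult_left integrable_norm int c)
      fix k
      show "cmod (c k * exp (L k p) * (exp (L k h) - 1 - L k h)) \<le> cmod (c k * exp (L k p)) * (exp K * (K * norm h)\<^sup>2)"
      proof (cases "\<bar>k\<bar> \<le> N")
        case False then show ?thesis using NB(4)[of k] by simp
      next
        case True
        let ?z = "L k h"
        have z: "cmod ?z \<le> K * norm h" by (rule Lbd[OF True])
        have "cmod (exp ?z - (\<Sum>i\<le>1. ?z ^ i / fact i)) \<le> exp \<bar>Re ?z\<bar> * (cmod ?z) ^ Suc 1 / fact 1"
          by (rule Taylor_exp)
        then have "cmod (exp ?z - 1 - ?z) \<le> exp \<bar>Re ?z\<bar> * (cmod ?z)\<^sup>2"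
          by (simp add: numeral_2_eq_2 diff_diff_eq)
        also have "\<dots> \<le> exp K * (K * norm h)\<^sup>2"
        proof (intro mult_mono power_mono z)
          have "\<bar>Re ?z\<bar> \<le> K * norm h" using abs_Re_le_cmod z by (rule order_trans)
          also have "\<dots> \<le> K * 1" using that K by (intro mult_left_mono) (auto simp: h_def)
          finally show "exp \<bar>Re ?z\<bar> \<le> exp K" by simp
        qed auto
        finally show ?thesis unfolding norm_mult[of "c k * exp (L k p)"] by (rule mult_left_mono) simp
      qed
    qed
    also have "\<dots> = J * (exp K * (K * norm h)\<^sup>2)" unfolding J_def by (rule integral_mult_left_zero)
    finally show ?thesis by (simp add: h_def power_mult_distrib ac_simps)
  qed
  have "(G has_derivative D) (at p)"
  proof (rule has_derivativeI_sandwich[where e=1 and H="\<lambda>q. exp K * K\<^sup>2 * J * norm (q - p)"])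
    show "cmod (G q - G p - D (q - p)) / norm (q - p) \<le> exp K * K\<^sup>2 * J * norm (q - p)"
      if "q \<noteq> p" "dist q p < 1" for q
      using est[of q] that by (simp add: dist_norm divide_le_eq power2_eq_square mult.assoc)
    show "((\<lambda>q. exp K * K\<^sup>2 * J * norm (q - p)) \<longlongrightarrow> 0) (at p)"
      by (auto intro!: tendsto_eq_intros)
  qed (use D in auto)
  then have "((\<lambda>q. r * G q) has_derivative (\<lambda>h. r * D h)) (at p)"
    by (rule has_derivative_mult_right)
  then show ?thesis
    unfolding ef[abs_def] G_def D_def unfolding L_def[symmetric] .
qed

lemma efun_smooth:
  assumes "c \<in> bounded_cpt" "continuous_on UNIV a"
  shows "smooth (efun a c)"
proof (rule smooth_family[where X="efun a ` bounded_cpt"])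
  show "efun a c \<in> efun a ` bounded_cpt" using assms by auto
  fix g assume "g \<in> efun a ` bounded_cpt"
  then obtain d where d: "d \<in> bounded_cpt" "g = efun a d" by auto
  have "(\<lambda>x. efun a (\<lambda>k. (of_real (a k * fst v) + \<i> * of_real (k * snd v)) * d k) x) \<in> efun a ` bounded_cpt" for v
    by (intro imageI bounded_cpt_mult[OF d(1)] continuous_intros assms(2))
  then show "\<exists>g'. (\<forall>x. (g has_derivative g' x) (at x)) \<and> (\<forall>v. (\<lambda>x. g' x v) \<in> efun a ` bounded_cpt)"
    using efun_has_derivative[OF d(1) assms(2)] d(2)
    by (intro exI[of _ "\<lambda>x h. efun a (\<lambda>k. (of_real (a k * fst h) + \<i> * of_real (k * snd h)) * d k) x"]) auto
qed

section \<open>Band-limited functions and their cut-offs\<close>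

lemma inv_fourier_reflect: "inv_fourier (\<lambda>k. c (- k)) y = inv_fourier c (- y)"
  unfolding inv_fourier_def
  by (subst lborel_integral_real_affine[of "-1" _ 0]) simp_all

lemma nn2_reflect:
  fixes f :: "real \<Rightarrow> 'b::euclidean_space"
  assumes [measurable]: "f \<in> borel_measurable borel"
  shows "nn2 lborel (\<lambda>y. f (- y)) = nn2 lborel f"
  unfolding nn2_def by (subst (2) nn_integral_real_affine[of _ "-1" 0]) simp_all

lemma L2_reflect:
  fixes f :: "real \<Rightarrow> complex"
  assumes "f \<in> L2 lborel"
  shows "(\<lambda>y. f (- y)) \<in> L2 lborel"
proof -
  have [measurable]: "f \<in> borel_measurable borel" using assms by (simp add: L2_iff)
  show ?thesis using assms nn2_reflect[of f] by (simp add: L2_iff)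
qed

text \<open>Plancherel is applied on the frequency side, where the difference is transformed back:
  inversion is available for the test function \<open>f\<close>, while \<open>c\<close> only has to
  be reflected.\<close>

lemma plancherel_inverse:
  assumes f: "f \<in> test_functions \<Omega>" and c: "integrable lborel c" "c \<in> L2 lborel"
  shows "nn2 lborel (\<lambda>k. inv_fourier f k - c (- k)) = nn2 lborel (\<lambda>y. f y - inv_fourier c y)"
proof -
  have [measurable]: "f \<in> borel_measurable borel" "c \<in> borel_measurable borel"
    using f c by (auto intro: test_functions_measurable)
  have c': "integrable lborel (\<lambda>k. c (- k))" "(\<lambda>k. c (- k)) \<in> L2 lborel"
    using lborel_integrable_real_affine[OF c(1), of "-1" 0] L2_reflect[OF c(2)] by simp_all
  note i = inv_fourier_test_integrable[OF f]
  have "nn2 lborel (\<lambda>k. inv_fourier f k - c (- k)) = nn2 lborel (inv_fourier (\<lambda>k. inv_fourier f k - c (- k)))"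
    using i c' by (intro plancherel[symmetric] L2_diff) auto
  also have "inv_fourier (\<lambda>k. inv_fourier f k - c (- k)) = (\<lambda>y. f (- y) - inv_fourier c (- y))"
    by (intro ext) (simp add: inv_fourier_diff[OF i(1) c'(1)] inv_fourier_inversion_test[OF f] inv_fourier_reflect)
  also have "nn2 lborel \<dots> = nn2 lborel (\<lambda>y. f y - inv_fourier c y)"
    by (rule nn2_reflect) simp
  finally show ?thesis .
qed

lemma nn2_cutoff_tendsto:
  fixes F :: "'a \<Rightarrow> complex"
  assumes F: "F \<in> L2 M" and [measurable]: "\<And>n. u n \<in> borel_measurable M"
    and "\<And>n x. 0 \<le> u n x" "\<And>n x. u n x \<le> (1::real)" and lim: "\<And>x. (\<lambda>n. u n x) \<longlonglongrightarrow> 1"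
  shows "(\<lambda>n. nn2 M (\<lambda>x. of_real (u n x) * F x - F x)) \<longlonglongrightarrow> 0"
proof -
  have [measurable]: "F \<in> borel_measurable M" using F by (simp add: L2_iff)
  have eq: "of_real (u n x) * F x - F x = of_real (u n x - 1) * F x" for n x
    by (simp add: algebra_simps)
  have "(\<lambda>n. nn2 M (\<lambda>x. of_real (u n x) * F x - F x)) \<longlonglongrightarrow> (\<integral>\<^sup>+x. 0 \<partial>M)"
    unfolding nn2_def
  proof (rule nn_integral_dominated_convergence[where w="\<lambda>x. ennreal ((norm (F x))\<^sup>2)"])
    have "(norm (of_real (u n x) * F x - F x))\<^sup>2 \<le> (norm (F x))\<^sup>2" for n x
      unfolding eq norm_mult norm_of_real using assms(3,4)[of n x]
      by (intro power_mono mult_left_le_one_le) auto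
    then show "AE x in M. ennreal ((norm (of_real (u n x) * F x - F x))\<^sup>2) \<le> ennreal ((norm (F x))\<^sup>2)" for n
      by (intro AE_I2 ennreal_leI)
    have "(\<lambda>n. (norm (of_real (u n x) * F x - F x))\<^sup>2) \<longlonglongrightarrow> (norm (of_real 1 * F x - F x))\<^sup>2" for x
      by (intro tendsto_intros lim)
    then show "AE x in M. (\<lambda>n. ennreal ((norm (of_real (u n x) * F x - F x))\<^sup>2)) \<longlonglongrightarrow> 0"
      by (intro AE_I2) (simp add: ennreal_0 [symmetric] del: ennreal_0)
    show "(\<integral>\<^sup>+x. ennreal ((norm (F x))\<^sup>2) \<partial>M) < \<infinity>" using F by (simp add: L2_iff nn2_def)
  qed auto
  then show ?thesis by simp
qed

text \<open>The counterpart of \<open>nn2_cutoff_tendsto\<close> for the commutator terms: a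
  derivative of the cut-off is uniformly of order 1/n, so its product with a fixed L^2 function
  vanishes in the limit.\<close>

lemma nn2_small_tendsto:
  fixes F :: "'a \<Rightarrow> complex"
  assumes F: "F \<in> L2 M" and bd: "\<And>n x. cmod (D n x) \<le> C / real (Suc n)" and "C \<ge> 0"
  shows "(\<lambda>n. nn2 M (\<lambda>x. D n x * F x)) \<longlonglongrightarrow> 0"
proof (rule ennreal_tendsto_0_bound)
  have [measurable]: "F \<in> borel_measurable M" using F by (simp add: L2_iff)
  show "nn2 M (\<lambda>x. D n x * F x) \<le> nn2 M F * ennreal ((C / real (Suc n))\<^sup>2)" for n
    using \<open>C \<ge> 0\<close> mult_right_mono[OF bd[of n] norm_ge_zero]
    by (subst mult.commute) (intro nn2_scale_le, auto simp: norm_mult)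
  have "(\<lambda>n. (C / real (Suc n))\<^sup>2) \<longlonglongrightarrow> 0"
    using tendsto_power[OF LIMSEQ_Suc[OF lim_const_over_n[of C]], of 2] by simp
  then show "(\<lambda>n. nn2 M F * ennreal ((C / real (Suc n))\<^sup>2)) \<longlonglongrightarrow> 0"
    using F by (intro ennreal_cmult_tendsto_0) (simp_all add: L2_iff ennreal_0 [symmetric] del: ennreal_0)
qed

lemma inv_fourier_bounded_cpt:
  assumes c: "c \<in> bounded_cpt"
  shows "smooth (inv_fourier c)"
    and "ddx (inv_fourier c) = inv_fourier (\<lambda>k. \<i> * of_real k * c k)"
proof -
  have L: "bounded_linear (\<lambda>y::real. (0::real, y))"
    by (rule bounded_linear_Pair[OF bounded_linear_zero bounded_linear_ident])
  have eq: "inv_fourier c = (\<lambda>y. efun (\<lambda>_. 0) c (0, y))" by (simp add: efun_def fun_eq_iff)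
  show "smooth (inv_fourier c)"
    unfolding eq by (rule smooth_compose_linear[OF L efun_smooth[OF c]]) auto
  have fd: "(inv_fourier c has_derivative (\<lambda>h. efun (\<lambda>_. 0) (\<lambda>k. (of_real (0 * fst (0::real, h)) + \<i> * of_real (k * snd (0::real, h))) * c k) (0, y))) (at y)" for y
    unfolding eq
    by (rule has_derivative_compose[OF bounded_linear_imp_has_derivative[OF L] efun_has_derivative[OF c]]) auto
  have "frechet_derivative (inv_fourier c) (at y) = (\<lambda>h. efun (\<lambda>_. 0) (\<lambda>k. (of_real (0 * fst (0::real, h)) + \<i> * of_real (k * snd (0::real, h))) * c k) (0, y))" for y
    by (rule frechet_derivative_at[OF fd, symmetric])
  then show "ddx (inv_fourier c) = inv_fourier (\<lambda>k. \<i> * of_real k * c k)"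
    by (auto simp: ddx_def efun_def fun_eq_iff)
qed

lemma inv_fourier_L2:
  assumes "c \<in> bounded_cpt"
  shows "inv_fourier c \<in> L2 lborel"
proof -
  have [measurable]: "c \<in> borel_measurable borel" using assms by (rule bounded_cpt_measurable)
  show ?thesis
    using plancherel[OF bounded_cpt_integrable[OF assms]] bounded_cpt_integrable(2)[OF assms] by (simp add: L2_iff)
qed

text \<open>A density of bounded support gives a smooth function whose own support is in general
  unbounded; the cut-off turns it into a test function.\<close>

definition cutoff_inv_fourier :: "nat \<Rightarrow> (real \<Rightarrow> complex) \<Rightarrow> real \<Rightarrow> complex" where
  "cutoff_inv_fourier n c y = of_real (cut (real (Suc n)) y) * inv_fourier c y"

lemma cutoff_inv_fourier_test:
  assumes "c \<in> bounded_cpt"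
  shows "cutoff_inv_fourier n c \<in> test_functions UNIV"
proof -
  have "\<bar>y\<bar> \<le> real (Suc n)" if "cutoff_inv_fourier n c y \<noteq> 0" for y
    using that cut_zero[of "real (Suc n)" y] by (cases "\<bar>y\<bar> \<le> real (Suc n)") (auto simp: cutoff_inv_fourier_def)
  then have "bounded {y. cutoff_inv_fourier n c y \<noteq> 0}"
    by (intro boundedI[where B="real (Suc n)"]) (simp only: mem_Collect_eq real_norm_def)
  moreover have "smooth (cutoff_inv_fourier n c)"
    unfolding cutoff_inv_fourier_def[abs_def]
    by (rule smooth_mult[OF smooth_of_real[OF smooth_cut] inv_fourier_bounded_cpt(1)[OF assms]])
  ultimately show ?thesis by (simp add: test_functions_UNIV_iff)
qed

text \<open>Convergence is required in H^(1/2), the dual of the trace space. It is obtained from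
  H^1, since the squared inverse weight is at most 1 + k^2: both the functions and their derivatives
  converge in L^2. The reflection in \<open>c (- k)\<close> comes from transforming twice with the
  same kernel.\<close>

lemma cutoff_inv_fourier_tendsto:
  assumes c: "c \<in> bounded_cpt"
  shows "(\<lambda>n. nn2 lborel (\<lambda>k. (inv_fourier (cutoff_inv_fourier n c) k - c (- k)) / of_real (wt k))) \<longlonglongrightarrow> 0"
proof -
  define b where "b = cutoff_inv_fourier"
  define c' where "c' k = \<i> * of_real k * c k" for k
  have c': "c' \<in> bounded_cpt" unfolding c'_def[abs_def] by (intro bounded_cpt_mult c continuous_intros)
  note [measurable] = bounded_cpt_measurable[OF c] bounded_cpt_measurable[OF c']
  have b: "b n c \<in> test_functions UNIV" for n unfolding b_def by (rule cutoff_inv_fourier_test[OF c])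
  note [measurable] = test_functions_measurable[OF b]
  have [measurable]: "cut R \<in> borel_measurable borel" for R
    by (rule smooth_borel_measurable[OF smooth_cut])
  obtain C where C: "C > 0" "\<And>R x. R > 0 \<Longrightarrow> \<bar>deriv (cut R) x\<bar> \<le> C / R"
    "\<And>R x. (cut R has_real_derivative deriv (cut R) x) (at x)" using cut_derivative_bound by blast
  have [measurable]: "deriv (cut R) \<in> borel_measurable borel" for R
  proof -
    have "deriv (cut R) = ddx (cut R)"
      using C(3)[of R]
      by (intro ext vector_derivative_unique_at[OF _ ddx_has_vector_derivative[OF smooth_cut]])
        (simp add: has_real_derivative_iff_has_vector_derivative)
    then show ?thesis
      using smooth_borel_measurable[OF smooth_frechet_derivative[OF smooth_cut, where v=1]] by (simp add: ddx_def[abs_def])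
  qed
  have ddxb: "ddx (b n c) y = of_real (deriv (cut (real (Suc n))) y) * inv_fourier c y
      + of_real (cut (real (Suc n)) y) * inv_fourier c' y" for n y
  proof -
    have 1: "((\<lambda>y. complex_of_real (cut (real (Suc n)) y)) has_vector_derivative of_real (deriv (cut (real (Suc n))) y)) (at y)"
      using C(3)[of "real (Suc n)" y]
      by (intro has_vector_derivative_of_real) (simp add: has_real_derivative_iff_has_vector_derivative)
    have 2: "(inv_fourier c has_vector_derivative inv_fourier c' y) (at y)"
      using ddx_has_vector_derivative[OF inv_fourier_bounded_cpt(1)[OF c], of y]
      unfolding inv_fourier_bounded_cpt(2)[OF c] c'_def[abs_def] .
    have "(b n c has_vector_derivative of_real (cut (real (Suc n)) y) * inv_fourier c' y
        + of_real (deriv (cut (real (Suc n))) y) * inv_fourier c y) (at y)"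
      unfolding b_def cutoff_inv_fourier_def[abs_def] by (rule has_vector_derivative_mult[OF 1 2])
    then show ?thesis
      using vector_derivative_unique_at[OF ddx_has_vector_derivative[OF test_functions_smooth[OF b]]]
      by (simp add: add.commute)
  qed
  have cutlim: "(\<lambda>n. nn2 lborel (\<lambda>y. of_real (cut (real (Suc n)) y) * F y - F y)) \<longlonglongrightarrow> 0"
    if "F \<in> L2 lborel" for F :: "real \<Rightarrow> complex"
  proof (rule nn2_cutoff_tendsto[OF that])
    show "cut (real (Suc n)) \<in> borel_measurable lborel" for n by simp
    show "0 \<le> cut (real (Suc n)) y" for n y by (rule cut_nonneg)
    show "cut (real (Suc n)) y \<le> 1" for n y by (rule cut_le_1)
    show "(\<lambda>n. cut (real (Suc n)) y) \<longlonglongrightarrow> 1" for y by (rule cut_tendsto_1)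
  qed
  have l0: "(\<lambda>n. nn2 lborel (\<lambda>y. b n c y - inv_fourier c y)) \<longlonglongrightarrow> 0"
    unfolding b_def cutoff_inv_fourier_def by (rule cutlim[OF inv_fourier_L2[OF c]])
  have l1: "(\<lambda>n. nn2 lborel (\<lambda>y. ddx (b n c) y - inv_fourier c' y)) \<longlonglongrightarrow> 0"
  proof -
    have x: "(\<lambda>n. nn2 lborel (\<lambda>y. of_real (cut (real (Suc n)) y) * inv_fourier c' y - inv_fourier c' y)) \<longlonglongrightarrow> 0"
      by (rule cutlim[OF inv_fourier_L2[OF c']])
    have y: "(\<lambda>n. nn2 lborel (\<lambda>y. complex_of_real (deriv (cut (real (Suc n))) y) * inv_fourier c y)) \<longlonglongrightarrow> 0"
      by (rule nn2_small_tendsto[OF inv_fourier_L2[OF c], where C=C])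
        (use C(1) C(2)[of "real (Suc _)"] in simp_all)
    have "(\<lambda>n. 2 * nn2 lborel (\<lambda>y. complex_of_real (deriv (cut (real (Suc n))) y) * inv_fourier c y)
      + 2 * nn2 lborel (\<lambda>y. of_real (cut (real (Suc n)) y) * inv_fourier c' y - inv_fourier c' y)) \<longlonglongrightarrow> 0 + 0"
      by (intro tendsto_add ennreal_cmult_tendsto_0 x y) auto
    moreover have "nn2 lborel (\<lambda>y. ddx (b n c) y - inv_fourier c' y)
      \<le> 2 * nn2 lborel (\<lambda>y. complex_of_real (deriv (cut (real (Suc n))) y) * inv_fourier c y)
      + 2 * nn2 lborel (\<lambda>y. of_real (cut (real (Suc n)) y) * inv_fourier c' y - inv_fourier c' y)" for n
    proof -
      have e: "(\<lambda>y. ddx (b n c) y - inv_fourier c' y)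
        = (\<lambda>y. complex_of_real (deriv (cut (real (Suc n))) y) * inv_fourier c y
          + (of_real (cut (real (Suc n)) y) * inv_fourier c' y - inv_fourier c' y))"
        by (simp add: ddxb fun_eq_iff)
      show ?thesis unfolding e by (rule nn2_add_le) measurable
    qed
    ultimately show ?thesis unfolding add_0 by (rule ennreal_tendsto_0_bound[rotated])
  qed
  have "nn2 lborel (\<lambda>k. (inv_fourier (b n c) k - c (- k)) / of_real (wt k))
      \<le> nn2 lborel (\<lambda>y. b n c y - inv_fourier c y) + nn2 lborel (\<lambda>y. ddx (b n c) y - inv_fourier c' y)" for n
  proof -
    let ?h = "\<lambda>k. inv_fourier (b n c) k - c (- k)"
    have h': "inv_fourier (ddx (b n c)) k - c' (- k) = - \<i> * of_real k * ?h k" for k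
      by (simp add: inv_fourier_ddx[OF b] c'_def algebra_simps)
    have p: "(cmod (z / of_real (wt k)))\<^sup>2 \<le> (cmod z)\<^sup>2 + (cmod (- \<i> * of_real k * z))\<^sup>2" for z k
    proof -
      have "(cmod (z / of_real (wt k)))\<^sup>2 = (cmod z)\<^sup>2 * (1 / wt k)\<^sup>2"
        by (simp add: norm_divide power_divide)
      also have "\<dots> \<le> (cmod z)\<^sup>2 * (1 + k\<^sup>2)" by (intro mult_left_mono inverse_wt_squared_le) auto
      finally show ?thesis by (simp add: norm_mult power_mult_distrib algebra_simps)
    qed
    have "nn2 lborel (\<lambda>k. ?h k / of_real (wt k))
      \<le> (\<integral>\<^sup>+k. ennreal ((cmod (?h k))\<^sup>2) + ennreal ((cmod (- \<i> * of_real k * ?h k))\<^sup>2) \<partial>lborel)"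
      unfolding nn2_def by (rule nn_integral_mono) (use p in \<open>auto simp flip: ennreal_plus intro!: ennreal_leI\<close>)
    also have "\<dots> = nn2 lborel ?h + nn2 lborel (\<lambda>k. inv_fourier (ddx (b n c)) k - c' (- k))"
      unfolding h' nn2_def by (rule nn_integral_add) measurable
    also have "\<dots> = nn2 lborel (\<lambda>y. b n c y - inv_fourier c y) + nn2 lborel (\<lambda>y. ddx (b n c) y - inv_fourier c' y)"
      by (simp only: plancherel_inverse[OF b bounded_cpt_integrable[OF c]]
        plancherel_inverse[OF test_functions_ddx[OF b] bounded_cpt_integrable[OF c']])
    finally show ?thesis .
  qed
  moreover have "(\<lambda>n. nn2 lborel (\<lambda>y. b n c y - inv_fourier c y) + nn2 lborel (\<lambda>y. ddx (b n c) y - inv_fourier c' y)) \<longlonglongrightarrow> 0"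
    using tendsto_add[OF l0 l1] by simp
  ultimately show ?thesis unfolding b_def by (rule ennreal_tendsto_0_bound)
qed

text \<open>Fourier transforms of test functions are dense enough to reach every density in
  \<open>bounded_cpt\<close>, and these are rich enough to contain one proportional to the conjugate
  of \<open>v\<close> at each frequency of a bounded interval.\<close>

lemma inv_fourier_functional_unique:
  fixes v :: "real \<Rightarrow> complex"
  assumes v: "(\<lambda>k. of_real (wt k) * v k) \<in> L2 lborel"
    and z: "\<And>\<phi>. \<phi> \<in> test_functions UNIV \<Longrightarrow> (LINT k|lborel. inv_fourier \<phi> k * v k) = 0"
  shows "AE k in lborel. v k = 0"
proof -
  have vm [measurable]: "v \<in> borel_measurable borel"
  proof -
    have "(\<lambda>k. (of_real (wt k) * v k) / of_real (wt k)) \<in> borel_measurable borel"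
      using v by (intro borel_measurable_divide) (auto simp: L2_iff)
    moreover have "(of_real (wt k) * v k) / of_real (wt k) = v k" for k using wt_pos[of k] by simp
    ultimately show ?thesis by simp
  qed
  \<comment> \<open>Passage from test functions to bounded densities: the transforms of the former
    approximate the latter in H^(1/2), and the pairing with \<open>v\<close> is continuous
    there.\<close>
  have zc: "(LINT k|lborel. c (- k) * v k) = 0" if c: "c \<in> bounded_cpt" for c
  proof -
    let ?b = "\<lambda>n k. inv_fourier (cutoff_inv_fourier n c) k / of_real (wt k)"
    let ?c = "\<lambda>k. c (- k) / of_real (wt k)"
    have b: "?b n \<in> L2 lborel" for n by (rule inv_fourier_test_wt[OF cutoff_inv_fourier_test[OF c]])
    have t: "(\<lambda>n. nn2 lborel (\<lambda>k. ?b n k - ?c k)) \<longlonglongrightarrow> 0"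
      using cutoff_inv_fourier_tendsto[OF c] by (simp only: diff_divide_distrib)
    have "continuous_on UNIV (\<lambda>k. 1 / complex_of_real (wt k))"
      unfolding wt_def by (intro continuous_intros) (auto simp: add_nonneg_eq_0_iff)
    from bounded_cpt_mult[OF bounded_cpt_reflect[OF c] this]
    have "?c \<in> bounded_cpt" by simp
    then have c2: "?c \<in> L2 lborel" by (rule bounded_cpt_integrable)
    have "(\<lambda>n. LINT k|lborel. ?b n k * (of_real (wt k) * v k)) \<longlonglongrightarrow> (LINT k|lborel. ?c k * (of_real (wt k) * v k))"
      by (rule L2_product_tendsto[OF b c2 v t])
    then have "(\<lambda>n. LINT k|lborel. inv_fourier (cutoff_inv_fourier n c) k * v k) \<longlonglongrightarrow> (LINT k|lborel. c (- k) * v k)"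
      by (simp only: wt_product)
    then have "(\<lambda>n::nat. 0) \<longlonglongrightarrow> (LINT k|lborel. c (- k) * v k)"
      by (simp only: z[OF cutoff_inv_fourier_test[OF c]])
    then show ?thesis by (metis LIMSEQ_unique tendsto_const)
  qed
  have "AE k in lborel. indicator {- real N..real N} k * ((cmod (v k))\<^sup>2 / (1 + cmod (v k))) = 0" for N
  proof -
    \<comment> \<open>With d = q conj(v) the integrand d v is real and nonnegative. Dividing by 1 +
      |v| keeps \<open>d\<close> bounded although \<open>v\<close> may be unbounded, and the
      indicator gives it bounded support.\<close>
    define q where "q k = indicator {- real N..real N} k * inverse (1 + cmod (v k))" for k
    define d where "d k = complex_of_real (q k) * cnj (v k)" for k
    have [measurable]: "(\<lambda>k. cnj (v k)) \<in> borel_measurable borel"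
      by (rule borel_measurable_continuous_on[OF _ vm]) (intro continuous_intros)
    have d1: "cmod (d k) \<le> 1" for k
    proof -
      have "inverse (1 + cmod (v k)) * cmod (v k) \<le> 1"
        by (simp add: field_simps add_pos_nonneg)
      moreover have "0 \<le> inverse (1 + cmod (v k))" by simp
      ultimately show ?thesis unfolding d_def q_def norm_mult norm_of_real complex_mod_cnj
        by (cases "k \<in> {- real N..real N}") (simp_all add: abs_mult del: atLeastAtMost_iff)
    qed
    have "d k = 0" if "real N < \<bar>k\<bar>" for k
    proof -
      have "k \<notin> {- real N..real N}" using that by auto
      then show ?thesis unfolding d_def q_def by (simp del: atLeastAtMost_iff)
    qed
    then have "\<forall>k. cmod (d k) \<le> 1 \<and> (real N < \<bar>k\<bar> \<longrightarrow> d k = 0)" using d1 by blast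
    moreover have "d \<in> borel_measurable borel" unfolding d_def[abs_def] q_def by measurable
    ultimately have "d \<in> bounded_cpt" unfolding bounded_cpt_def by blast
    from zc[OF bounded_cpt_reflect[OF this]]
    have 0: "(LINT k|lborel. d k * v k) = 0" by simp
    have dv: "d k * v k = of_real (indicator {- real N..real N} k * ((cmod (v k))\<^sup>2 / (1 + cmod (v k))))" for k
    proof -
      have "d k * v k = complex_of_real (q k) * complex_of_real ((cmod (v k))\<^sup>2)"
        unfolding d_def complex_norm_square by (simp only: ac_simps)
      then show ?thesis by (simp only: q_def of_real_mult[symmetric] divide_inverse ac_simps)
    qed
    have le: "(cmod (v k))\<^sup>2 / (1 + cmod (v k)) \<le> 1 / wt k * cmod (of_real (wt k) * v k)" for k
    proof -
      have "(cmod (v k))\<^sup>2 / (1 + cmod (v k)) \<le> cmod (v k)"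
        by (simp add: divide_le_eq add_pos_nonneg power2_eq_square algebra_simps)
      then show ?thesis using wt_pos[of k] by (simp add: norm_mult)
    qed
    have int: "integrable lborel (\<lambda>k. d k * v k)"
    proof -
      have "(\<lambda>k. d k / of_real (wt k)) \<in> L2 lborel"
      proof -
        have "continuous_on UNIV (\<lambda>k. 1 / complex_of_real (wt k))"
          unfolding wt_def by (intro continuous_intros) (auto simp: add_nonneg_eq_0_iff)
        from bounded_cpt_integrable(2)[OF bounded_cpt_mult[OF \<open>d \<in> bounded_cpt\<close> this]] show ?thesis by simp
      qed
      from wt_product_integrable[OF this v] show ?thesis .
    qed
    let ?g = "\<lambda>k. indicator {- real N..real N} k * ((cmod (v k))\<^sup>2 / (1 + cmod (v k)))"
    have "integrable lborel ?g" using integrable_Re[OF int] by (simp add: dv)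
    moreover have "(LINT k|lborel. ?g k) = 0"
      using 0 unfolding dv by (simp only: integral_complex_of_real of_real_eq_0_iff)
    ultimately show ?thesis
      by (subst integral_nonneg_eq_0_iff_AE[symmetric]) (auto simp: add_pos_nonneg less_imp_le)
  qed
  then have "AE k in lborel. \<forall>N. indicator {- real N..real N} k * ((cmod (v k))\<^sup>2 / (1 + cmod (v k))) = 0"
    unfolding AE_all_countable by blast
  then show ?thesis
  proof (rule AE_mp, intro AE_I2 impI)
    fix k assume a: "\<forall>N. indicator {- real N..real N} k * ((cmod (v k))\<^sup>2 / (1 + cmod (v k))) = (0::real)"
    obtain N where "\<bar>k\<bar> \<le> real N" using real_arch_simple by blast
    then have "k \<in> {- real N..real N}" by auto
    then have "(cmod (v k))\<^sup>2 / (1 + cmod (v k)) = 0" using a[rule_format, of N] by simp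
    moreover have "1 + cmod (v k) > 0" by (simp add: add_pos_nonneg)
    ultimately show "v k = 0" by simp
  qed
qed

text \<open>Taking a component under the vector-valued integral requires integrability, which the
  weight condition supplies through the pairing of H^(1/2) with H^(-1/2). Hence the second
  equivalence is shown under the first condition.\<close>

lemma sobolev_rep_iff:
  "sobolev_rep (- 1 / 2) u w \<longleftrightarrow>
    (\<forall>i. (\<lambda>k. of_real (wt k) * w k $ i) \<in> L2 lborel) \<and>
    (\<forall>\<phi>\<in>test_functions UNIV. \<forall>i. u \<phi> $ i = (LINT k|lborel. inv_fourier \<phi> k * w k $ i))"
proof -
  have L: "(\<lambda>k. (1 + k\<^sup>2) powr (- 1 / 2 / 2) *\<^sub>R w k) \<in> L2 lborel
     \<longleftrightarrow> (\<forall>i. (\<lambda>k. of_real (wt k) * w k $ i) \<in> L2 lborel)"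
    unfolding L2_spinor_iff wt_def[symmetric] forall_2 vector_scaleR_component
    by (simp only: scaleR_conv_of_real)
  have "(u \<phi> = (LINT k|lborel. inv_fourier \<phi> k *s w k)) \<longleftrightarrow> (\<forall>i. u \<phi> $ i = (LINT k|lborel. inv_fourier \<phi> k * w k $ i))"
    if w: "\<forall>i. (\<lambda>k. of_real (wt k) * w k $ i) \<in> L2 lborel" and \<phi>: "\<phi> \<in> test_functions UNIV" for \<phi>
  proof -
    have "integrable lborel (\<lambda>k. inv_fourier \<phi> k * w k $ i)" for i
      using w by (intro wt_product_integrable inv_fourier_test_wt[OF \<phi>]) simp
    then have "integrable lborel (\<lambda>k. inv_fourier \<phi> k *s w k)"
      by (simp add: spinor_integrable_iff)
    then show ?thesis by (simp add: vec_eq_iff spinor_integral_nth)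
  qed
  then show ?thesis unfolding sobolev_rep_def L by blast
qed

text \<open>This turns the definite description in \<open>sobolev_norm\<close> into an honest norm.
  Only values on test functions are compared, in agreement with the way distributions are
  represented.\<close>

lemma sobolev_rep_unique:
  assumes "sobolev_rep (- 1 / 2) u w" "sobolev_rep (- 1 / 2) u' w'"
    and u: "\<And>\<phi>. \<phi> \<in> test_functions UNIV \<Longrightarrow> u \<phi> = u' \<phi>"
  shows "AE k in lborel. w k = w' k"
proof -
  have "AE k in lborel. w k $ i - w' k $ i = 0" for i
  proof (rule inv_fourier_functional_unique)
    have w: "(\<lambda>k. of_real (wt k) * w k $ i) \<in> L2 lborel" "(\<lambda>k. of_real (wt k) * w' k $ i) \<in> L2 lborel"
      using assms(1,2) unfolding sobolev_rep_iff by auto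
    show "(\<lambda>k. of_real (wt k) * (w k $ i - w' k $ i)) \<in> L2 lborel"
      using L2_diff[OF w] by (simp add: right_diff_distrib)
    fix \<phi> :: "real \<Rightarrow> complex" assume \<phi>: "\<phi> \<in> test_functions UNIV"
    have "integrable lborel (\<lambda>k. inv_fourier \<phi> k * w k $ i)" "integrable lborel (\<lambda>k. inv_fourier \<phi> k * w' k $ i)"
      by (rule wt_product_integrable[OF inv_fourier_test_wt[OF \<phi>] w(1)]
          wt_product_integrable[OF inv_fourier_test_wt[OF \<phi>] w(2)])+
    moreover have "(LINT k|lborel. inv_fourier \<phi> k * w k $ i) = (LINT k|lborel. inv_fourier \<phi> k * w' k $ i)"
      using assms(1,2) u[OF \<phi>] \<phi> unfolding sobolev_rep_iff by metis
    ultimately show "(LINT k|lborel. inv_fourier \<phi> k * (w k $ i - w' k $ i)) = 0"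
      by (simp add: right_diff_distrib)
  qed
  then have "AE k in lborel. \<forall>i. w k $ i - w' k $ i = 0" by (simp add: forall_2)
  then show ?thesis by (rule AE_mp) (auto simp: vec_eq_iff)
qed

lemma sobolev_norm_eq:
  assumes "sobolev_rep (- 1 / 2) u w"
  shows "sobolev_norm (- 1 / 2) u = L2_norm lborel (\<lambda>k. wt k *\<^sub>R w k)"
  unfolding sobolev_norm_def wt_def[symmetric]
proof (rule the_equality)
  show "\<exists>w'. sobolev_rep (- 1 / 2) u w' \<and> L2_norm lborel (\<lambda>k. wt k *\<^sub>R w k) = L2_norm lborel (\<lambda>k. wt k *\<^sub>R w' k)"
    using assms by blast
  fix r assume "\<exists>w'. sobolev_rep (- 1 / 2) u w' \<and> r = L2_norm lborel (\<lambda>k. wt k *\<^sub>R w' k)"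
  then obtain w' where w': "sobolev_rep (- 1 / 2) u w'" "r = L2_norm lborel (\<lambda>k. wt k *\<^sub>R w' k)" by blast
  have L: "(\<lambda>k. wt k *\<^sub>R w k) \<in> L2 lborel" "(\<lambda>k. wt k *\<^sub>R w' k) \<in> L2 lborel"
    using assms w'(1) unfolding sobolev_rep_def wt_def by auto
  have "AE k in lborel. wt k *\<^sub>R w k = wt k *\<^sub>R w' k"
    using sobolev_rep_unique[OF assms w'(1)] by auto
  then show "r = L2_norm lborel (\<lambda>k. wt k *\<^sub>R w k)"
    using L nn2_cong_AE[where M=lborel and f="\<lambda>k. wt k *\<^sub>R w k" and g="\<lambda>k. wt k *\<^sub>R w' k"] unfolding w'(2)
    by (simp add: L2_norm_eq L2_iff)
qed

lemma sobolev_rep_diff: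
  assumes "sobolev_rep (- 1 / 2) u w" "sobolev_rep (- 1 / 2) u' w'"
  shows "sobolev_rep (- 1 / 2) (\<lambda>\<phi>. u \<phi> - u' \<phi>) (\<lambda>k. w k - w' k)"
proof -
  have w: "(\<lambda>k. of_real (wt k) * w k $ i) \<in> L2 lborel" "(\<lambda>k. of_real (wt k) * w' k $ i) \<in> L2 lborel" for i
    using assms unfolding sobolev_rep_iff by auto
  show ?thesis
    unfolding sobolev_rep_iff
  proof (intro conjI allI ballI)
    show "(\<lambda>k. of_real (wt k) * (w k - w' k) $ i) \<in> L2 lborel" for i
      using L2_diff[OF w[of i]] by (simp add: right_diff_distrib)
    fix \<phi> :: "real \<Rightarrow> complex" and i assume \<phi>: "\<phi> \<in> test_functions UNIV"
    have "integrable lborel (\<lambda>k. inv_fourier \<phi> k * w k $ i)" "integrable lborel (\<lambda>k. inv_fourier \<phi> k * w' k $ i)"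
      by (rule wt_product_integrable[OF inv_fourier_test_wt[OF \<phi>] w(1)]
          wt_product_integrable[OF inv_fourier_test_wt[OF \<phi>] w(2)])+
    then show "(u \<phi> - u' \<phi>) $ i = (LINT k|lborel. inv_fourier \<phi> k * (w k - w' k) $ i)"
      using assms \<phi> unfolding sobolev_rep_iff by (simp add: right_diff_distrib)
  qed
qed

section \<open>Partial Fourier transform and energies on half planes\<close>

lemma test_functions_nth:
  fixes F :: "'a::euclidean_space \<Rightarrow> spinor"
  assumes "F \<in> test_functions UNIV"
  shows "(\<lambda>p. F p $ i) \<in> test_functions UNIV"
proof -
  have "smooth (\<lambda>p. F p $ i)"
    by (rule smooth_linear[OF bounded_linear_vec_nth test_functions_smooth[OF assms]])
  moreover have "bounded {p. F p $ i \<noteq> 0}"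
    by (rule bounded_subset[OF test_functions_bounded_support[OF assms]]) auto
  ultimately show ?thesis by (simp add: test_functions_UNIV_iff)
qed

lemma partial_nth:
  fixes F :: "real \<times> real \<Rightarrow> spinor"
  assumes "smooth F"
  shows "partial_x F p $ i = partial_x (\<lambda>p. F p $ i) p" "partial_y F p $ i = partial_y (\<lambda>p. F p $ i) p"
proof -
  have "((\<lambda>p. F p $ i) has_derivative (\<lambda>h. frechet_derivative F (at p) h $ i)) (at p)"
    by (rule bounded_linear.has_derivative[OF bounded_linear_vec_nth smooth_has_derivative[OF assms]])
  then have "frechet_derivative (\<lambda>p. F p $ i) (at p) = (\<lambda>h. frechet_derivative F (at p) h $ i)"
    by (rule frechet_derivative_at[symmetric])
  then show "partial_x F p $ i = partial_x (\<lambda>p. F p $ i) p" "partial_y F p $ i = partial_y (\<lambda>p. F p $ i) p"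
    by (simp_all add: partial_x_def partial_y_def)
qed

lemma test_functions_partial:
  assumes "f \<in> test_functions \<Omega>"
  shows "partial_x f \<in> test_functions \<Omega>" "partial_y f \<in> test_functions \<Omega>"
  using test_functions_frechet_derivative[OF assms, of "(1, 0)"] test_functions_frechet_derivative[OF assms, of "(0, 1)"]
  by (simp_all add: partial_x_def[abs_def] partial_y_def[abs_def])

lemma slice_has_derivative:
  assumes "smooth f"
  shows "((\<lambda>y. f (x, y)) has_vector_derivative partial_y f (x, y)) (at y)"
    and "((\<lambda>x. f (x, y)) has_vector_derivative partial_x f (x, y)) (at x)"
proof -
  let ?D = "frechet_derivative f (at (x, y))"
  have D: "(f has_derivative ?D) (at (x, y))" by (rule smooth_has_derivative[OF assms])
  note lin = has_derivative_linear[OF D]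
  have "((\<lambda>y. (x, y)) has_derivative (\<lambda>h. (0, h))) (at y)"
    by (intro has_derivative_Pair has_derivative_const has_derivative_ident)
  from has_derivative_compose[OF this, of f ?D] D
  have "((\<lambda>y. f (x, y)) has_derivative (\<lambda>h. ?D (0, h))) (at y)" by simp
  moreover have e: "(\<lambda>h. ?D (0, h)) = (\<lambda>h. h *\<^sub>R ?D (0, 1))"
  proof
    fix h :: real
    show "?D (0, h) = h *\<^sub>R ?D (0, 1)" using linear_scale[OF lin, of h "(0, 1)"] by simp
  qed
  ultimately show "((\<lambda>y. f (x, y)) has_vector_derivative partial_y f (x, y)) (at y)"
    unfolding has_vector_derivative_def partial_y_def by (simp only: e)
  have "((\<lambda>x. (x, y)) has_derivative (\<lambda>h. (h, 0))) (at x)"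
    by (intro has_derivative_Pair has_derivative_const has_derivative_ident)
  from has_derivative_compose[OF this, of f ?D] D
  have "((\<lambda>x. f (x, y)) has_derivative (\<lambda>h. ?D (h, 0))) (at x)" by simp
  moreover have e: "(\<lambda>h. ?D (h, 0)) = (\<lambda>h. h *\<^sub>R ?D (1, 0))"
  proof
    fix h :: real
    show "?D (h, 0) = h *\<^sub>R ?D (1, 0)" using linear_scale[OF lin, of h "(1, 0)"] by simp
  qed
  ultimately show "((\<lambda>x. f (x, y)) has_vector_derivative partial_x f (x, y)) (at x)"
    unfolding has_vector_derivative_def partial_x_def by (simp only: e)
qed

lemma slice_test:
  assumes "f \<in> test_functions UNIV"
  shows "(\<lambda>y. f (x, y)) \<in> test_functions UNIV" "ddx (\<lambda>y. f (x, y)) = (\<lambda>y. partial_y f (x, y))"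
proof -
  have L: "bounded_linear (\<lambda>y::real. (0::real, y))"
    by (rule bounded_linear_Pair[OF bounded_linear_zero bounded_linear_ident])
  have sm: "smooth (\<lambda>y. f (x, y))"
    using smooth_compose_affine[OF L test_functions_smooth[OF assms], of "(x, 0)"] by simp
  obtain M where M: "\<And>p. f p \<noteq> 0 \<Longrightarrow> norm p \<le> M"
    using test_functions_bounded_support[OF assms] by (auto simp: bounded_iff)
  have "bounded {y. f (x, y) \<noteq> 0}"
  proof (rule boundedI[where B=M])
    fix y assume "y \<in> {y. f (x, y) \<noteq> 0}"
    then have "norm (x, y) \<le> M" using M by simp
    then show "norm y \<le> M" using norm_snd_le[of y x] by linarith
  qed
  then show "(\<lambda>y. f (x, y)) \<in> test_functions UNIV" using sm by (simp add: test_functions_UNIV_iff)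
  show "ddx (\<lambda>y. f (x, y)) = (\<lambda>y. partial_y f (x, y))"
    by (rule ext) (rule vector_derivative_unique_at[OF ddx_has_vector_derivative[OF sm]
        slice_has_derivative(1)[OF test_functions_smooth[OF assms]]])
qed

text \<open>The Fourier transform in y on the vertical line of abscissa x. Reflecting the frequency
  turns the inverse transform into the direct one, so that the y-derivative becomes multiplication
  by i k.\<close>

definition fhat :: "(real \<times> real \<Rightarrow> complex) \<Rightarrow> real \<Rightarrow> real \<Rightarrow> complex" where
  "fhat f x k = inv_fourier (\<lambda>y. f (x, y)) (- k)"

lemma fhat_partial_y:
  assumes "f \<in> test_functions UNIV"
  shows "fhat (partial_y f) x k = \<i> * of_real k * fhat f x k"
  using inv_fourier_ddx[OF slice_test(1)[OF assms], of x "- k"] slice_test(2)[OF assms, of x]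
  by (simp add: fhat_def)

lemma fhat_add:
  "f \<in> test_functions UNIV \<Longrightarrow> g \<in> test_functions UNIV \<Longrightarrow> fhat (\<lambda>p. f p + g p) x k = fhat f x k + fhat g x k"
  unfolding fhat_def by (intro inv_fourier_add test_functions_integrable[OF slice_test(1)])

lemma fhat_cmult: "fhat (\<lambda>p. c * f p) x k = c * fhat f x k"
  unfolding fhat_def by (rule inv_fourier_cmult)

lemma fhat_measurable [measurable]:
  assumes [measurable]: "f \<in> borel_measurable borel"
  shows "(\<lambda>(x, k). fhat f x k) \<in> borel_measurable (borel \<Otimes>\<^sub>M borel)"
proof -
  have [measurable]: "f \<in> borel_measurable (lborel \<Otimes>\<^sub>M lborel)"
    unfolding lborel_prod by simp
  have "(\<lambda>q. LINT y|lborel. exp (\<i> * of_real (- snd q) * of_real y) * f (fst q, y)) \<in> borel_measurable (lborel \<Otimes>\<^sub>M lborel)"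
    by (rule lborel.borel_measurable_lebesgue_integral) (simp add: split_beta', measurable)
  then have "(\<lambda>q. fhat f (fst q) (snd q)) \<in> borel_measurable (lborel \<Otimes>\<^sub>M lborel)"
    unfolding fhat_def inv_fourier_def by measurable
  then show ?thesis by (simp add: split_beta' cong: measurable_cong_sets)
qed

lemma fhat_plancherel:
  assumes "f \<in> test_functions UNIV"
  shows "nn2 lborel (fhat f x) = nn2 lborel (\<lambda>y. f (x, y))"
proof -
  note s = slice_test(1)[OF assms, of x]
  have [measurable]: "(\<lambda>y. f (x, y)) \<in> borel_measurable borel" by (rule test_functions_measurable[OF s])
  have "nn2 lborel (fhat f x) = nn2 lborel (inv_fourier (\<lambda>y. f (x, y)))"
    unfolding fhat_def[abs_def] by (rule nn2_reflect) measurable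
  then show ?thesis using plancherel_test[OF s] by simp
qed

lemma fhat_outside:
  assumes "\<And>p. f p \<noteq> 0 \<Longrightarrow> norm p \<le> M" "\<bar>x\<bar> > M"
  shows "fhat f x k = 0"
proof -
  have "f (x, y) = 0" for y
    using assms(1)[of "(x, y)"] assms(2) norm_fst_le[of x y] by fastforce
  then show ?thesis by (simp add: fhat_def inv_fourier_def)
qed

text \<open>Leibniz' rule on a compact interval: \<open>?N\<close> bounds the supports of both
  \<open>f\<close> and its x-derivative, so one and the same interval represents both transforms for
  all x.\<close>

lemma fhat_has_vector_derivative:
  assumes f: "f \<in> test_functions UNIV"
  shows "((\<lambda>x. fhat f x k) has_vector_derivative fhat (partial_x f) x k) (at x)"
proof -
  obtain M where M: "M > 0" "\<And>p. f p \<noteq> 0 \<Longrightarrow> norm p \<le> M"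
    using test_functions_bounded_support[OF f] by (auto simp: bounded_pos)
  obtain M' where M': "M' > 0" "\<And>p. partial_x f p \<noteq> 0 \<Longrightarrow> norm p \<le> M'"
    using test_functions_bounded_support[OF test_functions_partial(1)[OF f]] by (auto simp: bounded_pos)
  let ?N = "max M M'" and ?e = "\<lambda>y. exp (\<i> * of_real (- k) * complex_of_real y)"
  have eq: "fhat g x k = of_real (1 / sqrt (2 * pi)) * integral (cbox (- ?N) ?N) (\<lambda>y. ?e y * g (x, y))"
    if "g \<in> test_functions UNIV" "\<And>p. g p \<noteq> 0 \<Longrightarrow> norm p \<le> ?N" for g x
  proof -
    have z: "g (x, y) = 0" if "y \<notin> {- ?N..?N}" for y
    proof (rule ccontr)
      assume "g (x, y) \<noteq> 0"
      from \<open>\<And>p. g p \<noteq> 0 \<Longrightarrow> norm p \<le> ?N\<close>[OF this] have "\<bar>y\<bar> \<le> ?N" using norm_snd_le[of y x] by simp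
      with that show False by (auto simp: abs_le_iff)
    qed
    have "integrable lborel (\<lambda>y. ?e y * g (x, y))"
      by (rule inv_fourier_integrable_integrand[OF test_functions_integrable[OF slice_test(1)[OF that(1)]]])
    then have si: "set_integrable lborel {- ?N..?N} (\<lambda>y. ?e y * g (x, y))"
      unfolding set_integrable_def by (intro integrable_mult_indicator) auto
    have "(LINT y|lborel. ?e y * g (x, y)) = (LINT y:{- ?N..?N}|lborel. ?e y * g (x, y))"
      unfolding set_lebesgue_integral_def using z
      by (intro Bochner_Integration.integral_cong refl) (auto simp: indicator_def)
    also have "\<dots> = integral {- ?N..?N} (\<lambda>y. ?e y * g (x, y))" by (rule set_borel_integral_eq_integral(2)[OF si])
    finally show ?thesis by (simp add: fhat_def inv_fourier_def)
  qed
  have cf: "continuous_on S (\<lambda>q. g (fst q, snd q))" if "g \<in> test_functions UNIV" for g :: "real \<times> real \<Rightarrow> complex" and S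
    using test_functions_continuous[OF that] by simp
  have "((\<lambda>x. integral (cbox (- ?N) ?N) (\<lambda>y. ?e y * f (x, y))) has_vector_derivative
      integral (cbox (- ?N) ?N) (\<lambda>y. ?e y * partial_x f (x, y))) (at x within UNIV)"
  proof (rule leibniz_rule_vector_derivative)
    fix x t
    show "((\<lambda>x. ?e t * f (x, t)) has_vector_derivative ?e t * partial_x f (x, t)) (at x within UNIV)"
      using has_vector_derivative_mult_right[OF slice_has_derivative(2)[OF test_functions_smooth[OF f]]] by auto
    show "(\<lambda>y. ?e y * f (x, y)) integrable_on cbox (- ?N) ?N"
      by (intro integrable_continuous continuous_intros test_functions_continuous[OF slice_test(1)[OF f]])
    show "continuous_on (UNIV \<times> cbox (- ?N) ?N) (\<lambda>(x, t). ?e t * partial_x f (x, t))"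
      unfolding split_beta' by (intro continuous_intros cf test_functions_partial f)
  qed auto
  then have "((\<lambda>x. integral (cbox (- ?N) ?N) (\<lambda>y. ?e y * f (x, y))) has_vector_derivative
      integral (cbox (- ?N) ?N) (\<lambda>y. ?e y * partial_x f (x, y))) (at x)" by simp
  note d = has_vector_derivative_mult_right[OF this, of "of_real (1 / sqrt (2 * pi))"]
  have "norm p \<le> ?N" if "f p \<noteq> 0" for p using M(2)[OF that] by simp
  from eq[OF f this] have 1: "fhat f x k = of_real (1 / sqrt (2 * pi))
      * integral (cbox (- ?N) ?N) (\<lambda>y. ?e y * f (x, y))" for x .
  have "norm p \<le> ?N" if "partial_x f p \<noteq> 0" for p using M'(2)[OF that] by simp
  from eq[OF test_functions_partial(1)[OF f] this] have 2: "fhat (partial_x f) x k = of_real (1 / sqrt (2 * pi))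
      * integral (cbox (- ?N) ?N) (\<lambda>y. ?e y * partial_x f (x, y))" for x .
  show ?thesis unfolding 1 2 by (rule d)
qed

definition ftrace :: "(real \<times> real \<Rightarrow> spinor) \<Rightarrow> real \<Rightarrow> spinor" where
  "ftrace F k = (\<chi> i. fhat (\<lambda>p. F p $ i) 0 k)"

text \<open>By inversion the values on the line are the inverse transform of \<open>ftrace\<close>;
  the multiplication formula then moves this transform to the test function.\<close>

lemma sobolev_rep_line_restriction:
  assumes F: "F \<in> test_functions UNIV"
  shows "sobolev_rep (- 1 / 2) (line_restriction F) (ftrace F)"
  unfolding sobolev_rep_iff
proof (intro conjI allI ballI)
  fix i
  note s = slice_test(1)[OF test_functions_nth[OF F], of 0 i]
  have h: "integrable lborel (\<lambda>k. inv_fourier (\<lambda>y. F (0, y) $ i) (- k))" "(\<lambda>k. inv_fourier (\<lambda>y. F (0, y) $ i) (- k)) \<in> L2 lborel"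
    using lborel_integrable_real_affine[OF inv_fourier_test_integrable(1)[OF s], of "-1" 0]
      L2_reflect[OF inv_fourier_test_integrable(2)[OF s]] by auto
  have "nn2 lborel (\<lambda>k. of_real (wt k) * inv_fourier (\<lambda>y. F (0, y) $ i) (- k)) \<le> nn2 lborel (\<lambda>k. inv_fourier (\<lambda>y. F (0, y) $ i) (- k))"
    using wt_le_1 wt_pos by (intro nn2_mono) (simp add: norm_mult mult_left_le_one_le less_imp_le)
  then show "(\<lambda>k. of_real (wt k) * ftrace F k $ i) \<in> L2 lborel"
    using h(2) unfolding L2_iff by (auto simp: ftrace_def fhat_def intro: le_less_trans)
  fix \<phi> :: "real \<Rightarrow> complex" assume \<phi>: "\<phi> \<in> test_functions UNIV"
  have sl: "(\<lambda>y. F (0, y) $ j) \<in> test_functions UNIV" for j by (rule slice_test(1)[OF test_functions_nth[OF F]])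
  have i: "integrable lborel (\<lambda>y. \<phi> y * F (0, y) $ j)" for j
    by (rule test_functions_integrable[OF test_functions_UNIV_mult[OF test_functions_smooth[OF \<phi>] sl]])
  have inv: "inv_fourier (\<lambda>k. inv_fourier (\<lambda>y. F (0, y) $ i) (- k)) y = F (0, y) $ i" for y
    using inv_fourier_inversion_test[OF s, of "- y"] by (simp add: inv_fourier_reflect)
  have "line_restriction F \<phi> $ i = (LINT y|lborel. \<phi> y * F (0, y) $ i)"
    unfolding line_restriction_def using i by (subst spinor_integral_nth) (auto simp: spinor_integrable_iff)
  also have "\<dots> = (LINT k|lborel. inv_fourier \<phi> k * inv_fourier (\<lambda>y. F (0, y) $ i) (- k))"
    using inv_fourier_parseval[OF test_functions_integrable[OF \<phi>] h(1)] by (simp add: inv)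
  finally show "line_restriction F \<phi> $ i = (LINT k|lborel. inv_fourier \<phi> k * ftrace F k $ i)"
    by (simp add: ftrace_def fhat_def)
qed

text \<open>One sign parameter covers both half planes: s = 1 gives \<open>Omega_plus\<close> and s
  = -1 gives \<open>Omega_minus\<close>.\<close>

definition half :: "real \<Rightarrow> (real \<times> real) set" where "half s = {p. 0 < s * fst p}"

lemma half_measurable [measurable]: "half s \<in> sets borel"
  unfolding half_def by (intro borel_open open_Collect_less continuous_intros)

lemma nn2_half:
  assumes [measurable]: "f \<in> borel_measurable borel"
  shows "nn2 (lborel_on (half s)) f
    = (\<integral>\<^sup>+x. indicator {x. 0 < s * x} x * nn2 lborel (\<lambda>y. f (x, y)) \<partial>lborel)"
proof -
  have [measurable]: "f \<in> borel_measurable (lborel \<Otimes>\<^sub>M lborel)" unfolding lborel_prod by simp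
  have "nn2 (lborel_on (half s)) f = (\<integral>\<^sup>+p. ennreal ((norm (f p))\<^sup>2) * indicator (half s) p \<partial>lborel)"
    unfolding nn2_def by (rule nn_integral_restrict_space) simp
  also have "\<dots> = (\<integral>\<^sup>+p. ennreal ((norm (f p))\<^sup>2) * indicator {x. 0 < s * x} (fst p) \<partial>(lborel \<Otimes>\<^sub>M lborel))"
    by (simp add: lborel_prod half_def indicator_def)
  also have "\<dots> = (\<integral>\<^sup>+x. \<integral>\<^sup>+y. ennreal ((norm (f (x, y)))\<^sup>2) * indicator {x. 0 < s * x} x \<partial>lborel \<partial>lborel)"
    by (subst lborel.nn_integral_fst[symmetric]) simp_all
  also have "\<dots> = (\<integral>\<^sup>+x. indicator {x. 0 < s * x} x * nn2 lborel (\<lambda>y. f (x, y)) \<partial>lborel)"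
    unfolding nn2_def by (intro nn_integral_cong) (subst nn_integral_multc; simp add: mult.commute)
  finally show ?thesis .
qed

text \<open>Plancherel on each vertical line, then Tonelli to bring the frequency outside: the norm
  on a half plane splits into energies of one-dimensional problems.\<close>

lemma nn2_half_fhat:
  assumes f: "f \<in> test_functions UNIV"
  shows "nn2 (lborel_on (half s)) f
    = (\<integral>\<^sup>+k. (\<integral>\<^sup>+x. indicator {x. 0 < s * x} x * ennreal ((cmod (fhat f x k))\<^sup>2) \<partial>lborel) \<partial>lborel)"
proof -
  have [measurable]: "f \<in> borel_measurable borel" by (rule test_functions_measurable[OF f])
  have "nn2 (lborel_on (half s)) f = (\<integral>\<^sup>+x. indicator {x. 0 < s * x} x * nn2 lborel (fhat f x) \<partial>lborel)"
    by (simp add: nn2_half fhat_plancherel[OF f])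
  also have "\<dots> = (\<integral>\<^sup>+x. (\<integral>\<^sup>+k. indicator {x. 0 < s * x} x * ennreal ((cmod (fhat f x k))\<^sup>2) \<partial>lborel) \<partial>lborel)"
    unfolding nn2_def by (intro nn_integral_cong nn_integral_cmult[symmetric]) measurable
  also have "\<dots> = (\<integral>\<^sup>+k. (\<integral>\<^sup>+x. indicator {x. 0 < s * x} x * ennreal ((cmod (fhat f x k))\<^sup>2) \<partial>lborel) \<partial>lborel)"
    by (rule lborel_pair.Fubini'[symmetric]) (simp add: split_beta', measurable)
  finally show ?thesis .
qed

text \<open>The only boundary term sits at 0. It is the lower end of the half line for s = 1 and the
  upper end for s = -1, whence the sign.\<close>

lemma integral_half_derivative:
  fixes g :: "real \<Rightarrow> real"
  assumes s: "s = 1 \<or> s = -1" and d: "\<And>x. (g has_real_derivative g' x) (at x)"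
    and c: "continuous_on UNIV g'" and M: "M > 0" and z: "\<And>x. \<bar>x\<bar> \<ge> M \<Longrightarrow> g x = 0"
    and z': "\<And>x. \<bar>x\<bar> \<ge> M \<Longrightarrow> g' x = 0"
  shows "(LINT x|lborel. indicator {x. 0 < s * x} x * g' x) = - s * g 0"
proof -
  have dv: "(g has_vector_derivative g' x) (at x within S)" for x S
    using d has_real_derivative_iff_has_vector_derivative has_vector_derivative_at_within by blast
  have ne: "AE x in lborel. x \<noteq> (0::real)" by (rule AE_lborel_singleton)
  have pos: "(LINT x|lborel. indicator {x. 0 < x} x * g' x) = - g 0"
  proof -
    have "(LINT x|lborel. indicator {x. 0 < x} x * g' x) = (LINT x|lborel. indicator {0..M} x *\<^sub>R g' x)"
    proof (rule integral_cong_AE)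
      show "AE x in lborel. indicator {x. 0 < x} x * g' x = indicator {0..M} x *\<^sub>R g' x"
        using ne by eventually_elim (use z' in \<open>auto simp: indicator_def\<close>)
    qed (use borel_measurable_continuous_onI[OF c] in measurable)
    also have "\<dots> = g M - g 0"
      using M by (intro integral_FTC_Icc dv continuous_on_subset[OF c]) auto
    finally show ?thesis using z[of M] M by simp
  qed
  have neg: "(LINT x|lborel. indicator {x. x < 0} x * g' x) = g 0"
  proof -
    have "(LINT x|lborel. indicator {x. x < 0} x * g' x) = (LINT x|lborel. indicator {-M..0} x *\<^sub>R g' x)"
    proof (rule integral_cong_AE)
      show "AE x in lborel. indicator {x. x < 0} x * g' x = indicator {-M..0} x *\<^sub>R g' x"
        using ne by eventually_elim (use z' in \<open>auto simp: indicator_def\<close>)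
    qed (use borel_measurable_continuous_onI[OF c] in measurable)
    also have "\<dots> = g 0 - g (- M)"
      using M by (intro integral_FTC_Icc dv continuous_on_subset[OF c]) auto
    finally show ?thesis using z[of "-M"] M by simp
  qed
  from s show ?thesis using pos neg by auto
qed

text \<open>Energy estimates for $u' = -\delta a u + \rho$ on the half line $\{s x > 0\}$: the solution of the
  homogeneous equation decays there if $\delta = s$ and grows if $\delta = -s$. In the latter case the
  boundary value is controlled by the source.\<close>

lemma half_line_energy:
  fixes u \<rho> :: "real \<Rightarrow> complex"
  assumes s: "s = 1 \<or> s = -1" and a: "a > 0"
    and du: "\<And>x. (u has_vector_derivative (- of_real (\<delta> * a) * u x + \<rho> x)) (at x)"
    and c: "continuous_on UNIV \<rho>" and M: "M > 0" and z: "\<And>x. \<bar>x\<bar> \<ge> M \<Longrightarrow> u x = 0"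
    and z': "\<And>x. \<bar>x\<bar> \<ge> M \<Longrightarrow> \<rho> x = 0"
  defines "I \<equiv> \<lambda>f::real \<Rightarrow> complex. \<integral>\<^sup>+x. indicator {x. 0 < s * x} x * ennreal ((cmod (f x))\<^sup>2) \<partial>lborel"
  shows "\<delta> = s \<Longrightarrow> I u \<le> ennreal (1 / a) * ennreal ((cmod (u 0))\<^sup>2) + ennreal (1 / a\<^sup>2) * I \<rho>"
    and "\<delta> = - s \<Longrightarrow> I u \<le> ennreal (1 / a\<^sup>2) * I \<rho>"
    and "\<delta> = - s \<Longrightarrow> ennreal ((cmod (u 0))\<^sup>2) \<le> ennreal (1 / a) * I \<rho>"
proof -
  define H where "H = {x. 0 < s * x}"
  have H[measurable]: "H \<in> sets borel" unfolding H_def by (intro borel_open open_Collect_less continuous_intros)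
  have cu: "continuous_on UNIV u"
    using du by (intro continuous_at_imp_continuous_on ballI has_vector_derivative_continuous) auto
  have bdd: "bounded {x. f x \<noteq> 0}" if "\<And>x. \<bar>x\<bar> \<ge> M \<Longrightarrow> f x = 0" for f :: "real \<Rightarrow> 'z::zero"
  proof (rule boundedI[where B=M])
    show "norm x \<le> M" if "x \<in> {x. f x \<noteq> 0}" for x
      using \<open>\<And>x. \<bar>x\<bar> \<ge> M \<Longrightarrow> f x = 0\<close>[of x] that by (cases "M \<le> \<bar>x\<bar>") auto
  qed
  have int: "integrable lborel (\<lambda>x. indicator H x * f x)"
    if "continuous_on UNIV f" "\<And>x. \<bar>x\<bar> \<ge> M \<Longrightarrow> f x = 0" for f :: "real \<Rightarrow> real"
    using integrable_mult_indicator[OF _ integrable_compact_support[OF that(1) bdd[OF that(2)]], of H] H by simp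
  define A where "A = (LINT x|lborel. indicator H x * (cmod (u x))\<^sup>2)"
  define B where "B = (LINT x|lborel. indicator H x * (cmod (\<rho> x))\<^sup>2)"
  define X where "X = (LINT x|lborel. indicator H x * Re (cnj (u x) * \<rho> x))"
  have iA: "integrable lborel (\<lambda>x. indicator H x * (cmod (u x))\<^sup>2)"
    by (rule int) (auto intro!: continuous_intros cu z)
  have iB: "integrable lborel (\<lambda>x. indicator H x * (cmod (\<rho> x))\<^sup>2)"
    by (rule int) (auto intro!: continuous_intros c z')
  have iX: "integrable lborel (\<lambda>x. indicator H x * Re (cnj (u x) * \<rho> x))"
    by (rule int) (auto intro!: continuous_intros c cu simp: z')
  have eA: "I u = ennreal A" and eB: "I \<rho> = ennreal B"
    unfolding I_def A_def B_def H_def[symmetric] using iA iB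
    by (subst nn_integral_eq_integral[symmetric]; auto simp: ennreal_mult ennreal_indicator intro!: nn_integral_cong)+
  have A0: "A \<ge> 0" and B0: "B \<ge> 0" unfolding A_def B_def by (auto intro!: integral_nonneg_AE)
  have d: "((\<lambda>x. (cmod (u x))\<^sup>2) has_real_derivative (- 2 * \<delta> * a * (cmod (u x))\<^sup>2 + 2 * Re (cnj (u x) * \<rho> x))) (at x)" for x
  proof -
    let ?u' = "- of_real (\<delta> * a) * u x + \<rho> x"
    have 1: "((\<lambda>x. Re (u x)) has_real_derivative Re ?u') (at x)" "((\<lambda>x. Im (u x)) has_real_derivative Im ?u') (at x)"
      using bounded_linear.has_vector_derivative[OF bounded_linear_Re du]
        bounded_linear.has_vector_derivative[OF bounded_linear_Im du]
      by (auto simp: has_real_derivative_iff_has_vector_derivative)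
    from DERIV_add[OF DERIV_power[OF 1(1), of 2] DERIV_power[OF 1(2), of 2]]
    show ?thesis
      unfolding cmod_power2 by (rule DERIV_cong) (simp add: algebra_simps power2_eq_square)
  qed
  \<comment> \<open>Integrating the derivative of |u|^2 over the half line gives the balance
    \<open>key\<close> between the boundary value, the energy and the work of the source.\<close>
  have "(LINT x|lborel. indicator H x * (- 2 * \<delta> * a * (cmod (u x))\<^sup>2 + 2 * Re (cnj (u x) * \<rho> x))) = - s * (cmod (u 0))\<^sup>2"
    unfolding H_def
    by (rule integral_half_derivative[OF s d _ M]) (auto intro!: continuous_intros c cu simp: z z')
  moreover have "(LINT x|lborel. indicator H x * (- 2 * \<delta> * a * (cmod (u x))\<^sup>2 + 2 * Re (cnj (u x) * \<rho> x)))
    = (LINT x|lborel. (- 2 * \<delta> * a) * (indicator H x * (cmod (u x))\<^sup>2) + 2 * (indicator H x * Re (cnj (u x) * \<rho> x)))"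
    by (intro Bochner_Integration.integral_cong refl) (simp add: algebra_simps)
  moreover have "\<dots> = (- 2 * \<delta> * a) * A + 2 * X"
    unfolding A_def X_def using iA iX
    by (subst Bochner_Integration.integral_add) (auto simp del: Re_complex_of_real times_complex.sel)
  ultimately have key: "s * (cmod (u 0))\<^sup>2 = 2 * \<delta> * a * A - 2 * X" by linarith
  \<comment> \<open>Young's inequality with weight \<open>a\<close>: the source term absorbs at most
    one half of the 2 a A in the balance, whichever its sign.\<close>
  have "2 * \<bar>X\<bar> \<le> a * A + (1 / a) * B"
  proof -
    have "\<bar>X\<bar> \<le> (LINT x|lborel. \<bar>indicator H x * Re (cnj (u x) * \<rho> x)\<bar>)"
      unfolding X_def using integral_norm_bound[of lborel "\<lambda>x. indicator H x * Re (cnj (u x) * \<rho> x)"] by simp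
    also have "\<dots> \<le> (LINT x|lborel. (a / 2) * (indicator H x * (cmod (u x))\<^sup>2) + (1 / (2 * a)) * (indicator H x * (cmod (\<rho> x))\<^sup>2))"
    proof (rule integral_mono)
      fix x
      have "\<bar>Re (cnj (u x) * \<rho> x)\<bar> \<le> cmod (u x) * cmod (\<rho> x)"
        using abs_Re_le_cmod[of "cnj (u x) * \<rho> x"] by (simp only: norm_mult complex_mod_cnj)
      also have "\<dots> \<le> (a / 2) * (cmod (u x))\<^sup>2 + (1 / (2 * a)) * (cmod (\<rho> x))\<^sup>2"
      proof -
        have "0 \<le> (a * cmod (u x) - cmod (\<rho> x))\<^sup>2 / (2 * a)" using a by simp
        also have "\<dots> = (a / 2) * (cmod (u x))\<^sup>2 + (1 / (2 * a)) * (cmod (\<rho> x))\<^sup>2 - cmod (u x) * cmod (\<rho> x)"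
          using a by (simp add: power2_eq_square field_simps)
        finally show ?thesis by simp
      qed
      finally show "\<bar>indicator H x * Re (cnj (u x) * \<rho> x)\<bar>
        \<le> (a / 2) * (indicator H x * (cmod (u x))\<^sup>2) + (1 / (2 * a)) * (indicator H x * (cmod (\<rho> x))\<^sup>2)"
        by (cases "x \<in> H") auto
    qed (intro integrable_abs iX Bochner_Integration.integrable_add integrable_mult_right iA iB)+
    also have "\<dots> = (a / 2) * A + (1 / (2 * a)) * B"
      unfolding A_def B_def using iA iB by (subst Bochner_Integration.integral_add) auto
    finally show ?thesis using a by (simp add: field_simps)
  qed
  then have X: "2 * X \<le> a * A + (1 / a) * B" "- (2 * X) \<le> a * A + (1 / a) * B" by linarith+
  have good: "A \<le> (1 / a) * (cmod (u 0))\<^sup>2 + (1 / a\<^sup>2) * B" if "\<delta> = s"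
  proof -
    have "2 * a * A = (cmod (u 0))\<^sup>2 + 2 * (s * X)"
      using s key that by (elim disjE) (simp_all add: mult.assoc)
    moreover have "2 * (s * X) \<le> a * A + (1 / a) * B" using s X by auto
    ultimately have "a * A \<le> (cmod (u 0))\<^sup>2 + (1 / a) * B" by linarith
    then have "(1 / a) * (a * A) \<le> (1 / a) * ((cmod (u 0))\<^sup>2 + (1 / a) * B)" using a by (intro mult_left_mono) auto
    then show ?thesis using a by (simp add: power2_eq_square field_simps)
  qed
  \<comment> \<open>For the growing sign the boundary value and the energy stand on the same side of
    the balance, so the source controls both at once.\<close>
  have bad: "a * A + (cmod (u 0))\<^sup>2 \<le> (1 / a) * B" if "\<delta> = - s"
  proof -
    have "(cmod (u 0))\<^sup>2 = - 2 * a * A - 2 * (s * X)"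
      using s key that by (elim disjE) (simp_all add: mult.assoc)
    moreover have "- (2 * (s * X)) \<le> a * A + (1 / a) * B" using s X by auto
    ultimately show ?thesis by linarith
  qed
  have aA: "a * A \<ge> 0" using a A0 by simp
  show "I u \<le> ennreal (1 / a) * ennreal ((cmod (u 0))\<^sup>2) + ennreal (1 / a\<^sup>2) * I \<rho>" if "\<delta> = s"
    using good[OF that] a A0 B0 unfolding eA eB by (simp add: ennreal_leI flip: ennreal_mult ennreal_plus)
  show "I u \<le> ennreal (1 / a\<^sup>2) * I \<rho>" if "\<delta> = - s"
  proof -
    have "a * A \<le> (1 / a) * B" using bad[OF that] by (smt (verit) zero_le_power2)
    then have "A \<le> (1 / a\<^sup>2) * B" using a by (simp add: power2_eq_square field_simps)
    then show ?thesis using a B0 unfolding eA eB by (simp add: ennreal_leI flip: ennreal_mult)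
  qed
  show "ennreal ((cmod (u 0))\<^sup>2) \<le> ennreal (1 / a) * I \<rho>" if "\<delta> = - s"
    using bad[OF that] aA a B0 unfolding eB by (simp add: ennreal_leI flip: ennreal_mult)
qed

section \<open>A priori estimates for the eigenvalue equation\<close>

lemma pauli_components:
  "(pauli1 *v w) $ 1 = w $ 2" "(pauli1 *v w) $ 2 = w $ 1"
  "(pauli2 *v w) $ 1 = - \<i> * w $ 2" "(pauli2 *v w) $ 2 = \<i> * w $ 1"
  "(pauli3 *v w) $ 1 = w $ 1" "(pauli3 *v w) $ 2 = - w $ 2"
  by (simp_all add: pauli1_def pauli2_def pauli3_def matrix_vector_mult_def sum_2 vector_2)

lemma test_functions_UNIV_cmult: "f \<in> test_functions UNIV \<Longrightarrow> (\<lambda>p. c * f p) \<in> test_functions UNIV"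
  for f :: "'a::euclidean_space \<Rightarrow> complex"
  by (rule test_functions_UNIV_mult[OF smooth_const])

locale shell =
  fixes m \<eta> \<tau> :: real
  assumes m_pos: "m > 0" and shell_eq: "\<eta>\<^sup>2 - \<tau>\<^sup>2 = 4"
begin

text \<open>The square roots that symmetrize the symbol at \<open>zs\<close>: zs + m = m s1^2, zs -
  m = -m s2^2, and \<open>mu\<close> is m s1 s2, the positive root of m^2 - zs^2.\<close>

definition s1 :: real where "s1 = sqrt (1 - \<tau> / \<eta>)"
definition s2 :: real where "s2 = sqrt (1 + \<tau> / \<eta>)"
definition mu :: real where "mu = 2 * m / \<bar>\<eta>\<bar>"
definition zs :: real where "zs = - (\<tau> / \<eta>) * m"
abbreviation kap :: "real \<Rightarrow> real" where "kap \<equiv> kappa m \<eta>"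

section \<open>Consequences of the shell condition\<close>

lemma eta_nonzero: "\<eta> \<noteq> 0"
proof
  assume "\<eta> = 0"
  then show False using shell_eq zero_le_power2[of \<tau>] by simp
qed

lemma quotient_squared: "1 - (\<tau> / \<eta>)\<^sup>2 = 4 / \<eta>\<^sup>2"
proof -
  have "1 - (\<tau> / \<eta>)\<^sup>2 = (\<eta>\<^sup>2 - \<tau>\<^sup>2) / \<eta>\<^sup>2"
    using eta_nonzero by (simp add: diff_divide_distrib power_divide)
  then show ?thesis by (simp only: shell_eq)
qed

lemma quotient_bounds: "\<tau> / \<eta> < 1" "- 1 < \<tau> / \<eta>"
proof -
  have "4 / \<eta>\<^sup>2 > 0" using eta_nonzero by simp
  then have "(\<tau> / \<eta>)\<^sup>2 < 1" using quotient_squared by linarith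
  then have "\<bar>\<tau> / \<eta>\<bar> < 1" by (simp only: abs_square_less_1)
  then show "\<tau> / \<eta> < 1" "- 1 < \<tau> / \<eta>" by linarith+
qed

lemma s_pos: "s1 > 0" "s2 > 0" and s_squared: "s1\<^sup>2 = 1 - \<tau> / \<eta>" "s2\<^sup>2 = 1 + \<tau> / \<eta>"
  using quotient_bounds by (auto simp: s1_def s2_def)

lemma s_prod: "s1 * s2 = 2 / \<bar>\<eta>\<bar>"
proof -
  have "s1 * s2 = sqrt ((1 - \<tau> / \<eta>) * (1 + \<tau> / \<eta>))" by (simp only: s1_def s2_def real_sqrt_mult)
  also have "(1 - \<tau> / \<eta>) * (1 + \<tau> / \<eta>) = (2 / \<bar>\<eta>\<bar>)\<^sup>2"
    using quotient_squared by (simp add: power2_eq_square algebra_simps)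
  finally show ?thesis by simp
qed

lemma mu_eq: "mu = m * s1 * s2" using s_prod by (simp add: mu_def mult.assoc)
lemma mu_pos: "mu > 0" using m_pos eta_nonzero by (simp add: mu_def)
lemma zs_plus: "zs + m = m * s1\<^sup>2" and zs_minus: "zs - m = - (m * s2\<^sup>2)"
  by (simp_all add: zs_def s_squared algebra_simps)

lemma kap_eq: "kap k = sqrt (k\<^sup>2 + mu\<^sup>2)"
  by (simp add: kappa_def mu_def power_divide power_mult_distrib)

lemma kap_squared: "(kap k)\<^sup>2 = k\<^sup>2 + mu\<^sup>2" by (simp add: kap_eq)
lemma kap_pos: "kap k > 0" using mu_pos by (simp add: kap_eq add_nonneg_pos)
lemma kap_ge_mu: "kap k \<ge> mu" using mu_pos by (simp add: kap_eq real_le_rsqrt)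
lemma kap_gt: "\<bar>k\<bar> < kap k"
  unfolding kap_eq using mu_pos by (intro real_less_rsqrt) simp

lemma kap_continuous: "continuous_on S kap"
  unfolding kappa_def by (intro continuous_intros)

lemma kap_measurable [measurable]: "kap \<in> borel_measurable borel"
  by (rule borel_measurable_continuous_onI[OF kap_continuous])

text \<open>Near k = 0 the root is bounded below by \<open>mu\<close>, for large k by |k|; the
  factor \<open>min 1 mu\<close> covers both. Together with \<open>kap_wt\<close> this makes kappa
  equivalent to the inverse square of the weight of H^(-1/2).\<close>

lemma inverse_kap_le: "1 / kap k \<le> 1 / min 1 mu * (wt k)\<^sup>2"
proof -
  let ?c = "min 1 mu"
  have c: "?c > 0" using mu_pos by simp
  have "?c\<^sup>2 \<le> 1" "?c\<^sup>2 \<le> mu\<^sup>2" using c mu_pos by (auto intro: power_le_one power_mono)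
  then have "?c\<^sup>2 * k\<^sup>2 + ?c\<^sup>2 \<le> k\<^sup>2 + mu\<^sup>2" by (intro add_mono) (auto intro: mult_left_le_one_le)
  then have "(?c * sqrt (1 + k\<^sup>2))\<^sup>2 \<le> (kap k)\<^sup>2"
    by (simp add: kap_squared power_mult_distrib algebra_simps)
  then have le: "?c * sqrt (1 + k\<^sup>2) \<le> kap k" using kap_pos[of k] by (simp add: power2_le_iff_abs_le less_imp_le)
  have p: "sqrt (1 + k\<^sup>2) > 0" by (simp add: add_pos_nonneg)
  have "1 / kap k \<le> 1 / (?c * sqrt (1 + k\<^sup>2))"
    using le c p by (intro divide_left_mono mult_pos_pos kap_pos) auto
  then show ?thesis by (simp add: wt_squared)
qed

text \<open>The entries of the eigenvectors of the symbol. The squares of \<open>pm 1 k\<close> and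
  \<open>pm (- 1) k\<close> add up to 2 kappa and their product is the constant \<open>mu\<close>;
  up to scaling they play the part of cosine and sine.\<close>

definition pm :: "real \<Rightarrow> real \<Rightarrow> real" where "pm d k = sqrt (kap k - d * k)"

lemma pm_squared: "\<bar>d\<bar> = 1 \<Longrightarrow> (pm d k)\<^sup>2 = kap k - d * k"
  and pm_pos: "\<bar>d\<bar> = 1 \<Longrightarrow> pm d k > 0"
proof -
  assume "\<bar>d\<bar> = 1"
  then have "d = 1 \<or> d = -1" by auto
  then have "kap k - d * k > 0" using kap_gt[of k] by (auto simp: abs_less_iff)
  then show "(pm d k)\<^sup>2 = kap k - d * k" "pm d k > 0" by (simp_all add: pm_def)
qed

lemma pm_prod: "\<bar>d\<bar> = 1 \<Longrightarrow> pm d k * pm (- d) k = mu"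
proof -
  assume d: "\<bar>d\<bar> = 1"
  then have "d * d = 1" by (metis abs_mult_self_eq mult_1)
  have "(pm d k * pm (- d) k)\<^sup>2 = (kap k)\<^sup>2 - (d * d) * k\<^sup>2"
    using d by (simp add: power_mult_distrib pm_squared) (simp add: power2_eq_square algebra_simps)
  also have "\<dots> = mu\<^sup>2" using \<open>d * d = 1\<close> by (simp add: kap_squared)
  finally have "(pm d k * pm (- d) k)\<^sup>2 = mu\<^sup>2" .
  moreover have "pm d k * pm (- d) k \<ge> 0" using pm_pos[of d k] pm_pos[of "- d" k] d by simp
  ultimately show ?thesis using mu_pos by (simp add: power2_eq_iff_nonneg)
qed

lemma pm_continuous: "continuous_on S (pm d)"
  unfolding pm_def by (intro continuous_intros kap_continuous)

lemma pm_measurable [measurable]: "pm d \<in> borel_measurable borel"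
  by (rule borel_measurable_continuous_onI[OF pm_continuous])

text \<open>After the rescaling by \<^term>\<open>s1\<close> and \<^term>\<open>s2\<close> the symbol of the equation is Hermitian; \<open>mode d k v\<close> is, up to
  normalization, the component of $v$ along its eigenvector for the eigenvalue $-d\kappa$.\<close>

definition mode :: "real \<Rightarrow> real \<Rightarrow> spinor \<Rightarrow> complex" where
  "mode d k v = of_real (pm d k / s1) * v $ 1 - \<i> * of_real (d * pm (- d) k / s2) * v $ 2"

text \<open>The eigenvector in the original components, with the rescaling undone:
  \<open>mode (- d)\<close> vanishes on it and \<open>mode d\<close> equals 2 kappa. It is the
  direction of the mode that decays on the half plane d x > 0.\<close>

definition amp :: "real \<Rightarrow> real \<Rightarrow> spinor" where
  "amp d k = vector [of_real (s1 * pm d k), \<i> * of_real (d * s2 * pm (- d) k)]"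

text \<open>The two combinations form a matrix with orthogonal rows of equal length; it is a
  rotation up to scaling and a phase.\<close>

lemma rotation_identity:
  fixes a b :: real and X Y :: complex
  assumes "\<bar>d\<bar> = 1"
  shows "(cmod (of_real a * X - \<i> * of_real (d * b) * Y))\<^sup>2 + (cmod (of_real b * X + \<i> * of_real (d * a) * Y))\<^sup>2
    = (a\<^sup>2 + b\<^sup>2) * ((cmod X)\<^sup>2 + (cmod Y)\<^sup>2)"
proof -
  have "d = 1 \<or> d = -1" using assms by auto
  then show ?thesis
    by (elim disjE) (simp_all add: cmod_power2, simp_all add: power2_eq_square algebra_simps)
qed

lemma mode_sum:
  assumes d: "\<bar>d\<bar> = 1"
  shows "(cmod (mode d k v))\<^sup>2 + (cmod (mode (- d) k v))\<^sup>2
    = 2 * kap k * ((cmod (v $ 1))\<^sup>2 / s1\<^sup>2 + (cmod (v $ 2))\<^sup>2 / s2\<^sup>2)"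
proof -
  let ?X = "v $ 1 / of_real s1" and ?Y = "v $ 2 / of_real s2"
  have "mode d k v = of_real (pm d k) * ?X - \<i> * of_real (d * pm (- d) k) * ?Y"
    "mode (- d) k v = of_real (pm (- d) k) * ?X + \<i> * of_real (d * pm d k) * ?Y"
    by (simp_all add: mode_def)
  moreover have "(pm d k)\<^sup>2 + (pm (- d) k)\<^sup>2 = 2 * kap k" using d by (simp add: pm_squared)
  ultimately show ?thesis
    using rotation_identity[OF d, of "pm d k" ?X "pm (- d) k" ?Y] s_pos
    by (simp add: norm_divide power_divide)
qed

text \<open>The worst factor between the squared norms of a spinor after and before the
  rescaling.\<close>

definition sc :: real where "sc = max (1 / s1\<^sup>2) (1 / s2\<^sup>2)"

lemma sc_pos: "sc > 0" using s_pos by (simp add: sc_def less_max_iff_disj)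

lemma mode_sum_le:
  assumes d: "\<bar>d\<bar> = 1"
  shows "(cmod (mode d k v))\<^sup>2 + (cmod (mode (- d) k v))\<^sup>2 \<le> 2 * kap k * sc * (norm v)\<^sup>2"
proof -
  have "1 / s1\<^sup>2 * (cmod (v $ 1))\<^sup>2 + 1 / s2\<^sup>2 * (cmod (v $ 2))\<^sup>2 \<le> sc * (cmod (v $ 1))\<^sup>2 + sc * (cmod (v $ 2))\<^sup>2"
    by (intro add_mono mult_right_mono) (auto simp: sc_def)
  then have "(cmod (v $ 1))\<^sup>2 / s1\<^sup>2 + (cmod (v $ 2))\<^sup>2 / s2\<^sup>2 \<le> sc * (norm v)\<^sup>2"
    by (simp add: spinor_norm algebra_simps)
  then show ?thesis unfolding mode_sum[OF d] mult.assoc[of "2 * kap k"]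
    using kap_pos[of k] by (intro mult_left_mono) auto
qed

lemma mode_sum_ge:
  assumes d: "\<bar>d\<bar> = 1"
  shows "(norm v)\<^sup>2 \<le> 1 / kap k * ((cmod (mode d k v))\<^sup>2 + (cmod (mode (- d) k v))\<^sup>2)"
proof -
  have lt: "s1\<^sup>2 \<le> 2" "s2\<^sup>2 \<le> 2" using quotient_bounds by (auto simp: s_squared)
  have "1 / 2 * (cmod (v $ 1))\<^sup>2 + 1 / 2 * (cmod (v $ 2))\<^sup>2 \<le> 1 / s1\<^sup>2 * (cmod (v $ 1))\<^sup>2 + 1 / s2\<^sup>2 * (cmod (v $ 2))\<^sup>2"
    using s_pos lt by (intro add_mono mult_right_mono divide_left_mono) auto
  then have "(norm v)\<^sup>2 \<le> 2 * ((cmod (v $ 1))\<^sup>2 / s1\<^sup>2 + (cmod (v $ 2))\<^sup>2 / s2\<^sup>2)"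
    by (simp add: spinor_norm)
  then show ?thesis unfolding mode_sum[OF d] using kap_pos[of k] by simp
qed

text \<open>In the rescaled components the matrix of the two modes is unitary up to the factor 2
  kappa in squared length, so a vector with one mode zero is recovered from the other by the
  adjoint.\<close>

lemma mode_amp:
  assumes d: "\<bar>d\<bar> = 1" and z: "mode (- d) k v = 0"
  shows "v = (mode d k v / of_real (2 * kap k)) *s amp d k"
proof -
  let ?a = "pm d k" and ?b = "pm (- d) k"
  have dd: "d * d = 1" using d by (metis abs_mult_self_eq mult_1)
  have ab: "?a\<^sup>2 + ?b\<^sup>2 = 2 * kap k" using d by (simp add: pm_squared)
  let ?X = "v $ 1 / of_real s1" and ?Y = "v $ 2 / of_real s2"
  have u: "mode d k v = of_real ?a * ?X - \<i> * of_real (d * ?b) * ?Y"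
    by (simp add: mode_def)
  have z': "of_real ?b * ?X + \<i> * of_real (d * ?a) * ?Y = 0"
    using z by (simp add: mode_def)
  have cdd: "complex_of_real d * complex_of_real d = 1" using dd by (metis of_real_1 of_real_mult)
  have "of_real ?a * mode d k v + of_real ?b * (of_real ?b * ?X + \<i> * of_real (d * ?a) * ?Y) = of_real (?a\<^sup>2 + ?b\<^sup>2) * ?X"
    unfolding u by (simp add: power2_eq_square algebra_simps)
  then have X: "of_real (2 * kap k) * ?X = of_real ?a * mode d k v" unfolding z' ab by simp
  have "\<i> * of_real (d * ?b) * mode d k v - \<i> * of_real (d * ?a) * (of_real ?b * ?X + \<i> * of_real (d * ?a) * ?Y)
      = (of_real d * of_real d) * (of_real (?a\<^sup>2 + ?b\<^sup>2) * ?Y)"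
    unfolding u by (simp add: power2_eq_square algebra_simps)
  then have Y: "of_real (2 * kap k) * ?Y = \<i> * of_real (d * ?b) * mode d k v" unfolding z' ab cdd by simp
  have k: "complex_of_real (2 * kap k) \<noteq> 0" "complex_of_real s1 \<noteq> 0" "complex_of_real s2 \<noteq> 0"
    using kap_pos[of k] s_pos by auto
  have "?X = of_real ?a * mode d k v / of_real (2 * kap k)" using X k by (metis nonzero_mult_div_cancel_left)
  moreover have "?Y = \<i> * of_real (d * ?b) * mode d k v / of_real (2 * kap k)" using Y k by (metis nonzero_mult_div_cancel_left)
  ultimately have "v $ 1 = of_real s1 * (of_real ?a * mode d k v / of_real (2 * kap k))"
    "v $ 2 = of_real s2 * (\<i> * of_real (d * ?b) * mode d k v / of_real (2 * kap k))"
    using k by (metis nonzero_mult_div_cancel_left times_divide_eq_right)+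
  then show ?thesis by (simp add: vec_eq_iff forall_2 amp_def vector_2)
qed

lemma amp_norm: "\<bar>d\<bar> = 1 \<Longrightarrow> (norm (amp d k))\<^sup>2 = s1\<^sup>2 * (kap k - d * k) + s2\<^sup>2 * (kap k + d * k)"
  using pm_squared[of d k] pm_squared[of "- d" k]
  by (simp add: spinor_norm amp_def vector_2 norm_mult power_mult_distrib flip: power2_abs[of d])

lemma amp_norm_le: "\<bar>d\<bar> = 1 \<Longrightarrow> (norm (amp d k))\<^sup>2 \<le> 4 * kap k"
proof -
  assume d: "\<bar>d\<bar> = 1"
  have "(norm (amp d k))\<^sup>2 = 2 * kap k + (s2\<^sup>2 - s1\<^sup>2) * (d * k)"
    unfolding amp_norm[OF d] by (simp add: s_squared algebra_simps)
  also have "(s2\<^sup>2 - s1\<^sup>2) * (d * k) \<le> \<bar>s2\<^sup>2 - s1\<^sup>2\<bar> * \<bar>d * k\<bar>" by (metis abs_ge_self abs_mult)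
  also have "\<dots> \<le> 2 * kap k"
  proof (rule mult_mono)
    show "\<bar>s2\<^sup>2 - s1\<^sup>2\<bar> \<le> 2" using quotient_bounds unfolding s_squared by linarith
    show "\<bar>d * k\<bar> \<le> kap k" using d kap_gt[of k] by (simp add: abs_mult)
  qed auto
  finally show ?thesis by simp
qed

text \<open>The defect in the eigenvalue equation after multiplication by i, which isolates the
  gradient: zero residual means (sigma . grad) F = i (zs - m sigma_3) F.\<close>

definition resid :: "(real \<times> real \<Rightarrow> spinor) \<Rightarrow> real \<times> real \<Rightarrow> spinor" where
  "resid F p = sigma_grad F p - \<i> *s (complex_of_real zs *s F p - m *\<^sub>R (pauli3 *v F p))"

lemma resid_components:
  assumes "smooth F"
  shows "resid F p $ 1 = partial_x (\<lambda>p. F p $ 2) p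
      + ((- \<i>) * partial_y (\<lambda>p. F p $ 2) p + (- \<i> * of_real (zs - m)) * F p $ 1)"
    and "resid F p $ 2 = partial_x (\<lambda>p. F p $ 1) p
      + (\<i> * partial_y (\<lambda>p. F p $ 1) p + (- \<i> * of_real (zs + m)) * F p $ 2)"
  unfolding resid_def sigma_grad_def vector_minus_component vector_add_component pauli_components partial_nth[OF assms]
    vector_smult_component vector_scaleR_component
  by (simp_all add: scaleR_conv_of_real algebra_simps)

lemma resid_test:
  assumes F: "F \<in> test_functions UNIV"
  shows "(\<lambda>p. resid F p $ i) \<in> test_functions UNIV"
proof -
  have "(\<lambda>p. resid F p $ 1) \<in> test_functions UNIV" "(\<lambda>p. resid F p $ 2) \<in> test_functions UNIV"
    unfolding resid_components[OF test_functions_smooth[OF F]]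
    by (intro test_functions_UNIV_add test_functions_UNIV_cmult test_functions_partial test_functions_nth F)+
  then show ?thesis using exhaust_2[of i] by auto
qed

lemma fhat_resid:
  assumes F: "F \<in> test_functions UNIV"
  defines "f \<equiv> \<lambda>i x k. fhat (\<lambda>p. F p $ i) x k"
  shows "fhat (partial_x (\<lambda>p. F p $ 2)) x k
      = fhat (\<lambda>p. resid F p $ 1) x k - of_real k * f 2 x k + \<i> * of_real (zs - m) * f 1 x k"
    and "fhat (partial_x (\<lambda>p. F p $ 1)) x k
      = fhat (\<lambda>p. resid F p $ 2) x k + of_real k * f 1 x k + \<i> * of_real (zs + m) * f 2 x k"
proof -
  note t = test_functions_nth[OF F]
  show "fhat (partial_x (\<lambda>p. F p $ 2)) x k
      = fhat (\<lambda>p. resid F p $ 1) x k - of_real k * f 2 x k + \<i> * of_real (zs - m) * f 1 x k"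
    unfolding resid_components[OF test_functions_smooth[OF F]] f_def
    by (subst fhat_add, (intro test_functions_UNIV_add test_functions_UNIV_cmult test_functions_partial t)+)+
      (simp only: fhat_cmult fhat_partial_y[OF t], simp add: algebra_simps)
  show "fhat (partial_x (\<lambda>p. F p $ 1)) x k
      = fhat (\<lambda>p. resid F p $ 2) x k + of_real k * f 1 x k + \<i> * of_real (zs + m) * f 2 x k"
    unfolding resid_components[OF test_functions_smooth[OF F]] f_def
    by (subst fhat_add, (intro test_functions_UNIV_add test_functions_UNIV_cmult test_functions_partial t)+)+
      (simp only: fhat_cmult fhat_partial_y[OF t], simp add: algebra_simps)
qed

definition fvec :: "(real \<times> real \<Rightarrow> spinor) \<Rightarrow> real \<Rightarrow> real \<Rightarrow> spinor" where
  "fvec F x k = (\<chi> i. fhat (\<lambda>p. F p $ i) x k)"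

text \<open>The residual enters the equation for the modes with its components swapped.\<close>

definition rvec :: "(real \<times> real \<Rightarrow> spinor) \<Rightarrow> real \<Rightarrow> real \<Rightarrow> spinor" where
  "rvec F x k = vector [fhat (\<lambda>p. resid F p $ 2) x k, fhat (\<lambda>p. resid F p $ 1) x k]"

text \<open>As a row vector \<open>mode d k\<close> is a left eigenvector of the symbol for the
  eigenvalue -d kappa, so each mode satisfies a scalar equation of its own.\<close>

lemma mode_fvec_derivative:
  assumes F: "F \<in> test_functions UNIV" and d: "\<bar>d\<bar> = 1"
  shows "((\<lambda>x. mode d k (fvec F x k)) has_vector_derivative
    (- of_real (d * kap k) * mode d k (fvec F x k) + mode d k (rvec F x k))) (at x)"
proof -
  note t = test_functions_nth[OF F]
  let ?f = "\<lambda>i. fhat (\<lambda>p. F p $ i) x k" and ?r = "\<lambda>i. fhat (\<lambda>p. resid F p $ i) x k"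
  let ?a = "complex_of_real (pm d k / s1)" and ?b = "\<i> * complex_of_real (d * pm (- d) k / s2)"
  have dd: "d * d = 1" using d by (metis abs_mult_self_eq mult_1)
  have "((\<lambda>x. ?a * fhat (\<lambda>p. F p $ 1) x k - ?b * fhat (\<lambda>p. F p $ 2) x k) has_vector_derivative
     (?a * fhat (partial_x (\<lambda>p. F p $ 1)) x k - ?b * fhat (partial_x (\<lambda>p. F p $ 2)) x k)) (at x)"
    by (intro has_vector_derivative_diff has_vector_derivative_mult_right fhat_has_vector_derivative t)
  moreover have "?a * fhat (partial_x (\<lambda>p. F p $ 1)) x k - ?b * fhat (partial_x (\<lambda>p. F p $ 2)) x k
    = - of_real (d * kap k) * (?a * ?f 1 - ?b * ?f 2) + (?a * ?r 2 - ?b * ?r 1)"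
  proof -
    let ?A = "pm d k" and ?B = "pm (- d) k"
    have AB: "?A * ?B = mu" by (rule pm_prod[OF d])
    have A2: "?A * ?A = kap k - d * k" and B2: "?B * ?B = kap k + d * k"
      using pm_squared[OF d, of k] pm_squared[of "- d" k] d by (simp_all add: power2_eq_square)
    \<comment> \<open>The constant m s1 s2 = \<open>mu\<close> is replaced by the product of
      \<open>?A\<close> and \<open>?B\<close>; then \<open>?A\<close> factors out and the square of
      \<open>?B\<close> is evaluated. The second identity follows in the same way with the roles
      exchanged.\<close>
    have "?A / s1 * k - d * ?B / s2 * (m * s2\<^sup>2) = (?A * k - d * ?B * (?A * ?B)) / s1"
      unfolding AB mu_eq using s_pos by (simp add: power2_eq_square field_simps)
    also have "?A * k - d * ?B * (?A * ?B) = ?A * (k - d * (?B * ?B))" by (simp add: algebra_simps)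
    also have "k - d * (?B * ?B) = - d * kap k" unfolding B2 using dd by (simp add: algebra_simps flip: mult.assoc)
    finally have c1: "?A / s1 * k - d * ?B / s2 * (m * s2\<^sup>2) = - (d * kap k) * (?A / s1)" by simp
    have "?A / s1 * (m * s1\<^sup>2) + d * ?B / s2 * k = (?A * (?A * ?B) + d * ?B * k) / s2"
      unfolding AB mu_eq using s_pos by (simp add: power2_eq_square field_simps)
    also have "?A * (?A * ?B) + d * ?B * k = ?B * (?A * ?A + d * k)" by (simp add: algebra_simps)
    also have "\<dots> = (d * d) * ?B * kap k" unfolding A2 dd by simp
    finally have c2: "?A / s1 * (m * s1\<^sup>2) + d * ?B / s2 * k = (d * kap k) * (d * ?B / s2)" by simp
    have c1': "?a * of_real k - ?b * (\<i> * of_real (zs - m)) = - of_real (d * kap k) * ?a"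
    proof -
      have "?a * of_real k - ?b * (\<i> * of_real (zs - m)) = of_real (?A / s1 * k - d * ?B / s2 * (m * s2\<^sup>2))"
        unfolding zs_minus by (simp add: algebra_simps)
      then show ?thesis unfolding c1 by simp
    qed
    have c2': "?a * (\<i> * of_real (zs + m)) + ?b * of_real k = of_real (d * kap k) * ?b"
    proof -
      have "?a * (\<i> * of_real (zs + m)) + ?b * of_real k = \<i> * of_real (?A / s1 * (m * s1\<^sup>2) + d * ?B / s2 * k)"
        unfolding zs_plus by (simp add: algebra_simps)
      then show ?thesis unfolding c2 by simp
    qed
    have "?a * fhat (partial_x (\<lambda>p. F p $ 1)) x k - ?b * fhat (partial_x (\<lambda>p. F p $ 2)) x k
      = (?a * of_real k - ?b * (\<i> * of_real (zs - m))) * ?f 1 + (?a * (\<i> * of_real (zs + m)) + ?b * of_real k) * ?f 2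
        + (?a * ?r 2 - ?b * ?r 1)"
      unfolding fhat_resid[OF F] by (simp add: algebra_simps del: of_real_add of_real_diff)
    then show ?thesis unfolding c1' c2' by (simp add: algebra_simps)
  qed
  ultimately show ?thesis by (simp add: mode_def fvec_def rvec_def vector_2)
qed

section \<open>Energies of the two modes at fixed frequency\<close>

definition slice_energy :: "real \<Rightarrow> (real \<Rightarrow> complex) \<Rightarrow> ennreal" where
  "slice_energy s f = (\<integral>\<^sup>+x. indicator {x. 0 < s * x} x * ennreal ((cmod (f x))\<^sup>2) \<partial>lborel)"

lemma mode_continuous:
  assumes "continuous_on UNIV (\<lambda>x. v x $ 1)" "continuous_on UNIV (\<lambda>x. v x $ 2)"
  shows "continuous_on UNIV (\<lambda>x. mode d k (v x))"
  unfolding mode_def by (intro continuous_intros assms)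

text \<open>On the half line s x > 0 the mode \<open>s\<close> decays and the mode
  \<open>- s\<close> grows, which are the two cases of \<open>half_line_energy\<close> at a =
  kappa.\<close>

lemma mode_energy:
  assumes F: "F \<in> test_functions UNIV" and s: "s = 1 \<or> s = -1"
  shows "slice_energy s (\<lambda>x. mode s k (fvec F x k))
     \<le> ennreal (1 / kap k) * ennreal ((cmod (mode s k (ftrace F k)))\<^sup>2)
       + ennreal (1 / (kap k)\<^sup>2) * slice_energy s (\<lambda>x. mode s k (rvec F x k))"
    and "slice_energy s (\<lambda>x. mode (- s) k (fvec F x k))
     \<le> ennreal (1 / (kap k)\<^sup>2) * slice_energy s (\<lambda>x. mode (- s) k (rvec F x k))"
    and "ennreal ((cmod (mode (- s) k (ftrace F k)))\<^sup>2)
     \<le> ennreal (1 / kap k) * slice_energy s (\<lambda>x. mode (- s) k (rvec F x k))"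
proof -
  have d: "\<bar>s\<bar> = 1" "\<bar>- s\<bar> = 1" using s by auto
  obtain M where M: "M > 0" "\<And>p. F p \<noteq> 0 \<Longrightarrow> norm p \<le> M"
    using test_functions_bounded_support[OF F] by (auto simp: bounded_pos)
  have "\<exists>N>0. \<forall>p. resid F p $ i \<noteq> 0 \<longrightarrow> norm p \<le> N" for i
    using test_functions_bounded_support[OF resid_test[OF F, of i]] by (auto simp: bounded_pos)
  then obtain N where N: "\<And>i. N i > 0" "\<And>i p. resid F p $ i \<noteq> 0 \<Longrightarrow> norm p \<le> N i" by metis
  define K where "K = M + N 1 + N 2 + 1"
  have K: "K > 0" "M < K" "N 1 < K" "N 2 < K" using M(1) N(1)[of 1] N(1)[of 2] by (auto simp: K_def)
  have z: "mode e k (fvec F x k) = 0" if "\<bar>x\<bar> \<ge> K" for x e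
  proof -
    have "fhat (\<lambda>p. F p $ i) x k = 0" for i
    proof (rule fhat_outside[of _ M])
      show "norm p \<le> M" if "F p $ i \<noteq> 0" for p
        using that M(2)[of p] by (cases "F p = 0") simp_all
    qed (use K(2) that in simp)
    then show ?thesis by (simp add: mode_def fvec_def)
  qed
  have z': "mode e k (rvec F x k) = 0" if "\<bar>x\<bar> \<ge> K" for x e
  proof -
    have "fhat (\<lambda>p. resid F p $ 1) x k = 0" "fhat (\<lambda>p. resid F p $ 2) x k = 0"
      by (rule fhat_outside[of _ "N 1"] fhat_outside[of _ "N 2"]; use N(2) K that in auto)+
    then show ?thesis by (simp add: mode_def rvec_def vector_2)
  qed
  have "continuous_on UNIV (\<lambda>x. fhat (\<lambda>p. resid F p $ i) x k)" for i
    using fhat_has_vector_derivative[OF resid_test[OF F]]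
    by (intro continuous_at_imp_continuous_on ballI has_vector_derivative_continuous) blast
  then have c: "continuous_on UNIV (\<lambda>x. mode e k (rvec F x k))" for e
    by (intro mode_continuous) (simp_all add: rvec_def vector_2)
  have tr: "fvec F 0 k = ftrace F k" by (simp add: fvec_def ftrace_def)
  note E = half_line_energy[OF s kap_pos mode_fvec_derivative[OF F] c K(1) z z', folded slice_energy_def, unfolded tr]
  show "slice_energy s (\<lambda>x. mode s k (fvec F x k))
     \<le> ennreal (1 / kap k) * ennreal ((cmod (mode s k (ftrace F k)))\<^sup>2)
       + ennreal (1 / (kap k)\<^sup>2) * slice_energy s (\<lambda>x. mode s k (rvec F x k))"
    using E(1)[OF d(1)] by blast
  show "slice_energy s (\<lambda>x. mode (- s) k (fvec F x k))
     \<le> ennreal (1 / (kap k)\<^sup>2) * slice_energy s (\<lambda>x. mode (- s) k (rvec F x k))"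
    using E(2)[OF d(2)] by blast
  show "ennreal ((cmod (mode (- s) k (ftrace F k)))\<^sup>2)
     \<le> ennreal (1 / kap k) * slice_energy s (\<lambda>x. mode (- s) k (rvec F x k))"
    using E(3)[OF d(2)] by blast
qed

lemma slice_energy_measurable:
  fixes g :: "real \<Rightarrow> real \<Rightarrow> complex"
  assumes [measurable]: "(\<lambda>(x, k). g x k) \<in> borel_measurable (borel \<Otimes>\<^sub>M borel)"
  shows "(\<lambda>k. slice_energy s (\<lambda>x. g x k)) \<in> borel_measurable borel"
proof -
  have [measurable]: "(\<lambda>(x, k). g x k) \<in> borel_measurable (lborel \<Otimes>\<^sub>M lborel)"
    using assms by (simp cong: measurable_cong_sets)
  have "(\<lambda>k. \<integral>\<^sup>+x. indicator {x. 0 < s * x} x * ennreal ((cmod (g x k))\<^sup>2) \<partial>lborel) \<in> borel_measurable lborel"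
    by measurable
  then show ?thesis by (simp add: slice_energy_def)
qed

lemma mode_slice_le:
  assumes [measurable]: "(\<lambda>x. v x $ 1) \<in> borel_measurable borel" "(\<lambda>x. v x $ 2) \<in> borel_measurable borel"
    and d: "\<bar>d\<bar> = 1"
  shows "slice_energy s (\<lambda>x. mode d k (v x)) + slice_energy s (\<lambda>x. mode (- d) k (v x))
    \<le> ennreal (2 * kap k * sc) * (slice_energy s (\<lambda>x. v x $ 1) + slice_energy s (\<lambda>x. v x $ 2))"
proof -
  have [measurable]: "(\<lambda>x. mode e k (v x)) \<in> borel_measurable borel" for e unfolding mode_def by measurable
  have p: "indicator H x * ennreal ((cmod (mode d k (v x)))\<^sup>2) + indicator H x * ennreal ((cmod (mode (- d) k (v x)))\<^sup>2)
    \<le> ennreal (2 * kap k * sc) * (indicator H x * ennreal ((cmod (v x $ 1))\<^sup>2) + indicator H x * ennreal ((cmod (v x $ 2))\<^sup>2))"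
    for x and H :: "real set"
  proof (cases "x \<in> H")
    case True
    have "ennreal ((cmod (mode d k (v x)))\<^sup>2) + ennreal ((cmod (mode (- d) k (v x)))\<^sup>2)
      = ennreal ((cmod (mode d k (v x)))\<^sup>2 + (cmod (mode (- d) k (v x)))\<^sup>2)" by (rule ennreal_plus[symmetric]) auto
    also have "\<dots> \<le> ennreal (2 * kap k * sc * (norm (v x))\<^sup>2)" by (rule ennreal_leI[OF mode_sum_le[OF d]])
    also have "\<dots> = ennreal (2 * kap k * sc) * (ennreal ((cmod (v x $ 1))\<^sup>2) + ennreal ((cmod (v x $ 2))\<^sup>2))"
      unfolding spinor_norm using kap_pos[of k] sc_pos by (subst ennreal_mult) (auto simp: ennreal_plus)
    finally show ?thesis using True by simp
  qed simp
  show ?thesis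
    unfolding slice_energy_def
    by (subst (1 2) nn_integral_add[symmetric]; (subst nn_integral_cmult[symmetric])?;
      (rule nn_integral_mono, rule p)?) measurable
qed

lemma mode_slice_ge:
  assumes [measurable]: "(\<lambda>x. v x $ 1) \<in> borel_measurable borel" "(\<lambda>x. v x $ 2) \<in> borel_measurable borel"
    and d: "\<bar>d\<bar> = 1"
  shows "slice_energy s (\<lambda>x. v x $ 1) + slice_energy s (\<lambda>x. v x $ 2)
    \<le> ennreal (1 / kap k) * (slice_energy s (\<lambda>x. mode d k (v x)) + slice_energy s (\<lambda>x. mode (- d) k (v x)))"
proof -
  have [measurable]: "(\<lambda>x. mode e k (v x)) \<in> borel_measurable borel" for e unfolding mode_def by measurable
  have p: "indicator H x * ennreal ((cmod (v x $ 1))\<^sup>2) + indicator H x * ennreal ((cmod (v x $ 2))\<^sup>2)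
    \<le> ennreal (1 / kap k) * (indicator H x * ennreal ((cmod (mode d k (v x)))\<^sup>2) + indicator H x * ennreal ((cmod (mode (- d) k (v x)))\<^sup>2))"
    for x and H :: "real set"
  proof (cases "x \<in> H")
    case True
    have "ennreal ((cmod (v x $ 1))\<^sup>2) + ennreal ((cmod (v x $ 2))\<^sup>2) = ennreal ((norm (v x))\<^sup>2)"
      unfolding spinor_norm by (rule ennreal_plus[symmetric]) auto
    also have "\<dots> \<le> ennreal (1 / kap k * ((cmod (mode d k (v x)))\<^sup>2 + (cmod (mode (- d) k (v x)))\<^sup>2))"
      by (rule ennreal_leI[OF mode_sum_ge[OF d]])
    also have "\<dots> = ennreal (1 / kap k) * (ennreal ((cmod (mode d k (v x)))\<^sup>2) + ennreal ((cmod (mode (- d) k (v x)))\<^sup>2))"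
      using kap_pos[of k] by (subst ennreal_mult) (auto simp: ennreal_plus)
    finally show ?thesis using True by simp
  qed simp
  show ?thesis
    unfolding slice_energy_def
    by (subst (1 2) nn_integral_add[symmetric]; (subst nn_integral_cmult[symmetric])?;
      (rule nn_integral_mono, rule p)?) measurable
qed

text \<open>The sum of the three constants that arise for the trace, for the source in the field and
  for the growing mode, so that one number serves for all.\<close>

definition apriori :: real where "apriori = 2 * sc / min 1 mu + 2 * sc / mu\<^sup>2 + 2 * sc"

text \<open>The powers of kappa are what matters. Passing to the modes costs a factor kappa, passing
  back gains one, and the decay gains one for the trace and two for the source. The trace is left
  with 1/kappa, comparable to the squared weight of H^(-1/2), and the source with a bounded
  factor.\<close>

lemma slice_apriori:
  assumes F: "F \<in> test_functions UNIV" and s: "s = 1 \<or> s = -1"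
  shows "slice_energy s (\<lambda>x. fhat (\<lambda>p. F p $ 1) x k) + slice_energy s (\<lambda>x. fhat (\<lambda>p. F p $ 2) x k)
    \<le> ennreal apriori * (ennreal ((norm (wt k *\<^sub>R ftrace F k))\<^sup>2)
      + (slice_energy s (\<lambda>x. fhat (\<lambda>p. resid F p $ 1) x k) + slice_energy s (\<lambda>x. fhat (\<lambda>p. resid F p $ 2) x k)))"
    and "ennreal ((cmod (mode (- s) k (ftrace F k)))\<^sup>2)
    \<le> ennreal apriori * (slice_energy s (\<lambda>x. fhat (\<lambda>p. resid F p $ 1) x k) + slice_energy s (\<lambda>x. fhat (\<lambda>p. resid F p $ 2) x k))"
proof -
  have d: "\<bar>s\<bar> = 1" using s by auto
  have cont: "continuous_on UNIV (\<lambda>x. fhat f x k)" if "f \<in> test_functions UNIV" for f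
    using fhat_has_vector_derivative[OF that]
    by (intro continuous_at_imp_continuous_on ballI has_vector_derivative_continuous) blast
  have m: "(\<lambda>x. fhat f x k) \<in> borel_measurable borel" if "f \<in> test_functions UNIV" for f
    by (rule borel_measurable_continuous_onI[OF cont[OF that]])
  have mF: "(\<lambda>x. fvec F x k $ 1) \<in> borel_measurable borel" "(\<lambda>x. fvec F x k $ 2) \<in> borel_measurable borel"
    using m[OF test_functions_nth[OF F]] by (simp_all add: fvec_def)
  have mR: "(\<lambda>x. rvec F x k $ 1) \<in> borel_measurable borel" "(\<lambda>x. rvec F x k $ 2) \<in> borel_measurable borel"
    using m[OF resid_test[OF F]] by (simp_all add: rvec_def vector_2)
  let ?R = "slice_energy s (\<lambda>x. fhat (\<lambda>p. resid F p $ 1) x k) + slice_energy s (\<lambda>x. fhat (\<lambda>p. resid F p $ 2) x k)"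
  let ?T = "ennreal ((norm (ftrace F k))\<^sup>2)" and ?K = "kap k"
  note K = kap_pos[of k]
  let ?mr = "\<lambda>d. slice_energy s (\<lambda>x. mode d k (rvec F x k))"
  have R: "?mr s + ?mr (- s) \<le> ennreal (2 * ?K * sc) * ?R"
    using mode_slice_le[OF mR d, of s k] by (simp add: rvec_def vector_2 add.commute)
  have tr: "ennreal ((cmod (mode s k (ftrace F k)))\<^sup>2) \<le> ennreal (2 * ?K * sc) * ?T"
  proof -
    have "(cmod (mode s k (ftrace F k)))\<^sup>2 \<le> 2 * ?K * sc * (norm (ftrace F k))\<^sup>2"
      using mode_sum_le[OF d, of k "ftrace F k"] by (smt (verit) zero_le_power2)
    then show ?thesis using K sc_pos by (simp add: ennreal_leI flip: ennreal_mult)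
  qed
  have "slice_energy s (\<lambda>x. fvec F x k $ 1) + slice_energy s (\<lambda>x. fvec F x k $ 2)
    \<le> ennreal (1 / ?K) * (slice_energy s (\<lambda>x. mode s k (fvec F x k)) + slice_energy s (\<lambda>x. mode (- s) k (fvec F x k)))"
    by (rule mode_slice_ge[OF mF d])
  also have "\<dots> \<le> ennreal (1 / ?K) * ((ennreal (1 / ?K) * ennreal ((cmod (mode s k (ftrace F k)))\<^sup>2)
      + ennreal (1 / ?K\<^sup>2) * ?mr s) + ennreal (1 / ?K\<^sup>2) * ?mr (- s))"
    by (intro mult_left_mono add_mono mode_energy F s) auto
  also have "\<dots> = ennreal (1 / ?K) * (ennreal (1 / ?K) * ennreal ((cmod (mode s k (ftrace F k)))\<^sup>2)
      + ennreal (1 / ?K\<^sup>2) * (?mr s + ?mr (- s)))"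
    by (simp add: distrib_left add.assoc)
  also have "\<dots> \<le> ennreal (1 / ?K) * (ennreal (1 / ?K) * (ennreal (2 * ?K * sc) * ?T)
      + ennreal (1 / ?K\<^sup>2) * (ennreal (2 * ?K * sc) * ?R))"
    by (intro mult_left_mono add_mono tr R) auto
  also have "\<dots> = ennreal (2 * sc * (1 / ?K)) * ?T + ennreal (2 * sc / ?K\<^sup>2) * ?R"
  proof -
    have 1: "1 / ?K * (1 / ?K * (2 * ?K * sc)) = 2 * sc * (1 / ?K)" "1 / ?K * (1 / ?K\<^sup>2 * (2 * ?K * sc)) = 2 * sc / ?K\<^sup>2"
      using K by (simp_all add: power2_eq_square)
    have comb: "ennreal a * (ennreal b * (ennreal c * X)) = ennreal (a * (b * c)) * X"
      if "a \<ge> 0" "b \<ge> 0" "c \<ge> 0" for a b c X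
      using that by (simp add: ennreal_mult mult.assoc)
    have "1 / ?K \<ge> 0" "1 / ?K\<^sup>2 \<ge> 0" "2 * ?K * sc \<ge> 0" using K sc_pos by simp_all
    then show ?thesis unfolding distrib_left[of "ennreal (1 / ?K)"] by (simp only: comb 1)
  qed
  also have "\<dots> \<le> ennreal apriori * ennreal ((wt k)\<^sup>2 * (norm (ftrace F k))\<^sup>2) + ennreal apriori * ?R"
  proof (rule add_mono)
    have "2 * sc * (1 / ?K) \<le> 2 * sc * (1 / min 1 mu * (wt k)\<^sup>2)"
      using sc_pos by (intro mult_left_mono inverse_kap_le) auto
    also have "\<dots> = (2 * sc / min 1 mu) * (wt k)\<^sup>2" by simp
    also have "\<dots> \<le> apriori * (wt k)\<^sup>2" using sc_pos mu_pos by (intro mult_right_mono) (auto simp: apriori_def)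
    finally have "2 * sc * (1 / ?K) * (norm (ftrace F k))\<^sup>2 \<le> apriori * (wt k)\<^sup>2 * (norm (ftrace F k))\<^sup>2"
      by (rule mult_right_mono) simp
    moreover have "apriori \<ge> 0" using sc_pos mu_pos by (simp add: apriori_def)
    ultimately show "ennreal (2 * sc * (1 / ?K)) * ?T \<le> ennreal apriori * ennreal ((wt k)\<^sup>2 * (norm (ftrace F k))\<^sup>2)"
      using K sc_pos by (simp add: ennreal_leI mult.assoc flip: ennreal_mult)
    have "2 * sc / ?K\<^sup>2 \<le> 2 * sc / mu\<^sup>2"
      using kap_ge_mu[of k] mu_pos sc_pos K by (intro divide_left_mono power_mono mult_pos_pos zero_less_power) auto
    also have "\<dots> \<le> apriori" using sc_pos mu_pos by (auto simp: apriori_def)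
    finally show "ennreal (2 * sc / ?K\<^sup>2) * ?R \<le> ennreal apriori * ?R" by (intro mult_right_mono ennreal_leI) auto
  qed
  finally show "slice_energy s (\<lambda>x. fhat (\<lambda>p. F p $ 1) x k) + slice_energy s (\<lambda>x. fhat (\<lambda>p. F p $ 2) x k)
    \<le> ennreal apriori * (ennreal ((norm (wt k *\<^sub>R ftrace F k))\<^sup>2) + ?R)"
    by (simp add: fvec_def distrib_left power_mult_distrib)
  have "ennreal ((cmod (mode (- s) k (ftrace F k)))\<^sup>2) \<le> ennreal (1 / ?K) * ?mr (- s)"
    by (rule mode_energy(3)[OF F s])
  also have "\<dots> \<le> ennreal (1 / ?K) * (?mr s + ?mr (- s))" by (intro mult_left_mono) auto
  also have "\<dots> \<le> ennreal (1 / ?K) * (ennreal (2 * ?K * sc) * ?R)" by (intro mult_left_mono R) auto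
  also have "\<dots> = ennreal (2 * sc) * ?R"
  proof -
    have "1 / ?K * (2 * ?K * sc) = 2 * sc" using K by simp
    then show ?thesis using K sc_pos by (simp add: mult.assoc[symmetric] flip: ennreal_mult)
  qed
  also have "\<dots> \<le> ennreal apriori * ?R"
    using sc_pos mu_pos by (intro mult_right_mono ennreal_leI) (auto simp: apriori_def)
  finally show "ennreal ((cmod (mode (- s) k (ftrace F k)))\<^sup>2) \<le> ennreal apriori * ?R" .
qed

lemma nn2_half_spinor:
  fixes F :: "real \<times> real \<Rightarrow> spinor"
  assumes F: "\<And>i. (\<lambda>p. F p $ i) \<in> test_functions UNIV"
  shows "nn2 (lborel_on (half s)) F = (\<integral>\<^sup>+k. slice_energy s (\<lambda>x. fhat (\<lambda>p. F p $ 1) x k)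
     + slice_energy s (\<lambda>x. fhat (\<lambda>p. F p $ 2) x k) \<partial>lborel)"
proof -
  have m: "(\<lambda>p. F p $ i) \<in> borel_measurable borel" for i by (rule test_functions_measurable[OF F])
  have "F \<in> borel_measurable borel" by (rule spinor_measurableI[OF m m])
  then have "F \<in> borel_measurable (lborel_on (half s))" by (intro measurable_restrict_space1) simp
  then have "nn2 (lborel_on (half s)) F = nn2 (lborel_on (half s)) (\<lambda>p. F p $ 1) + nn2 (lborel_on (half s)) (\<lambda>p. F p $ 2)"
    by (rule nn2_spinor)
  also have "\<dots> = (\<integral>\<^sup>+k. slice_energy s (\<lambda>x. fhat (\<lambda>p. F p $ 1) x k) \<partial>lborel)
     + (\<integral>\<^sup>+k. slice_energy s (\<lambda>x. fhat (\<lambda>p. F p $ 2) x k) \<partial>lborel)"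
    unfolding nn2_half_fhat[OF F] slice_energy_def ..
  also have "\<dots> = (\<integral>\<^sup>+k. slice_energy s (\<lambda>x. fhat (\<lambda>p. F p $ 1) x k)
     + slice_energy s (\<lambda>x. fhat (\<lambda>p. F p $ 2) x k) \<partial>lborel)"
    using slice_energy_measurable[OF fhat_measurable[OF m]]
    by (intro nn_integral_add[symmetric]) auto
  finally show ?thesis .
qed

text \<open>The slices are integrated over k. In the limit of vanishing residual the first bound
  makes a solution depend continuously on its trace and the second removes the growing part of the
  trace. On the right stand only quantities that the definition of the trace controls.\<close>

lemma apriori_estimate:
  assumes F: "F \<in> test_functions UNIV" and s: "s = 1 \<or> s = -1"
  shows "nn2 (lborel_on (half s)) F
      \<le> ennreal apriori * (nn2 lborel (\<lambda>k. wt k *\<^sub>R ftrace F k) + nn2 (lborel_on (half s)) (resid F))"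
    and "nn2 lborel (\<lambda>k. mode (- s) k (ftrace F k)) \<le> ennreal apriori * nn2 (lborel_on (half s)) (resid F)"
proof -
  let ?R = "\<lambda>k. slice_energy s (\<lambda>x. fhat (\<lambda>p. resid F p $ 1) x k) + slice_energy s (\<lambda>x. fhat (\<lambda>p. resid F p $ 2) x k)"
  have mR [measurable]: "?R \<in> borel_measurable borel"
    using slice_energy_measurable[OF fhat_measurable[OF test_functions_measurable[OF resid_test[OF F]]]]
    by (intro borel_measurable_add)
  have [measurable]: "(\<lambda>k. ftrace F k) \<in> borel_measurable borel"
  proof (rule spinor_measurableI)
    have "inv_fourier (\<lambda>y. F (0, y) $ i) \<in> borel_measurable borel" for i
      by (intro inv_fourier_measurable test_functions_measurable[where \<Omega>=UNIV] slice_test(1) test_functions_nth F)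
    then have "(\<lambda>k. inv_fourier (\<lambda>y. F (0, y) $ i) (- k)) \<in> borel_measurable borel" for i by measurable
    then show "(\<lambda>k. ftrace F k $ 1) \<in> borel_measurable borel" "(\<lambda>k. ftrace F k $ 2) \<in> borel_measurable borel"
      by (simp_all add: ftrace_def fhat_def)
  qed
  have "nn2 (lborel_on (half s)) F \<le> (\<integral>\<^sup>+k. ennreal apriori * (ennreal ((norm (wt k *\<^sub>R ftrace F k))\<^sup>2) + ?R k) \<partial>lborel)"
    unfolding nn2_half_spinor[OF test_functions_nth[OF F]] by (intro nn_integral_mono slice_apriori F s)
  also have "\<dots> = ennreal apriori * ((\<integral>\<^sup>+k. ennreal ((norm (wt k *\<^sub>R ftrace F k))\<^sup>2) \<partial>lborel) + (\<integral>\<^sup>+k. ?R k \<partial>lborel))"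
    by (subst nn_integral_cmult, measurable, subst nn_integral_add) measurable
  finally show "nn2 (lborel_on (half s)) F
      \<le> ennreal apriori * (nn2 lborel (\<lambda>k. wt k *\<^sub>R ftrace F k) + nn2 (lborel_on (half s)) (resid F))"
    unfolding nn2_half_spinor[OF resid_test[OF F]] by (simp add: nn2_def)
  have "nn2 lborel (\<lambda>k. mode (- s) k (ftrace F k)) \<le> (\<integral>\<^sup>+k. ennreal apriori * ?R k \<partial>lborel)"
    unfolding nn2_def by (intro nn_integral_mono slice_apriori F s)
  also have "\<dots> = ennreal apriori * nn2 (lborel_on (half s)) (resid F)"
    unfolding nn2_half_spinor[OF resid_test[OF F]] by (rule nn_integral_cmult) simp
  finally show "nn2 lborel (\<lambda>k. mode (- s) k (ftrace F k)) \<le> ennreal apriori * nn2 (lborel_on (half s)) (resid F)" .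
qed

end

section \<open>Weak gradients and Dirichlet traces\<close>

lemma partial_product:
  fixes f g :: "real \<times> real \<Rightarrow> complex"
  assumes "smooth f" "smooth g"
  shows "partial_x (\<lambda>p. f p * g p) p = f p * partial_x g p + partial_x f p * g p"
    and "partial_y (\<lambda>p. f p * g p) p = f p * partial_y g p + partial_y f p * g p"
proof -
  have "((\<lambda>p. f p * g p) has_derivative
      (\<lambda>h. f p * frechet_derivative g (at p) h + frechet_derivative f (at p) h * g p)) (at p)"
    by (rule has_derivative_mult[OF smooth_has_derivative[OF assms(1)] smooth_has_derivative[OF assms(2)]])
  note e = frechet_derivative_at[OF this, symmetric]
  show "partial_x (\<lambda>p. f p * g p) p = f p * partial_x g p + partial_x f p * g p"
    "partial_y (\<lambda>p. f p * g p) p = f p * partial_y g p + partial_y f p * g p"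
    by (simp_all add: partial_x_def partial_y_def e)
qed

lemma integral_partial_eq_0:
  fixes f :: "real \<times> real \<Rightarrow> complex"
  assumes f: "f \<in> test_functions UNIV"
  shows "(LINT p|lborel. partial_x f p) = 0" "(LINT p|lborel. partial_y f p) = 0"
proof -
  note sm = test_functions_smooth[OF f]
  have ix: "integrable (lborel \<Otimes>\<^sub>M lborel) (partial_x f)" and iy: "integrable (lborel \<Otimes>\<^sub>M lborel) (partial_y f)"
    unfolding lborel_prod by (rule test_functions_integrable[OF test_functions_partial(1)[OF f]]
        test_functions_integrable[OF test_functions_partial(2)[OF f]])+
  have cont: "continuous_on UNIV (\<lambda>q. g (fst q, snd q))" if "g \<in> test_functions UNIV" for g :: "real \<times> real \<Rightarrow> complex"
    using test_functions_continuous[OF that] by simp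
  obtain M where M: "\<And>p. f p \<noteq> 0 \<Longrightarrow> norm p \<le> M"
    using test_functions_bounded_support[OF f] by (auto simp: bounded_iff)
  have "(LINT x|lborel. partial_x f (x, y)) = 0" for y
  proof (rule integral_derivative_eq_0[OF slice_has_derivative(2)[OF sm]])
    show "continuous_on UNIV (\<lambda>x. partial_x f (x, y))"
      by (rule continuous_on_compose2[OF test_functions_continuous[OF test_functions_partial(1)[OF f], of UNIV]])
        (auto intro!: continuous_intros)
    show "bounded {x. f (x, y) \<noteq> 0}"
    proof (rule boundedI[where B=M])
      fix x assume "x \<in> {x. f (x, y) \<noteq> 0}"
      then have "norm (x, y) \<le> M" using M by simp
      then show "norm x \<le> M" using norm_fst_le[of x y] by linarith
    qed
  qed
  then have "(LINT y|lborel. LINT x|lborel. partial_x f (x, y)) = 0" by simp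
  then show "(LINT p|lborel. partial_x f p) = 0"
    using lborel_pair.integral_snd[of "\<lambda>x y. partial_x f (x, y)"] ix by (simp add: lborel_prod)
  have "(LINT y|lborel. partial_y f (x, y)) = 0" for x
  proof (rule integral_derivative_eq_0[OF slice_has_derivative(1)[OF sm]])
    show "continuous_on UNIV (\<lambda>y. partial_y f (x, y))"
      by (rule continuous_on_compose2[OF test_functions_continuous[OF test_functions_partial(2)[OF f], of UNIV]])
        (auto intro!: continuous_intros)
    show "bounded {y. f (x, y) \<noteq> 0}" by (rule test_functions_bounded_support[OF slice_test(1)[OF f]])
  qed
  then have "(LINT x|lborel. LINT y|lborel. partial_y f (x, y)) = 0" by simp
  then show "(LINT p|lborel. partial_y f p) = 0"
    using lborel_pair.integral_fst'[OF iy] by (simp add: lborel_prod)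
qed

lemma integral_by_parts:
  fixes f \<phi> :: "real \<times> real \<Rightarrow> complex"
  assumes f: "f \<in> test_functions UNIV" and \<phi>: "\<phi> \<in> test_functions UNIV"
  shows "(LINT p|lborel. \<phi> p * partial_x f p) = - (LINT p|lborel. partial_x \<phi> p * f p)"
    and "(LINT p|lborel. \<phi> p * partial_y f p) = - (LINT p|lborel. partial_y \<phi> p * f p)"
proof -
  have t: "(\<lambda>p. \<phi> p * f p) \<in> test_functions UNIV"
    by (rule test_functions_UNIV_mult[OF test_functions_smooth[OF \<phi>] f])
  have i: "integrable lborel (\<lambda>p. u p * v p)" if "u \<in> test_functions UNIV" "v \<in> test_functions UNIV"
    for u v :: "real \<times> real \<Rightarrow> complex"
    by (rule test_functions_integrable[OF test_functions_UNIV_mult[OF test_functions_smooth[OF that(1)] that(2)]])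
  note tp = test_functions_partial
  have "(LINT p|lborel. \<phi> p * partial_x f p) + (LINT p|lborel. partial_x \<phi> p * f p) = 0"
    using integral_partial_eq_0(1)[OF t] i[OF \<phi> tp(1)[OF f]] i[OF tp(1)[OF \<phi>] f]
    unfolding partial_product[OF test_functions_smooth[OF \<phi>] test_functions_smooth[OF f]] by simp
  then show "(LINT p|lborel. \<phi> p * partial_x f p) = - (LINT p|lborel. partial_x \<phi> p * f p)"
    by (simp add: eq_neg_iff_add_eq_0)
  have "(LINT p|lborel. \<phi> p * partial_y f p) + (LINT p|lborel. partial_y \<phi> p * f p) = 0"
    using integral_partial_eq_0(2)[OF t] i[OF \<phi> tp(2)[OF f]] i[OF tp(2)[OF \<phi>] f]
    unfolding partial_product[OF test_functions_smooth[OF \<phi>] test_functions_smooth[OF f]] by simp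
  then show "(LINT p|lborel. \<phi> p * partial_y f p) = - (LINT p|lborel. partial_y \<phi> p * f p)"
    by (simp add: eq_neg_iff_add_eq_0)
qed

lemma L2_restrict:
  assumes "f \<in> L2 lborel" "\<Omega> \<in> sets borel"
  shows "f \<in> L2 (lborel_on \<Omega>)"
proof -
  have [measurable]: "f \<in> borel_measurable borel" using assms(1) by (simp add: L2_iff)
  have "nn2 (lborel_on \<Omega>) f = (\<integral>\<^sup>+p. ennreal ((norm (f p))\<^sup>2) * indicator \<Omega> p \<partial>lborel)"
    unfolding nn2_def using assms(2) by (intro nn_integral_restrict_space) simp
  also have "\<dots> \<le> nn2 lborel f"
    unfolding nn2_def by (intro nn_integral_mono) (auto simp: indicator_def)
  also have "\<dots> < \<infinity>" using assms(1) by (simp add: L2_iff)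
  finally show ?thesis using measurable_restrict_space1[of f lborel borel \<Omega>] by (simp add: L2_iff)
qed

text \<open>Scalar form of the definition. Every integral is a pairing of L^2 functions, so
  components, sums and factors may be taken out.\<close>

lemma weak_sigma_grad_iff:
  assumes f: "f \<in> L2 (lborel_on \<Omega>)" and g: "g \<in> L2 (lborel_on \<Omega>)" and \<Omega>: "\<Omega> \<in> sets borel"
  shows "weak_sigma_grad \<Omega> f g \<longleftrightarrow> (\<forall>\<phi>::real \<times> real \<Rightarrow> complex. \<phi> \<in> test_functions \<Omega> \<longrightarrow>
    (LINT p|lborel_on \<Omega>. \<phi> p * g p $ 1) = - ((LINT p|lborel_on \<Omega>. partial_x \<phi> p * f p $ 2)
      - \<i> * (LINT p|lborel_on \<Omega>. partial_y \<phi> p * f p $ 2)) \<and>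
    (LINT p|lborel_on \<Omega>. \<phi> p * g p $ 2) = - ((LINT p|lborel_on \<Omega>. partial_x \<phi> p * f p $ 1)
      + \<i> * (LINT p|lborel_on \<Omega>. partial_y \<phi> p * f p $ 1)))"
proof -
  have fg: "(\<lambda>p. f p $ i) \<in> L2 (lborel_on \<Omega>)" "(\<lambda>p. g p $ i) \<in> L2 (lborel_on \<Omega>)" for i
    using f g exhaust_2[of i] unfolding L2_spinor_iff by auto
  have "((LINT p|lborel_on \<Omega>. \<phi> p *s g p) =
        - (LINT p|lborel_on \<Omega>. partial_x \<phi> p *s (pauli1 *v f p) + partial_y \<phi> p *s (pauli2 *v f p)))
    \<longleftrightarrow> (LINT p|lborel_on \<Omega>. \<phi> p * g p $ 1) = - ((LINT p|lborel_on \<Omega>. partial_x \<phi> p * f p $ 2)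
      - \<i> * (LINT p|lborel_on \<Omega>. partial_y \<phi> p * f p $ 2)) \<and>
    (LINT p|lborel_on \<Omega>. \<phi> p * g p $ 2) = - ((LINT p|lborel_on \<Omega>. partial_x \<phi> p * f p $ 1)
      + \<i> * (LINT p|lborel_on \<Omega>. partial_y \<phi> p * f p $ 1))"
    if \<phi>: "\<phi> \<in> test_functions \<Omega>" for \<phi>
  proof -
    have t: "u \<in> L2 (lborel_on \<Omega>)" if "u \<in> test_functions \<Omega>" for u :: "real \<times> real \<Rightarrow> complex"
      by (rule L2_restrict[OF test_functions_L2[OF that] \<Omega>])
    note i1 = L2_product(1)[OF t[OF \<phi>] fg(2)]
    note ix = L2_product(1)[OF t[OF test_functions_partial(1)[OF \<phi>]] fg(1)]
    note iy = L2_product(1)[OF t[OF test_functions_partial(2)[OF \<phi>]] fg(1)]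
    have iyc: "integrable (lborel_on \<Omega>) (\<lambda>p. c * (partial_y \<phi> p * f p $ i))" for c i
      by (rule integrable_mult_right[OF iy])
    have L: "integrable (lborel_on \<Omega>) (\<lambda>p. \<phi> p *s g p)"
      using i1 by (simp add: spinor_integrable_iff)
    have c: "(partial_x \<phi> p *s (pauli1 *v f p) + partial_y \<phi> p *s (pauli2 *v f p)) $ 1
        = partial_x \<phi> p * f p $ 2 + (- \<i>) * (partial_y \<phi> p * f p $ 2)"
      "(partial_x \<phi> p *s (pauli1 *v f p) + partial_y \<phi> p *s (pauli2 *v f p)) $ 2
        = partial_x \<phi> p * f p $ 1 + \<i> * (partial_y \<phi> p * f p $ 1)" for p
      by (simp_all add: pauli_components)
    have R: "integrable (lborel_on \<Omega>) (\<lambda>p. partial_x \<phi> p *s (pauli1 *v f p) + partial_y \<phi> p *s (pauli2 *v f p))"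
      unfolding spinor_integrable_iff c by (intro conjI Bochner_Integration.integrable_add ix iyc)
    show ?thesis
      unfolding vec_eq_iff forall_2 vector_uminus_component spinor_integral_nth[OF L] spinor_integral_nth[OF R] c
        vector_smult_component
      by (subst (1 2) Bochner_Integration.integral_add[OF ix iyc]) (simp only: integral_mult_right_zero, simp)
  qed
  then show ?thesis unfolding weak_sigma_grad_def using g by auto
qed

lemma test_integral_restrict:
  assumes "\<And>p. p \<notin> \<Omega> \<Longrightarrow> f p = (0::complex)" "\<Omega> \<in> sets borel"
  shows "(LINT p|lborel_on \<Omega>. f p) = (LINT p|lborel. f p)"
proof -
  have "(LINT p|lborel_on \<Omega>. f p) = (LINT p|lborel. indicator \<Omega> p *\<^sub>R f p)"
    using assms(2) by (intro integral_restrict_space) simp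
  also have "\<dots> = (LINT p|lborel. f p)"
    using assms(1) by (intro Bochner_Integration.integral_cong refl) (auto simp: indicator_def)
  finally show ?thesis .
qed

lemma sigma_grad_components:
  assumes "smooth F"
  shows "sigma_grad F p $ 1 = partial_x (\<lambda>p. F p $ 2) p - \<i> * partial_y (\<lambda>p. F p $ 2) p"
    and "sigma_grad F p $ 2 = partial_x (\<lambda>p. F p $ 1) p + \<i> * partial_y (\<lambda>p. F p $ 1) p"
  by (simp_all add: sigma_grad_def pauli_components partial_nth[OF assms])

lemma sigma_grad_L2:
  assumes F: "F \<in> test_functions UNIV"
  shows "sigma_grad F \<in> L2 lborel"
proof -
  note t = test_functions_partial(1)[OF test_functions_nth[OF F]] test_functions_partial(2)[OF test_functions_nth[OF F]]
  have "(\<lambda>p. sigma_grad F p $ 1) \<in> test_functions UNIV" "(\<lambda>p. sigma_grad F p $ 2) \<in> test_functions UNIV"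
    unfolding sigma_grad_components[OF test_functions_smooth[OF F]]
    by (intro test_functions_UNIV_add test_functions_UNIV_diff test_functions_UNIV_cmult t)+
  then show ?thesis unfolding L2_spinor_iff by (auto intro: test_functions_L2)
qed

lemma nn2_nth_le:
  fixes f :: "'a \<Rightarrow> spinor"
  shows "nn2 M (\<lambda>x. f x $ i) \<le> nn2 M f"
  by (rule nn2_mono) (rule Finite_Cartesian_Product.norm_nth_le)

text \<open>The weak gradient is closed: both sides of its defining identity are continuous in the
  graph norm, and for the approximants the identity is integration by parts.\<close>

lemma weak_sigma_gradI:
  assumes \<Omega>: "\<Omega> \<in> sets borel" and f: "f \<in> L2 (lborel_on \<Omega>)" and g: "g \<in> L2 (lborel_on \<Omega>)"
    and F: "\<And>n::nat. F n \<in> test_functions UNIV"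
    and cf: "(\<lambda>n. nn2 (lborel_on \<Omega>) (\<lambda>p. F n p - f p)) \<longlonglongrightarrow> 0"
    and cg: "(\<lambda>n. nn2 (lborel_on \<Omega>) (\<lambda>p. sigma_grad (F n) p - g p)) \<longlonglongrightarrow> 0"
  shows "weak_sigma_grad \<Omega> f g"
proof -
  have fg: "(\<lambda>p. f p $ i) \<in> L2 (lborel_on \<Omega>)" "(\<lambda>p. g p $ i) \<in> L2 (lborel_on \<Omega>)" for i
    using f g exhaust_2[of i] unfolding L2_spinor_iff by auto
  have FG: "(\<lambda>p. F n p $ i) \<in> L2 (lborel_on \<Omega>)" "(\<lambda>p. sigma_grad (F n) p $ i) \<in> L2 (lborel_on \<Omega>)" for n i
    using L2_restrict[OF test_functions_L2[OF F] \<Omega>] L2_restrict[OF sigma_grad_L2[OF F] \<Omega>] exhaust_2[of i]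
    unfolding L2_spinor_iff by auto
  have ci: "(\<lambda>n. nn2 (lborel_on \<Omega>) (\<lambda>p. F n p $ i - f p $ i)) \<longlonglongrightarrow> 0"
    "(\<lambda>n. nn2 (lborel_on \<Omega>) (\<lambda>p. sigma_grad (F n) p $ i - g p $ i)) \<longlonglongrightarrow> 0" for i
    using ennreal_tendsto_0_bound[OF _ cf] ennreal_tendsto_0_bound[OF _ cg]
      nn2_nth_le[of "lborel_on \<Omega>" "\<lambda>p. F _ p - f p" i] nn2_nth_le[of "lborel_on \<Omega>" "\<lambda>p. sigma_grad (F _) p - g p" i]
    by (simp_all only: vector_minus_component)
  show ?thesis
    unfolding weak_sigma_grad_iff[OF f g \<Omega>]
  proof (intro allI impI conjI)
    fix \<phi> :: "real \<times> real \<Rightarrow> complex" assume \<phi>: "\<phi> \<in> test_functions \<Omega>"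
    have \<phi>': "\<phi> \<in> test_functions UNIV" using \<phi> test_functions_subset by blast
    have t: "u \<in> L2 (lborel_on \<Omega>)" if "u \<in> test_functions \<Omega>" for u :: "real \<times> real \<Rightarrow> complex"
      by (rule L2_restrict[OF test_functions_L2[OF that] \<Omega>])
    have lim: "(\<lambda>n. LINT p|lborel_on \<Omega>. u p * F n p $ i) \<longlonglongrightarrow> (LINT p|lborel_on \<Omega>. u p * f p $ i)"
      "(\<lambda>n. LINT p|lborel_on \<Omega>. u p * sigma_grad (F n) p $ i) \<longlonglongrightarrow> (LINT p|lborel_on \<Omega>. u p * g p $ i)"
      if "u \<in> test_functions \<Omega>" for u i
      using L2_product_tendsto[OF FG(1) fg(1) t[OF that] ci(1)] L2_product_tendsto[OF FG(2) fg(2) t[OF that] ci(2)]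
      by (simp_all only: mult.commute)
    have r: "(LINT p|lborel_on \<Omega>. u p * v p) = (LINT p|lborel. u p * v p)" if "u \<in> test_functions \<Omega>" for u v :: "real \<times> real \<Rightarrow> complex"
      using test_functions_zero_outside[OF that] by (intro test_integral_restrict \<Omega>) simp
    note tn = test_functions_nth[OF F]
    have i: "integrable lborel (\<lambda>p. \<phi> p * v p)" if "v \<in> test_functions UNIV" for v :: "real \<times> real \<Rightarrow> complex"
      by (rule test_functions_integrable[OF test_functions_UNIV_mult[OF test_functions_smooth[OF \<phi>'] that]])
    \<comment> \<open>The test function vanishes outside the region, so the integrals extend to the
      whole plane, where the approximants can be integrated by parts without a boundary
      term.\<close>
    have s1: "(LINT p|lborel_on \<Omega>. \<phi> p * sigma_grad (F n) p $ 1) = - ((LINT p|lborel_on \<Omega>. partial_x \<phi> p * F n p $ 2)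
      - \<i> * (LINT p|lborel_on \<Omega>. partial_y \<phi> p * F n p $ 2))"
      and s2: "(LINT p|lborel_on \<Omega>. \<phi> p * sigma_grad (F n) p $ 2) = - ((LINT p|lborel_on \<Omega>. partial_x \<phi> p * F n p $ 1)
      + \<i> * (LINT p|lborel_on \<Omega>. partial_y \<phi> p * F n p $ 1))" for n
    proof -
      have "(LINT p|lborel. \<phi> p * sigma_grad (F n) p $ 1)
        = (LINT p|lborel. \<phi> p * partial_x (\<lambda>p. F n p $ 2) p + (- \<i>) * (\<phi> p * partial_y (\<lambda>p. F n p $ 2) p))"
        unfolding sigma_grad_components[OF test_functions_smooth[OF F]] by (simp add: algebra_simps)
      also have "\<dots> = (LINT p|lborel. \<phi> p * partial_x (\<lambda>p. F n p $ 2) p) + (- \<i>) * (LINT p|lborel. \<phi> p * partial_y (\<lambda>p. F n p $ 2) p)"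
        by (subst Bochner_Integration.integral_add)
          (intro integrable_mult_right i test_functions_partial tn, intro integrable_mult_right i test_functions_partial tn, simp only: integral_mult_right_zero)
      finally show "(LINT p|lborel_on \<Omega>. \<phi> p * sigma_grad (F n) p $ 1) = - ((LINT p|lborel_on \<Omega>. partial_x \<phi> p * F n p $ 2)
        - \<i> * (LINT p|lborel_on \<Omega>. partial_y \<phi> p * F n p $ 2))"
        unfolding r[OF \<phi>] r[OF test_functions_partial(1)[OF \<phi>]] r[OF test_functions_partial(2)[OF \<phi>]]
          integral_by_parts[OF tn \<phi>'] by simp
      have "(LINT p|lborel. \<phi> p * sigma_grad (F n) p $ 2)
        = (LINT p|lborel. \<phi> p * partial_x (\<lambda>p. F n p $ 1) p + \<i> * (\<phi> p * partial_y (\<lambda>p. F n p $ 1) p))"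
        unfolding sigma_grad_components[OF test_functions_smooth[OF F]] by (simp add: algebra_simps)
      also have "\<dots> = (LINT p|lborel. \<phi> p * partial_x (\<lambda>p. F n p $ 1) p) + \<i> * (LINT p|lborel. \<phi> p * partial_y (\<lambda>p. F n p $ 1) p)"
        by (subst Bochner_Integration.integral_add)
          (intro integrable_mult_right i test_functions_partial tn, intro integrable_mult_right i test_functions_partial tn, simp only: integral_mult_right_zero)
      finally show "(LINT p|lborel_on \<Omega>. \<phi> p * sigma_grad (F n) p $ 2) = - ((LINT p|lborel_on \<Omega>. partial_x \<phi> p * F n p $ 1)
        + \<i> * (LINT p|lborel_on \<Omega>. partial_y \<phi> p * F n p $ 1))"
        unfolding r[OF \<phi>] r[OF test_functions_partial(1)[OF \<phi>]] r[OF test_functions_partial(2)[OF \<phi>]]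
          integral_by_parts[OF tn \<phi>'] by simp
    qed
    note px = test_functions_partial(1)[OF \<phi>] and py = test_functions_partial(2)[OF \<phi>]
    have "(\<lambda>n. LINT p|lborel_on \<Omega>. \<phi> p * sigma_grad (F n) p $ 1) \<longlonglongrightarrow> - ((LINT p|lborel_on \<Omega>. partial_x \<phi> p * f p $ 2)
      - \<i> * (LINT p|lborel_on \<Omega>. partial_y \<phi> p * f p $ 2))"
      unfolding s1 by (intro tendsto_intros lim px py)
    then show "(LINT p|lborel_on \<Omega>. \<phi> p * g p $ 1) = - ((LINT p|lborel_on \<Omega>. partial_x \<phi> p * f p $ 2)
      - \<i> * (LINT p|lborel_on \<Omega>. partial_y \<phi> p * f p $ 2))"
      using lim(2)[OF \<phi>] by (rule LIMSEQ_unique[rotated])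
    have "(\<lambda>n. LINT p|lborel_on \<Omega>. \<phi> p * sigma_grad (F n) p $ 2) \<longlonglongrightarrow> - ((LINT p|lborel_on \<Omega>. partial_x \<phi> p * f p $ 1)
      + \<i> * (LINT p|lborel_on \<Omega>. partial_y \<phi> p * f p $ 1))"
      unfolding s2 by (intro tendsto_intros lim px py)
    then show "(LINT p|lborel_on \<Omega>. \<phi> p * g p $ 2) = - ((LINT p|lborel_on \<Omega>. partial_x \<phi> p * f p $ 1)
      + \<i> * (LINT p|lborel_on \<Omega>. partial_y \<phi> p * f p $ 1))"
      using lim(2)[OF \<phi>] by (rule LIMSEQ_unique[rotated])
  qed
qed

text \<open>\<open>L2_norm\<close> takes the value 0 when its integral diverges; membership in
  \<open>L2\<close> rules this out and makes the two notions of convergence equivalent.\<close>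

lemma L2_norm_tendsto_iff:
  assumes "\<And>n. f n \<in> L2 M"
  shows "(\<lambda>n. L2_norm M (f n)) \<longlonglongrightarrow> 0 \<longleftrightarrow> (\<lambda>n. nn2 M (f n)) \<longlonglongrightarrow> 0"
proof -
  have m: "f n \<in> borel_measurable M" and fin: "nn2 M (f n) < \<infinity>" for n using assms by (auto simp: L2_iff)
  have eq: "nn2 M (f n) = ennreal ((L2_norm M (f n))\<^sup>2)" for n
    using fin[of n] by (simp add: L2_norm_eq[OF m])
  have "(\<lambda>n. nn2 M (f n)) \<longlonglongrightarrow> 0 \<longleftrightarrow> (\<lambda>n. (L2_norm M (f n))\<^sup>2) \<longlonglongrightarrow> 0"
    unfolding eq by (subst ennreal_0[symmetric], subst tendsto_ennreal_iff) auto
  also have "\<dots> \<longleftrightarrow> (\<lambda>n. L2_norm M (f n)) \<longlonglongrightarrow> 0"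
    by (simp add: power_tendsto_0_iff)
  finally show ?thesis by simp
qed

text \<open>The convergence of the trace in H^(-1/2) is expressed through Fourier representatives:
  the difference of \<open>line_restriction (F n)\<close> and \<open>T\<close> is represented by
  that of \<open>ftrace (F n)\<close> and \<open>w\<close>. The elimination rule below reverses this
  translation.\<close>

lemma has_dirichlet_traceI:
  assumes \<Omega>: "\<Omega> \<in> sets borel" and f: "f \<in> L2 (lborel_on \<Omega>)" and g: "g \<in> L2 (lborel_on \<Omega>)"
    and F: "\<And>n::nat. F n \<in> test_functions UNIV"
    and cf: "(\<lambda>n. nn2 (lborel_on \<Omega>) (\<lambda>p. F n p - f p)) \<longlonglongrightarrow> 0"
    and cg: "(\<lambda>n. nn2 (lborel_on \<Omega>) (\<lambda>p. sigma_grad (F n) p - g p)) \<longlonglongrightarrow> 0"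
    and w: "sobolev_rep (- 1 / 2) T w" and ct: "(\<lambda>n. nn2 lborel (\<lambda>k. wt k *\<^sub>R (ftrace (F n) k - w k))) \<longlonglongrightarrow> 0"
  shows "has_dirichlet_trace \<Omega> f T" "weak_sigma_grad \<Omega> f g"
proof -
  show wg: "weak_sigma_grad \<Omega> f g" by (rule weak_sigma_gradI[OF \<Omega> f g F cf cg])
  have L: "(\<lambda>p. F n p - f p) \<in> L2 (lborel_on \<Omega>)" "(\<lambda>p. sigma_grad (F n) p - g p) \<in> L2 (lborel_on \<Omega>)" for n
    by (intro L2_diff f g L2_restrict[OF test_functions_L2[OF F] \<Omega>] L2_restrict[OF sigma_grad_L2[OF F] \<Omega>])+
  note rep = sobolev_rep_diff[OF sobolev_rep_line_restriction[OF F] w]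
  have Lt: "(\<lambda>k. wt k *\<^sub>R (ftrace (F n) k - w k)) \<in> L2 lborel" for n
    using rep[of n] unfolding sobolev_rep_def wt_def by blast
  show "has_dirichlet_trace \<Omega> f T"
    unfolding has_dirichlet_trace_def
  proof (intro conjI exI[of _ g] exI[of _ F] allI)
    show "f \<in> H_sigma \<Omega>" using f wg by (auto simp: H_sigma_def)
    show "T \<in> sobolev (- 1 / 2)" using w by (auto simp: sobolev_def)
    show "(\<lambda>n. L2_norm (lborel_on \<Omega>) (\<lambda>p. F n p - f p)) \<longlonglongrightarrow> 0"
      using L2_norm_tendsto_iff[OF L(1)] cf by simp
    show "(\<lambda>n. L2_norm (lborel_on \<Omega>) (\<lambda>p. sigma_grad (F n) p - g p)) \<longlonglongrightarrow> 0"
      using L2_norm_tendsto_iff[OF L(2)] cg by simp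
    show "(\<lambda>n. sobolev_norm (- 1 / 2) (\<lambda>\<phi>. line_restriction (F n) \<phi> - T \<phi>)) \<longlonglongrightarrow> 0"
      unfolding sobolev_norm_eq[OF rep] using L2_norm_tendsto_iff[OF Lt] ct by simp
  qed (use wg F in auto)
qed

lemma has_dirichlet_traceE:
  assumes "has_dirichlet_trace \<Omega> f T" and \<Omega>: "\<Omega> \<in> sets borel"
  obtains g F w where "f \<in> L2 (lborel_on \<Omega>)" "weak_sigma_grad \<Omega> f g" "\<And>n::nat. F n \<in> test_functions UNIV"
    "(\<lambda>n. nn2 (lborel_on \<Omega>) (\<lambda>p. F n p - f p)) \<longlonglongrightarrow> 0"
    "(\<lambda>n. nn2 (lborel_on \<Omega>) (\<lambda>p. sigma_grad (F n) p - g p)) \<longlonglongrightarrow> 0"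
    "sobolev_rep (- 1 / 2) T w" "(\<lambda>n. nn2 lborel (\<lambda>k. wt k *\<^sub>R (ftrace (F n) k - w k))) \<longlonglongrightarrow> 0"
proof -
  from assms(1) obtain g F where f: "f \<in> H_sigma \<Omega>" and T: "T \<in> sobolev (- 1 / 2)" and g: "weak_sigma_grad \<Omega> f g"
    and F: "\<And>n::nat. F n \<in> test_functions UNIV"
    and cf: "(\<lambda>n. L2_norm (lborel_on \<Omega>) (\<lambda>p. F n p - f p)) \<longlonglongrightarrow> 0"
    and cg: "(\<lambda>n. L2_norm (lborel_on \<Omega>) (\<lambda>p. sigma_grad (F n) p - g p)) \<longlonglongrightarrow> 0"
    and ct: "(\<lambda>n. sobolev_norm (- 1 / 2) (\<lambda>\<phi>. line_restriction (F n) \<phi> - T \<phi>)) \<longlonglongrightarrow> 0"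
    unfolding has_dirichlet_trace_def by blast
  from T obtain w where w: "sobolev_rep (- 1 / 2) T w" by (auto simp: sobolev_def)
  have f2: "f \<in> L2 (lborel_on \<Omega>)" and g2: "g \<in> L2 (lborel_on \<Omega>)"
    using f g by (auto simp: H_sigma_def weak_sigma_grad_def)
  have L: "(\<lambda>p. F n p - f p) \<in> L2 (lborel_on \<Omega>)" "(\<lambda>p. sigma_grad (F n) p - g p) \<in> L2 (lborel_on \<Omega>)" for n
    by (intro L2_diff f2 g2 L2_restrict[OF test_functions_L2[OF F] \<Omega>] L2_restrict[OF sigma_grad_L2[OF F] \<Omega>])+
  note rep = sobolev_rep_diff[OF sobolev_rep_line_restriction[OF F] w]
  have Lt: "(\<lambda>k. wt k *\<^sub>R (ftrace (F n) k - w k)) \<in> L2 lborel" for n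
    using rep[of n] unfolding sobolev_rep_def wt_def by blast
  show thesis
  proof (rule that[OF f2 g F _ _ w])
    show "(\<lambda>n. nn2 (lborel_on \<Omega>) (\<lambda>p. F n p - f p)) \<longlonglongrightarrow> 0" using L2_norm_tendsto_iff[OF L(1)] cf by simp
    show "(\<lambda>n. nn2 (lborel_on \<Omega>) (\<lambda>p. sigma_grad (F n) p - g p)) \<longlonglongrightarrow> 0" using L2_norm_tendsto_iff[OF L(2)] cg by simp
    show "(\<lambda>n. nn2 lborel (\<lambda>k. wt k *\<^sub>R (ftrace (F n) k - w k))) \<longlonglongrightarrow> 0"
      using L2_norm_tendsto_iff[OF Lt] ct unfolding sobolev_norm_eq[OF rep] by simp
  qed
qed

section \<open>Functions orthogonal to all test functions\<close>

lemma box_Pair: "box (a, c) (b, d) = {a<..<b} \<times> {c<..<d :: real}" for a b :: real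
  by (auto simp: mem_box Basis_prod_def)

lemma bump_box_test:
  assumes "a \<le> b" "c \<le> d" "cbox (a, c) (b, d) \<subseteq> \<Omega>"
  shows "(\<lambda>p. complex_of_real (flat 0 (real n * ((fst p - a) * (b - fst p))))
      * complex_of_real (flat 0 (real n * ((snd p - c) * (d - snd p))))) \<in> test_functions \<Omega>" (is "?f \<in> _")
proof -
  have sm: "smooth ?f"
    by (rule smooth_mult[OF smooth_of_real[OF bump_smooth[OF smooth_fst[OF smooth_ident]]]
        smooth_of_real[OF bump_smooth[OF smooth_snd[OF smooth_ident]]]])
  have sub: "support_on UNIV ?f \<subseteq> cbox (a, c) (b, d)"
  proof
    fix p assume "p \<in> support_on UNIV ?f"
    then have "flat 0 (real n * ((fst p - a) * (b - fst p))) \<noteq> 0" "flat 0 (real n * ((snd p - c) * (d - snd p))) \<noteq> 0"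
      by (auto simp: support_on_def)
    note nz = this
    have "fst p \<in> {a..b}"
      using nz(1) bump_le[OF assms(1), of n "fst p"] bump_nonneg[of "real n * ((fst p - a) * (b - fst p))"]
      by (cases "fst p \<in> {a..b}") simp_all
    moreover have "snd p \<in> {c..d}"
      using nz(2) bump_le[OF assms(2), of n "snd p"] bump_nonneg[of "real n * ((snd p - c) * (d - snd p))"]
      by (cases "snd p \<in> {c..d}") simp_all
    ultimately show "p \<in> cbox (a, c) (b, d)" by (cases p) (simp add: cbox_Pair_eq)
  qed
  then have "closure (support_on UNIV ?f) \<subseteq> cbox (a, c) (b, d)" by (intro closure_minimal closed_cbox)
  moreover from this have "compact (closure (support_on UNIV ?f))"
    by (rule compact_closed_subset[OF compact_cbox closed_closure])
  ultimately show ?thesis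
    using sm assms(3) unfolding test_functions_def smooth_def by blast
qed

text \<open>The fundamental lemma of the calculus of variations on a half plane: bump functions give
  orthogonality to indicators of boxes, Dynkin's argument extends it to Borel sets inside a bounded
  box away from the axis, and such boxes exhaust the half plane.\<close>

lemma test_orthogonal_zero:
  fixes h :: "real \<times> real \<Rightarrow> complex"
  assumes h: "h \<in> L2 (lborel_on (half s))" and s: "s = 1 \<or> s = -1"
    and z: "\<And>\<phi>. \<phi> \<in> test_functions (half s) \<Longrightarrow> (LINT p|lborel_on (half s). \<phi> p * h p) = 0"
  shows "AE p in lborel_on (half s). h p = 0"
proof -
  let ?M = "lborel_on (half s)"
  have hm [measurable]: "h \<in> borel_measurable ?M" using h by (simp add: L2_iff)
  have sp: "space ?M = half s" by (simp add: space_restrict_space)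
  have msr: "f \<in> borel_measurable ?M" if "f \<in> borel_measurable borel" for f :: "real \<times> real \<Rightarrow> 'z::topological_space"
    using that by (intro measurable_restrict_space1) simp
  have int: "integrable ?M (\<lambda>p. complex_of_real (indicator (cbox u v) p) * h p)" for u v
  proof (rule L2_product(1)[OF L2_restrict h])
    have "integrable lborel (indicator (cbox u v) :: real \<times> real \<Rightarrow> real)"
      by (rule integrable_real_indicator) (auto simp: emeasure_lborel_cbox_eq)
    moreover have "(norm (complex_of_real (indicator (cbox u v) p)))\<^sup>2 = indicator (cbox u v) p" for p :: "real \<times> real"
      by (simp add: indicator_def)
    ultimately show "(\<lambda>p. complex_of_real (indicator (cbox u v) p)) \<in> L2 lborel" by (simp add: L2_def)
  qed simp
  \<comment> \<open>A nonempty box has to lie in the half plane together with its closure, because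
    the closed box carries the supports of the bumps that approximate the indicator of the open
    one.\<close>
  have zero_box: "(LINT p|?M. complex_of_real (indicator (box (a, c) (b, d)) p) * h p) = 0"
    if sub: "box (a, c) (b, d) = {} \<or> cbox (a, c) (b, d) \<subseteq> half s" for a b c d
  proof (cases "box (a, c) (b, d) = {}")
    case True then show ?thesis by simp
  next
    case False
    then have le: "a \<le> b" "c \<le> d" by (auto simp: box_Pair)
    let ?f = "\<lambda>n p. complex_of_real (flat 0 (real n * ((fst p - a) * (b - fst p))))
      * complex_of_real (flat 0 (real n * ((snd p - c) * (d - snd p))))"
    have t: "?f n \<in> test_functions (half s)" for n
      using sub False by (intro bump_box_test le) auto
    have ind: "indicator (box (a, c) (b, d)) p = (indicator {a<..<b} (fst p) * indicator {c<..<d} (snd p) :: real)"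
      "indicator (cbox (a, c) (b, d)) p = (indicator {a..b} (fst p) * indicator {c..d} (snd p) :: real)" for p :: "real \<times> real"
      by (cases p, simp add: box_Pair cbox_Pair_eq indicator_def)+
    have "(\<lambda>n. LINT p|?M. ?f n p * h p) \<longlonglongrightarrow> (LINT p|?M. complex_of_real (indicator (box (a, c) (b, d)) p) * h p)"
    proof (rule integral_dominated_convergence[where w="\<lambda>p. norm (complex_of_real (indicator (cbox (a, c) (b, d)) p) * h p)"])
      show "integrable ?M (\<lambda>p. norm (complex_of_real (indicator (cbox (a, c) (b, d)) p) * h p))"
        by (rule integrable_norm[OF int])
      show "(\<lambda>p. ?f n p * h p) \<in> borel_measurable ?M" for n
        by (rule borel_measurable_times[OF msr[OF test_functions_measurable[OF t]] hm])
      show "(\<lambda>p. complex_of_real (indicator (box (a, c) (b, d)) p) * h p) \<in> borel_measurable ?M"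
        by (rule borel_measurable_times[OF msr hm]) simp
      have "(\<lambda>n. ?f n p * h p) \<longlonglongrightarrow> (complex_of_real (indicator {a<..<b} (fst p)) * complex_of_real (indicator {c<..<d} (snd p))) * h p" for p
        by (intro tendsto_mult tendsto_const tendsto_of_real bump_tendsto le)
      then show "AE p in ?M. (\<lambda>n. ?f n p * h p) \<longlonglongrightarrow> complex_of_real (indicator (box (a, c) (b, d)) p) * h p"
        unfolding ind of_real_mult by simp
      have "norm (?f n p * h p) \<le> norm (complex_of_real (indicator (cbox (a, c) (b, d)) p) * h p)" for n p
        unfolding ind norm_mult norm_of_real abs_mult using bump_le[OF le(1), of n "fst p"] bump_le[OF le(2), of n "snd p"] bump_nonneg
        by (intro mult_right_mono mult_mono) auto
      then show "AE p in ?M. norm (?f n p * h p) \<le> norm (complex_of_real (indicator (cbox (a, c) (b, d)) p) * h p)" for n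
        by simp
    qed
    then show ?thesis unfolding z[OF t] using LIMSEQ_unique tendsto_const by blast
  qed
  \<comment> \<open>Boxes at distance 1/(n+1) from the axis and reaching out to n+1: their closures
    lie in the open half plane, and together they cover it.\<close>
  define lo hi where "lo n = (if s = 1 then 1 / real (Suc n) else - real (Suc n))"
    and "hi n = (if s = 1 then real (Suc n) else - (1 / real (Suc n)))" for n
  define B where "B n = box (lo n, - real (Suc n)) (hi n, real (Suc n))" for n
  have cB: "cbox (a, c) (b, d) \<subseteq> half s" if "lo n \<le> a" "b \<le> hi n" for a b c d n
  proof
    fix p assume "p \<in> cbox (a, c) (b, d)"
    then have "a \<le> fst p" "fst p \<le> b" by (cases p; simp add: cbox_Pair_eq)+
    then have l: "lo n \<le> fst p" "fst p \<le> hi n" using that by linarith+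
    have pos: "0 < 1 / real (Suc n)" by simp
    from s show "p \<in> half s"
    proof
      assume "s = 1"
      then show ?thesis using less_le_trans[OF pos] l(1) unfolding half_def lo_def by simp
    next
      assume "s = -1"
      then have "fst p \<le> - (1 / real (Suc n))" using l(2) unfolding hi_def by simp
      then have "fst p < 0" using pos by linarith
      then show ?thesis using \<open>s = -1\<close> by (simp add: half_def)
    qed
  qed
  have AE_B: "AE p in ?M. complex_of_real (indicator (B n) p) * h p = 0" for n
  proof -
    have iB: "integrable ?M (\<lambda>p. complex_of_real (indicator (A \<inter> B n) p) * h p)" if "A \<in> sets borel" for A
    proof (rule Bochner_Integration.integrable_bound[OF int[of "(lo n, - real (Suc n))" "(hi n, real (Suc n))"]])
      show "(\<lambda>p. complex_of_real (indicator (A \<inter> B n) p) * h p) \<in> borel_measurable ?M"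
        using that by (intro borel_measurable_times[OF msr hm]) (simp add: B_def)
      show "AE p in ?M. norm (complex_of_real (indicator (A \<inter> B n) p) * h p)
        \<le> norm (complex_of_real (indicator (cbox (lo n, - real (Suc n)) (hi n, real (Suc n))) p) * h p)"
        using box_subset_cbox unfolding B_def by (intro AE_I2) (auto simp: indicator_def norm_mult)
    qed
    let ?G = "range (\<lambda>(a, b). box a b :: (real \<times> real) set)"
    have gen: "sets (borel :: (real \<times> real) measure) = sigma_sets UNIV ?G"
      using arg_cong[OF borel_eq_box[where 'a="real \<times> real"], of sets] by (simp add: sets_measure_of)
    have zA: "(LINT p|?M. complex_of_real (indicator (A \<inter> B n) p) * h p) = 0" if "A \<in> sets borel" for A
    proof -
      have "Int_stable ?G" by (auto simp: Int_stable_def box_Int_box)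
      moreover have "?G \<subseteq> Pow UNIV" by simp
      moreover have "A \<in> sigma_sets UNIV ?G" using that gen by simp
      ultimately show ?thesis
      proof (induct rule: sigma_sets_induct_disjoint)
        case (basic A)
        then obtain a c b d where A: "A = box (a, c) (b, d)" by auto
        have "A \<inter> B n = box (max a (lo n), max c (- real (Suc n))) (min b (hi n), min d (real (Suc n)))"
          unfolding A B_def by (auto simp: box_Pair)
        then show ?case using zero_box cB[of n "max a (lo n)" "min b (hi n)"] by simp
      next
        case empty
        then show ?case by simp
      next
        case (compl A)
        have A: "A \<in> sets borel" using compl(1) gen by simp
        have "(\<lambda>p. complex_of_real (indicator ((UNIV - A) \<inter> B n) p) * h p)
          = (\<lambda>p. complex_of_real (indicator (UNIV \<inter> B n) p) * h p - complex_of_real (indicator (A \<inter> B n) p) * h p)"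
          by (auto simp: indicator_def)
        moreover have "(LINT p|?M. complex_of_real (indicator (UNIV \<inter> B n) p) * h p) = 0"
          unfolding B_def using zero_box cB[of n "lo n" "hi n"] by simp
        ultimately show ?case using iB[OF A] iB[of UNIV] compl(2) by simp
      next
        case (union A)
        have A: "A i \<in> sets borel" for i using union(2) gen by auto
        have "(LINT p:(\<Union>i. A i \<inter> B n \<inter> half s)|?M. h p) = (\<Sum>i. (LINT p:(A i \<inter> B n \<inter> half s)|?M. h p))"
        proof (rule lebesgue_integral_countable_add)
          show "A i \<inter> B n \<inter> half s \<in> sets ?M" for i
            using A[of i] by (auto simp: sets_restrict_space B_def intro!: image_eqI[of _ _ "A i \<inter> B n"])
          show "A i \<inter> B n \<inter> half s \<inter> (A j \<inter> B n \<inter> half s) = {}" if "i \<noteq> j" for i j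
            using union(1) that by (auto simp: disjoint_family_on_def)
          have "integrable ?M (\<lambda>p. complex_of_real (indicator ((\<Union>i. A i) \<inter> B n) p) * h p)"
            using A by (intro iB) auto
          then show "set_integrable ?M (\<Union>i. A i \<inter> B n \<inter> half s) h"
            unfolding set_integrable_def
            by (rule Bochner_Integration.integrable_cong[THEN iffD1, OF refl, rotated])
              (auto simp: sp indicator_def scaleR_conv_of_real)
        qed
        moreover have "(LINT p:(A i \<inter> B n \<inter> half s)|?M. h p) = 0" for i
        proof -
          have "(LINT p:(A i \<inter> B n \<inter> half s)|?M. h p) = (LINT p|?M. complex_of_real (indicator (A i \<inter> B n) p) * h p)"
            unfolding set_lebesgue_integral_def
            by (intro Bochner_Integration.integral_cong refl) (auto simp: sp indicator_def scaleR_conv_of_real)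
          then show ?thesis using union(3) by simp
        qed
        moreover have "(LINT p:(\<Union>i. A i \<inter> B n \<inter> half s)|?M. h p)
          = (LINT p|?M. complex_of_real (indicator ((\<Union>i. A i) \<inter> B n) p) * h p)"
          unfolding set_lebesgue_integral_def
          by (intro Bochner_Integration.integral_cong refl) (auto simp: sp indicator_def scaleR_conv_of_real)
        ultimately show ?case by simp
      qed
    qed
    show ?thesis
    proof (rule sigma_finite_measure.density_zero)
      show "sigma_finite_measure ?M"
        by (rule sigma_finite_measure_restrict_space[OF sigma_finite_lborel]) simp
      show "integrable ?M (\<lambda>p. complex_of_real (indicator (B n) p) * h p)" using iB[of UNIV] by simp
      fix A assume "A \<in> sets ?M"
      then obtain A' where A': "A' \<in> sets borel" "A = half s \<inter> A'" by (auto simp: sets_restrict_space)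
      have "set_lebesgue_integral ?M A (\<lambda>p. complex_of_real (indicator (B n) p) * h p)
        = (LINT p|?M. complex_of_real (indicator (A' \<inter> B n) p) * h p)"
        unfolding set_lebesgue_integral_def A'(2)
        by (intro Bochner_Integration.integral_cong refl) (auto simp: sp indicator_def)
      then show "set_lebesgue_integral ?M A (\<lambda>p. complex_of_real (indicator (B n) p) * h p) = 0"
        using zA[OF A'(1)] by simp
    qed
  qed
  have cover: "\<exists>n. p \<in> B n" if p: "p \<in> half s" for p
  proof -
    define r where "r = max (max \<bar>fst p\<bar> \<bar>snd p\<bar>) (1 / \<bar>fst p\<bar>)"
    obtain n where "r < real n" using reals_Archimedean2 by blast
    then have n: "\<bar>fst p\<bar> < real (Suc n)" "\<bar>snd p\<bar> < real (Suc n)" "1 / \<bar>fst p\<bar> < real (Suc n)" by (auto simp: r_def)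
    have "fst p \<noteq> 0" using p by (auto simp: half_def)
    with n(3) have "1 / real (Suc n) < \<bar>fst p\<bar>" by (simp add: field_simps)
    then have "p \<in> B n"
      using n(1,2) s p unfolding B_def lo_def hi_def half_def by (cases p) (auto simp: box_Pair)
    then show ?thesis ..
  qed
  have "AE p in ?M. \<forall>n. complex_of_real (indicator (B n) p) * h p = 0"
    unfolding AE_all_countable using AE_B by blast
  then show ?thesis
  proof (rule AE_mp, intro AE_I2 impI)
    fix p assume p: "p \<in> space ?M" and a: "\<forall>n. complex_of_real (indicator (B n) p) * h p = 0"
    obtain n where "p \<in> B n" using cover[of p] p unfolding sp by blast
    then show "h p = 0" using a[rule_format, of n] by simp
  qed
qed

lemma weak_sigma_grad_unique:
  assumes f: "f \<in> L2 (lborel_on (half s))" and s: "s = 1 \<or> s = -1"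
    and g: "weak_sigma_grad (half s) f g" and g': "weak_sigma_grad (half s) f g'"
  shows "AE p in lborel_on (half s). g p = g' p"
proof -
  let ?M = "lborel_on (half s)"
  have L: "g \<in> L2 ?M" "g' \<in> L2 ?M" using g g' by (auto simp: weak_sigma_grad_def)
  then have Li: "(\<lambda>p. g p $ i) \<in> L2 ?M" "(\<lambda>p. g' p $ i) \<in> L2 ?M" for i
    using exhaust_2[of i] unfolding L2_spinor_iff by auto
  note w = g[unfolded weak_sigma_grad_iff[OF f L(1) half_measurable]] g'[unfolded weak_sigma_grad_iff[OF f L(2) half_measurable]]
  have "AE p in ?M. g p $ i - g' p $ i = 0" for i
  proof (rule test_orthogonal_zero[OF L2_diff[OF Li] s])
    fix \<phi> :: "real \<times> real \<Rightarrow> complex" assume \<phi>: "\<phi> \<in> test_functions (half s)"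
    have t: "\<phi> \<in> L2 ?M" by (rule L2_restrict[OF test_functions_L2[OF \<phi>] half_measurable])
    have "(LINT p|?M. \<phi> p * g p $ i) = (LINT p|?M. \<phi> p * g' p $ i)"
      using w(1)[rule_format, OF \<phi>] w(2)[rule_format, OF \<phi>] exhaust_2[of i] by auto
    then show "(LINT p|?M. \<phi> p * (g p $ i - g' p $ i)) = 0"
      using L2_product(1)[OF t Li(1)] L2_product(1)[OF t Li(2)] by (simp add: right_diff_distrib)
  qed
  then have "AE p in ?M. \<forall>i. g p $ i - g' p $ i = 0" by (simp add: forall_2)
  then show ?thesis by (rule AE_mp) (auto simp: vec_eq_iff)
qed

section \<open>Superpositions of decaying modes\<close>

lemma efun_measurable:
  assumes [measurable]: "c \<in> borel_measurable borel" "a \<in> borel_measurable borel"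
  shows "efun a c \<in> borel_measurable borel"
proof -
  have "(\<lambda>q. LINT k|lborel. exp (\<i> * of_real (snd q) * of_real k) * (c k * exp (of_real (a k * fst q))))
      \<in> borel_measurable (lborel \<Otimes>\<^sub>M lborel)"
    by (rule lborel.borel_measurable_lebesgue_integral) (simp add: split_beta', measurable)
  then have "efun a c \<in> borel_measurable (lborel \<Otimes>\<^sub>M lborel)"
    unfolding efun_def[abs_def] inv_fourier_def by measurable
  then show ?thesis by (simp add: lborel_prod)
qed

text \<open>The substitution x = s u / a carries both half lines to the standard exponential
  integral over u >= 0; the endpoint is a null set.\<close>

lemma nn_integral_exp_half:
  assumes s: "s = 1 \<or> s = -1" and a: "a > 0"
  shows "(\<integral>\<^sup>+x. indicator {x. 0 < s * x} x * ennreal (exp (- a * (s * x))) \<partial>lborel) = ennreal (1 / a)"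
proof -
  let ?f = "\<lambda>x. indicator {x. 0 < s * x} x * ennreal (exp (- a * (s * x)))"
  have ss: "s * (s * u) = u" for u :: real using s by auto
  have m: "?f \<in> borel_measurable borel" by measurable
  have "(\<integral>\<^sup>+x. ?f x \<partial>lborel) = ennreal \<bar>s / a\<bar> * (\<integral>\<^sup>+u. ?f (0 + s / a * u) \<partial>lborel)"
    using a s by (intro nn_integral_real_affine m) auto
  also have "(\<integral>\<^sup>+u. ?f (0 + s / a * u) \<partial>lborel) = (\<integral>\<^sup>+u. ennreal (u ^ 0 * exp (- u)) * indicator {0..} u \<partial>lborel)"
  proof (rule nn_integral_cong_AE)
    have "AE u in lborel. u \<noteq> (0::real)" by (rule AE_lborel_singleton)
    then show "AE u in lborel. ?f (0 + s / a * u) = ennreal (u ^ 0 * exp (- u)) * indicator {0..} u"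
    proof eventually_elim
      case (elim u)
      have "s * (0 + s / a * u) = u / a" using ss[of "u / a"] by (simp add: mult.assoc)
      moreover have "indicator {x. 0 < s * x} w = (indicator {x. 0 < x} (s * w) :: ennreal)" for w
        by (simp add: indicator_def)
      ultimately have "?f (0 + s / a * u) = indicator {x. 0 < x} (u / a) * ennreal (exp (- a * (u / a)))"
        by (simp only:)
      also have "\<dots> = ennreal (u ^ 0 * exp (- u)) * indicator {0..} u"
        using a elim by (simp add: indicator_def zero_less_divide_iff mult.commute)
      finally show ?case .
    qed
  qed
  also have "\<dots> = 1" using nn_intergal_power_times_exp_Ici[of 0] by simp
  also have "\<bar>s / a\<bar> = 1 / a" using s a by auto
  finally show ?thesis by simp
qed

text \<open>The constant is 3^3: the inequality u/3 \<le> exp(u/3) is cubed.\<close>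

lemma mult_exp_bound: "u > 0 \<Longrightarrow> u ^ 3 * exp (- u) \<le> 27" for u :: real
proof -
  assume u: "u > 0"
  have "u / 3 \<le> exp (u / 3)" using exp_ge_add_one_self[of "u / 3"] by linarith
  then have "(u / 3) ^ 3 \<le> exp (u / 3) ^ 3" using u by (intro power_mono) auto
  also have "exp (u / 3) ^ 3 = exp u" by (simp flip: exp_of_nat_mult)
  finally have "u ^ 3 \<le> 27 * exp u" by (simp add: power_divide)
  then have "u ^ 3 * exp (- u) \<le> 27 * exp u * exp (- u)" by (rule mult_right_mono) simp
  then show ?thesis by (simp add: mult.assoc flip: exp_add)
qed

context shell
begin

text \<open>The weight under which a superposition of the modes exp(-kappa |x|) has finite energy,
  each frequency contributing |c|^2 / (2 kappa). Such a density is in general neither integrable nor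
  square integrable.\<close>

definition dens :: "(real \<Rightarrow> complex) set" where
  "dens = {c. (\<lambda>k. c k / of_real (sqrt (kap k))) \<in> L2 lborel}"

lemma dens_measurable: "c \<in> dens \<Longrightarrow> c \<in> borel_measurable borel"
proof -
  assume "c \<in> dens"
  then have "(\<lambda>k. (c k / of_real (sqrt (kap k))) * of_real (sqrt (kap k))) \<in> borel_measurable borel"
    by (intro borel_measurable_times) (auto simp: dens_def L2_iff)
  moreover have "(c k / of_real (sqrt (kap k))) * of_real (sqrt (kap k)) = c k" for k
    using kap_pos[of k] by simp
  ultimately show ?thesis by simp
qed

lemma kap_exp_bound:
  assumes "v > 0"
  shows "kap k * exp (- 2 * kap k * v) \<le> 27 / (8 * v ^ 3) * (1 / (kap k)\<^sup>2)"
proof -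
  have "(2 * kap k * v) ^ 3 * exp (- (2 * kap k * v)) \<le> 27"
    using kap_pos[of k] assms by (intro mult_exp_bound) simp
  then have "8 * v ^ 3 * (kap k)\<^sup>2 * (kap k * exp (- 2 * kap k * v)) \<le> 27"
    by (simp add: power_mult_distrib power3_eq_cube power2_eq_square mult_ac)
  moreover have "8 * v ^ 3 * (kap k)\<^sup>2 > 0" using kap_pos[of k] assms by simp
  ultimately have "kap k * exp (- 2 * kap k * v) \<le> 27 / (8 * v ^ 3 * (kap k)\<^sup>2)"
    by (simp add: pos_le_divide_eq mult.commute)
  then show ?thesis by simp
qed

text \<open>At positive distance \<open>v\<close> from the line the exponential outweighs the factor
  sqrt(kappa): the function \<open>?e\<close> is square integrable and bounded. Its product with the
  L^2 function \<open>?d\<close> is therefore in L^1, by Cauchy-Schwarz, and in L^2.\<close>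

lemma dens_exp:
  assumes c: "c \<in> dens" and v: "v > 0"
  shows "integrable lborel (\<lambda>k. c k * exp (of_real (- kap k * v)))" "(\<lambda>k. c k * exp (of_real (- kap k * v))) \<in> L2 lborel"
proof -
  have [measurable]: "c \<in> borel_measurable borel" by (rule dens_measurable[OF c])
  let ?d = "\<lambda>k. c k / of_real (sqrt (kap k))" and ?e = "\<lambda>k. complex_of_real (sqrt (kap k) * exp (- kap k * v))"
  have d: "?d \<in> L2 lborel" using c by (simp add: dens_def)
  have eq: "c k * exp (of_real (- kap k * v)) = ?d k * ?e k" for k
    unfolding exp_of_real using kap_pos[of k] by simp
  \<comment> \<open>Kappa times the squared exponential is bounded by a multiple of kappa^(-2),
    which is integrable in k; this is why the cubic bound \<open>mult_exp_bound\<close> is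
    used.\<close>
  have e2: "(cmod (?e k))\<^sup>2 \<le> 27 / (8 * v ^ 3) * (1 / (kap k)\<^sup>2)" for k
  proof -
    have "(cmod (?e k))\<^sup>2 = kap k * exp (- kap k * v) ^ 2"
      using kap_pos[of k] by (simp only: norm_of_real power2_abs power_mult_distrib) (simp add: less_imp_le[OF kap_pos])
    also have "exp (- kap k * v) ^ 2 = exp (- 2 * kap k * v)" by (simp flip: exp_double)
    finally show ?thesis using kap_exp_bound[OF v, of k] by simp
  qed
  have v3: "27 / (8 * v ^ 3) \<ge> 0" using v by simp
  have "integrable lborel (\<lambda>k. (cmod (?e k))\<^sup>2)"
  proof (rule Bochner_Integration.integrable_bound)
    show "integrable lborel (\<lambda>k::real. (27 / (8 * v ^ 3) * (1 / min 1 mu)\<^sup>2) * (1 / (1 + k\<^sup>2)))"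
      by (intro integrable_mult_right integrable_inverse_1_plus)
    have bnd: "(cmod (?e k))\<^sup>2 \<le> (27 / (8 * v ^ 3) * (1 / min 1 mu)\<^sup>2) * (1 / (1 + k\<^sup>2))" for k
    proof -
      have "(1 / kap k)\<^sup>2 \<le> (1 / min 1 mu * (wt k)\<^sup>2)\<^sup>2"
        using kap_pos[of k] by (intro power_mono inverse_kap_le) (simp add: less_imp_le[OF kap_pos])
      also have "\<dots> = (1 / min 1 mu)\<^sup>2 * (1 / (1 + k\<^sup>2))"
        unfolding wt_squared by (simp only: power_mult_distrib power_divide) (simp add: add_nonneg_nonneg)
      finally have "1 / (kap k)\<^sup>2 \<le> (1 / min 1 mu)\<^sup>2 * (1 / (1 + k\<^sup>2))" by (simp add: power_divide)
      from mult_left_mono[OF this v3] e2[of k] show ?thesis by (simp only: mult.assoc)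
    qed
    show "AE k in lborel. norm ((cmod (?e k))\<^sup>2) \<le> norm ((27 / (8 * v ^ 3) * (1 / min 1 mu)\<^sup>2) * (1 / (1 + k\<^sup>2)))"
    proof (rule AE_I2)
      fix k :: real
      show "norm ((cmod (?e k))\<^sup>2) \<le> norm ((27 / (8 * v ^ 3) * (1 / min 1 mu)\<^sup>2) * (1 / (1 + k\<^sup>2)))"
        unfolding real_norm_def abs_of_nonneg[OF zero_le_power2] by (rule order_trans[OF bnd abs_ge_self])
    qed
  qed measurable
  then have e: "?e \<in> L2 lborel" by (simp add: L2_def)
  show "integrable lborel (\<lambda>k. c k * exp (of_real (- kap k * v)))"
    unfolding eq by (rule L2_product(1)[OF d e])
  let ?C = "27 / (8 * v ^ 3) * (1 / mu\<^sup>2)"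
  have C0: "?C \<ge> 0" using v3 mu_pos by simp
  have "cmod (?e k) \<le> sqrt ?C" for k
  proof (rule real_le_rsqrt)
    have "1 / (kap k)\<^sup>2 \<le> 1 / mu\<^sup>2"
      using kap_ge_mu[of k] mu_pos kap_pos[of k] by (intro divide_left_mono power_mono mult_pos_pos zero_less_power) auto
    from mult_left_mono[OF this v3] e2[of k] show "(cmod (?e k))\<^sup>2 \<le> ?C" by linarith
  qed
  then have "norm (?d k * ?e k) \<le> sqrt ?C * norm (?d k)" for k
    unfolding norm_mult[of "?d k"] by (subst mult.commute) (intro mult_right_mono, auto)
  then have "nn2 lborel (\<lambda>k. ?d k * ?e k) \<le> ennreal ((sqrt ?C)\<^sup>2) * nn2 lborel ?d"
    using C0 by (intro nn2_scale_le) auto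
  also have "\<dots> < \<infinity>" using d by (simp add: L2_iff ennreal_mult_less_top)
  finally have "nn2 lborel (\<lambda>k. ?d k * ?e k) < \<infinity>" .
  then show "(\<lambda>k. c k * exp (of_real (- kap k * v))) \<in> L2 lborel"
    unfolding L2_iff eq by simp
qed

text \<open>Plancherel is applied at each x inside the half line, where \<open>dens_exp\<close>
  provides integrability; at x = 0 itself the density may fail to be square integrable.\<close>

lemma energy_efun:
  assumes c: "c \<in> dens" and s: "s = 1 \<or> s = -1"
  shows "nn2 (lborel_on (half s)) (efun (\<lambda>k. - s * kap k) c) = (\<integral>\<^sup>+k. ennreal ((cmod (c k))\<^sup>2 / (2 * kap k)) \<partial>lborel)"
proof -
  have [measurable]: "c \<in> borel_measurable borel" by (rule dens_measurable[OF c])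
  have m: "efun (\<lambda>k. - s * kap k) c \<in> borel_measurable borel" by (intro efun_measurable) measurable
  have x: "indicator {x. 0 < s * x} x * nn2 lborel (\<lambda>y. efun (\<lambda>k. - s * kap k) c (x, y))
    = (\<integral>\<^sup>+k. indicator {x. 0 < s * x} x * ennreal ((cmod (c k))\<^sup>2 * exp (- (2 * kap k) * (s * x))) \<partial>lborel)" for x
  proof (cases "0 < s * x")
    case False then show ?thesis by simp
  next
    case True
    have "(\<lambda>y. efun (\<lambda>k. - s * kap k) c (x, y)) = inv_fourier (\<lambda>k. c k * exp (of_real (- kap k * (s * x))))"
      by (simp add: efun_def fun_eq_iff mult_ac)
    then have "nn2 lborel (\<lambda>y. efun (\<lambda>k. - s * kap k) c (x, y)) = nn2 lborel (\<lambda>k. c k * exp (of_real (- kap k * (s * x))))"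
      by (simp only: plancherel[OF dens_exp[OF c True]])
    also have "\<dots> = (\<integral>\<^sup>+k. ennreal ((cmod (c k))\<^sup>2 * exp (- (2 * kap k) * (s * x))) \<partial>lborel)"
    proof -
      have "exp (- (2 * kap k) * (s * x)) = exp (- kap k * (s * x)) ^ 2" for k
        by (simp flip: exp_double)
      moreover have "cmod (exp (complex_of_real (- kap k * (s * x)))) = exp (- kap k * (s * x))" for k
        by (simp only: exp_of_real norm_of_real abs_exp_cancel)
      ultimately show ?thesis
        unfolding nn2_def norm_mult power_mult_distrib by (simp only:)
    qed
    finally show ?thesis using True by simp
  qed
  have "nn2 (lborel_on (half s)) (efun (\<lambda>k. - s * kap k) c)
    = (\<integral>\<^sup>+x. (\<integral>\<^sup>+k. indicator {x. 0 < s * x} x * ennreal ((cmod (c k))\<^sup>2 * exp (- (2 * kap k) * (s * x))) \<partial>lborel) \<partial>lborel)"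
    unfolding nn2_half[OF m] x ..
  also have "\<dots> = (\<integral>\<^sup>+k. (\<integral>\<^sup>+x. indicator {x. 0 < s * x} x * ennreal ((cmod (c k))\<^sup>2 * exp (- (2 * kap k) * (s * x))) \<partial>lborel) \<partial>lborel)"
    by (rule lborel_pair.Fubini'[symmetric]) (simp add: split_beta', measurable)
  also have "\<dots> = (\<integral>\<^sup>+k. ennreal ((cmod (c k))\<^sup>2 / (2 * kap k)) \<partial>lborel)"
  proof (rule nn_integral_cong)
    fix k
    have "(\<integral>\<^sup>+x. indicator {x. 0 < s * x} x * ennreal ((cmod (c k))\<^sup>2 * exp (- (2 * kap k) * (s * x))) \<partial>lborel)
      = (\<integral>\<^sup>+x. ennreal ((cmod (c k))\<^sup>2) * (indicator {x. 0 < s * x} x * ennreal (exp (- (2 * kap k) * (s * x)))) \<partial>lborel)"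
      by (intro nn_integral_cong) (simp add: ennreal_mult mult_ac)
    also have "\<dots> = ennreal ((cmod (c k))\<^sup>2) * ennreal (1 / (2 * kap k))"
      using nn_integral_exp_half[OF s, of "2 * kap k"] kap_pos[of k] by (subst nn_integral_cmult) auto
    also have "\<dots> = ennreal ((cmod (c k))\<^sup>2 / (2 * kap k))"
      using kap_pos[of k] by (simp flip: ennreal_mult)
    finally show "(\<integral>\<^sup>+x. indicator {x. 0 < s * x} x * ennreal ((cmod (c k))\<^sup>2 * exp (- (2 * kap k) * (s * x))) \<partial>lborel)
      = ennreal ((cmod (c k))\<^sup>2 / (2 * kap k))" .
  qed
  finally show ?thesis .
qed

text \<open>Linearity of the integral presupposes convergence, which the exponential guarantees
  inside the half plane.\<close>

lemma efun_diff:
  assumes c: "c \<in> dens" and d: "d \<in> dens" and p: "p \<in> half s"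
  shows "efun (\<lambda>k. - s * kap k) (\<lambda>k. c k - d k) p = efun (\<lambda>k. - s * kap k) c p - efun (\<lambda>k. - s * kap k) d p"
proof -
  have v: "0 < s * fst p" using p by (simp add: half_def)
  have e: "of_real (- s * kap k * fst p) = complex_of_real (- kap k * (s * fst p))" for k by simp
  show ?thesis
    unfolding efun_def e left_diff_distrib by (rule inv_fourier_diff[OF dens_exp(1)[OF c v] dens_exp(1)[OF d v]])
qed

definition xamp :: "real \<Rightarrow> (real \<Rightarrow> complex) \<Rightarrow> 2 \<Rightarrow> real \<Rightarrow> complex" where
  "xamp s \<xi> i k = \<xi> k * amp s k $ i"

definition fld :: "real \<Rightarrow> (real \<Rightarrow> complex) \<Rightarrow> real \<times> real \<Rightarrow> spinor" where
  "fld s \<xi> p = (\<chi> i. efun (\<lambda>k. - s * kap k) (xamp s \<xi> i) p)"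

lemma amp_continuous: "continuous_on UNIV (\<lambda>k. amp s k $ i)"
proof -
  have "continuous_on UNIV (\<lambda>k. amp s k $ 1)" "continuous_on UNIV (\<lambda>k. amp s k $ 2)"
    unfolding amp_def vector_2 by (intro continuous_intros pm_continuous)+
  then show ?thesis using exhaust_2[of i] by auto
qed

lemma amp_measurable [measurable]: "(\<lambda>k. amp s k $ i) \<in> borel_measurable borel"
  by (rule borel_measurable_continuous_onI[OF amp_continuous])

lemma xamp_bounded_cpt: "\<xi> \<in> bounded_cpt \<Longrightarrow> xamp s \<xi> i \<in> bounded_cpt"
  unfolding xamp_def[abs_def] using bounded_cpt_mult[OF _ amp_continuous] by (simp add: mult.commute)

text \<open>An amplitude has length at most 2 sqrt(kappa), which is exactly compensated by the
  weight in \<open>dens\<close>.\<close>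

lemma xamp_dens:
  assumes "\<xi> \<in> L2 lborel" and s: "s = 1 \<or> s = -1"
  shows "xamp s \<xi> i \<in> dens"
proof -
  have [measurable]: "\<xi> \<in> borel_measurable borel" using assms by (simp add: L2_iff)
  have "\<bar>s\<bar> = 1" using s by auto
  have bd: "norm (xamp s \<xi> i k / of_real (sqrt (kap k))) \<le> 2 * norm (\<xi> k)" for k
  proof -
    have "(norm (amp s k $ i))\<^sup>2 \<le> (norm (amp s k))\<^sup>2"
      by (intro power_mono Finite_Cartesian_Product.norm_nth_le norm_ge_zero)
    also have "\<dots> \<le> (2 * sqrt (kap k))\<^sup>2"
      using amp_norm_le[OF \<open>\<bar>s\<bar> = 1\<close>, of k] kap_pos[of k] by (simp add: power_mult_distrib less_imp_le[OF kap_pos])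
    finally have "norm (amp s k $ i) \<le> 2 * sqrt (kap k)"
      by (rule power2_le_imp_le) (simp add: less_imp_le[OF kap_pos])
    then have "norm (amp s k $ i) / sqrt (kap k) \<le> 2" using kap_pos[of k] by (simp add: divide_le_eq)
    from mult_left_mono[OF this, of "norm (\<xi> k)"] show ?thesis
      using kap_pos[of k] by (simp add: xamp_def norm_mult norm_divide less_imp_le[OF kap_pos] mult.commute)
  qed
  have "nn2 lborel (\<lambda>k. xamp s \<xi> i k / of_real (sqrt (kap k))) \<le> ennreal (2\<^sup>2) * nn2 lborel \<xi>"
    by (intro nn2_scale_le bd) auto
  also have "\<dots> < \<infinity>" using assms by (simp add: L2_iff ennreal_mult_less_top)
  finally show ?thesis unfolding dens_def L2_iff xamp_def by simp
qed

lemma fld_measurable: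
  assumes [measurable]: "\<xi> \<in> borel_measurable borel"
  shows "fld s \<xi> \<in> borel_measurable borel"
proof (rule spinor_measurableI)
  have "efun (\<lambda>k. - s * kap k) (xamp s \<xi> i) \<in> borel_measurable borel" for i
    by (intro efun_measurable) (auto simp: xamp_def[abs_def])
  then show "(\<lambda>p. fld s \<xi> p $ 1) \<in> borel_measurable borel" "(\<lambda>p. fld s \<xi> p $ 2) \<in> borel_measurable borel"
    by (simp_all add: fld_def)
qed

lemma fld_energy:
  assumes \<xi>: "\<xi> \<in> L2 lborel" and s: "s = 1 \<or> s = -1"
  shows "nn2 (lborel_on (half s)) (fld s \<xi>) = (\<integral>\<^sup>+k. ennreal ((cmod (\<xi> k))\<^sup>2 * ((norm (amp s k))\<^sup>2 / (2 * kap k))) \<partial>lborel)"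
proof -
  have [measurable]: "\<xi> \<in> borel_measurable borel" using assms by (simp add: L2_iff)
  have "nn2 (lborel_on (half s)) (fld s \<xi>)
    = nn2 (lborel_on (half s)) (\<lambda>p. fld s \<xi> p $ 1) + nn2 (lborel_on (half s)) (\<lambda>p. fld s \<xi> p $ 2)"
    by (rule nn2_spinor) (intro measurable_restrict_space1, simp add: fld_measurable)
  also have "\<dots> = (\<integral>\<^sup>+k. ennreal ((cmod (xamp s \<xi> 1 k))\<^sup>2 / (2 * kap k)) \<partial>lborel)
    + (\<integral>\<^sup>+k. ennreal ((cmod (xamp s \<xi> 2 k))\<^sup>2 / (2 * kap k)) \<partial>lborel)"
    by (simp only: fld_def vec_lambda_beta energy_efun[OF xamp_dens[OF \<xi> s] s])
  also have "\<dots> = (\<integral>\<^sup>+k. ennreal ((cmod (xamp s \<xi> 1 k))\<^sup>2 / (2 * kap k)) + ennreal ((cmod (xamp s \<xi> 2 k))\<^sup>2 / (2 * kap k)) \<partial>lborel)"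
    by (rule nn_integral_add[symmetric]) (auto simp: xamp_def)
  also have "\<dots> = (\<integral>\<^sup>+k. ennreal ((cmod (\<xi> k))\<^sup>2 * ((norm (amp s k))\<^sup>2 / (2 * kap k))) \<partial>lborel)"
  proof (rule nn_integral_cong)
    fix k
    have "(cmod (xamp s \<xi> 1 k))\<^sup>2 / (2 * kap k) + (cmod (xamp s \<xi> 2 k))\<^sup>2 / (2 * kap k)
      = (cmod (\<xi> k))\<^sup>2 * ((norm (amp s k))\<^sup>2 / (2 * kap k))"
      unfolding spinor_norm xamp_def norm_mult power_mult_distrib by (simp add: add_divide_distrib distrib_left)
    then show "ennreal ((cmod (xamp s \<xi> 1 k))\<^sup>2 / (2 * kap k)) + ennreal ((cmod (xamp s \<xi> 2 k))\<^sup>2 / (2 * kap k))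
      = ennreal ((cmod (\<xi> k))\<^sup>2 * ((norm (amp s k))\<^sup>2 / (2 * kap k)))"
      using kap_pos[of k] by (subst ennreal_plus[symmetric]) (auto simp: less_imp_le[OF kap_pos])
  qed
  finally show ?thesis .
qed

lemma fld_energy_le:
  assumes \<xi>: "\<xi> \<in> L2 lborel" and s: "s = 1 \<or> s = -1"
  shows "nn2 (lborel_on (half s)) (fld s \<xi>) \<le> 2 * nn2 lborel \<xi>"
proof -
  have [measurable]: "\<xi> \<in> borel_measurable borel" using assms by (simp add: L2_iff)
  have d: "\<bar>s\<bar> = 1" using s by auto
  have "nn2 (lborel_on (half s)) (fld s \<xi>) \<le> (\<integral>\<^sup>+k. 2 * ennreal ((cmod (\<xi> k))\<^sup>2) \<partial>lborel)"
    unfolding fld_energy[OF assms]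
  proof (rule nn_integral_mono)
    fix k
    have "(norm (amp s k))\<^sup>2 / (2 * kap k) \<le> 2"
      using amp_norm_le[OF d, of k] kap_pos[of k] by (simp add: divide_le_eq)
    then have "(cmod (\<xi> k))\<^sup>2 * ((norm (amp s k))\<^sup>2 / (2 * kap k)) \<le> (cmod (\<xi> k))\<^sup>2 * 2" by (rule mult_left_mono) simp
    then have "ennreal ((cmod (\<xi> k))\<^sup>2 * ((norm (amp s k))\<^sup>2 / (2 * kap k))) \<le> ennreal (2 * (cmod (\<xi> k))\<^sup>2)"
      by (intro ennreal_leI) simp
    then show "ennreal ((cmod (\<xi> k))\<^sup>2 * ((norm (amp s k))\<^sup>2 / (2 * kap k))) \<le> 2 * ennreal ((cmod (\<xi> k))\<^sup>2)"
      by (simp add: ennreal_mult)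
  qed
  then show ?thesis by (simp add: nn2_def nn_integral_cmult)
qed

lemma fld_L2:
  assumes \<xi>: "\<xi> \<in> L2 lborel" and s: "s = 1 \<or> s = -1"
  shows "fld s \<xi> \<in> L2 (lborel_on (half s))"
  unfolding L2_iff
proof
  show "fld s \<xi> \<in> borel_measurable (lborel_on (half s))"
    using \<xi> by (intro measurable_restrict_space1) (simp add: fld_measurable L2_iff)
  have "2 * nn2 lborel \<xi> < \<infinity>" using \<xi> by (simp add: L2_iff ennreal_mult_less_top)
  then show "nn2 (lborel_on (half s)) (fld s \<xi>) < \<infinity>"
    by (rule le_less_trans[OF fld_energy_le[OF \<xi> s]])
qed

lemma fld_diff:
  assumes "\<xi> \<in> L2 lborel" "\<zeta> \<in> L2 lborel" "s = 1 \<or> s = -1" "p \<in> half s"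
  shows "fld s (\<lambda>k. \<xi> k - \<zeta> k) p = fld s \<xi> p - fld s \<zeta> p"
proof -
  have x: "xamp s (\<lambda>k. \<xi> k - \<zeta> k) i = (\<lambda>k. xamp s \<xi> i k - xamp s \<zeta> i k)" for i
    by (simp add: xamp_def fun_eq_iff left_diff_distrib)
  show ?thesis
    unfolding fld_def vec_eq_iff x vector_minus_component vec_lambda_beta
    by (intro allI) (rule efun_diff[OF xamp_dens[OF assms(1,3)] xamp_dens[OF assms(2,3)] assms(4)])
qed

section \<open>Classical solutions with bounded densities\<close>

lemma efun_partial:
  assumes c: "c \<in> bounded_cpt"
  shows "partial_x (efun (\<lambda>k. - s * kap k) c) p = efun (\<lambda>k. - s * kap k) (\<lambda>k. of_real (- s * kap k) * c k) p"
    and "partial_y (efun (\<lambda>k. - s * kap k) c) p = efun (\<lambda>k. - s * kap k) (\<lambda>k. \<i> * of_real k * c k) p"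
proof -
  have "continuous_on UNIV (\<lambda>k. - s * kap k)" by (intro continuous_intros kap_continuous)
  note e = frechet_derivative_at[OF efun_has_derivative[OF c this], symmetric]
  show "partial_x (efun (\<lambda>k. - s * kap k) c) p = efun (\<lambda>k. - s * kap k) (\<lambda>k. of_real (- s * kap k) * c k) p"
    "partial_y (efun (\<lambda>k. - s * kap k) c) p = efun (\<lambda>k. - s * kap k) (\<lambda>k. \<i> * of_real k * c k) p"
    unfolding partial_x_def partial_y_def e by simp_all
qed

lemma efun_bounded_cpt_lincomb:
  assumes c: "c \<in> bounded_cpt" and d: "d \<in> bounded_cpt" and e: "e \<in> bounded_cpt"
    and a: "continuous_on UNIV a"
  shows "efun a c p + (\<beta> * efun a d p + \<gamma> * efun a e p) = efun a (\<lambda>k. c k + (\<beta> * d k + \<gamma> * e k)) p"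
proof -
  have i: "integrable lborel (\<lambda>k. u k * exp (of_real (a k * fst p)))" if "u \<in> bounded_cpt" for u
  proof -
    have "continuous_on UNIV (\<lambda>k. exp (complex_of_real (a k * fst p)))" by (intro continuous_intros a)
    from bounded_cpt_integrable(1)[OF bounded_cpt_mult[OF that this]] show ?thesis by (simp only: mult.commute)
  qed
  have "efun a (\<lambda>k. c k + (\<beta> * d k + \<gamma> * e k)) p = inv_fourier (\<lambda>k. c k * exp (of_real (a k * fst p))
      + (\<beta> * (d k * exp (of_real (a k * fst p))) + \<gamma> * (e k * exp (of_real (a k * fst p))))) (snd p)"
    unfolding efun_def by (simp add: algebra_simps)
  also have "\<dots> = efun a c p + (\<beta> * efun a d p + \<gamma> * efun a e p)"
    using i[OF c] i[OF d] i[OF e]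
    by (simp add: inv_fourier_add inv_fourier_cmult efun_def)
  finally show ?thesis by simp
qed

lemma fld_smooth: "\<xi> \<in> bounded_cpt \<Longrightarrow> smooth (\<lambda>p. fld s \<xi> p $ i)"
proof -
  assume "\<xi> \<in> bounded_cpt"
  have "continuous_on UNIV (\<lambda>k. - s * kap k)" by (intro continuous_intros kap_continuous)
  from efun_smooth[OF xamp_bounded_cpt[OF \<open>\<xi> \<in> bounded_cpt\<close>] this] show ?thesis
    by (simp add: fld_def)
qed

text \<open>The wave exp(-s kappa x + i k y) with amplitude \<open>amp s k\<close> solves the
  equation. Once m s1 s2 is replaced by \<open>pm s k * pm (- s) k\<close>, both components reduce
  to the values of the squares of \<open>pm\<close>.\<close>

lemma amp_symbol:
  assumes "\<bar>s\<bar> = 1"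
  shows "of_real (- s * kap k) * amp s k $ 2 + ((- \<i>) * (\<i> * of_real k * amp s k $ 2) + (- \<i> * of_real (zs - m)) * amp s k $ 1) = 0"
    and "of_real (- s * kap k) * amp s k $ 1 + (\<i> * (\<i> * of_real k * amp s k $ 1) + (- \<i> * of_real (zs + m)) * amp s k $ 2) = 0"
proof -
  let ?A = "pm s k" and ?B = "pm (- s) k"
  have AB: "?A * ?B = mu" by (rule pm_prod[OF assms])
  have A2: "?A * ?A = kap k - s * k" and B2: "?B * ?B = kap k + s * k"
    using pm_squared[OF assms, of k] pm_squared[of "- s" k] assms by (simp_all add: power2_eq_square)
  have ss: "s * s = 1" using assms by (metis abs_mult_self_eq mult_1)
  have "(- s * kap k) * (s * s2 * ?B) + k * (s * s2 * ?B) + m * s2\<^sup>2 * (s1 * ?A)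
    = s2 * (- (s * s) * kap k * ?B + s * k * ?B + (m * s1 * s2) * ?A)"
    by (simp add: power2_eq_square algebra_simps)
  also have "\<dots> = s2 * (- kap k * ?B + s * k * ?B + (?A * ?A) * ?B)"
    unfolding ss mu_eq[symmetric] AB[symmetric] by (simp add: algebra_simps)
  also have "\<dots> = 0" unfolding A2 by (simp add: algebra_simps)
  finally have 1: "(- s * kap k) * (s * s2 * ?B) + k * (s * s2 * ?B) + m * s2\<^sup>2 * (s1 * ?A) = 0" .
  have "of_real (- s * kap k) * amp s k $ 2 + ((- \<i>) * (\<i> * of_real k * amp s k $ 2) + (- \<i> * of_real (zs - m)) * amp s k $ 1)
    = \<i> * of_real ((- s * kap k) * (s * s2 * ?B) + k * (s * s2 * ?B) + m * s2\<^sup>2 * (s1 * ?A))"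
    unfolding zs_minus amp_def vector_2 by (simp add: algebra_simps)
  then show "of_real (- s * kap k) * amp s k $ 2 + ((- \<i>) * (\<i> * of_real k * amp s k $ 2) + (- \<i> * of_real (zs - m)) * amp s k $ 1) = 0"
    unfolding 1 by simp
  have "(- s * kap k) * (s1 * ?A) - k * (s1 * ?A) + m * s1\<^sup>2 * (s * s2 * ?B)
    = s1 * (- s * kap k * ?A - k * ?A + s * (m * s1 * s2) * ?B)"
    by (simp add: power2_eq_square algebra_simps)
  also have "\<dots> = s1 * (- s * kap k * ?A - k * ?A + s * (?B * ?B) * ?A)"
    unfolding mu_eq[symmetric] AB[symmetric] by (simp add: algebra_simps)
  also have "\<dots> = s1 * ?A * ((s * s - 1) * k)" unfolding B2 by (simp add: algebra_simps)
  also have "\<dots> = 0" unfolding ss by simp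
  finally have 2: "(- s * kap k) * (s1 * ?A) - k * (s1 * ?A) + m * s1\<^sup>2 * (s * s2 * ?B) = 0" .
  have "of_real (- s * kap k) * amp s k $ 1 + (\<i> * (\<i> * of_real k * amp s k $ 1) + (- \<i> * of_real (zs + m)) * amp s k $ 2)
    = of_real ((- s * kap k) * (s1 * ?A) - k * (s1 * ?A) + m * s1\<^sup>2 * (s * s2 * ?B))"
    unfolding zs_plus amp_def vector_2 by (simp add: algebra_simps)
  then show "of_real (- s * kap k) * amp s k $ 1 + (\<i> * (\<i> * of_real k * amp s k $ 1) + (- \<i> * of_real (zs + m)) * amp s k $ 2) = 0"
    unfolding 2 by simp
qed

lemma fld_equation:
  assumes \<xi>: "\<xi> \<in> bounded_cpt" and s: "\<bar>s\<bar> = 1"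
  shows "partial_x (\<lambda>p. fld s \<xi> p $ 2) p
      + ((- \<i>) * partial_y (\<lambda>p. fld s \<xi> p $ 2) p + (- \<i> * of_real (zs - m)) * fld s \<xi> p $ 1) = 0"
    and "partial_x (\<lambda>p. fld s \<xi> p $ 1) p
      + (\<i> * partial_y (\<lambda>p. fld s \<xi> p $ 1) p + (- \<i> * of_real (zs + m)) * fld s \<xi> p $ 2) = 0"
proof -
  let ?a = "\<lambda>k. - s * kap k"
  have a: "continuous_on UNIV ?a" by (intro continuous_intros kap_continuous)
  have ac: "continuous_on UNIV (\<lambda>k. complex_of_real (- s * kap k))" by (intro continuous_intros kap_continuous)
  have kc: "continuous_on UNIV (\<lambda>k. \<i> * complex_of_real k)" by (intro continuous_intros)
  note x = xamp_bounded_cpt[OF \<xi>, of s]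
  note b1 = bounded_cpt_mult[OF x ac] and b2 = bounded_cpt_mult[OF x kc]
  have f: "(\<lambda>p. fld s \<xi> p $ i) = efun ?a (xamp s \<xi> i)" for i by (simp add: fld_def)
  have fp: "fld s \<xi> p $ i = efun ?a (xamp s \<xi> i) p" for i by (simp add: fld_def)
  have z: "efun ?a (\<lambda>k. \<xi> k * u k) p = 0" if "\<And>k. u k = 0" for u
    by (simp add: that efun_def inv_fourier_def)
  show "partial_x (\<lambda>p. fld s \<xi> p $ 2) p
      + ((- \<i>) * partial_y (\<lambda>p. fld s \<xi> p $ 2) p + (- \<i> * of_real (zs - m)) * fld s \<xi> p $ 1) = 0"
    unfolding f fp efun_partial[OF x] efun_bounded_cpt_lincomb[OF b1 b2 x a]
    using z[OF amp_symbol(1)[OF s]] by (simp only: xamp_def distrib_left mult.left_commute[of "\<xi> _"] mult.assoc)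
  show "partial_x (\<lambda>p. fld s \<xi> p $ 1) p
      + (\<i> * partial_y (\<lambda>p. fld s \<xi> p $ 1) p + (- \<i> * of_real (zs + m)) * fld s \<xi> p $ 2) = 0"
    unfolding f fp efun_partial[OF x] efun_bounded_cpt_lincomb[OF b1 b2 x a]
    using z[OF amp_symbol(2)[OF s]] by (simp only: xamp_def distrib_left mult.left_commute[of "\<xi> _"] mult.assoc)
qed

end

section \<open>Truncated densities and cut-offs in the plane\<close>

lemma test_functions_spinorI:
  fixes F :: "'a::euclidean_space \<Rightarrow> spinor"
  assumes "\<And>i. (\<lambda>p. F p $ i) \<in> test_functions UNIV"
  shows "F \<in> test_functions UNIV"
proof -
  let ?L = "\<lambda>i z. (\<chi> j. if j = i then z else 0) :: spinor"
  have L: "bounded_linear (?L i)" for i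
    by (intro linear_conv_bounded_linear[THEN iffD1] linearI) (auto simp: vec_eq_iff)
  have eq: "F = (\<lambda>p. ?L 1 (F p $ 1) + ?L 2 (F p $ 2))"
    by (auto simp: fun_eq_iff vec_eq_iff forall_2)
  have "smooth (\<lambda>p. ?L 1 (F p $ 1) + ?L 2 (F p $ 2))"
    by (rule smooth_add; rule smooth_linear[OF L test_functions_smooth[OF assms]])
  then have "smooth F" using eq by simp
  moreover have "{p. F p \<noteq> 0} \<subseteq> {p. F p $ 1 \<noteq> 0} \<union> {p. F p $ 2 \<noteq> 0}"
    by (auto simp: vec_eq_iff forall_2)
  then have "bounded {p. F p \<noteq> 0}"
    by (rule bounded_subset[rotated]) (use test_functions_bounded_support[OF assms] in \<open>simp add: bounded_Un\<close>)
  ultimately show ?thesis by (simp add: test_functions_UNIV_iff)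
qed

text \<open>Both the frequency and the modulus are truncated, which puts an arbitrary measurable
  density into \<open>bounded_cpt\<close>.\<close>

definition truncate :: "nat \<Rightarrow> (real \<Rightarrow> complex) \<Rightarrow> real \<Rightarrow> complex" where
  "truncate n \<xi> k = (if \<bar>k\<bar> \<le> real n \<and> cmod (\<xi> k) \<le> real n then \<xi> k else 0)"

lemma truncate_bounded_cpt:
  assumes [measurable]: "\<xi> \<in> borel_measurable borel"
  shows "truncate n \<xi> \<in> bounded_cpt"
proof -
  have "truncate n \<xi> \<in> borel_measurable borel" unfolding truncate_def[abs_def] by measurable
  moreover have "\<forall>k. cmod (truncate n \<xi> k) \<le> real n \<and> (real n < \<bar>k\<bar> \<longrightarrow> truncate n \<xi> k = 0)"
    by (simp add: truncate_def)
  ultimately show ?thesis unfolding bounded_cpt_def by blast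
qed

lemma truncate_tendsto:
  assumes \<xi>: "\<xi> \<in> L2 lborel"
  shows "(\<lambda>n. nn2 lborel (\<lambda>k. truncate n \<xi> k - \<xi> k)) \<longlonglongrightarrow> 0"
proof -
  have [measurable]: "\<xi> \<in> borel_measurable borel" using \<xi> by (simp add: L2_iff)
  have "(\<lambda>n. nn2 lborel (\<lambda>k. truncate n \<xi> k - \<xi> k)) \<longlonglongrightarrow> (\<integral>\<^sup>+k. 0 \<partial>(lborel::real measure))"
    unfolding nn2_def
  proof (rule nn_integral_dominated_convergence[where w="\<lambda>k. ennreal ((cmod (\<xi> k))\<^sup>2)"])
    show "(\<lambda>k. ennreal ((norm (truncate n \<xi> k - \<xi> k))\<^sup>2)) \<in> borel_measurable lborel" for n
      unfolding truncate_def by measurable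
    have "(norm (truncate n \<xi> k - \<xi> k))\<^sup>2 \<le> (cmod (\<xi> k))\<^sup>2" for n k by (simp add: truncate_def)
    then show "AE k in lborel. ennreal ((norm (truncate n \<xi> k - \<xi> k))\<^sup>2) \<le> ennreal ((cmod (\<xi> k))\<^sup>2)" for n
      by (intro AE_I2 ennreal_leI)
    show "(\<integral>\<^sup>+k. ennreal ((cmod (\<xi> k))\<^sup>2) \<partial>lborel) < \<infinity>" using \<xi> by (simp add: L2_iff nn2_def)
    have "(\<lambda>n. ennreal ((norm (truncate n \<xi> k - \<xi> k))\<^sup>2)) \<longlonglongrightarrow> 0" for k
    proof (rule tendsto_eventually)
      obtain N where "max \<bar>k\<bar> (cmod (\<xi> k)) \<le> real N" using real_arch_simple by blast
      then show "\<forall>\<^sub>F n in sequentially. ennreal ((norm (truncate n \<xi> k - \<xi> k))\<^sup>2) = 0"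
        unfolding eventually_sequentially by (intro exI[of _ N]) (auto simp: truncate_def)
    qed
    then show "AE k in lborel. (\<lambda>n. ennreal ((norm (truncate n \<xi> k - \<xi> k))\<^sup>2)) \<longlonglongrightarrow> 0" by simp
  qed auto
  then show ?thesis by simp
qed

definition cut2 :: "nat \<Rightarrow> real \<times> real \<Rightarrow> real" where
  "cut2 n p = cut (real (Suc n)) (fst p) * cut (real (Suc n)) (snd p)"

lemma cut2_test: "(\<lambda>p. complex_of_real (cut2 n p)) \<in> test_functions UNIV"
proof -
  have "smooth (\<lambda>p. complex_of_real (cut2 n p))"
    unfolding cut2_def
    by (rule smooth_of_real[OF smooth_mult[OF smooth_compose_real[OF smooth_cut smooth_fst[OF smooth_ident]]
        smooth_compose_real[OF smooth_cut smooth_snd[OF smooth_ident]]]])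
  moreover have "bounded {p. complex_of_real (cut2 n p) \<noteq> 0}"
  proof (rule boundedI[where B="real (Suc n) + real (Suc n)"])
    fix p assume "p \<in> {p. complex_of_real (cut2 n p) \<noteq> 0}"
    then have "cut (real (Suc n)) (fst p) \<noteq> 0" "cut (real (Suc n)) (snd p) \<noteq> 0" by (auto simp: cut2_def)
    then have "\<bar>fst p\<bar> \<le> real (Suc n)" "\<bar>snd p\<bar> \<le> real (Suc n)"
      using cut_zero[of "real (Suc n)" "fst p"] cut_zero[of "real (Suc n)" "snd p"] by (meson linear of_nat_0_less_iff zero_less_Suc)+
    then show "norm p \<le> real (Suc n) + real (Suc n)"
      using norm_Pair_le[of "fst p" "snd p"] by simp
  qed
  ultimately show ?thesis by (simp add: test_functions_UNIV_iff)
qed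

lemma cut2_partial_bound:
  obtains C where "C > 0" "\<And>n p. cmod (partial_x (\<lambda>p. complex_of_real (cut2 n p)) p) \<le> C / real (Suc n)"
    "\<And>n p. cmod (partial_y (\<lambda>p. complex_of_real (cut2 n p)) p) \<le> C / real (Suc n)"
proof -
  obtain C where C: "C > 0" "\<And>R x. R > 0 \<Longrightarrow> \<bar>deriv (cut R) x\<bar> \<le> C / R"
    "\<And>R x. (cut R has_real_derivative deriv (cut R) x) (at x)" using cut_derivative_bound by blast
  note sm = test_functions_smooth[OF cut2_test]
  have x: "partial_x (\<lambda>p. complex_of_real (cut2 n p)) (a, b) = of_real (deriv (cut (real (Suc n))) a * cut (real (Suc n)) b)"
    and y: "partial_y (\<lambda>p. complex_of_real (cut2 n p)) (a, b) = of_real (cut (real (Suc n)) a * deriv (cut (real (Suc n))) b)" for n a b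
  proof -
    have "((\<lambda>a. complex_of_real (cut (real (Suc n)) a * cut (real (Suc n)) b)) has_vector_derivative
        of_real (deriv (cut (real (Suc n))) a * cut (real (Suc n)) b)) (at a)"
      using DERIV_cmult_right[OF C(3)[of "real (Suc n)" a], of "cut (real (Suc n)) b"]
      by (intro has_vector_derivative_of_real) (simp only: has_real_derivative_iff_has_vector_derivative)
    from vector_derivative_unique_at[OF slice_has_derivative(2)[OF sm[of n], where x=a and y=b, unfolded cut2_def fst_conv snd_conv] this]
    show "partial_x (\<lambda>p. complex_of_real (cut2 n p)) (a, b) = of_real (deriv (cut (real (Suc n))) a * cut (real (Suc n)) b)"
      unfolding cut2_def .
    have "((\<lambda>b. complex_of_real (cut (real (Suc n)) a * cut (real (Suc n)) b)) has_vector_derivative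
        of_real (cut (real (Suc n)) a * deriv (cut (real (Suc n))) b)) (at b)"
      using DERIV_cmult[OF C(3)[of "real (Suc n)" b], of "cut (real (Suc n)) a"]
      by (intro has_vector_derivative_of_real) (simp only: has_real_derivative_iff_has_vector_derivative)
    from vector_derivative_unique_at[OF slice_has_derivative(1)[OF sm[of n], where x=a and y=b, unfolded cut2_def fst_conv snd_conv] this]
    show "partial_y (\<lambda>p. complex_of_real (cut2 n p)) (a, b) = of_real (cut (real (Suc n)) a * deriv (cut (real (Suc n))) b)"
      unfolding cut2_def .
  qed
  have c: "\<bar>cut R u\<bar> \<le> 1" for R u using cut_nonneg[of R u] cut_le_1[of R u] by simp
  have d: "\<bar>deriv (cut (real (Suc n))) u\<bar> \<le> C / real (Suc n)" for n u by (rule C(2)) simp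
  have C0: "0 \<le> C / real (Suc n)" for n using C(1) by simp
  show thesis
  proof (rule that[OF C(1)])
    show "cmod (partial_x (\<lambda>p. complex_of_real (cut2 n p)) p) \<le> C / real (Suc n)" for n p
      using mult_mono[OF d[of n "fst p"] c[of "real (Suc n)" "snd p"] C0 abs_ge_zero] x[of n "fst p" "snd p"]
      by (simp only: prod.collapse norm_of_real abs_mult mult_1_right)
    show "cmod (partial_y (\<lambda>p. complex_of_real (cut2 n p)) p) \<le> C / real (Suc n)" for n p
      using mult_mono[OF c[of "real (Suc n)" "fst p"] d[of n "snd p"] zero_le_one abs_ge_zero] y[of n "fst p" "snd p"]
      by (simp only: prod.collapse norm_of_real abs_mult mult_1_left)
  qed
qed

context shell
begin

text \<open>Kappa is at most |k| + mu; this is the comparison opposite to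
  \<open>inverse_kap_le\<close>.\<close>

lemma kap_wt: "kap k * (wt k)\<^sup>2 \<le> 1 + mu"
proof -
  have p: "sqrt (1 + k\<^sup>2) > 0" by (simp add: add_pos_nonneg)
  have "kap k \<le> \<bar>k\<bar> + mu" unfolding kap_eq using sqrt_add_le_add_sqrt[of "k\<^sup>2" "mu\<^sup>2"] mu_pos by simp
  also have "\<bar>k\<bar> \<le> sqrt (1 + k\<^sup>2)" by (rule real_le_rsqrt) simp
  also have "mu \<le> mu * sqrt (1 + k\<^sup>2)" using mu_pos by simp
  finally have "kap k \<le> (1 + mu) * sqrt (1 + k\<^sup>2)" by (simp add: algebra_simps)
  then show ?thesis using p by (simp add: wt_squared divide_le_eq)
qed

definition cfld :: "real \<Rightarrow> (real \<Rightarrow> complex) \<Rightarrow> nat \<Rightarrow> real \<times> real \<Rightarrow> spinor" where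
  "cfld s \<xi> n p = of_real (cut2 n p) *s fld s \<xi> p"

lemma cfld_nth: "(\<lambda>p. cfld s \<xi> n p $ i) = (\<lambda>p. of_real (cut2 n p) * fld s \<xi> p $ i)"
  by (simp add: cfld_def)

lemma cfld_test:
  assumes "\<xi> \<in> bounded_cpt"
  shows "cfld s \<xi> n \<in> test_functions UNIV"
proof (rule test_functions_spinorI)
  show "(\<lambda>p. cfld s \<xi> n p $ i) \<in> test_functions UNIV" for i
    unfolding cfld_nth using test_functions_UNIV_mult[OF fld_smooth[OF assms] cut2_test] by (simp only: mult.commute)
qed

lemma fld_nth_L2:
  assumes "\<xi> \<in> L2 lborel" "s = 1 \<or> s = -1"
  shows "(\<lambda>p. fld s \<xi> p $ i) \<in> L2 (lborel_on (half s))"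
  using fld_L2[OF assms] exhaust_2[of i] unfolding L2_spinor_iff by auto

lemma nn2_spinor_tendsto:
  fixes f :: "nat \<Rightarrow> 'a \<Rightarrow> spinor"
  assumes "\<And>n. f n \<in> borel_measurable M" "\<And>i. (\<lambda>n. nn2 M (\<lambda>x. f n x $ i)) \<longlonglongrightarrow> 0"
  shows "(\<lambda>n. nn2 M (f n)) \<longlonglongrightarrow> 0"
  unfolding nn2_spinor[OF assms(1)] using tendsto_add[OF assms(2)[of 1] assms(2)[of 2]] by simp

text \<open>The field solves the equation exactly, so the residual of the cut-off field consists
  only of terms with a derivative on the cut-off, which are of order 1/n. On the line the cut-off in
  x equals 1, so the trace is the one-dimensional cut-off of a band-limited function.\<close>

lemma cfld_tendsto:
  assumes \<xi>: "\<xi> \<in> bounded_cpt" and s: "s = 1 \<or> s = -1"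
  shows "(\<lambda>n. nn2 (lborel_on (half s)) (\<lambda>p. cfld s \<xi> n p - fld s \<xi> p)) \<longlonglongrightarrow> 0" (is ?A)
    and "(\<lambda>n. nn2 (lborel_on (half s)) (resid (cfld s \<xi> n))) \<longlonglongrightarrow> 0" (is ?B)
    and "(\<lambda>n. nn2 lborel (\<lambda>k. ftrace (cfld s \<xi> n) k - \<xi> k *s amp s k)) \<longlonglongrightarrow> 0" (is ?C)
proof -
  let ?M = "lborel_on (half s)"
  have d: "\<bar>s\<bar> = 1" using s by auto
  have \<xi>2: "\<xi> \<in> L2 lborel" by (rule bounded_cpt_integrable[OF \<xi>])
  note F = fld_nth_L2[OF \<xi>2 s]
  have msr: "f \<in> borel_measurable ?M" if "f \<in> borel_measurable borel" for f :: "real \<times> real \<Rightarrow> 'z::topological_space"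
    using that by (intro measurable_restrict_space1) simp
  have mc: "cfld s \<xi> n \<in> borel_measurable borel" for n by (rule test_functions_measurable[OF cfld_test[OF \<xi>]])
  have mf: "fld s \<xi> \<in> borel_measurable borel" by (rule fld_measurable[OF bounded_cpt_measurable[OF \<xi>]])
  have cutm: "cut2 n \<in> borel_measurable borel" for n
    using measurable_compose[OF test_functions_measurable[OF cut2_test[of n]] borel_measurable_Re] by simp
  show ?A
  proof (rule nn2_spinor_tendsto)
    show "(\<lambda>p. cfld s \<xi> n p - fld s \<xi> p) \<in> borel_measurable ?M" for n
      by (rule msr) (intro borel_measurable_diff mc mf)
    fix i
    have "(\<lambda>n. nn2 ?M (\<lambda>p. of_real (cut2 n p) * fld s \<xi> p $ i - fld s \<xi> p $ i)) \<longlonglongrightarrow> 0"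
    proof (rule nn2_cutoff_tendsto[OF F])
      show "cut2 n \<in> borel_measurable ?M" for n by (rule msr[OF cutm])
      show "0 \<le> cut2 n p" for n p unfolding cut2_def by (intro mult_nonneg_nonneg cut_nonneg)
      show "cut2 n p \<le> 1" for n p unfolding cut2_def by (intro mult_le_one cut_le_1 cut_nonneg)
      show "(\<lambda>n. cut2 n p) \<longlonglongrightarrow> 1" for p
        unfolding cut2_def using tendsto_mult[OF cut_tendsto_1[of "fst p"] cut_tendsto_1[of "snd p"]] by (simp only: mult_1)
    qed
    then show "(\<lambda>n. nn2 ?M (\<lambda>p. (cfld s \<xi> n p - fld s \<xi> p) $ i)) \<longlonglongrightarrow> 0" by (simp add: cfld_def)
  qed
  obtain C where C: "C > 0" "\<And>n p. cmod (partial_x (\<lambda>p. complex_of_real (cut2 n p)) p) \<le> C / real (Suc n)"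
    "\<And>n p. cmod (partial_y (\<lambda>p. complex_of_real (cut2 n p)) p) \<le> C / real (Suc n)" using cut2_partial_bound by blast
  let ?X = "\<lambda>n. partial_x (\<lambda>p. complex_of_real (cut2 n p))" and ?Y = "\<lambda>n. partial_y (\<lambda>p. complex_of_real (cut2 n p))"
  have R1: "resid (cfld s \<xi> n) p $ 1 = (?X n p - \<i> * ?Y n p) * fld s \<xi> p $ 2" for n p
  proof -
    let ?u = "complex_of_real (cut2 n p)"
    have "resid (cfld s \<xi> n) p $ 1 = ?u * (partial_x (\<lambda>p. fld s \<xi> p $ 2) p
      + ((- \<i>) * partial_y (\<lambda>p. fld s \<xi> p $ 2) p + (- \<i> * of_real (zs - m)) * fld s \<xi> p $ 1))
      + (?X n p - \<i> * ?Y n p) * fld s \<xi> p $ 2"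
      unfolding resid_components[OF test_functions_smooth[OF cfld_test[OF \<xi>]]] cfld_nth
        partial_product[OF test_functions_smooth[OF cut2_test] fld_smooth[OF \<xi>]]
      by (simp add: cfld_def algebra_simps)
    then show ?thesis unfolding fld_equation[OF \<xi> d] by simp
  qed
  have R2: "resid (cfld s \<xi> n) p $ 2 = (?X n p + \<i> * ?Y n p) * fld s \<xi> p $ 1" for n p
  proof -
    let ?u = "complex_of_real (cut2 n p)"
    have "resid (cfld s \<xi> n) p $ 2 = ?u * (partial_x (\<lambda>p. fld s \<xi> p $ 1) p
      + (\<i> * partial_y (\<lambda>p. fld s \<xi> p $ 1) p + (- \<i> * of_real (zs + m)) * fld s \<xi> p $ 2))
      + (?X n p + \<i> * ?Y n p) * fld s \<xi> p $ 1"
      unfolding resid_components[OF test_functions_smooth[OF cfld_test[OF \<xi>]]] cfld_nth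
        partial_product[OF test_functions_smooth[OF cut2_test] fld_smooth[OF \<xi>]]
      by (simp add: cfld_def algebra_simps)
    then show ?thesis unfolding fld_equation[OF \<xi> d] by simp
  qed
  have iY: "cmod (\<i> * ?Y n p) \<le> C / real (Suc n)" for n p using C(3)[of n p] by (simp add: norm_mult)
  have bd: "cmod (?X n p - \<i> * ?Y n p) \<le> 2 * C / real (Suc n)" "cmod (?X n p + \<i> * ?Y n p) \<le> 2 * C / real (Suc n)" for n p
    using norm_triangle_ineq4[of "?X n p" "\<i> * ?Y n p"] norm_triangle_ineq[of "?X n p" "\<i> * ?Y n p"] C(2)[of n p] iY[of n p]
    by linarith+
  show ?B
  proof (rule nn2_spinor_tendsto)
    have "(\<lambda>p. resid (cfld s \<xi> n) p $ i) \<in> borel_measurable borel" for n i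
      by (rule test_functions_measurable[OF resid_test[OF cfld_test[OF \<xi>]]])
    then show "resid (cfld s \<xi> n) \<in> borel_measurable ?M" for n by (intro msr spinor_measurableI)
    fix i :: 2
    have l: "(\<lambda>n. nn2 ?M (\<lambda>p. (?X n p - \<i> * ?Y n p) * fld s \<xi> p $ 2)) \<longlonglongrightarrow> 0"
      "(\<lambda>n. nn2 ?M (\<lambda>p. (?X n p + \<i> * ?Y n p) * fld s \<xi> p $ 1)) \<longlonglongrightarrow> 0"
      by (rule nn2_small_tendsto[OF F, where C="2 * C"], rule bd, use C(1) in simp)+
    from exhaust_2[of i] show "(\<lambda>n. nn2 ?M (\<lambda>p. resid (cfld s \<xi> n) p $ i)) \<longlonglongrightarrow> 0"
    proof
      assume i: "i = 1"
      show ?thesis unfolding i R1 by (rule l(1))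
    next
      assume i: "i = 2"
      show ?thesis unfolding i R2 by (rule l(2))
    qed
  qed
  show ?C
  proof (rule nn2_spinor_tendsto)
    have tr: "ftrace (cfld s \<xi> n) k $ i = inv_fourier (cutoff_inv_fourier n (xamp s \<xi> i)) (- k)" for n k i
    proof -
      have "cut (real (Suc n)) 0 = 1" by (simp add: cut_def flat_def exp_minus)
      then have "(\<lambda>y. cfld s \<xi> n (0, y) $ i) = cutoff_inv_fourier n (xamp s \<xi> i)"
        by (simp add: cfld_def cut2_def cutoff_inv_fourier_def fld_def efun_def fun_eq_iff)
      then show ?thesis by (simp add: ftrace_def fhat_def)
    qed
    have cm: "(\<lambda>k. inv_fourier (cutoff_inv_fourier n (xamp s \<xi> i)) k - xamp s \<xi> i (- k)) \<in> borel_measurable borel" for n i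
      using bounded_cpt_measurable[OF xamp_bounded_cpt[OF \<xi>, of s i]]
        test_functions_measurable[OF cutoff_inv_fourier_test[OF xamp_bounded_cpt[OF \<xi>, of s i], of n]]
      by measurable
    have "(\<lambda>k. ftrace (cfld s \<xi> n) k $ i) \<in> borel_measurable borel" for n i
      unfolding tr using test_functions_measurable[OF cutoff_inv_fourier_test[OF xamp_bounded_cpt[OF \<xi>, of s i], of n]]
      by measurable
    moreover have "(\<lambda>k. (\<xi> k *s amp s k) $ i) \<in> borel_measurable borel" for i
      using bounded_cpt_measurable[OF xamp_bounded_cpt[OF \<xi>, of s i]] by (simp add: xamp_def[abs_def])
    ultimately show "(\<lambda>k. ftrace (cfld s \<xi> n) k - \<xi> k *s amp s k) \<in> borel_measurable lborel" for n
      by (intro spinor_measurableI) (simp_all only: vector_minus_component measurable_lborel2 borel_measurable_diff)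
    fix i
    \<comment> \<open>The weight is at most 1, so division by it only enlarges the norm, and the
      convergence already established in H^(1/2) dominates.\<close>
    have le: "nn2 lborel (\<lambda>k. (ftrace (cfld s \<xi> n) k - \<xi> k *s amp s k) $ i)
      \<le> nn2 lborel (\<lambda>k. (inv_fourier (cutoff_inv_fourier n (xamp s \<xi> i)) k - xamp s \<xi> i (- k)) / of_real (wt k))" for n
    proof -
      have "nn2 lborel (\<lambda>k. (ftrace (cfld s \<xi> n) k - \<xi> k *s amp s k) $ i)
        = nn2 lborel (\<lambda>k. (\<lambda>k. inv_fourier (cutoff_inv_fourier n (xamp s \<xi> i)) k - xamp s \<xi> i (- k)) (- k))"
        by (simp add: tr xamp_def)
      also have "\<dots> = nn2 lborel (\<lambda>k. inv_fourier (cutoff_inv_fourier n (xamp s \<xi> i)) k - xamp s \<xi> i (- k))"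
        by (rule nn2_reflect[OF cm])
      also have "\<dots> \<le> nn2 lborel (\<lambda>k. (inv_fourier (cutoff_inv_fourier n (xamp s \<xi> i)) k - xamp s \<xi> i (- k)) / of_real (wt k))"
      proof (rule nn2_mono)
        fix k
        show "norm (inv_fourier (cutoff_inv_fourier n (xamp s \<xi> i)) k - xamp s \<xi> i (- k))
          \<le> norm ((inv_fourier (cutoff_inv_fourier n (xamp s \<xi> i)) k - xamp s \<xi> i (- k)) / of_real (wt k))"
          using wt_pos[of k] wt_le_1[of k] by (simp add: norm_divide le_divide_eq mult_left_le)
      qed
      finally show ?thesis .
    qed
    show "(\<lambda>n. nn2 lborel (\<lambda>k. (ftrace (cfld s \<xi> n) k - \<xi> k *s amp s k) $ i)) \<longlonglongrightarrow> 0"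
      by (rule ennreal_tendsto_0_bound[OF le cutoff_inv_fourier_tendsto[OF xamp_bounded_cpt[OF \<xi>]]])
  qed
qed

text \<open>The squared length of \<open>amp\<close> is at most 4 kappa, and kappa times the squared
  weight is at most 1 + mu: an L^2 density yields a trace in H^(-1/2).\<close>

lemma wt_amp_le:
  assumes [measurable]: "\<xi> \<in> borel_measurable borel" and s: "\<bar>s\<bar> = 1"
  shows "nn2 lborel (\<lambda>k. wt k *\<^sub>R (\<xi> k *s amp s k)) \<le> ennreal (4 * (1 + mu)) * nn2 lborel \<xi>"
proof -
  have "norm (wt k *\<^sub>R (\<xi> k *s amp s k)) \<le> sqrt (4 * (1 + mu)) * norm (\<xi> k)" for k
  proof (rule power2_le_imp_le)
    have "(norm (\<xi> k *s amp s k))\<^sup>2 = (norm (\<xi> k))\<^sup>2 * (norm (amp s k))\<^sup>2"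
      unfolding spinor_norm by (simp add: norm_mult power_mult_distrib distrib_left)
    then have "(norm (wt k *\<^sub>R (\<xi> k *s amp s k)))\<^sup>2 = (norm (\<xi> k))\<^sup>2 * ((wt k)\<^sup>2 * (norm (amp s k))\<^sup>2)"
      by (simp add: power_mult_distrib)
    also have "\<dots> \<le> (norm (\<xi> k))\<^sup>2 * ((wt k)\<^sup>2 * (4 * kap k))"
      by (intro mult_left_mono amp_norm_le s) auto
    also have "\<dots> \<le> (norm (\<xi> k))\<^sup>2 * (4 * (1 + mu))"
      using kap_wt[of k] by (intro mult_left_mono) (auto simp: mult_ac)
    also have "\<dots> = (sqrt (4 * (1 + mu)) * norm (\<xi> k))\<^sup>2"
      using mu_pos by (simp only: power_mult_distrib) simp
    finally show "(norm (wt k *\<^sub>R (\<xi> k *s amp s k)))\<^sup>2 \<le> (sqrt (4 * (1 + mu)) * norm (\<xi> k))\<^sup>2" .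
  qed (use mu_pos in simp)
  then have "nn2 lborel (\<lambda>k. wt k *\<^sub>R (\<xi> k *s amp s k)) \<le> ennreal ((sqrt (4 * (1 + mu)))\<^sup>2) * nn2 lborel \<xi>"
    by (intro nn2_scale_le) (use mu_pos in auto)
  then show ?thesis using mu_pos by simp
qed

text \<open>Two approximations are combined: the density is truncated, then the resulting smooth
  field is cut off. The truncation error is controlled in field and trace by the L^2 norm of the
  discarded density, and the truncated field still solves the equation, so a suitable choice of both
  parameters makes all three errors small.\<close>

lemma fld_approximation:
  assumes \<xi>: "\<xi> \<in> L2 lborel" and s: "s = 1 \<or> s = -1"
  obtains F where "\<And>n::nat. F n \<in> test_functions UNIV"
    "(\<lambda>n. nn2 (lborel_on (half s)) (\<lambda>p. F n p - fld s \<xi> p)) \<longlonglongrightarrow> 0"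
    "(\<lambda>n. nn2 (lborel_on (half s)) (resid (F n))) \<longlonglongrightarrow> 0"
    "(\<lambda>n. nn2 lborel (\<lambda>k. wt k *\<^sub>R (ftrace (F n) k - \<xi> k *s amp s k))) \<longlonglongrightarrow> 0"
proof -
  let ?M = "lborel_on (half s)"
  have d: "\<bar>s\<bar> = 1" using s by auto
  have m\<xi>[measurable]: "\<xi> \<in> borel_measurable borel" using \<xi> by (simp add: L2_iff)
  define T where "T n = truncate n \<xi>" for n
  have T: "T n \<in> bounded_cpt" for n unfolding T_def by (rule truncate_bounded_cpt[OF m\<xi>])
  note T2 = bounded_cpt_integrable(2)[OF T]
  have mT[measurable]: "T n \<in> borel_measurable borel" for n by (rule bounded_cpt_measurable[OF T])
  have Tl: "(\<lambda>n. nn2 lborel (\<lambda>k. T n k - \<xi> k)) \<longlonglongrightarrow> 0" unfolding T_def by (rule truncate_tendsto[OF \<xi>])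
  have msr: "f \<in> borel_measurable ?M" if "f \<in> borel_measurable borel" for f :: "real \<times> real \<Rightarrow> spinor"
    using that by (intro measurable_restrict_space1) simp
  have amps: "(\<lambda>k. \<zeta> k *s amp s k) \<in> borel_measurable borel" if "\<zeta> \<in> borel_measurable borel" for \<zeta>
    using that by (intro spinor_measurableI) (simp_all)
  have trm: "ftrace (cfld s (T n) j) \<in> borel_measurable borel" for n j
  proof -
    have A: "(\<lambda>k. wt k *\<^sub>R ftrace (cfld s (T n) j) k) \<in> borel_measurable borel"
      using sobolev_rep_line_restriction[OF cfld_test[OF T]] unfolding sobolev_rep_def L2_iff wt_def by simp
    have "(\<lambda>k. (1 / wt k) *\<^sub>R (wt k *\<^sub>R ftrace (cfld s (T n) j) k)) \<in> borel_measurable borel"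
      by (rule borel_measurable_scaleR[OF _ A]) measurable
    moreover have "(\<lambda>k. (1 / wt k) *\<^sub>R (wt k *\<^sub>R ftrace (cfld s (T n) j) k)) = ftrace (cfld s (T n) j)"
    proof
      fix k
      show "(1 / wt k) *\<^sub>R (wt k *\<^sub>R ftrace (cfld s (T n) j) k) = ftrace (cfld s (T n) j) k"
        using wt_pos[of k] by simp
    qed
    ultimately show ?thesis by (simp only:)
  qed
  \<comment> \<open>The truncation error enters the field estimate with the factor 2 * 2 and the
    trace estimate with the factor 2 * 4 (1 + mu); the sum dominates both.\<close>
  define c where "c = 4 + 8 * (1 + mu)"
  have c: "c > 0" using mu_pos by (simp add: c_def)
  have "\<exists>F\<in>test_functions UNIV. nn2 ?M (\<lambda>p. F p - fld s \<xi> p) \<le> ennreal (2 * e + c * e)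
    \<and> nn2 ?M (resid F) \<le> ennreal (2 * e + c * e) \<and> nn2 lborel (\<lambda>k. wt k *\<^sub>R (ftrace F k - \<xi> k *s amp s k)) \<le> ennreal (2 * e + c * e)"
    if e: "e > 0" for e
  proof -
    have "\<forall>\<^sub>F n in sequentially. nn2 lborel (\<lambda>k. T n k - \<xi> k) < ennreal e"
      using order_tendstoD(2)[OF Tl] e by simp
    then obtain n where n: "nn2 lborel (\<lambda>k. T n k - \<xi> k) < ennreal e" by (auto simp: eventually_sequentially)
    have ev: "\<forall>\<^sub>F j in sequentially. u j < ennreal e" if "u \<longlonglongrightarrow> 0" for u :: "nat \<Rightarrow> ennreal"
      using order_tendstoD(2)[OF that] e by simp
    have "\<forall>\<^sub>F j in sequentially. nn2 ?M (\<lambda>p. cfld s (T n) j p - fld s (T n) p) < ennreal e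
      \<and> nn2 ?M (resid (cfld s (T n) j)) < ennreal e
      \<and> nn2 lborel (\<lambda>k. ftrace (cfld s (T n) j) k - T n k *s amp s k) < ennreal e"
      using ev[OF cfld_tendsto(1)[OF T s, of n]] ev[OF cfld_tendsto(2)[OF T s, of n]] ev[OF cfld_tendsto(3)[OF T s, of n]]
      by eventually_elim blast
    then obtain j where j: "nn2 ?M (\<lambda>p. cfld s (T n) j p - fld s (T n) p) < ennreal e"
      "nn2 ?M (resid (cfld s (T n) j)) < ennreal e"
      "nn2 lborel (\<lambda>k. ftrace (cfld s (T n) j) k - T n k *s amp s k) < ennreal e"
      by (auto simp: eventually_sequentially)
    let ?F = "cfld s (T n) j"
    have e1: "2 * ennreal e = ennreal (2 * e)" using e ennreal_mult[of 2 e] by simp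
    have e2: "2 * (2 * ennreal e) = ennreal (4 * e)" unfolding e1 using e ennreal_mult[of 2 "2 * e"] by simp
    show ?thesis
    proof (intro bexI[of _ ?F] conjI)
      show "?F \<in> test_functions UNIV" by (rule cfld_test[OF T])
      have "nn2 ?M (\<lambda>p. ?F p - fld s \<xi> p) \<le> 2 * nn2 ?M (\<lambda>p. ?F p - fld s (T n) p) + 2 * nn2 ?M (\<lambda>p. fld s (T n) p - fld s \<xi> p)"
        by (rule nn2_triangle3; rule msr; (rule fld_measurable[OF mT] fld_measurable[OF m\<xi>] test_functions_measurable[OF cfld_test[OF T]]))
      also have "nn2 ?M (\<lambda>p. fld s (T n) p - fld s \<xi> p) = nn2 ?M (fld s (\<lambda>k. T n k - \<xi> k))"
        unfolding nn2_def
        by (intro nn_integral_cong) (simp add: fld_diff[OF T2 \<xi> s] space_restrict_space)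
      also have "\<dots> \<le> 2 * nn2 lborel (\<lambda>k. T n k - \<xi> k)" by (rule fld_energy_le[OF L2_diff[OF T2 \<xi>] s])
      finally have "nn2 ?M (\<lambda>p. ?F p - fld s \<xi> p) \<le> 2 * nn2 ?M (\<lambda>p. ?F p - fld s (T n) p) + 2 * (2 * nn2 lborel (\<lambda>k. T n k - \<xi> k))"
        by (simp add: add_left_mono mult_left_mono)
      also have "\<dots> \<le> 2 * ennreal e + 2 * (2 * ennreal e)"
        using n j by (intro add_mono mult_left_mono less_imp_le) auto
      also have "\<dots> = ennreal (2 * e + 4 * e)" unfolding e2 unfolding e1 using e by (simp only: ennreal_plus)
      also have "\<dots> \<le> ennreal (2 * e + c * e)" using e mu_pos by (intro ennreal_leI) (simp add: c_def algebra_simps)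
      finally show "nn2 ?M (\<lambda>p. ?F p - fld s \<xi> p) \<le> ennreal (2 * e + c * e)" .
      have "ennreal e \<le> ennreal (2 * e + c * e)" using e c by (intro ennreal_leI) (simp add: algebra_simps)
      then show "nn2 ?M (resid ?F) \<le> ennreal (2 * e + c * e)" using j(2) by simp
      have "nn2 lborel (\<lambda>k. wt k *\<^sub>R (ftrace ?F k - \<xi> k *s amp s k))
        = nn2 lborel (\<lambda>k. wt k *\<^sub>R (ftrace ?F k - T n k *s amp s k) + wt k *\<^sub>R ((T n k - \<xi> k) *s amp s k))"
        by (simp add: scaleR_right_diff_distrib vector_ssub_ldistrib vector_sadd_rdistrib vec_eq_iff algebra_simps
            scaleR_right_distrib[symmetric] flip: scaleR_diff_right)
      also have "\<dots> \<le> 2 * nn2 lborel (\<lambda>k. wt k *\<^sub>R (ftrace ?F k - T n k *s amp s k)) + 2 * nn2 lborel (\<lambda>k. wt k *\<^sub>R ((T n k - \<xi> k) *s amp s k))"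
        using trm amps by (intro nn2_add_le) auto
      also have "\<dots> \<le> 2 * nn2 lborel (\<lambda>k. ftrace ?F k - T n k *s amp s k) + 2 * (ennreal (4 * (1 + mu)) * nn2 lborel (\<lambda>k. T n k - \<xi> k))"
      proof (intro add_mono mult_left_mono)
        show "nn2 lborel (\<lambda>k. wt k *\<^sub>R (ftrace ?F k - T n k *s amp s k)) \<le> nn2 lborel (\<lambda>k. ftrace ?F k - T n k *s amp s k)"
          using wt_le_1 wt_pos by (intro nn2_mono) (simp add: mult_left_le_one_le less_imp_le[OF wt_pos])
        show "nn2 lborel (\<lambda>k. wt k *\<^sub>R ((T n k - \<xi> k) *s amp s k)) \<le> ennreal (4 * (1 + mu)) * nn2 lborel (\<lambda>k. T n k - \<xi> k)"
          by (rule wt_amp_le[OF _ d]) simp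
      qed auto
      also have "\<dots> \<le> 2 * ennreal e + 2 * (ennreal (4 * (1 + mu)) * ennreal e)"
        using less_imp_le[OF n] less_imp_le[OF j(3)] by (intro add_mono mult_left_mono) auto
      also have "\<dots> = ennreal (2 * e + 8 * (1 + mu) * e)"
      proof -
        have "ennreal (4 * (1 + mu)) * ennreal e = ennreal (4 * (1 + mu) * e)" "ennreal 2 * ennreal (4 * (1 + mu) * e) = ennreal (2 * (4 * (1 + mu) * e))"
          by (rule ennreal_mult[symmetric]; use e mu_pos in simp)+
        moreover have "2 * (4 * (1 + mu) * e) = 8 * (1 + mu) * e" by simp
        ultimately have "2 * (ennreal (4 * (1 + mu)) * ennreal e) = ennreal (8 * (1 + mu) * e)"
          by (simp only: ennreal_numeral)
        then show ?thesis unfolding e1 using e mu_pos by (simp flip: ennreal_plus)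
      qed
      also have "\<dots> \<le> ennreal (2 * e + c * e)" using e mu_pos by (intro ennreal_leI) (simp add: c_def algebra_simps)
      finally show "nn2 lborel (\<lambda>k. wt k *\<^sub>R (ftrace ?F k - \<xi> k *s amp s k)) \<le> ennreal (2 * e + c * e)" .
    qed
  qed
  note approx = this
  \<comment> \<open>The common bound at the error 1/(n+1), from which a sequence is
    selected.\<close>
  define r where "r n = 2 * (1 / real (Suc n)) + c * (1 / real (Suc n))" for n
  define Q where "Q n F \<longleftrightarrow> nn2 ?M (\<lambda>p. F p - fld s \<xi> p) \<le> ennreal (r n) \<and> nn2 ?M (resid F) \<le> ennreal (r n)
    \<and> nn2 lborel (\<lambda>k. wt k *\<^sub>R (ftrace F k - \<xi> k *s amp s k)) \<le> ennreal (r n)" for n F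
  have "\<exists>F. F \<in> test_functions UNIV \<and> Q n F" for n
    using approx[of "1 / real (Suc n)"] unfolding Q_def r_def Bex_def by simp
  then obtain F where F: "\<And>n. F n \<in> test_functions UNIV" and Q: "\<And>n. Q n (F n)" by metis
  have "(\<lambda>n. 1 / real (Suc n)) \<longlonglongrightarrow> 0" by real_asymp
  then have "(\<lambda>n. 2 * (1 / real (Suc n)) + c * (1 / real (Suc n))) \<longlonglongrightarrow> 2 * 0 + c * 0" by (intro tendsto_intros)
  then have "r \<longlonglongrightarrow> 0" by (simp add: r_def[abs_def])
  then have lim: "(\<lambda>n. ennreal (r n)) \<longlonglongrightarrow> 0" by (simp add: ennreal_0[symmetric] del: ennreal_0)
  show thesis
    by (rule that[OF F]; rule ennreal_tendsto_0_bound[OF _ lim]) (use Q[unfolded Q_def] in blast)+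
qed

end

section \<open>The jump condition and the explicit eigenfunctions\<close>

context shell
begin

text \<open>The right-hand side i (zs - m sigma_3) v of the equation solved for the gradient. As a
  bounded operator it passes to L^2 limits.\<close>

definition gop :: "spinor \<Rightarrow> spinor" where
  "gop v = \<i> *s (complex_of_real zs *s v - m *\<^sub>R (pauli3 *v v))"

lemma gop_components: "gop v $ 1 = \<i> * of_real (zs - m) * v $ 1" "gop v $ 2 = \<i> * of_real (zs + m) * v $ 2"
  unfolding gop_def vector_minus_component vector_smult_component vector_scaleR_component pauli_components
  by (simp_all add: scaleR_conv_of_real algebra_simps)

lemma gop_diff: "gop (u - v) = gop u - gop v"
  unfolding vec_eq_iff forall_2 gop_components vector_minus_component by (simp add: algebra_simps)

lemma gop_norm_le: "norm (gop v) \<le> (\<bar>zs\<bar> + m) * norm v"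
proof (rule power2_le_imp_le)
  have "(zs - m)\<^sup>2 \<le> (\<bar>zs\<bar> + m)\<^sup>2" "(zs + m)\<^sup>2 \<le> (\<bar>zs\<bar> + m)\<^sup>2"
    using m_pos by (auto intro!: power2_le_iff_abs_le[THEN iffD2])
  then have "(zs - m)\<^sup>2 * (cmod (v $ 1))\<^sup>2 + (zs + m)\<^sup>2 * (cmod (v $ 2))\<^sup>2
    \<le> (\<bar>zs\<bar> + m)\<^sup>2 * (cmod (v $ 1))\<^sup>2 + (\<bar>zs\<bar> + m)\<^sup>2 * (cmod (v $ 2))\<^sup>2"
    by (intro add_mono mult_right_mono) auto
  then show "(norm (gop v))\<^sup>2 \<le> ((\<bar>zs\<bar> + m) * norm v)\<^sup>2"
    unfolding power_mult_distrib spinor_norm gop_components norm_mult norm_of_real norm_ii power2_abs by (simp add: ring_distribs)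
qed (use m_pos in auto)

lemma gop_measurable:
  assumes [measurable]: "f \<in> borel_measurable M"
  shows "(\<lambda>p. gop (f p)) \<in> borel_measurable M"
  by (rule spinor_measurableI) (unfold gop_components, measurable)

lemma gop_L2:
  assumes f: "f \<in> L2 M"
  shows "(\<lambda>p. gop (f p)) \<in> L2 M"
  unfolding L2_iff
proof
  have m: "f \<in> borel_measurable M" using f by (simp add: L2_iff)
  show "(\<lambda>p. gop (f p)) \<in> borel_measurable M" by (rule gop_measurable[OF m])
  have "nn2 M (\<lambda>p. gop (f p)) \<le> ennreal ((\<bar>zs\<bar> + m)\<^sup>2) * nn2 M f"
    by (rule nn2_scale_le[OF m gop_norm_le]) (use m_pos in auto)
  also have "\<dots> < \<infinity>" using f by (simp add: L2_iff ennreal_mult_less_top)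
  finally show "nn2 M (\<lambda>p. gop (f p)) < \<infinity>" .
qed

lemma resid_gop: "resid F p = sigma_grad F p - gop (F p)"
  by (simp add: resid_def gop_def)

lemma gop_iff: "of_real zs *s v = (- \<i>) *s g + m *\<^sub>R (pauli3 *v v) \<longleftrightarrow> g = gop v"
proof -
  have "z = - \<i> * w + u \<longleftrightarrow> w = \<i> * (z - u)" for z w u :: complex
  proof
    assume "z = - \<i> * w + u"
    then show "w = \<i> * (z - u)" by (simp flip: mult.assoc)
  next
    assume "w = \<i> * (z - u)"
    then show "z = - \<i> * w + u" by (simp flip: mult.assoc)
  qed
  then show ?thesis
    unfolding gop_def vec_eq_iff vector_smult_component vector_minus_component vector_add_component by simp
qed

text \<open>For the approximants the gradient is the residual plus \<open>gop\<close> of the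
  function, and \<open>gop\<close> is bounded. Hence the gradients converge to
  \<open>gop (\<psi> p)\<close>, and one sequence witnesses both the trace and the weak
  gradient.\<close>

lemma trace_of_fld:
  assumes \<xi>: "\<xi> \<in> L2 lborel" and s: "s = 1 \<or> s = -1" and \<psi>: "\<psi> \<in> L2 (lborel_on (half s))"
    and ae: "AE p in lborel_on (half s). \<psi> p = fld s \<xi> p" and T: "sobolev_rep (- 1 / 2) T (\<lambda>k. \<xi> k *s amp s k)"
  shows "has_dirichlet_trace (half s) \<psi> T" "weak_sigma_grad (half s) \<psi> (\<lambda>p. gop (\<psi> p))"
proof -
  let ?M = "lborel_on (half s)"
  obtain F where F: "\<And>n::nat. F n \<in> test_functions UNIV"
    and cf: "(\<lambda>n. nn2 ?M (\<lambda>p. F n p - fld s \<xi> p)) \<longlonglongrightarrow> 0"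
    and cr: "(\<lambda>n. nn2 ?M (resid (F n))) \<longlonglongrightarrow> 0"
    and ct: "(\<lambda>n. nn2 lborel (\<lambda>k. wt k *\<^sub>R (ftrace (F n) k - \<xi> k *s amp s k))) \<longlonglongrightarrow> 0"
    by (rule fld_approximation[OF \<xi> s]) (rule that; assumption)
  have FL: "F n \<in> L2 ?M" "sigma_grad (F n) \<in> L2 ?M" for n
    by (rule L2_restrict[OF test_functions_L2[OF F] half_measurable], rule L2_restrict[OF sigma_grad_L2[OF F] half_measurable])
  have m: "\<psi> \<in> borel_measurable ?M" "F n \<in> borel_measurable ?M" "sigma_grad (F n) \<in> borel_measurable ?M" for n
    using FL \<psi> by (auto simp: L2_iff)
  note [measurable] = m gop_measurable[OF m(1)] gop_measurable[OF m(2)]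
  have "nn2 ?M (\<lambda>p. F n p - \<psi> p) = nn2 ?M (\<lambda>p. F n p - fld s \<xi> p)" for n
    by (rule nn2_cong_AE) (use ae in auto)
  with cf have cf': "(\<lambda>n. nn2 ?M (\<lambda>p. F n p - \<psi> p)) \<longlonglongrightarrow> 0" by simp
  define c where "c = ennreal ((\<bar>zs\<bar> + m)\<^sup>2)"
  have bd: "nn2 ?M (\<lambda>p. sigma_grad (F n) p - gop (\<psi> p))
    \<le> 2 * nn2 ?M (resid (F n)) + 2 * (c * nn2 ?M (\<lambda>p. F n p - \<psi> p))" for n
  proof -
    have "nn2 ?M (\<lambda>p. sigma_grad (F n) p - gop (\<psi> p)) = nn2 ?M (\<lambda>p. resid (F n) p + gop (F n p - \<psi> p))"
      by (simp add: resid_gop gop_diff)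
    also have "\<dots> \<le> 2 * nn2 ?M (resid (F n)) + 2 * nn2 ?M (\<lambda>p. gop (F n p - \<psi> p))"
    proof (rule nn2_add_le)
      show "resid (F n) \<in> borel_measurable ?M" unfolding resid_gop[abs_def] by measurable
      show "(\<lambda>p. gop (F n p - \<psi> p)) \<in> borel_measurable ?M" unfolding gop_diff by measurable
    qed
    also have "nn2 ?M (\<lambda>p. gop (F n p - \<psi> p)) \<le> c * nn2 ?M (\<lambda>p. F n p - \<psi> p)"
      unfolding c_def by (rule nn2_scale_le[OF _ gop_norm_le]) (use m_pos in auto)
    finally show ?thesis by (simp add: mult_left_mono)
  qed
  have "(\<lambda>n. 2 * nn2 ?M (resid (F n)) + 2 * (c * nn2 ?M (\<lambda>p. F n p - \<psi> p))) \<longlonglongrightarrow> 0 + 0"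
    by (intro tendsto_add ennreal_cmult_tendsto_0 cr cf') (auto simp: c_def)
  then have cg: "(\<lambda>n. nn2 ?M (\<lambda>p. sigma_grad (F n) p - gop (\<psi> p))) \<longlonglongrightarrow> 0"
    using ennreal_tendsto_0_bound[OF bd] by simp
  show "has_dirichlet_trace (half s) \<psi> T" "weak_sigma_grad (half s) \<psi> (\<lambda>p. gop (\<psi> p))"
    by (rule has_dirichlet_traceI[OF half_measurable \<psi> gop_L2[OF \<psi>] F cf' cg T ct])+
qed

text \<open>The distribution whose Fourier transform is the density times the amplitude; for an L^2
  density \<open>trace_of_fld\<close> shows that it is the trace of the corresponding field.\<close>

definition amp_distr :: "real \<Rightarrow> (real \<Rightarrow> complex) \<Rightarrow> distr" where
  "amp_distr s \<xi> \<phi> = (LINT k|lborel. inv_fourier \<phi> k *s (\<xi> k *s amp s k))"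

lemma amp_distr_rep:
  assumes \<xi>: "\<xi> \<in> L2 lborel" and s: "\<bar>s\<bar> = 1"
  shows "sobolev_rep (- 1 / 2) (amp_distr s \<xi>) (\<lambda>k. \<xi> k *s amp s k)"
proof -
  have [measurable]: "\<xi> \<in> borel_measurable borel" using \<xi> by (simp add: L2_iff)
  have "(\<lambda>k. wt k *\<^sub>R (\<xi> k *s amp s k)) \<in> borel_measurable borel"
  proof (rule spinor_measurableI)
    have [measurable]: "(\<lambda>k. amp s k $ i) \<in> borel_measurable borel" for i using amp_measurable[of s] by measurable
    show "(\<lambda>k. (wt k *\<^sub>R (\<xi> k *s amp s k)) $ 1) \<in> borel_measurable borel" "(\<lambda>k. (wt k *\<^sub>R (\<xi> k *s amp s k)) $ 2) \<in> borel_measurable borel"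
      unfolding vector_scaleR_component vector_smult_component by measurable
  qed
  moreover have "nn2 lborel (\<lambda>k. wt k *\<^sub>R (\<xi> k *s amp s k)) < \<infinity>"
    using wt_amp_le[of \<xi> s] s \<xi> by (auto simp: L2_iff ennreal_mult_less_top intro: le_less_trans)
  ultimately have "(\<lambda>k. wt k *\<^sub>R (\<xi> k *s amp s k)) \<in> L2 lborel" by (simp add: L2_iff)
  then show ?thesis unfolding sobolev_rep_def wt_def by (simp add: amp_distr_def)
qed

end

section \<open>The matrices of the jump condition\<close>

lemma pauli0_vector [simp]: "pauli0 *v w = w"
  by (simp add: pauli0_def)

lemma shell_matrix_eq:
  "shell_matrix \<eta> \<tau> = vector [vector [of_real ((\<eta> + \<tau>) / 2), 0], vector [0, of_real ((\<eta> - \<tau>) / 2)]]"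
  unfolding vec_eq_iff forall_2 shell_matrix_def pauli0_def pauli3_def mat_def vector_2 vector_scaleR_component
    vector_add_component vec_lambda_beta
  by (simp add: complex_eq_iff)

lemma shell_matrix_components:
  "(shell_matrix \<eta> \<tau> *v w) $ 1 = of_real ((\<eta> + \<tau>) / 2) * w $ 1"
  "(shell_matrix \<eta> \<tau> *v w) $ 2 = of_real ((\<eta> - \<tau>) / 2) * w $ 2"
  unfolding shell_matrix_eq by (simp_all add: matrix_vector_mult_def sum_2 vector_2)

lemma normal_components:
  "((- \<i>) *s (dot_sigma normal_vec *v w)) $ 1 = \<i> * w $ 2"
  "((- \<i>) *s (dot_sigma normal_vec *v w)) $ 2 = \<i> * w $ 1"
  by (simp_all add: dot_sigma_def normal_vec_def pauli1_def pauli2_def matrix_vector_mult_def sum_2 vector_2)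

text \<open>\<open>matrix_inv\<close> is a choice among two-sided inverses; any explicit candidate
  must coincide with it.\<close>

lemma matrix_inv_unique:
  fixes A N :: "'a::comm_ring_1^'n^'n"
  assumes "A ** N = mat 1" "N ** A = mat 1"
  shows "matrix_inv A = N"
proof -
  have "A ** matrix_inv A = mat 1 \<and> matrix_inv A ** A = mat 1"
    unfolding matrix_inv_def by (rule someI[of _ N]) (use assms in simp)
  then show ?thesis using assms by (metis matrix_mul_assoc matrix_mul_lid matrix_mul_rid)
qed

context shell
begin

lemma half_product: "((\<eta> + \<tau>) / 2) * ((\<eta> - \<tau>) / 2) = 1"
  using shell_eq by (simp add: power2_eq_square algebra_simps)

text \<open>The diagonal entries of the product are (1 - a b)/2 and vanish by the shell condition,
  so Lambda exchanges the components.\<close>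

lemma Lambda_components:
  "(Lambda \<eta> \<tau> *v w) $ 1 = - \<i> * of_real ((\<eta> - \<tau>) / 2) * w $ 2"
  "(Lambda \<eta> \<tau> *v w) $ 2 = - \<i> * of_real ((\<eta> + \<tau>) / 2) * w $ 1"
proof -
  define a b where "a = complex_of_real ((\<eta> + \<tau>) / 2)" and "b = complex_of_real ((\<eta> - \<tau>) / 2)"
  have ab: "a * b = 1" "b * a = 1" using half_product unfolding a_def b_def of_real_mult[symmetric] by (simp_all add: mult.commute)
  \<comment> \<open>The adjugate divided by the determinant a b - i^2 = 2.\<close>
  define N :: cmat where "N = vector [vector [- b / 2, - \<i> / 2], vector [- \<i> / 2, - a / 2]]"
  have S: "shell_matrix \<eta> \<tau> = vector [vector [a, 0], vector [0, b]]"
    by (simp only: shell_matrix_eq a_def b_def)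
  have P: "mat \<i> ** pauli1 = vector [vector [0, \<i>], vector [\<i>, 0]]"
    unfolding vec_eq_iff forall_2 by (simp add: matrix_matrix_mult_def sum_2 pauli1_def mat_def vector_2)
  have A: "mat \<i> ** pauli1 - shell_matrix \<eta> \<tau> = vector [vector [- a, \<i>], vector [\<i>, - b]]"
    and B: "mat \<i> ** pauli1 + shell_matrix \<eta> \<tau> = vector [vector [a, \<i>], vector [\<i>, b]]"
    unfolding S P vec_eq_iff forall_2 by (simp_all add: vector_2)
  have "matrix_inv (mat \<i> ** pauli1 - shell_matrix \<eta> \<tau>) = N"
    by (rule matrix_inv_unique; unfold A N_def vec_eq_iff forall_2)
      (simp_all add: matrix_matrix_mult_def sum_2 mat_def vector_2 ab)
  then have "Lambda \<eta> \<tau> = vector [vector [0, - \<i> * b], vector [- \<i> * a, 0]]"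
    unfolding Lambda_def B N_def vec_eq_iff forall_2 by (simp add: matrix_matrix_mult_def sum_2 vector_2 ab)
  then show "(Lambda \<eta> \<tau> *v w) $ 1 = - \<i> * of_real ((\<eta> - \<tau>) / 2) * w $ 2"
    "(Lambda \<eta> \<tau> *v w) $ 2 = - \<i> * of_real ((\<eta> + \<tau>) / 2) * w $ 1"
    unfolding a_def[symmetric] b_def[symmetric] by (simp_all add: matrix_vector_mult_def sum_2 vector_2)
qed

text \<open>The jump condition is linear in both traces, and by a b = 1 it can be solved for the
  trace from the right. It becomes an explicit transfer relation from left to right.\<close>

lemma jump_iff:
  "(- \<i>) *s (dot_sigma normal_vec *v (p - q)) = shell_matrix \<eta> \<tau> *v (p + q) \<longleftrightarrow> p = Lambda \<eta> \<tau> *v q"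
proof -
  define a b where "a = complex_of_real ((\<eta> + \<tau>) / 2)" and "b = complex_of_real ((\<eta> - \<tau>) / 2)"
  have ab: "a * b = 1" using half_product unfolding a_def b_def of_real_mult[symmetric] by simp
  have "\<i> * (p2 - q2) = a * (p1 + q1) \<and> \<i> * (p1 - q1) = b * (p2 + q2) \<longleftrightarrow> p1 = - \<i> * b * q2 \<and> p2 = - \<i> * a * q1"
    for p1 p2 q1 q2
  proof
    assume h: "\<i> * (p2 - q2) = a * (p1 + q1) \<and> \<i> * (p1 - q1) = b * (p2 + q2)"
    have "2 * (p1 + \<i> * b * q2) = 0" "2 * (p2 + \<i> * a * q1) = 0" using h ab i_squared by algebra+
    then have "p1 + \<i> * b * q2 = 0" "p2 + \<i> * a * q1 = 0" unfolding mult_eq_0_iff by simp_all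
    then show "p1 = - \<i> * b * q2 \<and> p2 = - \<i> * a * q1" by (simp add: eq_neg_iff_add_eq_0)
  next
    assume "p1 = - \<i> * b * q2 \<and> p2 = - \<i> * a * q1"
    then show "\<i> * (p2 - q2) = a * (p1 + q1) \<and> \<i> * (p1 - q1) = b * (p2 + q2)" using ab i_squared by algebra
  qed
  then show ?thesis
    unfolding vec_eq_iff forall_2 normal_components shell_matrix_components Lambda_components vector_minus_component
      vector_add_component a_def[symmetric] b_def[symmetric] .
qed

text \<open>Here eta - tau = eta s1^2 and eta + tau = eta s2^2, while eta s1 s2 / 2 is the sign of
  eta.\<close>

lemma half_sums: "(\<eta> - \<tau>) / 2 * s2 = sgn \<eta> * s1" "(\<eta> + \<tau>) / 2 * s1 = sgn \<eta> * s2"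
proof -
  have b: "(\<eta> - \<tau>) / 2 = \<eta> / 2 * s1\<^sup>2" "(\<eta> + \<tau>) / 2 = \<eta> / 2 * s2\<^sup>2"
    unfolding s_squared using eta_nonzero by (simp_all add: field_simps)
  have e: "\<eta> / 2 * (s1 * s2) = sgn \<eta>" unfolding s_prod using eta_nonzero by (simp add: sgn_real_def)
  show "(\<eta> - \<tau>) / 2 * s2 = sgn \<eta> * s1" "(\<eta> + \<tau>) / 2 * s1 = sgn \<eta> * s2"
    unfolding b e[symmetric] by (simp_all add: power2_eq_square)
qed

text \<open>Exchanging the components of \<open>amp (- 1)\<close> puts \<open>pm 1\<close> and
  \<open>pm (- 1)\<close> where \<open>amp 1\<close> has them. The remaining constants agree by
  \<open>half_sums\<close>, in which k does not occur, so a single matrix matches all frequencies;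
  the sign of eta is left over.\<close>

lemma Lambda_amp: "Lambda \<eta> \<tau> *v amp (- 1) k = of_real (- sgn \<eta>) *s amp 1 k"
proof -
  have "- \<i> * of_real ((\<eta> - \<tau>) / 2) * (amp (- 1) k $ 2) = - of_real ((\<eta> - \<tau>) / 2 * s2) * of_real (pm 1 k)"
    "- \<i> * of_real ((\<eta> + \<tau>) / 2) * (amp (- 1) k $ 1) = - \<i> * of_real ((\<eta> + \<tau>) / 2 * s1) * of_real (pm (- 1) k)"
    by (simp_all add: amp_def vector_2 mult_ac)
  then show ?thesis
    unfolding vec_eq_iff forall_2 Lambda_components half_sums vector_smult_component
    by (simp add: amp_def vector_2)
qed

text \<open>The explicit vector is the amplitude decaying on the left half plane; on the right
  Lambda supplies the other one.\<close>

lemma amplitude_eq: "amplitude m \<eta> \<tau> k = amp (- 1) k"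
  by (simp add: amplitude_def amp_def real_sqrt_mult s1_def s2_def pm_def)

end

section \<open>Splitting the plane into half planes\<close>

lemma Omega_half: "Omega_plus = half 1" "Omega_minus = half (-1)"
  by (auto simp: Omega_plus_def Omega_minus_def half_def)

lemma AE_half: "(AE p in lborel_on (half s). P p) \<longleftrightarrow> (AE p in lborel. p \<in> half s \<longrightarrow> P p)"
  by (subst AE_restrict_space_iff) (auto intro: half_measurable)

lemma AE_off_axis: "AE p in lborel. fst (p :: real \<times> real) \<noteq> 0"
proof (rule AE_I')
  have "negligible {p :: real \<times> real. (1, 0) \<bullet> p = 0}" by (rule negligible_hyperplane) (simp add: zero_prod_def)
  moreover have "{p :: real \<times> real. (1, 0) \<bullet> p = 0} \<in> sets borel" by (intro borel_closed closed_hyperplane)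
  moreover have "{p :: real \<times> real. (1, 0) \<bullet> p = 0} = {p. fst p = 0}" by (auto simp: inner_prod_def)
  ultimately show "{p :: real \<times> real. fst p = 0} \<in> null_sets lborel"
    by (simp add: negligible_iff_null_sets null_sets_def)
qed auto

lemma AE_halves:
  "(AE p in lborel. P p) \<longleftrightarrow> (AE p in lborel_on (half 1). P p) \<and> (AE p in lborel_on (half (-1)). P p)"
proof
  assume "AE p in lborel. P p"
  then show "(AE p in lborel_on (half 1). P p) \<and> (AE p in lborel_on (half (-1)). P p)"
    unfolding AE_half by auto
next
  assume "(AE p in lborel_on (half 1). P p) \<and> (AE p in lborel_on (half (-1)). P p)"
  then have "AE p in lborel. p \<in> half 1 \<longrightarrow> P p" "AE p in lborel. p \<in> half (-1) \<longrightarrow> P p"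
    by (simp_all only: AE_half)
  with AE_off_axis show "AE p in lborel. P p"
    by eventually_elim (auto simp: half_def)
qed

lemma nn2_restrict_half:
  fixes f :: "real \<times> real \<Rightarrow> 'b::euclidean_space"
  shows "nn2 (lborel_on (half s)) f = (\<integral>\<^sup>+p. ennreal ((norm (f p))\<^sup>2) * indicator (half s) p \<partial>lborel)"
  unfolding nn2_def by (rule nn_integral_restrict_space) (auto intro: half_measurable)

lemma nn2_halves:
  fixes f :: "real \<times> real \<Rightarrow> 'b::euclidean_space"
  assumes [measurable]: "f \<in> borel_measurable borel"
  shows "nn2 lborel f = nn2 (lborel_on (half 1)) f + nn2 (lborel_on (half (-1))) f"
proof -
  have [measurable]: "half s \<in> sets borel" for s by (rule half_measurable)
  have "nn2 lborel f = (\<integral>\<^sup>+p. ennreal ((norm (f p))\<^sup>2) * indicator (half 1) p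
      + ennreal ((norm (f p))\<^sup>2) * indicator (half (-1)) p \<partial>lborel)"
    unfolding nn2_def
  proof (rule nn_integral_cong_AE)
    show "AE p in lborel. ennreal ((norm (f p))\<^sup>2) = ennreal ((norm (f p))\<^sup>2) * indicator (half 1) p
      + ennreal ((norm (f p))\<^sup>2) * indicator (half (-1)) p"
      using AE_off_axis by eventually_elim (auto simp: half_def indicator_def)
  qed
  also have "\<dots> = nn2 (lborel_on (half 1)) f + nn2 (lborel_on (half (-1))) f"
    unfolding nn2_restrict_half by (rule nn_integral_add) auto
  finally show ?thesis .
qed

lemma spinor_norm_smult: "norm (c *s (v :: spinor)) = cmod c * norm v"
  by (rule power2_eq_imp_eq) (simp_all add: power_mult_distrib spinor_norm norm_mult ring_distribs)

lemma L2_smult: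
  fixes f :: "'a \<Rightarrow> spinor"
  assumes f: "f \<in> L2 M"
  shows "(\<lambda>x. c *s f x) \<in> L2 M"
  unfolding L2_iff
proof
  have m [measurable]: "f \<in> borel_measurable M" using f by (simp add: L2_iff)
  show "(\<lambda>x. c *s f x) \<in> borel_measurable M"
    by (rule spinor_measurableI) (unfold vector_smult_component, measurable)
  have "nn2 M (\<lambda>x. c *s f x) \<le> ennreal ((cmod c)\<^sup>2) * nn2 M f"
    by (rule nn2_scale_le[OF m]) (simp_all add: spinor_norm_smult)
  also have "\<dots> < \<infinity>" using f by (simp add: L2_iff ennreal_mult_less_top)
  finally show "nn2 M (\<lambda>x. c *s f x) < \<infinity>" .
qed

lemma L2_cmult:
  fixes f :: "'a \<Rightarrow> complex"
  assumes f: "f \<in> L2 M"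
  shows "(\<lambda>x. c * f x) \<in> L2 M"
  unfolding L2_iff
proof
  have m [measurable]: "f \<in> borel_measurable M" using f by (simp add: L2_iff)
  show "(\<lambda>x. c * f x) \<in> borel_measurable M" by measurable
  have "nn2 M (\<lambda>x. c * f x) \<le> ennreal ((cmod c)\<^sup>2) * nn2 M f"
    by (rule nn2_scale_le[OF m]) (simp_all add: norm_mult)
  also have "\<dots> < \<infinity>" using f by (simp add: L2_iff ennreal_mult_less_top)
  finally show "nn2 M (\<lambda>x. c * f x) < \<infinity>" .
qed

context shell
begin

text \<open>The factor $1/\sqrt 2$ is the quotient of the constants $1/(2\sqrt\pi)$ in \<^const>\<open>psi\<close> and $1/\sqrt{2\pi}$ in
  \<^const>\<open>inv_fourier\<close>; the sign comes from \<open>Lambda_amp\<close>.\<close>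

definition lam :: "real \<Rightarrow> real" where "lam s = (if s = 1 then - sgn \<eta> else 1) / sqrt 2"

definition dsty :: "real \<Rightarrow> (real \<Rightarrow> complex) \<Rightarrow> real \<Rightarrow> complex" where
  "dsty s \<Xi> k = of_real (lam s) * \<Xi> k"

lemma lam_squared: "(lam s)\<^sup>2 = 1 / 2"
  using eta_nonzero by (simp add: lam_def power_divide sgn_real_def)

lemma dsty_L2: "\<Xi> \<in> L2 lborel \<Longrightarrow> dsty s \<Xi> \<in> L2 lborel"
  unfolding dsty_def[abs_def] by (rule L2_cmult)

lemma Lambda_dsty: "dsty 1 \<Xi> k *s amp 1 k = Lambda \<eta> \<tau> *v (dsty (-1) \<Xi> k *s amp (-1) k)"
proof -
  have "Lambda \<eta> \<tau> *v (c *s v) = c *s (Lambda \<eta> \<tau> *v v)" for c v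
    unfolding vec_eq_iff forall_2 Lambda_components vector_smult_component by (simp add: mult_ac)
  then show ?thesis
    by (simp add: Lambda_amp dsty_def lam_def vector_smult_assoc mult_ac)
qed

lemma fld_component:
  "fld s \<xi> (x, y) $ i = inv_fourier (\<lambda>k. (\<xi> k *s amp s k) $ i * exp (of_real (- s * kap k * x))) y"
  by (simp add: fld_def efun_def xamp_def vector_smult_component)

text \<open>Away from the line the vector integral in \<open>psi\<close> converges, so components
  may be taken under it and its kernel splits into exp(i k y) and the decaying exponential. On the
  right Lambda acts on the integral, and \<open>Lambda_dsty\<close> identifies this with a change of
  amplitude.\<close>

lemma psi_half:
  assumes \<Xi>: "\<Xi> \<in> L2 lborel" and s: "s = 1 \<or> s = -1" and p: "p \<in> half s"
  shows "psi m \<eta> \<tau> \<Xi> p = fld s (dsty s \<Xi>) p"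
proof -
  obtain x y where xy: "p = (x, y)" by fastforce
  have [measurable]: "\<Xi> \<in> borel_measurable borel" using \<Xi> by (simp add: L2_iff)
  have [measurable]: "(\<lambda>k. amp t k $ i) \<in> borel_measurable borel" for t i using amp_measurable[of t] by measurable
  define v where "v = s * x"
  have v: "v > 0" "\<bar>x\<bar> = v" using p s by (auto simp: half_def xy v_def)
  define E where "E k = exp (\<i> * complex_of_real (k * y) - of_real (kap k * \<bar>x\<bar>))" for k
  define G where "G i k = \<Xi> k * amp (-1) k $ i * exp (of_real (- kap k * v))" for i k
  have E: "E k = exp (\<i> * of_real y * of_real k) * exp (of_real (- kap k * v))" for k
    unfolding E_def v(2) by (simp add: mult_exp_exp mult_ac)
  have [measurable]: "E \<in> borel_measurable borel" unfolding E[abs_def] by measurable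
  define I where "I = (LINT k|lborel. (\<Xi> k * E k) *s amp (-1) k)"
  have "integrable lborel (\<lambda>k. ((\<Xi> k * E k) *s amp (-1) k) $ i)" for i
  \<comment> \<open>The oscillating factor has modulus 1, so integrability is inherited from the
    purely decaying kernel \<open>G i\<close>.\<close>
  proof (rule Bochner_Integration.integrable_bound)
    show "integrable lborel (G i)"
      using dens_exp(1)[OF xamp_dens[OF \<Xi>, of "-1" i] v(1)] by (simp add: G_def[abs_def] xamp_def)
    show "(\<lambda>k. ((\<Xi> k * E k) *s amp (-1) k) $ i) \<in> borel_measurable lborel"
      unfolding vector_smult_component by measurable
    show "AE k in lborel. norm (((\<Xi> k * E k) *s amp (-1) k) $ i) \<le> norm (G i k)"
      unfolding E G_def by (simp add: norm_mult)
  qed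
  then have int: "integrable lborel (\<lambda>k. (\<Xi> k * E k) *s amp (-1) k)" by (simp add: spinor_integrable_iff)
  have I: "I $ i = of_real (sqrt (2 * pi)) * inv_fourier (G i) y" for i
  proof -
    have "I $ i = (LINT k|lborel. ((\<Xi> k * E k) *s amp (-1) k) $ i)"
      unfolding I_def by (rule spinor_integral_nth[OF int])
    also have "\<dots> = (LINT k|lborel. exp (\<i> * of_real y * of_real k) * G i k)"
      unfolding vector_smult_component E G_def by (simp only: mult_ac)
    finally show ?thesis by (simp add: inv_fourier_def)
  qed
  have c: "complex_of_real (1 / (2 * sqrt pi)) * (of_real (sqrt (2 * pi)) * z) = of_real (1 / sqrt 2) * z" for z
  proof -
    have "1 / (2 * sqrt pi) * sqrt (2 * pi) = 1 / sqrt 2"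
      by (simp add: real_sqrt_mult real_div_sqrt field_simps)
    then show ?thesis by (metis mult.assoc of_real_mult)
  qed
  have psi: "psi m \<eta> \<tau> \<Xi> p = of_real (1 / (2 * sqrt pi)) *s ((heaviside x *\<^sub>R Lambda \<eta> \<tau> + heaviside (- x) *\<^sub>R pauli0) *v I)"
    unfolding psi_def xy I_def E_def amplitude_eq by simp
  show ?thesis
  proof (cases "s = 1")
    case True
    have x: "x > 0" using v True by (simp add: v_def)
    have vx: "v = x" using True by (simp add: v_def)
    \<comment> \<open>Lambda exchanges the components with a factor that depends on the row;
      \<open>i\<close>, \<open>j\<close> and \<open>t\<close> are kept general so that both rows
      come from one computation.\<close>
    have "fld 1 (dsty 1 \<Xi>) (x, y) $ i = of_real (1 / sqrt 2) * (- \<i> * of_real t) * inv_fourier (G j) y"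
      if "(i = 1 \<and> j = 2 \<and> t = (\<eta> - \<tau>) / 2) \<or> (i = 2 \<and> j = 1 \<and> t = (\<eta> + \<tau>) / 2)" for i j t
    proof -
      have "(\<lambda>k. (dsty 1 \<Xi> k *s amp 1 k) $ i * exp (of_real (- 1 * kap k * x)))
        = (\<lambda>k. of_real (1 / sqrt 2) * (- \<i> * of_real t) * G j k)"
      proof
        fix k
        have e: "- 1 * kap k * x = - kap k * v" and l: "lam (- 1) = 1 / sqrt 2" by (simp_all add: vx lam_def)
        show "(dsty 1 \<Xi> k *s amp 1 k) $ i * exp (of_real (- 1 * kap k * x)) = of_real (1 / sqrt 2) * (- \<i> * of_real t) * G j k"
          unfolding Lambda_dsty e G_def using that
          by (elim disjE conjE) (simp_all only: Lambda_components vector_smult_component dsty_def l mult_ac)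
      qed
      then show ?thesis unfolding fld_component by (simp only: inv_fourier_cmult)
    qed
    note f = this[OF disjI1[OF conjI[OF refl conjI[OF refl refl]]]] this[OF disjI2[OF conjI[OF refl conjI[OF refl refl]]]]
    have M: "heaviside x *\<^sub>R Lambda \<eta> \<tau> + heaviside (- x) *\<^sub>R pauli0 = Lambda \<eta> \<tau>" using x by (simp add: heaviside_def)
    have c2: "complex_of_real (1 / (2 * sqrt pi)) * (- \<i> * of_real t * (of_real (sqrt (2 * pi)) * w))
      = of_real (1 / sqrt 2) * (- \<i> * of_real t) * w" for t w
      using c[of "- \<i> * of_real t * w"] by (simp only: mult_ac)
    show ?thesis
      unfolding xy True psi[unfolded xy] M vec_eq_iff forall_2 vector_smult_component Lambda_components I f c2 by simp
  next
    case False
    then have s1: "s = -1" using s by simp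
    have x: "x < 0" using v s1 by (simp add: v_def)
    have "(\<lambda>k. (dsty (-1) \<Xi> k *s amp (-1) k) $ i * exp (of_real (- (-1) * kap k * x)))
        = (\<lambda>k. of_real (1 / sqrt 2) * G i k)" for i
      by (auto simp: vector_smult_component G_def dsty_def lam_def v_def s1 fun_eq_iff)
    then have f: "fld (-1) (dsty (-1) \<Xi>) (x, y) $ i = of_real (1 / sqrt 2) * inv_fourier (G i) y" for i
      unfolding fld_component by (simp only: inv_fourier_cmult)
    have "psi m \<eta> \<tau> \<Xi> p = of_real (1 / (2 * sqrt pi)) *s I"
      unfolding psi using x by (simp add: heaviside_def)
    then show ?thesis
      unfolding vec_eq_iff by (simp only: vector_smult_component I c xy s1 f simp_thms)
  qed
qed

text \<open>\<open>heaviside 0\<close> is 0, so both terms vanish on the line, whatever value the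
  integral has there.\<close>

lemma psi_axis: "fst p = 0 \<Longrightarrow> psi m \<eta> \<tau> \<Xi> p = 0"
  by (cases p) (simp add: psi_def heaviside_def)

lemma psi_measurable:
  assumes \<Xi>: "\<Xi> \<in> L2 lborel"
  shows "psi m \<eta> \<tau> \<Xi> \<in> borel_measurable borel"
proof -
  have [measurable]: "fld s (dsty s \<Xi>) \<in> borel_measurable borel" for s
    using dsty_L2[OF \<Xi>] by (intro fld_measurable) (simp add: L2_iff)
  have [measurable]: "half s \<in> sets borel" for s by (rule half_measurable)
  have "psi m \<eta> \<tau> \<Xi> = (\<lambda>p. if p \<in> half 1 then fld 1 (dsty 1 \<Xi>) p else if p \<in> half (-1) then fld (-1) (dsty (-1) \<Xi>) p else 0)"
    using psi_half[OF \<Xi>] psi_axis by (auto simp: fun_eq_iff half_def)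
  then show ?thesis by simp
qed

text \<open>The two sides may carry different shares at a given frequency, but |amp 1|^2 + |amp
  (-1)|^2 = 2 (s1^2 + s2^2) kappa = 4 kappa. With the factor 1/2 from \<open>lam_squared\<close> and
  1/(2 kappa) from the energy this gives exactly 1.\<close>

lemma nn2_psi:
  assumes \<Xi>: "\<Xi> \<in> L2 lborel"
  shows "nn2 lborel (psi m \<eta> \<tau> \<Xi>) = nn2 lborel \<Xi>"
proof -
  have [measurable]: "\<Xi> \<in> borel_measurable borel" using \<Xi> by (simp add: L2_iff)
  have m [measurable]: "amp t \<in> borel_measurable borel" for t using amp_measurable[of t] by (intro spinor_measurableI)
  have "nn2 (lborel_on (half s)) (psi m \<eta> \<tau> \<Xi>)
    = (\<integral>\<^sup>+k. ennreal ((cmod (\<Xi> k))\<^sup>2 / 2 * ((norm (amp s k))\<^sup>2 / (2 * kap k))) \<partial>lborel)" if s: "s = 1 \<or> s = -1" for s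
  proof -
    have "nn2 (lborel_on (half s)) (psi m \<eta> \<tau> \<Xi>) = nn2 (lborel_on (half s)) (fld s (dsty s \<Xi>))"
      by (rule nn2_cong_AE) (simp add: AE_half psi_half[OF \<Xi> s])
    also have "\<dots> = (\<integral>\<^sup>+k. ennreal ((cmod (\<Xi> k))\<^sup>2 / 2 * ((norm (amp s k))\<^sup>2 / (2 * kap k))) \<partial>lborel)"
      unfolding fld_energy[OF dsty_L2[OF \<Xi>] s]
      by (simp add: dsty_def norm_mult power_mult_distrib lam_squared)
    finally show ?thesis .
  qed
  note h = this[OF disjI1[OF refl]] this[OF disjI2[OF refl]]
  have "nn2 lborel (psi m \<eta> \<tau> \<Xi>) = (\<integral>\<^sup>+k. ennreal ((cmod (\<Xi> k))\<^sup>2 / 2 * ((norm (amp 1 k))\<^sup>2 / (2 * kap k)))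
      + ennreal ((cmod (\<Xi> k))\<^sup>2 / 2 * ((norm (amp (-1) k))\<^sup>2 / (2 * kap k))) \<partial>lborel)"
    unfolding nn2_halves[OF psi_measurable[OF \<Xi>]] h by (rule nn_integral_add[symmetric]) auto
  also have "\<dots> = nn2 lborel \<Xi>"
    unfolding nn2_def
  proof (rule nn_integral_cong)
    fix k
    have "(norm (amp 1 k))\<^sup>2 + (norm (amp (-1) k))\<^sup>2 = 2 * (s1\<^sup>2 + s2\<^sup>2) * kap k"
      by (simp add: amp_norm algebra_simps)
    then have "(norm (amp 1 k))\<^sup>2 + (norm (amp (-1) k))\<^sup>2 = 4 * kap k" by (simp add: s_squared)
    then have "(cmod (\<Xi> k))\<^sup>2 / 2 * ((norm (amp 1 k))\<^sup>2 / (2 * kap k)) + (cmod (\<Xi> k))\<^sup>2 / 2 * ((norm (amp (-1) k))\<^sup>2 / (2 * kap k))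
      = (cmod (\<Xi> k))\<^sup>2"
      using kap_pos[of k] by (simp flip: distrib_left add_divide_distrib)
    then show "ennreal ((cmod (\<Xi> k))\<^sup>2 / 2 * ((norm (amp 1 k))\<^sup>2 / (2 * kap k)))
      + ennreal ((cmod (\<Xi> k))\<^sup>2 / 2 * ((norm (amp (-1) k))\<^sup>2 / (2 * kap k))) = ennreal ((norm (\<Xi> k))\<^sup>2)"
      using kap_pos[of k] by (subst ennreal_plus[symmetric]) auto
  qed
  finally show ?thesis .
qed

lemma psi_L2: "\<Xi> \<in> L2 lborel \<Longrightarrow> psi m \<eta> \<tau> \<Xi> \<in> L2 lborel"
  using psi_measurable[of \<Xi>] nn2_psi[of \<Xi>] by (simp add: L2_iff)

lemma psi_norm: "\<Xi> \<in> L2 lborel \<Longrightarrow> L2_norm lborel (psi m \<eta> \<tau> \<Xi>) = L2_norm lborel \<Xi>"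
  using psi_L2[of \<Xi>] by (simp add: L2_iff L2_norm_eq nn2_psi)

text \<open>\<open>Lambda_dsty\<close> holds frequency by frequency, and a constant matrix passes
  through the pairing with a test function.\<close>

lemma amp_distr_jump:
  assumes \<Xi>: "\<Xi> \<in> L2 lborel" and \<phi>: "\<phi> \<in> test_functions UNIV"
  shows "amp_distr 1 (dsty 1 \<Xi>) \<phi> = Lambda \<eta> \<tau> *v amp_distr (-1) (dsty (-1) \<Xi>) \<phi>"
proof -
  have rep: "sobolev_rep (- 1 / 2) (amp_distr s (dsty s \<Xi>)) (\<lambda>k. dsty s \<Xi> k *s amp s k)" if "s = 1 \<or> s = -1" for s
    using that by (intro amp_distr_rep dsty_L2[OF \<Xi>]) auto
  define W where "W k = dsty (-1) \<Xi> k *s amp (-1) k" for k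
  have t1: "amp_distr 1 (dsty 1 \<Xi>) \<phi> $ i = (LINT k|lborel. inv_fourier \<phi> k * (Lambda \<eta> \<tau> *v W k) $ i)" for i
    using rep[of 1] \<phi> unfolding sobolev_rep_iff Lambda_dsty W_def by blast
  have tm: "amp_distr (-1) (dsty (-1) \<Xi>) \<phi> $ i = (LINT k|lborel. inv_fourier \<phi> k * W k $ i)" for i
    using rep[of "-1"] \<phi> unfolding sobolev_rep_iff W_def by blast
  have c: "(LINT k|lborel. inv_fourier \<phi> k * (c * z k)) = c * (LINT k|lborel. inv_fourier \<phi> k * z k)"
    for c and z :: "real \<Rightarrow> complex"
    unfolding mult.left_commute[of _ c] by (rule integral_mult_right_zero)
  show ?thesis
    unfolding vec_eq_iff forall_2 t1 Lambda_components tm c by (intro conjI refl)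
qed

text \<open>Stated for every representative, since the eigenspace contains all Borel functions that
  agree almost everywhere with a superposition. The weak gradient \<open>gop (\<psi> p)\<close> from
  \<open>trace_of_fld\<close> is at once the witness for the action of the operator.\<close>

lemma psi_eigenfunction:
  assumes \<Xi>: "\<Xi> \<in> L2 lborel" and \<psi>: "\<psi> \<in> L2 lborel" and ae: "AE p in lborel. \<psi> p = psi m \<eta> \<tau> \<Xi> p"
  shows "\<psi> \<in> eigenspace (dirac_shell m \<eta> \<tau>) (of_real zs)"
proof -
  define T where "T s = amp_distr s (dsty s \<Xi>)" for s
  have L: "\<psi> \<in> L2 (lborel_on (half s))" for s by (rule L2_restrict[OF \<psi> half_measurable])
  have rep: "sobolev_rep (- 1 / 2) (T s) (\<lambda>k. dsty s \<Xi> k *s amp s k)" if "s = 1 \<or> s = -1" for s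
    unfolding T_def using that by (intro amp_distr_rep dsty_L2[OF \<Xi>]) auto
  have tr: "has_dirichlet_trace (half s) \<psi> (T s)" "weak_sigma_grad (half s) \<psi> (\<lambda>p. gop (\<psi> p))" if s: "s = 1 \<or> s = -1" for s
  proof -
    have "AE p in lborel_on (half s). \<psi> p = fld s (dsty s \<Xi>) p"
      unfolding AE_half using ae by eventually_elim (simp add: psi_half[OF \<Xi> s])
    from trace_of_fld[OF dsty_L2[OF \<Xi>] s L this rep[OF s]]
    show "has_dirichlet_trace (half s) \<psi> (T s)" "weak_sigma_grad (half s) \<psi> (\<lambda>p. gop (\<psi> p))" .
  qed
  have T: "T 1 \<phi> = Lambda \<eta> \<tau> *v T (-1) \<phi>" if "\<phi> \<in> test_functions UNIV" for \<phi>
    unfolding T_def by (rule amp_distr_jump[OF \<Xi> that])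
  have "\<psi> \<in> shell_domain \<eta> \<tau>"
    unfolding shell_domain_def Omega_half H_sigma_def mem_Collect_eq
    using L \<psi> tr(1)[of 1] tr(1)[of "-1"] tr(2)[of 1] tr(2)[of "-1"] T jump_iff by fast
  moreover have "acts_as_dirac m (half s) \<psi> (\<lambda>p. of_real zs *s \<psi> p)" if "s = 1 \<or> s = -1" for s
    unfolding acts_as_dirac_def
    by (intro exI[of _ "\<lambda>p. gop (\<psi> p)"] conjI tr(2)[OF that] AE_I2) (rule gop_iff[THEN iffD2, OF refl])
  ultimately show ?thesis
    using L2_smult[OF \<psi>] by (simp add: eigenspace_def dirac_shell_def Omega_half)
qed

section \<open>Infinite multiplicity\<close>

lemma fld_cmult: "fld s (\<lambda>k. c * \<xi> k) p = c *s fld s \<xi> p"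
  by (cases p) (simp add: vec_eq_iff fld_component vector_smult_component mult.assoc inv_fourier_cmult)

lemma psi_combination:
  assumes \<Xi>: "\<Xi> \<in> L2 lborel" "\<Theta> \<in> L2 lborel"
  shows "psi m \<eta> \<tau> (\<lambda>k. \<Xi> k + c * \<Theta> k) p = psi m \<eta> \<tau> \<Xi> p + c *s psi m \<eta> \<tau> \<Theta> p"
proof (cases "fst p = 0")
  case True
  then show ?thesis by (simp add: psi_axis)
next
  case False
  then have "p \<in> half 1 \<or> p \<in> half (-1)" by (auto simp: half_def)
  then obtain s where s: "s = 1 \<or> s = -1" and p: "p \<in> half s" by blast
  \<comment> \<open>The sum is written as a difference with the factor - c, in order to apply
    \<open>fld_diff\<close>.\<close>
  have L: "dsty s \<Xi> \<in> L2 lborel" "(\<lambda>k. (- c) * dsty s \<Theta> k) \<in> L2 lborel"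
    by (intro dsty_L2 L2_cmult \<Xi>)+
  have "psi m \<eta> \<tau> (\<lambda>k. \<Xi> k + c * \<Theta> k) p = fld s (dsty s (\<lambda>k. \<Xi> k + c * \<Theta> k)) p"
    by (rule psi_half[OF _ s p]) (intro L2_add L2_cmult \<Xi>)
  also have "dsty s (\<lambda>k. \<Xi> k + c * \<Theta> k) = (\<lambda>k. dsty s \<Xi> k - (- c) * dsty s \<Theta> k)"
    by (simp add: dsty_def fun_eq_iff algebra_simps)
  also have "fld s \<dots> p = fld s (dsty s \<Xi>) p - (- c) *s fld s (dsty s \<Theta>) p"
    unfolding fld_diff[OF L s p] fld_cmult ..
  also have "\<dots> = psi m \<eta> \<tau> \<Xi> p + c *s psi m \<eta> \<tau> \<Theta> p"
    unfolding psi_half[OF \<Xi>(1) s p] psi_half[OF \<Xi>(2) s p] by (simp add: vec_eq_iff)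
  finally show ?thesis .
qed

lemma unit_indicator_L2: "(indicator {a<..<a + 1 :: real} :: real \<Rightarrow> complex) \<in> L2 lborel"
proof -
  have "(cmod (indicator {a<..<a + 1} k))\<^sup>2 = indicator {a<..<a + 1} k" for k by (simp add: indicator_def)
  then show ?thesis by (simp add: L2_iff nn2_def ennreal_indicator)
qed

text \<open>Indicators of disjoint unit intervals serve as densities. By linearity and the norm
  identity a relation between the eigenfunctions that holds almost everywhere is one between the
  densities, and these have disjoint supports.\<close>

lemma infinite_multiplicity: "eigenvalue_of_infinite_multiplicity (dirac_shell m \<eta> \<tau>) (of_real zs)"
proof -
  define J :: "nat \<Rightarrow> real \<Rightarrow> complex" where "J n = indicator {real n<..<real n + 1}" for n
  have J: "J n \<in> L2 lborel" for n unfolding J_def by (rule unit_indicator_L2)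
  have "psi m \<eta> \<tau> (J n) \<in> eigenspace (dirac_shell m \<eta> \<tau>) (of_real zs)" for n
    by (rule psi_eigenfunction[OF J[of n] psi_L2[OF J]]) simp
  moreover have "c n = 0" if ae: "AE p in lborel. (\<Sum>n<N. c n *s psi m \<eta> \<tau> (J n) p) = 0" and n: "n < N" for N c n
  proof (rule ccontr)
    assume cn: "c n \<noteq> 0"
    have sum: "(\<lambda>k. \<Sum>j<M. c j * J j k) \<in> L2 lborel \<and> (\<forall>p. psi m \<eta> \<tau> (\<lambda>k. \<Sum>j<M. c j * J j k) p = (\<Sum>j<M. c j *s psi m \<eta> \<tau> (J j) p))" for M
    proof (induction M)
      case 0
      have "psi m \<eta> \<tau> (\<lambda>k. 0) p = 0" for p by (cases p) (simp add: psi_def)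
      then show ?case by (simp add: L2_iff nn2_def)
    next
      case (Suc M)
      then show ?case by (simp add: psi_combination J L2_add L2_cmult)
    qed
    let ?S = "\<lambda>k. \<Sum>j<N. c j * J j k"
    have S: "?S \<in> L2 lborel" using sum by blast
    have [measurable]: "?S \<in> borel_measurable borel" using S by (simp add: L2_iff)
    have "nn2 lborel ?S = nn2 lborel (psi m \<eta> \<tau> ?S)" by (rule nn2_psi[OF S, symmetric])
    also have "\<dots> = nn2 lborel (\<lambda>_ :: real \<times> real. 0 :: spinor)"       by (rule nn2_cong_AE) (use ae in \<open>simp only: sum[THEN conjunct2, rule_format]\<close>)
    finally have "(\<integral>\<^sup>+k. ennreal ((norm (?S k))\<^sup>2) \<partial>lborel) = 0" by (simp add: nn2_def)
    then have "AE k in lborel. ?S k = 0" by (subst (asm) nn_integral_0_iff_AE) auto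
    moreover have "?S k = c n" if "k \<in> {real n<..<real n + 1}" for k
    proof -
      have Jk: "J j k = (if j = n then 1 else 0)" for j
        using that by (auto simp: J_def indicator_def)
      show ?thesis unfolding Jk using n by (simp add: if_distrib cong: if_cong)
    qed
    \<comment> \<open>A nonzero coefficient would make an interval of length 1 a null set.\<close>
    ultimately have out: "AE k in lborel. k \<notin> {real n<..<real n + 1}" using cn by (auto elim!: eventually_mono)
    have null: "emeasure lborel {real n<..<real n + 1} = 0" by (rule iffD1[OF AE_iff_measurable out]) auto
    have "emeasure lborel {real n<..<real n + 1} = ennreal 1" by (subst emeasure_lborel_Ioo) simp_all
    from trans[OF this[symmetric] null] show False by simp
  qed
  ultimately show ?thesis unfolding eigenvalue_of_infinite_multiplicity_def by (intro exI[of _ "\<lambda>n. psi m \<eta> \<tau> (J n)"]) blast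
qed

end

section \<open>Eigenfunctions are superpositions of decaying modes\<close>

lemma sigma_grad_diff:
  assumes "smooth F" "smooth G"
  shows "sigma_grad (\<lambda>p. F p - G p) p = sigma_grad F p - sigma_grad G p"
proof -
  have d: "(H has_derivative frechet_derivative H (at p)) (at p)" if "smooth H" for H :: "real \<times> real \<Rightarrow> spinor"
    using smooth_differentiable[OF that, of p] by (simp add: frechet_derivative_works)
  have "frechet_derivative (\<lambda>p. F p - G p) (at p) = (\<lambda>v. frechet_derivative F (at p) v - frechet_derivative G (at p) v)"
    by (rule frechet_derivative_at[OF has_derivative_diff[OF d[OF assms(1)] d[OF assms(2)]], symmetric])
  then show ?thesis by (simp add: sigma_grad_def partial_x_def partial_y_def matrix_vector_mult_diff_distrib)
qed

lemma ftrace_diff: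
  assumes F: "F \<in> test_functions UNIV" and G: "G \<in> test_functions UNIV"
  shows "ftrace (\<lambda>p. F p - G p) k = ftrace F k - ftrace G k"
proof -
  have "fhat (\<lambda>p. F p $ i + (- 1) * G p $ i) 0 k = fhat (\<lambda>p. F p $ i) 0 k + (- 1) * fhat (\<lambda>p. G p $ i) 0 k" for i
    unfolding fhat_cmult[symmetric]
    by (rule fhat_add[OF test_functions_nth[OF F] test_functions_UNIV_cmult[OF test_functions_nth[OF G]]])
  then show ?thesis by (simp add: ftrace_def vec_eq_iff)
qed

lemma sobolev_rep_measurable:
  assumes "sobolev_rep (- 1 / 2) T w"
  shows "w \<in> borel_measurable borel"
proof (rule spinor_measurableI)
  have "w k $ i = (of_real (wt k) * w k $ i) / of_real (wt k)" for k i using wt_pos[of k] by simp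
  moreover have "(\<lambda>k. (of_real (wt k) * w k $ i) / of_real (wt k)) \<in> borel_measurable borel" for i
    using assms unfolding sobolev_rep_iff by (intro borel_measurable_divide) (auto simp: L2_iff)
  ultimately show "(\<lambda>k. w k $ 1) \<in> borel_measurable borel" "(\<lambda>k. w k $ 2) \<in> borel_measurable borel" by simp_all
qed

lemma ftrace_measurable: "F \<in> test_functions UNIV \<Longrightarrow> ftrace F \<in> borel_measurable borel"
  by (rule sobolev_rep_measurable[OF sobolev_rep_line_restriction])

lemma nn2_eq_0_iff:
  assumes [measurable]: "f \<in> borel_measurable M"
  shows "nn2 M f = 0 \<longleftrightarrow> (AE x in M. f x = 0)"
  unfolding nn2_def by (subst nn_integral_0_iff_AE) auto

lemma ennreal_bound_tendsto_0:
  fixes a :: ennreal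
  assumes "\<And>n. a \<le> u n" "u \<longlonglongrightarrow> 0"
  shows "a = 0"
  using ennreal_tendsto_0_bound[OF assms] by (simp add: LIMSEQ_const_iff)

context shell
begin

lemma mode_diff: "mode d k (u - v) = mode d k u - mode d k v"
  unfolding mode_def vector_minus_component right_diff_distrib by algebra

lemma mode_measurable:
  assumes [measurable]: "w \<in> borel_measurable borel"
  shows "(\<lambda>k. mode d k (w k)) \<in> borel_measurable borel"
  unfolding mode_def by measurable

lemma resid_diff:
  assumes "F \<in> test_functions UNIV" "G \<in> test_functions UNIV"
  shows "resid (\<lambda>p. F p - G p) p = resid F p - resid G p"
  using assms by (simp add: resid_gop gop_diff sigma_grad_diff test_functions_smooth)

lemma resid_L2:
  assumes "F \<in> test_functions UNIV"
  shows "resid F \<in> L2 lborel"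
  unfolding L2_spinor_iff by (intro conjI; rule test_functions_L2[OF resid_test[OF assms]])

text \<open>The trace and the action of the operator each come with a weak gradient of their own.
  Uniqueness identifies them, so the gradients of the approximants converge to
  \<open>gop (\<psi> p)\<close> and their residuals to 0.\<close>

lemma dirac_approximation:
  assumes s: "s = 1 \<or> s = -1" and T: "has_dirichlet_trace (half s) \<psi> T"
    and act: "acts_as_dirac m (half s) \<psi> (\<lambda>p. of_real zs *s \<psi> p)"
  obtains F w where "\<And>n::nat. F n \<in> test_functions UNIV"
    "(\<lambda>n. nn2 (lborel_on (half s)) (\<lambda>p. F n p - \<psi> p)) \<longlonglongrightarrow> 0"
    "(\<lambda>n. nn2 (lborel_on (half s)) (resid (F n))) \<longlonglongrightarrow> 0"
    "sobolev_rep (- 1 / 2) T w" "(\<lambda>n. nn2 lborel (\<lambda>k. wt k *\<^sub>R (ftrace (F n) k - w k))) \<longlonglongrightarrow> 0"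
proof -
  let ?M = "lborel_on (half s)"
  obtain g F w where \<psi>: "\<psi> \<in> L2 ?M" and g: "weak_sigma_grad (half s) \<psi> g" and F: "\<And>n::nat. F n \<in> test_functions UNIV"
    and cf: "(\<lambda>n. nn2 ?M (\<lambda>p. F n p - \<psi> p)) \<longlonglongrightarrow> 0"
    and cg: "(\<lambda>n. nn2 ?M (\<lambda>p. sigma_grad (F n) p - g p)) \<longlonglongrightarrow> 0"
    and w: "sobolev_rep (- 1 / 2) T w" and ct: "(\<lambda>n. nn2 lborel (\<lambda>k. wt k *\<^sub>R (ftrace (F n) k - w k))) \<longlonglongrightarrow> 0"
    by (rule has_dirichlet_traceE[OF T half_measurable]) (rule that; assumption)
  from act obtain g' where g': "weak_sigma_grad (half s) \<psi> g'" and e: "AE p in ?M. g' p = gop (\<psi> p)"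
    unfolding acts_as_dirac_def gop_iff by blast
  have eq: "AE p in ?M. g p = gop (\<psi> p)"
    using weak_sigma_grad_unique[OF \<psi> s g g'] e by eventually_elim simp
  have FL: "F n \<in> L2 ?M" "sigma_grad (F n) \<in> L2 ?M" for n
    by (rule L2_restrict[OF test_functions_L2[OF F] half_measurable], rule L2_restrict[OF sigma_grad_L2[OF F] half_measurable])
  have m: "\<psi> \<in> borel_measurable ?M" "F n \<in> borel_measurable ?M" "sigma_grad (F n) \<in> borel_measurable ?M" for n
    using FL \<psi> by (auto simp: L2_iff)
  have mg: "g \<in> borel_measurable ?M" using g by (simp add: weak_sigma_grad_def L2_iff)
  note [measurable] = m mg gop_measurable[OF m(1)] gop_measurable[OF m(2)]
  define c where "c = ennreal ((\<bar>zs\<bar> + m)\<^sup>2)"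
  have bd: "nn2 ?M (resid (F n)) \<le> 2 * nn2 ?M (\<lambda>p. sigma_grad (F n) p - g p) + 2 * (c * nn2 ?M (\<lambda>p. F n p - \<psi> p))" for n
  proof -
    have "nn2 ?M (resid (F n)) = nn2 ?M (\<lambda>p. (sigma_grad (F n) p - g p) - gop (F n p - \<psi> p))"
      by (rule nn2_cong_AE) (use eq in \<open>eventually_elim, simp add: resid_gop gop_diff\<close>)
    also have "\<dots> \<le> 2 * nn2 ?M (\<lambda>p. sigma_grad (F n) p - g p) + 2 * nn2 ?M (\<lambda>p. gop (F n p - \<psi> p))"
      by (rule nn2_diff_le) (unfold gop_diff, measurable)
    also have "nn2 ?M (\<lambda>p. gop (F n p - \<psi> p)) \<le> c * nn2 ?M (\<lambda>p. F n p - \<psi> p)"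
      unfolding c_def by (rule nn2_scale_le[OF _ gop_norm_le]) (use m_pos in auto)
    finally show ?thesis by (simp add: mult_left_mono)
  qed
  have "(\<lambda>n. 2 * nn2 ?M (\<lambda>p. sigma_grad (F n) p - g p) + 2 * (c * nn2 ?M (\<lambda>p. F n p - \<psi> p))) \<longlonglongrightarrow> 0 + 0"
    by (intro tendsto_add ennreal_cmult_tendsto_0 cg cf) (auto simp: c_def)
  then have "(\<lambda>n. nn2 ?M (resid (F n))) \<longlonglongrightarrow> 0"
    using ennreal_tendsto_0_bound[OF bd] by simp
  from that[OF F cf this w ct] show thesis .
qed

text \<open>The a priori estimate makes the growing mode of the approximate traces vanish in the
  limit; what remains is a multiple of the amplitude, with the coefficient read off from the
  decaying mode.\<close>

lemma trace_polarized:
  assumes s: "s = 1 \<or> s = -1" and F: "\<And>n::nat. F n \<in> test_functions UNIV"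
    and cr: "(\<lambda>n. nn2 (lborel_on (half s)) (resid (F n))) \<longlonglongrightarrow> 0"
    and w: "sobolev_rep (- 1 / 2) T w" and ct: "(\<lambda>n. nn2 lborel (\<lambda>k. wt k *\<^sub>R (ftrace (F n) k - w k))) \<longlonglongrightarrow> 0"
  obtains \<xi> where "\<xi> \<in> L2 lborel" "AE k in lborel. w k = \<xi> k *s amp s k"
proof -
  have d: "\<bar>s\<bar> = 1" "\<bar>- s\<bar> = 1" using s by auto
  have mw [measurable]: "w \<in> borel_measurable borel" by (rule sobolev_rep_measurable[OF w])
  have mF [measurable]: "ftrace (F n) \<in> borel_measurable borel" for n by (rule ftrace_measurable[OF F])
  note [measurable] = mode_measurable[OF mw] mode_measurable[OF mF]
  \<comment> \<open>The residual bounds the growing mode in L^2, but the traces converge only with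
    the weight \<open>wt\<close>, and a mode may exceed its vector by a factor of order sqrt(kappa).
    With the weight wt / sqrt(kappa) both sources of error are controlled.\<close>
  define h where "h v k = (wt k / sqrt (kap k)) *\<^sub>R mode (- s) k (v k)" for v :: "real \<Rightarrow> spinor" and k
  have mh [measurable]: "h w \<in> borel_measurable borel" "h (ftrace (F n)) \<in> borel_measurable borel" for n
    unfolding h_def[abs_def] by measurable
  have A: "nn2 lborel (h (ftrace (F n))) \<le> ennreal (1 / mu) * (ennreal apriori * nn2 (lborel_on (half s)) (resid (F n)))" for n
  proof -
    have "nn2 lborel (h (ftrace (F n))) \<le> ennreal ((1 / sqrt mu)\<^sup>2) * nn2 lborel (\<lambda>k. mode (- s) k (ftrace (F n) k))"
    proof (rule nn2_scale_le)
      fix k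
      have "wt k / sqrt (kap k) \<le> 1 / sqrt mu"
        using wt_pos[of k] wt_le_1[of k] kap_ge_mu[of k] mu_pos by (intro frac_le) auto
      then show "norm (h (ftrace (F n)) k) \<le> 1 / sqrt mu * norm (mode (- s) k (ftrace (F n) k))"
        unfolding h_def norm_scaleR using wt_pos[of k] kap_pos[of k] by (intro mult_right_mono) auto
    qed (use mu_pos in auto)
    also have "\<dots> \<le> ennreal (1 / mu) * (ennreal apriori * nn2 (lborel_on (half s)) (resid (F n)))"
      using mu_pos by (intro mult_mono apriori_estimate(2)[OF F s]) (auto simp: power_divide)
    finally show ?thesis .
  qed
  have B: "nn2 lborel (\<lambda>k. h (ftrace (F n)) k - h w k) \<le> ennreal (2 * sc) * nn2 lborel (\<lambda>k. wt k *\<^sub>R (ftrace (F n) k - w k))" for n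
  proof -
    have "nn2 lborel (\<lambda>k. h (ftrace (F n)) k - h w k) \<le> ennreal ((sqrt (2 * sc))\<^sup>2) * nn2 lborel (\<lambda>k. wt k *\<^sub>R (ftrace (F n) k - w k))"
    proof (rule nn2_scale_le)
      fix k
      let ?v = "ftrace (F n) k - w k"
      have "(cmod (mode (- s) k ?v))\<^sup>2 \<le> 2 * kap k * sc * (norm ?v)\<^sup>2"
        using mode_sum_le[OF d(1), of k ?v] zero_le_power2[of "cmod (mode s k ?v)"] by linarith
      then have "(wt k)\<^sup>2 / kap k * (cmod (mode (- s) k ?v))\<^sup>2 \<le> (wt k)\<^sup>2 / kap k * (2 * kap k * sc * (norm ?v)\<^sup>2)"
        using kap_pos[of k] by (intro mult_left_mono) auto
      also have "\<dots> = (sqrt (2 * sc) * norm (wt k *\<^sub>R ?v))\<^sup>2"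
      proof -
        have "(sqrt (2 * sc))\<^sup>2 = 2 * sc" using sc_pos by simp
        moreover have "(norm (wt k *\<^sub>R ?v))\<^sup>2 = (wt k)\<^sup>2 * (norm ?v)\<^sup>2" unfolding norm_scaleR power_mult_distrib by simp
        ultimately show ?thesis unfolding power_mult_distrib using kap_pos[of k] by simp
      qed
      also have "(wt k)\<^sup>2 / kap k * (cmod (mode (- s) k ?v))\<^sup>2 = (norm (h (ftrace (F n)) k - h w k))\<^sup>2"
        unfolding h_def scaleR_diff_right[symmetric] mode_diff[symmetric] norm_scaleR power_mult_distrib power2_abs power_divide
        using kap_pos[of k] by (simp add: less_imp_le)
      finally show "norm (h (ftrace (F n)) k - h w k) \<le> sqrt (2 * sc) * norm (wt k *\<^sub>R ?v)"
        by (rule power2_le_imp_le) (use sc_pos in simp)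
    qed (use sc_pos in auto)
    then show ?thesis using sc_pos by simp
  qed
  have "nn2 lborel (h w) = 0"
  proof (rule ennreal_bound_tendsto_0)
    fix n
    have "nn2 lborel (h w) = nn2 lborel (\<lambda>k. h (ftrace (F n)) k - (h (ftrace (F n)) k - h w k))" by simp
    also have "\<dots> \<le> 2 * nn2 lborel (h (ftrace (F n))) + 2 * nn2 lborel (\<lambda>k. h (ftrace (F n)) k - h w k)"
      by (rule nn2_diff_le) measurable
    also have "\<dots> \<le> 2 * (ennreal (1 / mu) * (ennreal apriori * nn2 (lborel_on (half s)) (resid (F n))))
      + 2 * (ennreal (2 * sc) * nn2 lborel (\<lambda>k. wt k *\<^sub>R (ftrace (F n) k - w k)))"
      by (intro add_mono mult_left_mono A B) auto
    finally show "nn2 lborel (h w) \<le> 2 * (ennreal (1 / mu) * (ennreal apriori * nn2 (lborel_on (half s)) (resid (F n))))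
      + 2 * (ennreal (2 * sc) * nn2 lborel (\<lambda>k. wt k *\<^sub>R (ftrace (F n) k - w k)))" .
  next
    have "(\<lambda>n. 2 * (ennreal (1 / mu) * (ennreal apriori * nn2 (lborel_on (half s)) (resid (F n))))
      + 2 * (ennreal (2 * sc) * nn2 lborel (\<lambda>k. wt k *\<^sub>R (ftrace (F n) k - w k)))) \<longlonglongrightarrow> 0 + 0"
      by (intro tendsto_add ennreal_cmult_tendsto_0 cr ct) auto
    then show "(\<lambda>n. 2 * (ennreal (1 / mu) * (ennreal apriori * nn2 (lborel_on (half s)) (resid (F n))))
      + 2 * (ennreal (2 * sc) * nn2 lborel (\<lambda>k. wt k *\<^sub>R (ftrace (F n) k - w k)))) \<longlonglongrightarrow> 0" by simp
  qed
  then have "AE k in lborel. h w k = 0" by (subst (asm) nn2_eq_0_iff) auto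
  then have "AE k in lborel. w k = (mode s k (w k) / of_real (2 * kap k)) *s amp s k"
  proof eventually_elim
    case (elim k)
    then have "mode (- s) k (w k) = 0" using wt_pos[of k] kap_pos[of k] by (simp add: h_def)
    then show ?case by (rule mode_amp[OF d(1)])
  qed
  moreover have "(\<lambda>k. mode s k (w k) / of_real (2 * kap k)) \<in> L2 lborel"
    unfolding L2_iff
  proof
    show "(\<lambda>k. mode s k (w k) / of_real (2 * kap k)) \<in> borel_measurable lborel" by measurable
    have wL: "(\<lambda>k. wt k *\<^sub>R w k) \<in> L2 lborel" using w unfolding sobolev_rep_def wt_def by blast
    \<comment> \<open>The quotient sc / 2 remains of the bound on the modes after division by (2
      kappa)^2 and separation of 1/kappa; \<open>min 1 mu\<close> comes from comparing 1/kappa with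
      the squared weight.\<close>
    define C where "C = sqrt (sc / (2 * min 1 mu))"
    have "nn2 lborel (\<lambda>k. mode s k (w k) / of_real (2 * kap k)) \<le> ennreal (C\<^sup>2) * nn2 lborel (\<lambda>k. wt k *\<^sub>R w k)"
    proof (rule nn2_scale_le)
      fix k
      have "(cmod (mode s k (w k)))\<^sup>2 \<le> 2 * kap k * sc * (norm (w k))\<^sup>2"
        using mode_sum_le[OF d(1), of k "w k"] zero_le_power2[of "cmod (mode (- s) k (w k))"] by linarith
      then have "(cmod (mode s k (w k)))\<^sup>2 / (2 * kap k)\<^sup>2 \<le> 2 * kap k * sc * (norm (w k))\<^sup>2 / (2 * kap k)\<^sup>2"
        by (rule divide_right_mono) simp
      also have "\<dots> = sc / 2 * (norm (w k))\<^sup>2 * (1 / kap k)"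
        using kap_pos[of k] by (simp add: power2_eq_square field_simps)
      also have "\<dots> \<le> sc / 2 * (norm (w k))\<^sup>2 * (1 / min 1 mu * (wt k)\<^sup>2)"
        using sc_pos by (intro mult_left_mono inverse_kap_le) auto
      also have "\<dots> = (C * norm (wt k *\<^sub>R w k))\<^sup>2"
        using sc_pos mu_pos by (simp add: C_def power_mult_distrib)
      also have "(cmod (mode s k (w k)))\<^sup>2 / (2 * kap k)\<^sup>2 = (norm (mode s k (w k) / of_real (2 * kap k)))\<^sup>2"
        unfolding norm_divide power_divide norm_of_real power2_abs ..
      finally show "norm (mode s k (w k) / of_real (2 * kap k)) \<le> C * norm (wt k *\<^sub>R w k)"
        by (rule power2_le_imp_le) (use sc_pos mu_pos in \<open>simp add: C_def\<close>)
    qed (use sc_pos mu_pos in \<open>auto simp: C_def\<close>)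
    also have "\<dots> < \<infinity>" using wL by (simp add: L2_iff ennreal_mult_less_top)
    finally show "nn2 lborel (\<lambda>k. mode s k (w k) / of_real (2 * kap k)) < \<infinity>" .
  qed
  ultimately show thesis using that by blast
qed

text \<open>The approximants of the function and of the field with the same trace have small
  residuals and traces that approach each other, so the a priori estimate applied to their
  difference forces the two limits to agree.\<close>

lemma field_determined:
  assumes s: "s = 1 \<or> s = -1" and \<psi>: "\<psi> \<in> L2 (lborel_on (half s))" and F: "\<And>n::nat. F n \<in> test_functions UNIV"
    and cf: "(\<lambda>n. nn2 (lborel_on (half s)) (\<lambda>p. F n p - \<psi> p)) \<longlonglongrightarrow> 0"
    and cr: "(\<lambda>n. nn2 (lborel_on (half s)) (resid (F n))) \<longlonglongrightarrow> 0"
    and w: "sobolev_rep (- 1 / 2) T w" and ct: "(\<lambda>n. nn2 lborel (\<lambda>k. wt k *\<^sub>R (ftrace (F n) k - w k))) \<longlonglongrightarrow> 0"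
    and \<xi>: "\<xi> \<in> L2 lborel" and ae: "AE k in lborel. w k = \<xi> k *s amp s k"
  shows "AE p in lborel_on (half s). \<psi> p = fld s \<xi> p"
proof -
  let ?M = "lborel_on (half s)"
  obtain G where G: "\<And>n::nat. G n \<in> test_functions UNIV"
    and gf: "(\<lambda>n. nn2 ?M (\<lambda>p. G n p - fld s \<xi> p)) \<longlonglongrightarrow> 0"
    and gr: "(\<lambda>n. nn2 ?M (resid (G n))) \<longlonglongrightarrow> 0"
    and gt: "(\<lambda>n. nn2 lborel (\<lambda>k. wt k *\<^sub>R (ftrace (G n) k - \<xi> k *s amp s k))) \<longlonglongrightarrow> 0"
    by (rule fld_approximation[OF \<xi> s]) (rule that; assumption)
  have "nn2 lborel (\<lambda>k. wt k *\<^sub>R (ftrace (G n) k - \<xi> k *s amp s k)) = nn2 lborel (\<lambda>k. wt k *\<^sub>R (ftrace (G n) k - w k))" for n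
    by (rule nn2_cong_AE) (use ae in \<open>eventually_elim, simp\<close>)
  with gt have gt': "(\<lambda>n. nn2 lborel (\<lambda>k. wt k *\<^sub>R (ftrace (G n) k - w k))) \<longlonglongrightarrow> 0" by simp
  have mw [measurable]: "w \<in> borel_measurable borel" by (rule sobolev_rep_measurable[OF w])
  have mt [measurable]: "ftrace (F n) \<in> borel_measurable borel" "ftrace (G n) \<in> borel_measurable borel" for n
    by (intro ftrace_measurable F G)+
  have "F n \<in> L2 ?M" "G n \<in> L2 ?M" "resid (F n) \<in> L2 ?M" "resid (G n) \<in> L2 ?M" for n
    using L2_restrict[OF test_functions_L2[OF F] half_measurable] L2_restrict[OF test_functions_L2[OF G] half_measurable]
      L2_restrict[OF resid_L2[OF F] half_measurable] L2_restrict[OF resid_L2[OF G] half_measurable] by blast+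
  then have m [measurable]: "F n \<in> borel_measurable ?M" "G n \<in> borel_measurable ?M"
    "resid (F n) \<in> borel_measurable ?M" "resid (G n) \<in> borel_measurable ?M" for n
    by (auto simp: L2_iff)
  have m\<psi> [measurable]: "\<psi> \<in> borel_measurable ?M" "fld s \<xi> \<in> borel_measurable ?M"
    using \<psi> fld_L2[OF \<xi> s] by (auto simp: L2_iff)
  define r where "r n = 2 * nn2 lborel (\<lambda>k. wt k *\<^sub>R (ftrace (F n) k - w k)) + 2 * nn2 lborel (\<lambda>k. wt k *\<^sub>R (ftrace (G n) k - w k))
      + (2 * nn2 ?M (resid (F n)) + 2 * nn2 ?M (resid (G n)))" for n
  have bd: "nn2 ?M (\<lambda>p. F n p - G n p) \<le> ennreal apriori * r n" for n
  proof -
    have "nn2 ?M (\<lambda>p. F n p - G n p) \<le> ennreal apriori * (nn2 lborel (\<lambda>k. wt k *\<^sub>R ftrace (\<lambda>p. F n p - G n p) k)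
        + nn2 ?M (resid (\<lambda>p. F n p - G n p)))"
      by (rule apriori_estimate(1)[OF test_functions_UNIV_diff[OF F G] s])
    also have "\<dots> \<le> ennreal apriori * r n"
      unfolding r_def
    proof (intro mult_left_mono add_mono)
      have "nn2 lborel (\<lambda>k. wt k *\<^sub>R ftrace (\<lambda>p. F n p - G n p) k)
        = nn2 lborel (\<lambda>k. wt k *\<^sub>R (ftrace (F n) k - w k) - wt k *\<^sub>R (ftrace (G n) k - w k))"
        by (simp add: ftrace_diff[OF F G] scaleR_diff_right)
      also have "\<dots> \<le> 2 * nn2 lborel (\<lambda>k. wt k *\<^sub>R (ftrace (F n) k - w k)) + 2 * nn2 lborel (\<lambda>k. wt k *\<^sub>R (ftrace (G n) k - w k))"
        by (rule nn2_diff_le) measurable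
      finally show "nn2 lborel (\<lambda>k. wt k *\<^sub>R ftrace (\<lambda>p. F n p - G n p) k)
        \<le> 2 * nn2 lborel (\<lambda>k. wt k *\<^sub>R (ftrace (F n) k - w k)) + 2 * nn2 lborel (\<lambda>k. wt k *\<^sub>R (ftrace (G n) k - w k))" .
      show "nn2 ?M (resid (\<lambda>p. F n p - G n p)) \<le> 2 * nn2 ?M (resid (F n)) + 2 * nn2 ?M (resid (G n))"
        unfolding resid_diff[OF F G, abs_def] by (rule nn2_diff_le) measurable
    qed auto
    finally show ?thesis .
  qed
  have "r \<longlonglongrightarrow> 0 + 0 + (0 + 0)"
    unfolding r_def[abs_def] by (intro tendsto_add ennreal_cmult_tendsto_0 cr ct gr gt') auto
  then have r: "(\<lambda>n. ennreal apriori * r n) \<longlonglongrightarrow> 0" by (intro ennreal_cmult_tendsto_0) auto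
  note fg = ennreal_tendsto_0_bound[OF bd r]
  have "nn2 ?M (\<lambda>p. \<psi> p - fld s \<xi> p) = 0"
  proof (rule ennreal_bound_tendsto_0)
    fix n
    have "nn2 ?M (\<lambda>p. \<psi> p - fld s \<xi> p) \<le> 2 * nn2 ?M (\<lambda>p. \<psi> p - F n p) + 2 * nn2 ?M (\<lambda>p. F n p - fld s \<xi> p)"
      by (rule nn2_triangle3) measurable
    also have "\<dots> \<le> 2 * nn2 ?M (\<lambda>p. F n p - \<psi> p) + 2 * (2 * nn2 ?M (\<lambda>p. F n p - G n p) + 2 * nn2 ?M (\<lambda>p. G n p - fld s \<xi> p))"
      unfolding nn2_minus_commute[of ?M \<psi>] by (intro add_mono mult_left_mono order_refl nn2_triangle3) auto
    finally show "nn2 ?M (\<lambda>p. \<psi> p - fld s \<xi> p)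
      \<le> 2 * nn2 ?M (\<lambda>p. F n p - \<psi> p) + 2 * (2 * nn2 ?M (\<lambda>p. F n p - G n p) + 2 * nn2 ?M (\<lambda>p. G n p - fld s \<xi> p))" .
  next
    have "(\<lambda>n. 2 * nn2 ?M (\<lambda>p. F n p - G n p) + 2 * nn2 ?M (\<lambda>p. G n p - fld s \<xi> p)) \<longlonglongrightarrow> 0 + 0"
      by (intro tendsto_add ennreal_cmult_tendsto_0 fg gf) auto
    then have l: "(\<lambda>n. 2 * (2 * nn2 ?M (\<lambda>p. F n p - G n p) + 2 * nn2 ?M (\<lambda>p. G n p - fld s \<xi> p))) \<longlonglongrightarrow> 0"
      by (intro ennreal_cmult_tendsto_0) auto
    have "(\<lambda>n. 2 * nn2 ?M (\<lambda>p. F n p - \<psi> p) + 2 * (2 * nn2 ?M (\<lambda>p. F n p - G n p) + 2 * nn2 ?M (\<lambda>p. G n p - fld s \<xi> p))) \<longlonglongrightarrow> 0 + 0"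
      by (intro tendsto_add l ennreal_cmult_tendsto_0 cf) auto
    then show "(\<lambda>n. 2 * nn2 ?M (\<lambda>p. F n p - \<psi> p) + 2 * (2 * nn2 ?M (\<lambda>p. F n p - G n p) + 2 * nn2 ?M (\<lambda>p. G n p - fld s \<xi> p))) \<longlonglongrightarrow> 0"
      by simp
  qed
  then show ?thesis by (subst (asm) nn2_eq_0_iff) auto
qed

text \<open>The density is read off from the trace on the left. On the right the trace is found from
  the jump condition: it is Lambda applied to the left one, hence already a multiple of the
  amplitude that decays there.\<close>

lemma eigenfunction_form:
  assumes "\<psi> \<in> eigenspace (dirac_shell m \<eta> \<tau>) (of_real zs)"
  shows "\<psi> \<in> L2 lborel" "\<exists>\<Xi> \<in> L2 lborel. AE p in lborel. \<psi> p = psi m \<eta> \<tau> \<Xi> p"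
proof -
  from assms have dom: "\<psi> \<in> shell_domain \<eta> \<tau>"
    and act: "acts_as_dirac m (half 1) \<psi> (\<lambda>p. of_real zs *s \<psi> p)" "acts_as_dirac m (half (-1)) \<psi> (\<lambda>p. of_real zs *s \<psi> p)"
    by (auto simp: eigenspace_def dirac_shell_def Omega_half)
  from dom show \<psi>: "\<psi> \<in> L2 lborel" by (simp add: shell_domain_def)
  have L: "\<psi> \<in> L2 (lborel_on (half s))" for s by (rule L2_restrict[OF \<psi> half_measurable])
  from dom obtain Tp Tm where Tp: "has_dirichlet_trace (half 1) \<psi> Tp" and Tm: "has_dirichlet_trace (half (-1)) \<psi> Tm"
    and jump: "\<And>\<phi>. \<phi> \<in> test_functions UNIV \<Longrightarrow> Tp \<phi> = Lambda \<eta> \<tau> *v Tm \<phi>"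
    unfolding shell_domain_def Omega_half jump_iff by blast
  obtain F w where F: "\<And>n::nat. F n \<in> test_functions UNIV"
    "(\<lambda>n. nn2 (lborel_on (half 1)) (\<lambda>p. F n p - \<psi> p)) \<longlonglongrightarrow> 0"
    "(\<lambda>n. nn2 (lborel_on (half 1)) (resid (F n))) \<longlonglongrightarrow> 0"
    "sobolev_rep (- 1 / 2) Tp w" "(\<lambda>n. nn2 lborel (\<lambda>k. wt k *\<^sub>R (ftrace (F n) k - w k))) \<longlonglongrightarrow> 0"
    by (rule dirac_approximation[OF disjI1[OF refl] Tp act(1)]) (rule that; assumption)
  obtain G v where G: "\<And>n::nat. G n \<in> test_functions UNIV"
    "(\<lambda>n. nn2 (lborel_on (half (-1))) (\<lambda>p. G n p - \<psi> p)) \<longlonglongrightarrow> 0"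
    "(\<lambda>n. nn2 (lborel_on (half (-1))) (resid (G n))) \<longlonglongrightarrow> 0"
    "sobolev_rep (- 1 / 2) Tm v" "(\<lambda>n. nn2 lborel (\<lambda>k. wt k *\<^sub>R (ftrace (G n) k - v k))) \<longlonglongrightarrow> 0"
    by (rule dirac_approximation[OF disjI2[OF refl] Tm act(2)]) (rule that; assumption)
  obtain \<xi> where \<xi>: "\<xi> \<in> L2 lborel" "AE k in lborel. v k = \<xi> k *s amp (-1) k"
    by (rule trace_polarized[OF disjI2[OF refl] G(1,3-5)]) (rule that; assumption)
  \<comment> \<open>The factor cancels \<open>lam (- 1)\<close>, which is 1 / sqrt 2.\<close>
  define \<Xi> where "\<Xi> k = of_real (sqrt 2) * \<xi> k" for k
  have \<Xi>: "\<Xi> \<in> L2 lborel" unfolding \<Xi>_def by (rule L2_cmult[OF \<xi>(1)])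
  have d: "dsty (-1) \<Xi> = \<xi>"
    by (simp add: dsty_def lam_def \<Xi>_def fun_eq_iff flip: of_real_mult)
  have rep: "sobolev_rep (- 1 / 2) (amp_distr s (dsty s \<Xi>)) (\<lambda>k. dsty s \<Xi> k *s amp s k)" if "s = 1 \<or> s = -1" for s
    using that by (intro amp_distr_rep dsty_L2[OF \<Xi>]) auto
  \<comment> \<open>The transform of the left trace is known only almost everywhere, which is enough
    because test functions see it through an integral.\<close>
  have T: "Tm \<phi> = amp_distr (-1) (dsty (-1) \<Xi>) \<phi>" if \<phi>: "\<phi> \<in> test_functions UNIV" for \<phi>
  proof -
    have mv [measurable]: "v \<in> borel_measurable borel" by (rule sobolev_rep_measurable[OF G(4)])
    have mx [measurable]: "(\<lambda>k. \<xi> k *s amp (-1) k) \<in> borel_measurable borel"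
      using sobolev_rep_measurable[OF rep[of "-1"]] by (simp add: d)
    have [measurable]: "inv_fourier \<phi> \<in> borel_measurable borel"
      by (rule inv_fourier_measurable[OF test_functions_measurable[OF \<phi>]])
    have "Tm \<phi> $ i = (LINT k|lborel. inv_fourier \<phi> k * v k $ i)" for i
      using G(4) \<phi> unfolding sobolev_rep_iff by blast
    moreover have "amp_distr (-1) (dsty (-1) \<Xi>) \<phi> $ i = (LINT k|lborel. inv_fourier \<phi> k * (\<xi> k *s amp (-1) k) $ i)" for i
      using rep[of "-1"] \<phi> unfolding sobolev_rep_iff d by blast
    moreover have "(LINT k|lborel. inv_fourier \<phi> k * v k $ i) = (LINT k|lborel. inv_fourier \<phi> k * (\<xi> k *s amp (-1) k) $ i)" for i
      using spinor_measurable_nth[OF mx, of i] by (intro integral_cong_AE) (use \<xi>(2) in auto)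
    ultimately show ?thesis by (simp add: vec_eq_iff)
  qed
  \<comment> \<open>Both sides represent the trace from the right, one by the approximation there
    and the other by the jump condition; representatives are unique up to null sets.\<close>
  have "AE k in lborel. w k = dsty 1 \<Xi> k *s amp 1 k"
    by (rule sobolev_rep_unique[OF F(4) rep]) (simp_all add: jump T amp_distr_jump[OF \<Xi>])
  from field_determined[OF disjI1[OF refl] L F dsty_L2[OF \<Xi>] this]
  have p: "AE p in lborel_on (half 1). \<psi> p = fld 1 (dsty 1 \<Xi>) p" .
  from field_determined[OF disjI2[OF refl] L G \<xi>]
  have n: "AE p in lborel_on (half (-1)). \<psi> p = fld (-1) (dsty (-1) \<Xi>) p" unfolding d .
  have "AE p in lborel. \<psi> p = psi m \<eta> \<tau> \<Xi> p"
    unfolding AE_halves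
  proof
    show "AE p in lborel_on (half 1). \<psi> p = psi m \<eta> \<tau> \<Xi> p"
      using p unfolding AE_half by eventually_elim (simp add: psi_half[OF \<Xi> disjI1[OF refl]])
    show "AE p in lborel_on (half (-1)). \<psi> p = psi m \<eta> \<tau> \<Xi> p"
      using n unfolding AE_half by eventually_elim (simp add: psi_half[OF \<Xi> disjI2[OF refl]])
  qed
  with \<Xi> show "\<exists>\<Xi> \<in> L2 lborel. AE p in lborel. \<psi> p = psi m \<eta> \<tau> \<Xi> p" by blast
qed

end

theorem theorem1p1:
  fixes m \<eta> \<tau> :: real
  assumes "m > 0" and "\<eta>\<^sup>2 - \<tau>\<^sup>2 = 4"
  shows "eigenvalue_of_infinite_multiplicity (dirac_shell m \<eta> \<tau>) (complex_of_real (- (\<tau> / \<eta>) * m)) \<and>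
    eigenspace (dirac_shell m \<eta> \<tau>) (complex_of_real (- (\<tau> / \<eta>) * m)) =
      {\<psi> \<in> L2 lborel. \<exists>\<Xi> \<in> L2 lborel. AE p in lborel. \<psi> p = psi m \<eta> \<tau> \<Xi> p} \<and>
    (\<forall>\<Xi> \<in> L2 lborel. psi m \<eta> \<tau> \<Xi> \<in> L2 lborel \<and>
      L2_norm lborel (psi m \<eta> \<tau> \<Xi>) = L2_norm lborel \<Xi>)"
proof -
  interpret shell m \<eta> \<tau> by unfold_locales (use assms in auto)
  have "eigenspace (dirac_shell m \<eta> \<tau>) (of_real zs) = {\<psi> \<in> L2 lborel. \<exists>\<Xi> \<in> L2 lborel. AE p in lborel. \<psi> p = psi m \<eta> \<tau> \<Xi> p}"
  proof (intro set_eqI iffI)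
    fix \<psi> assume "\<psi> \<in> eigenspace (dirac_shell m \<eta> \<tau>) (of_real zs)"
    from eigenfunction_form[OF this] show "\<psi> \<in> {\<psi> \<in> L2 lborel. \<exists>\<Xi> \<in> L2 lborel. AE p in lborel. \<psi> p = psi m \<eta> \<tau> \<Xi> p}"
      by (intro CollectI conjI)
  next
    fix \<psi> assume "\<psi> \<in> {\<psi> \<in> L2 lborel. \<exists>\<Xi> \<in> L2 lborel. AE p in lborel. \<psi> p = psi m \<eta> \<tau> \<Xi> p}"
    then show "\<psi> \<in> eigenspace (dirac_shell m \<eta> \<tau>) (of_real zs)"
      by (elim CollectE conjE bexE) (rule psi_eigenfunction)
  qed
  then show ?thesis
    unfolding zs_def[symmetric] by (intro conjI infinite_multiplicity ballI psi_L2 psi_norm)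
qed

end
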